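(* Let $\{(\widetilde\mu_n,\widetilde\psi_n)\}_{n\in\mathbb N}$ be given by $\widetilde\mu_1=1$, $\widetilde\psi_1(t)=\sqrt{1/\pi}$ and $\widetilde\mu_n=(n-1)^2+1$, $\widetilde\psi_n(t)=\sqrt{2/\pi}\cos((n-1)t)$ for $n\ge2$ (so $\|\widetilde\psi_n\|_{L^2(0,\pi)}=1$). Then there exist $L^2$-normalized eigenvalue--root vector pairs $\{(\widetilde\lambda_n,\widetilde\phi_n)\}_{n\in\mathbb N}$ of the eigenvalue problem: find $(\widetilde\lambda,\widetilde\phi)\in\mathbb C\times H^1(0,\pi)\setminus\{0\}$ with $$(\widetilde\phi',\widetilde\xi')_{L^2(0,\pi)}-(\omega^2r_1^2\delta^2e^{2\delta t}\widetilde{\mathfrak n}\,\widetilde\phi,\widetilde\xi)_{L^2(0,\pi)}+i\omega\varsigma\delta r_2\,\widetilde\phi(\pi)\overline{\widetilde\xi(\pi)}=\widetilde\lambda(\widetilde\phi,\widetilde\xi)_{L^2(0,\pi)}\quad\forall\widetilde\xi\in H^1(0,\pi),$$ with the following properties: (i) there exists $n_0>0$ such that $\widetilde\lambda_n$ is simple for all $n>n_0$; (ii) $\{\widetilde\phi_n\}_{n}$ forms a Bari basis of $L^2(0,\pi)$ and in particular $\sum_{n=1}^\infty\|\widetilde\psi_n-\widetilde\phi_n\|_{L^2(0,\pi)}^2<\infty$; (iii) $\{\widetilde\mu_n^{-1/2}\widetilde\phi_n\}_n$ forms a Bari basis of $H^1(0,\pi)$ and in particular $\sum_{n=1}^\infty\|\widetilde\mu_n^{-1/2}\widetilde\psi_n-\widetilde\mu_n^{-1/2}\widetilde\phi_n\|^2_{H^1(0,\pi)}<\infty$;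 (iv) $\lim_{n\to\infty}|\widetilde\lambda_n|^{1/2}/\widetilde\mu_n^{1/2}=\lim_{n\to\infty}|\widetilde\lambda_n|^{1/2}/\|\widetilde\phi_n\|_{H^1(0,\pi)}=1$, and the sequence $\{\widetilde\phi_n/\|\widetilde\phi_n\|_{H^1(0,\pi)}\}_n$ is quadratically close to the sequence $\{\widetilde\psi_n/\widetilde\mu_n^{1/2}\}_n$ in the $H^1(0,\pi)$-norm; (v) $\lim_{n\to\infty}\widetilde\lambda_n/\widetilde\mu_n=1$.
   Context: Data: $0<r_1<r_2<\infty$, $\omega>0$, $\varsigma>0$, $\delta=\frac1\pi\ln(r_2/r_1)$, $\widetilde{\mathfrak n}\in L^\infty(0,\pi)$ real-valued. The eigenvalue problem corresponds to the operator $\widetilde T\phi=-\phi''-\omega^2r_1^2\delta^2e^{2\delta t}\widetilde{\mathfrak n}\phi$ on $L^2(0,\pi)$ with $D(\widetilde T)=\{\phi\in H^2(0,\pi):\phi'(0)=0,\ \phi'(\pi)+i\omega\varsigma\delta r_2\phi(\pi)=0\}$. Root vectors: $\{\phi_n\}$ are the root vectors (generalized eigenvectors) of an operator $A$, with eigenvalues $\{\lambda_n\}$, if the spectrum of $A$ consists of countably many eigenvalues each of finite algebraic multiplicity; $\{\lambda_n\}_{n\in\mathbb N}$ enumerates $\sigma(A)$ with algebraic multiplicities; for each $m$ the set $\{\phi_n:\lambda_n=\lambda_m\}$ is a basis of the root space of $\lambda_m$; and for each $n$ either $\phi_{n+1}$ is an eigenvector or $(A-\lambda_{n+1})\phi_{n+1}=\phi_n$.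 The pairs $(\lambda_n,\phi_n)$ are normalized if in addition all eigenvectors among the $\phi_n$ are normalized. Simple means algebraic multiplicity one. Two sequences $(x_n),(y_n)$ in a Hilbert space are quadratically close if $\sum_n\|x_n-y_n\|^2<\infty$. A Bari basis is a (Riesz) basis that is quadratically close to an orthonormal basis. $H^1(0,\pi)$ carries the norm $\|u\|^2_{H^1}=\|u'\|^2_{L^2}+\|u\|_{L^2}^2$, for which $\{\widetilde\mu_n^{-1/2}\widetilde\psi_n\}$ is an orthonormal basis. *)

theory Defs
  imports "HOL-Analysis.Analysis"
begin

text \<open>The complex inner product is linear in its first argument; the real inner product, and with
  it norm and topology, is its real part.\<close>

class complex_inner = real_inner +
  fixes scaleC :: "complex \<Rightarrow> 'a \<Rightarrow> 'a"  (infixr \<open>*\<^sub>C\<close> 75)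
    and cinner :: "'a \<Rightarrow> 'a \<Rightarrow> complex"
  assumes scaleC_add_right: "a *\<^sub>C (x + y) = a *\<^sub>C x + a *\<^sub>C y"
    and scaleC_add_left: "(a + b) *\<^sub>C x = a *\<^sub>C x + b *\<^sub>C x"
    and scaleC_scaleC: "a *\<^sub>C b *\<^sub>C x = (a * b) *\<^sub>C x"
    and scaleC_one: "1 *\<^sub>C x = x"
    and scaleR_scaleC: "scaleR r x = complex_of_real r *\<^sub>C x"
    and cinner_commute: "cinner x y = cnj (cinner y x)"
    and cinner_add_left: "cinner (x + y) z = cinner x z + cinner y z"
    and cinner_scaleC_left: "cinner (a *\<^sub>C x) y = a * cinner x y"
    and inner_Re_cinner: "inner x y = Re (cinner x y)"

global_interpretation complex_vector: vector_space "scaleC :: complex \<Rightarrow> 'a \<Rightarrow> 'a::complex_inner"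
  defines cdependent = complex_vector.dependent
    and cspan = complex_vector.span
    and cdim = complex_vector.dim
  by unfold_locales (simp_all add: scaleC_add_right scaleC_add_left scaleC_scaleC scaleC_one)

definition orthonormal_basis :: "(nat \<Rightarrow> 'a::complex_inner) \<Rightarrow> bool" where
  "orthonormal_basis e \<longleftrightarrow>
     (\<forall>m n. cinner (e m) (e n) = (if m = n then 1 else 0)) \<and> closure (cspan (range e)) = UNIV"

definition quadratically_close :: "(nat \<Rightarrow> 'a::real_normed_vector) \<Rightarrow> (nat \<Rightarrow> 'a) \<Rightarrow> bool" where
  "quadratically_close x y \<longleftrightarrow> summable (\<lambda>n. (norm (x n - y n))\<^sup>2)"

text \<open>A Riesz basis is the image of an orthonormal basis under a bounded, boundedly invertible
  complex-linear operator.\<close>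

definition riesz_basis :: "(nat \<Rightarrow> 'a::complex_inner) \<Rightarrow> bool" where
  "riesz_basis b \<longleftrightarrow>
     (\<exists>(S :: 'a \<Rightarrow> 'a) e. bounded_linear S \<and> (\<forall>a x. S (a *\<^sub>C x) = a *\<^sub>C S x) \<and> bij S \<and> bounded_linear (inv S) \<and>
            orthonormal_basis e \<and> (\<forall>n. b n = S (e n)))"

definition bari_basis :: "(nat \<Rightarrow> 'a::complex_inner) \<Rightarrow> bool" where
  "bari_basis b \<longleftrightarrow> riesz_basis b \<and> (\<exists>e. orthonormal_basis e \<and> quadratically_close b e)"

text \<open>An unbounded operator is given by its domain \<open>D\<close> and a function \<open>A\<close>, of which only the values
  on \<open>D\<close> are relevant.\<close>

definition resolvent_set :: "'a::complex_inner set \<Rightarrow> ('a \<Rightarrow> 'a) \<Rightarrow> complex set" where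
  "resolvent_set D A =
     {l. bij_betw (\<lambda>u. A u - l *\<^sub>C u) D UNIV \<and> (\<exists>C. \<forall>u\<in>D. norm u \<le> C * norm (A u - l *\<^sub>C u))}"

definition spectrum :: "'a::complex_inner set \<Rightarrow> ('a \<Rightarrow> 'a) \<Rightarrow> complex set" where
  "spectrum D A = - resolvent_set D A"

definition eigenvector :: "'a::complex_inner set \<Rightarrow> ('a \<Rightarrow> 'a) \<Rightarrow> complex \<Rightarrow> 'a \<Rightarrow> bool" where
  "eigenvector D A l u \<longleftrightarrow> u \<in> D \<and> u \<noteq> 0 \<and> A u = l *\<^sub>C u"

text \<open>The kernel of the \<open>k\<close>-th power of \<open>A - l\<close> on its natural domain.\<close>

primrec ker_power :: "'a::complex_inner set \<Rightarrow> ('a \<Rightarrow> 'a) \<Rightarrow> complex \<Rightarrow> nat \<Rightarrow> 'a set" where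
  "ker_power D A l 0 = {0}"
| "ker_power D A l (Suc k) = {u \<in> D. A u - l *\<^sub>C u \<in> ker_power D A l k}"

definition root_space :: "'a::complex_inner set \<Rightarrow> ('a \<Rightarrow> 'a) \<Rightarrow> complex \<Rightarrow> 'a set" where
  "root_space D A l = (\<Union>k. ker_power D A l k)"

text \<open>The value of \<open>alg_mult\<close> is meaningful only for eigenvalues of finite algebraic multiplicity.\<close>

definition finite_alg_mult :: "'a::complex_inner set \<Rightarrow> ('a \<Rightarrow> 'a) \<Rightarrow> complex \<Rightarrow> bool" where
  "finite_alg_mult D A l \<longleftrightarrow> (\<exists>B. finite B \<and> root_space D A l \<subseteq> cspan B)"

definition alg_mult :: "'a::complex_inner set \<Rightarrow> ('a \<Rightarrow> 'a) \<Rightarrow> complex \<Rightarrow> nat" where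
  "alg_mult D A l = cdim (root_space D A l)"

definition simple_eigenvalue :: "'a::complex_inner set \<Rightarrow> ('a \<Rightarrow> 'a) \<Rightarrow> complex \<Rightarrow> bool" where
  "simple_eigenvalue D A l \<longleftrightarrow>
     (\<exists>u. eigenvector D A l u) \<and> finite_alg_mult D A l \<and> alg_mult D A l = 1"

definition root_vector_pairs ::
    "'a::complex_inner set \<Rightarrow> ('a \<Rightarrow> 'a) \<Rightarrow> (nat \<Rightarrow> complex) \<Rightarrow> (nat \<Rightarrow> 'a) \<Rightarrow> bool" where
  "root_vector_pairs D A l f \<longleftrightarrow>
     countable (spectrum D A) \<and>
     (\<forall>z\<in>spectrum D A. (\<exists>u. eigenvector D A z u) \<and> finite_alg_mult D A z) \<and>
     range l = spectrum D A \<and>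
     (\<forall>m. card {n. l n = l m} = alg_mult D A (l m)) \<and>
     (\<forall>m. \<not> cdependent (f ` {n. l n = l m}) \<and>
          cspan (f ` {n. l n = l m}) = root_space D A (l m)) \<and>
     (\<forall>n. eigenvector D A (l (Suc n)) (f (Suc n)) \<or>
          f (Suc n) \<in> D \<and> A (f (Suc n)) - l (Suc n) *\<^sub>C f (Suc n) = f n)"

text \<open>Normalization only concerns those \<open>f n\<close> that are eigenvectors.\<close>

definition normalized_root_vector_pairs ::
    "'a::complex_inner set \<Rightarrow> ('a \<Rightarrow> 'a) \<Rightarrow> (nat \<Rightarrow> complex) \<Rightarrow> (nat \<Rightarrow> 'a) \<Rightarrow> bool" where
  "normalized_root_vector_pairs D A l f \<longleftrightarrow>
     root_vector_pairs D A l f \<and> (\<forall>n. eigenvector D A (l n) (f n) \<longrightarrow> norm (f n) = 1)"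

abbreviation Mpi :: "real measure" where
  "Mpi \<equiv> lebesgue_on {0<..<pi}"

definition square_integrable :: "(real \<Rightarrow> complex) \<Rightarrow> bool" where
  "square_integrable f \<longleftrightarrow>
     f \<in> borel_measurable Mpi \<and> integrable Mpi (\<lambda>t. (cmod (f t))\<^sup>2)"

definition L2_eq :: "(real \<Rightarrow> complex) \<Rightarrow> (real \<Rightarrow> complex) \<Rightarrow> bool" where
  "L2_eq f g \<longleftrightarrow> square_integrable f \<and> square_integrable g \<and> (AE t in Mpi. f t = g t)"

lemma square_integrable_zero: "square_integrable (\<lambda>t. 0)"
  by (simp add: square_integrable_def)

lemma square_integrable_measurable: "square_integrable f \<Longrightarrow> f \<in> borel_measurable Mpi"
  by (simp add: square_integrable_def)

lemma cnj_measurable: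
  assumes "f \<in> borel_measurable M" shows "(\<lambda>t. cnj (f t)) \<in> borel_measurable M"
proof (rule measurable_compose[OF assms])
  show "cnj \<in> borel_measurable borel"
    by (intro borel_measurable_continuous_onI continuous_intros)
qed

lemma square_integrable_scale:
  assumes "square_integrable f" shows "square_integrable (\<lambda>t. c * f t)"
  using assms by (auto simp: square_integrable_def norm_mult power_mult_distrib)

lemma square_integrable_mult:
  assumes f: "square_integrable f" and g: "square_integrable g"
  shows "integrable Mpi (\<lambda>t. f t * cnj (g t))"
proof (rule Bochner_Integration.integrable_bound)
  show "integrable Mpi (\<lambda>t. (cmod (f t))\<^sup>2 + (cmod (g t))\<^sup>2)"
    using f g by (auto simp: square_integrable_def)
  show "(\<lambda>t. f t * cnj (g t)) \<in> borel_measurable Mpi"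
    using f g by (intro borel_measurable_times cnj_measurable square_integrable_measurable)
  show "AE t in Mpi. norm (f t * cnj (g t)) \<le> norm ((cmod (f t))\<^sup>2 + (cmod (g t))\<^sup>2)"
  proof (rule AE_I2)
    fix t
    have "2 * (cmod (f t) * cmod (g t)) \<le> (cmod (f t))\<^sup>2 + (cmod (g t))\<^sup>2"
      using sum_squares_bound[of "cmod (f t)" "cmod (g t)"] by simp
    moreover have "0 \<le> cmod (f t) * cmod (g t)" by simp
    ultimately have "cmod (f t) * cmod (g t) \<le> (cmod (f t))\<^sup>2 + (cmod (g t))\<^sup>2" by linarith
    then show "norm (f t * cnj (g t)) \<le> norm ((cmod (f t))\<^sup>2 + (cmod (g t))\<^sup>2)"
      by (simp add: norm_mult)
  qed
qed

lemma square_integrable_add: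
  assumes f: "square_integrable f" and g: "square_integrable g"
  shows "square_integrable (\<lambda>t. f t + g t)"
  unfolding square_integrable_def
proof
  show "(\<lambda>t. f t + g t) \<in> borel_measurable Mpi"
    using f g by (intro borel_measurable_add square_integrable_measurable)
  have eq: "(\<lambda>t. (cmod (f t + g t))\<^sup>2) =
      (\<lambda>t. (cmod (f t))\<^sup>2 + (cmod (g t))\<^sup>2 + 2 * Re (f t * cnj (g t)))"
    unfolding cmod_power2 by (rule ext) (simp add: power2_eq_square algebra_simps)
  show "integrable Mpi (\<lambda>t. (cmod (f t + g t))\<^sup>2)"
    unfolding eq using f g square_integrable_mult[OF f g] unfolding square_integrable_def
    by (intro Bochner_Integration.integrable_add integrable_mult_right integrable_Re) auto
qed

lemma square_integrable_uminus: "square_integrable f \<Longrightarrow> square_integrable (\<lambda>t. - f t)"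
  using square_integrable_scale[of f "-1"] by simp

lemma square_integrable_diff:
  "square_integrable f \<Longrightarrow> square_integrable g \<Longrightarrow> square_integrable (\<lambda>t. f t - g t)"
  using square_integrable_add[OF _ square_integrable_uminus, of f g] by simp

lemma square_integrable_continuous:
  assumes "continuous_on {0..pi} f" shows "square_integrable f"
  unfolding square_integrable_def
proof
  have c: "continuous_on {0<..<pi} f"
    using assms by (rule continuous_on_subset) auto
  show m: "f \<in> borel_measurable Mpi"
    by (rule continuous_imp_measurable_on_sets_lebesgue[OF c]) auto
  have "bounded (f ` {0..pi})"
    using assms compact_continuous_image compact_imp_bounded by blast
  then obtain B where B: "\<And>t. t \<in> {0..pi} \<Longrightarrow> norm (f t) \<le> B"
    unfolding bounded_iff by (metis imageI)
  show "integrable Mpi (\<lambda>t. (cmod (f t))\<^sup>2)"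
  proof (rule Bochner_Integration.integrable_bound)
    show "integrable Mpi (\<lambda>t. B\<^sup>2)"
      by (intro finite_measure.integrable_const finite_measure_lebesgue_on) auto
    show "(\<lambda>t. (cmod (f t))\<^sup>2) \<in> borel_measurable Mpi" using m by measurable
    show "AE t in Mpi. norm ((cmod (f t))\<^sup>2) \<le> norm (B\<^sup>2)"
      by (rule AE_I2) (use B in \<open>auto intro!: power_mono\<close>)
  qed
qed

quotient_type L2pi = "real \<Rightarrow> complex" / partial: L2_eq
proof (rule part_equivpI)
  show "\<exists>f. L2_eq f f"
    by (rule exI[of _ "\<lambda>t. 0"]) (simp add: L2_eq_def square_integrable_zero)
  show "symp L2_eq"
    by (auto simp: symp_def L2_eq_def elim: AE_mp)
  show "transp L2_eq"
    unfolding transp_def L2_eq_def by (auto elim!: AE_mp)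
qed

instantiation L2pi :: complex_inner
begin

lift_definition zero_L2pi :: L2pi is "\<lambda>t. 0"
  by (simp add: L2_eq_def square_integrable_zero)

lift_definition plus_L2pi :: "L2pi \<Rightarrow> L2pi \<Rightarrow> L2pi" is "\<lambda>f g t. f t + g t"
  unfolding L2_eq_def by (auto intro!: square_integrable_add elim!: AE_mp)

lift_definition minus_L2pi :: "L2pi \<Rightarrow> L2pi \<Rightarrow> L2pi" is "\<lambda>f g t. f t - g t"
  unfolding L2_eq_def by (auto intro!: square_integrable_diff elim!: AE_mp)

lift_definition uminus_L2pi :: "L2pi \<Rightarrow> L2pi" is "\<lambda>f t. - f t"
  unfolding L2_eq_def by (auto intro!: square_integrable_uminus elim!: AE_mp)

lift_definition scaleC_L2pi :: "complex \<Rightarrow> L2pi \<Rightarrow> L2pi" is "\<lambda>c f t. c * f t"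
  unfolding L2_eq_def by (auto intro!: square_integrable_scale elim!: AE_mp)

lift_definition cinner_L2pi :: "L2pi \<Rightarrow> L2pi \<Rightarrow> complex" is
  "\<lambda>f g. LINT t|Mpi. f t * cnj (g t)"
  unfolding L2_eq_def
  by (rule integral_cong_AE)
     (auto intro!: borel_measurable_times cnj_measurable dest!: square_integrable_measurable elim!: AE_mp)

definition scaleR_L2pi :: "real \<Rightarrow> L2pi \<Rightarrow> L2pi" where
  "scaleR_L2pi r x = complex_of_real r *\<^sub>C x"

definition inner_L2pi :: "L2pi \<Rightarrow> L2pi \<Rightarrow> real" where
  "inner_L2pi x y = Re (cinner x y)"

definition norm_L2pi :: "L2pi \<Rightarrow> real" where
  "norm_L2pi x = sqrt (inner x x)"

definition sgn_L2pi :: "L2pi \<Rightarrow> L2pi" where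
  "sgn_L2pi x = inverse (norm x) *\<^sub>R x"

definition dist_L2pi :: "L2pi \<Rightarrow> L2pi \<Rightarrow> real" where
  "dist_L2pi x y = norm (x - y)"

definition uniformity_L2pi :: "(L2pi \<times> L2pi) filter" where
  "uniformity_L2pi = (INF e\<in>{0<..}. principal {(x, y). dist x y < e})"

definition open_L2pi :: "L2pi set \<Rightarrow> bool" where
  "open_L2pi U \<longleftrightarrow> (\<forall>x\<in>U. eventually (\<lambda>(x', y). x' = x \<longrightarrow> y \<in> U) uniformity)"

instance
proof
  fix x y z :: L2pi and a b :: complex and r s :: real
  show assoc: "x + y + z = x + (y + z)"
    by transfer (auto simp: L2_eq_def add.assoc intro!: square_integrable_add)
  show "x + y = y + x"
    by transfer (auto simp: L2_eq_def add.commute intro!: square_integrable_add)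
  show "0 + x = x" by transfer (auto simp: L2_eq_def)
  show "- x + x = 0"
    by transfer (auto simp: L2_eq_def square_integrable_zero)
  show "x - y = x + - y"
    by transfer (auto simp: L2_eq_def intro!: square_integrable_diff)
  show ar: "a *\<^sub>C (x + y) = a *\<^sub>C x + a *\<^sub>C y"
    by transfer (auto simp: L2_eq_def distrib_left intro!: square_integrable_add square_integrable_scale)
  show al: "(a + b) *\<^sub>C x = a *\<^sub>C x + b *\<^sub>C x" for a b
    by transfer (auto simp: L2_eq_def distrib_right intro!: square_integrable_add square_integrable_scale)
  show as: "a *\<^sub>C b *\<^sub>C x = (a * b) *\<^sub>C x" for a b
    by transfer (auto simp: L2_eq_def mult.assoc intro!: square_integrable_scale)
  show a1: "1 *\<^sub>C x = x"
    by transfer (auto simp: L2_eq_def)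
  show "r *\<^sub>R x = complex_of_real r *\<^sub>C x"
    by (simp add: scaleR_L2pi_def)
  show "r *\<^sub>R (x + y) = r *\<^sub>R x + r *\<^sub>R y"
    unfolding scaleR_L2pi_def
    by transfer (auto simp: L2_eq_def distrib_left intro!: square_integrable_add square_integrable_scale)
  show "(r + s) *\<^sub>R x = r *\<^sub>R x + s *\<^sub>R x"
    by (simp add: scaleR_L2pi_def al)
  show "r *\<^sub>R s *\<^sub>R x = (r * s) *\<^sub>R x"
    by (simp add: scaleR_L2pi_def as)
  show "1 *\<^sub>R x = x"
    by (simp add: scaleR_L2pi_def a1)
  show comm: "cinner x y = cnj (cinner y x)" for x y :: L2pi
    by transfer (subst Bochner_Integration.integral_cnj[symmetric], simp add: mult.commute)
  show add: "cinner (x + y) z = cinner x z + cinner y z"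
    by transfer (auto simp: L2_eq_def distrib_right square_integrable_mult)
  show scl: "cinner (a *\<^sub>C x) y = a * cinner x y" for a
    by transfer (simp add: mult.assoc)
  show "inner x y = Re (cinner x y)"
    by (simp add: inner_L2pi_def)
  show "inner x y = inner y x"
    unfolding inner_L2pi_def by (subst comm) simp
  show "inner (x + y) z = inner x z + inner y z"
    by (simp add: inner_L2pi_def add)
  show "inner (r *\<^sub>R x) y = r * inner x y"
    by (simp add: inner_L2pi_def scaleR_L2pi_def scl)
  have xx: "Re (LINT t|Mpi. f t * cnj (f t)) = (LINT t|Mpi. (cmod (f t))\<^sup>2)" for f
    by (simp only: complex_norm_square[symmetric] integral_complex_of_real Re_complex_of_real)
  show "0 \<le> inner x x"
    unfolding inner_L2pi_def by transfer (simp add: xx)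
  show "(inner x x = 0) = (x = 0)"
    unfolding inner_L2pi_def
    by transfer
      (auto simp: xx L2_eq_def square_integrable_zero square_integrable_def integral_nonneg_eq_0_iff_AE)
  show "norm x = sqrt (inner x x)" by (simp add: norm_L2pi_def)
  show "sgn x = inverse (norm x) *\<^sub>R x" by (simp add: sgn_L2pi_def)
  show "dist x y = norm (x - y)" by (simp add: dist_L2pi_def)
  show "uniformity = (INF e\<in>{0<..}. principal {(x, y::L2pi). dist x y < e})"
    by (simp add: uniformity_L2pi_def)
  show "open U = (\<forall>x\<in>U. \<forall>\<^sub>F (x', y) in uniformity. x' = x \<longrightarrow> y \<in> U)" for U :: "L2pi set"
    by (simp add: open_L2pi_def)
qed

end

text \<open>Test functions are the real-valued elements of \<open>C\<^sup>1\<^sub>c(0,\<pi>)\<close>, extended by zero.\<close>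

definition test_function :: "(real \<Rightarrow> real) \<Rightarrow> bool" where
  "test_function p \<longleftrightarrow>
     p C1_differentiable_on UNIV \<and> (\<exists>a b. 0 < a \<and> b < pi \<and> (\<forall>t. t \<notin> {a..b} \<longrightarrow> p t = 0))"

text \<open>Since test functions are real-valued, the conjugation in \<open>cinner\<close> has no effect here:
  the condition reads \<open>\<integral> u p' = - \<integral> g p\<close>.\<close>

definition has_weak_derivative :: "L2pi \<Rightarrow> L2pi \<Rightarrow> bool" where
  "has_weak_derivative u g \<longleftrightarrow>
     (\<forall>p. test_function p \<longrightarrow>
        cinner u (abs_L2pi (\<lambda>t. complex_of_real (deriv p t)))
          = - cinner g (abs_L2pi (\<lambda>t. complex_of_real (p t))))"

definition weak_derivative :: "L2pi \<Rightarrow> L2pi" where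
  "weak_derivative u = (THE g. has_weak_derivative u g)"

lemma test_function_deriv:
  assumes "test_function p"
  shows "(p has_vector_derivative deriv p t) (at t)" "continuous_on UNIV (deriv p)"
    "continuous_on UNIV p"
proof -
  obtain D where D: "\<And>t. (p has_vector_derivative D t) (at t)" "continuous_on UNIV D"
    using assms unfolding test_function_def C1_differentiable_on_def by auto
  have "deriv p = D"
    using D(1) by (auto simp: has_real_derivative_iff_has_vector_derivative[symmetric] DERIV_imp_deriv)
  then show "(p has_vector_derivative deriv p t) (at t)" "continuous_on UNIV (deriv p)"
    using D by auto
  show "continuous_on UNIV p"
    using D(1) by (meson continuous_at_imp_continuous_on has_vector_derivative_continuous)
qed

lemma test_function_square_integrable:
  assumes "test_function p"
  shows "square_integrable (\<lambda>t. complex_of_real (p t))"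
    "square_integrable (\<lambda>t. complex_of_real (deriv p t))"
  by (rule square_integrable_continuous;
      intro continuous_intros continuous_on_subset[OF test_function_deriv(3)[OF assms]]
        continuous_on_subset[OF test_function_deriv(2)[OF assms]]; simp)+

lemma cinner_abs_L2pi:
  assumes "square_integrable f" "square_integrable g"
  shows "cinner (abs_L2pi f) (abs_L2pi g) = (LINT t|Mpi. f t * cnj (g t))"
  by (rule cinner_L2pi.abs_eq) (use assms in \<open>auto simp: L2_eq_def\<close>)

lemma abs_L2pi_cases:
  obtains f where "square_integrable f" "u = abs_L2pi f"
proof
  have "L2_eq (rep_L2pi u) (rep_L2pi u)"
    by (rule Quotient3_rep_reflp[OF Quotient3_L2pi])
  then show "square_integrable (rep_L2pi u)" by (simp add: L2_eq_def)
  show "u = abs_L2pi (rep_L2pi u)"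
    by (rule Quotient3_abs_rep[OF Quotient3_L2pi, symmetric])
qed

lemma has_real_derivative_pos_part_square:
  "((\<lambda>x::real. (max 0 x)\<^sup>2) has_real_derivative 2 * max 0 x) (at x)"
proof (cases x "0::real" rule: linorder_cases)
  case less
  have "((\<lambda>x::real. 0) has_real_derivative 2 * max 0 x) (at x)"
    using less by simp
  then show ?thesis
    by (rule DERIV_cong_ev[THEN iffD1, rotated -1])
       (use less in \<open>auto intro!: eventually_mono[OF order_tendstoD(2)[OF tendsto_ident_at]]
          simp: eventually_nhds_conv_at\<close>)
next
  case greater
  have "((\<lambda>x::real. x\<^sup>2) has_real_derivative 2 * max 0 x) (at x)"
    using greater by (auto intro!: derivative_eq_intros)
  then show ?thesis
    by (rule DERIV_cong_ev[THEN iffD1, rotated -1])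
       (use greater in \<open>auto intro!: eventually_mono[OF order_tendstoD(1)[OF tendsto_ident_at]]
          simp: eventually_nhds_conv_at\<close>)
next
  case equal
  have "((\<lambda>h::real. (max 0 h)\<^sup>2 / h) \<longlongrightarrow> 0) (at 0)"
  proof (rule Lim_null_comparison)
    show "\<forall>\<^sub>F h in at 0. norm ((max 0 h)\<^sup>2 / h) \<le> \<bar>h\<bar>"
      by (rule always_eventually) (auto simp: max_def power2_eq_square)
    show "((\<lambda>h::real. \<bar>h\<bar>) \<longlongrightarrow> 0) (at 0)"
      by (rule tendsto_eq_intros | simp)+
  qed
  then show ?thesis using equal by (simp add: DERIV_def)
qed

lemma test_function_bump:
  assumes "0 < a" "a < b" "b < pi"
  shows "test_function (\<lambda>t. 1 - (1 - (max 0 ((t - a) * (b - t)))\<^sup>2 / pi ^ 4) ^ k)"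
  unfolding test_function_def
proof (intro conjI exI)
  have sq: "((\<lambda>t. (max 0 ((t - a) * (b - t)))\<^sup>2) has_real_derivative
      2 * max 0 ((t - a) * (b - t)) * (a + b - 2 * t)) (at t)" for t
    by (rule DERIV_chain2[OF has_real_derivative_pos_part_square])
       (auto intro!: derivative_eq_intros simp: algebra_simps)
  have "((\<lambda>t. 1 - (1 - (max 0 ((t - a) * (b - t)))\<^sup>2 / pi ^ 4) ^ k) has_real_derivative
      of_nat k * (2 * max 0 ((t - a) * (b - t)) * (a + b - 2 * t) / pi ^ 4) *
        (1 - (max 0 ((t - a) * (b - t)))\<^sup>2 / pi ^ 4) ^ (k - 1)) (at t)" for t
    by (rule DERIV_cong[OF DERIV_diff[OF DERIV_const DERIV_power[OF DERIV_diff[OF DERIV_const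
          DERIV_cdivide[OF sq]]]]]) simp
  moreover have "continuous_on UNIV (\<lambda>t. of_nat k * (2 * max 0 ((t - a) * (b - t)) * (a + b - 2 * t) / pi ^ 4) *
        (1 - (max 0 ((t - a) * (b - t)))\<^sup>2 / pi ^ 4) ^ (k - 1))"
    by (intro continuous_intros) auto
  ultimately show "(\<lambda>t. 1 - (1 - (max 0 ((t - a) * (b - t)))\<^sup>2 / pi ^ 4) ^ k) C1_differentiable_on UNIV"
    unfolding C1_differentiable_on_def has_real_derivative_iff_has_vector_derivative
    by (intro exI conjI ballI)
  show "\<forall>t. t \<notin> {a..b} \<longrightarrow> 1 - (1 - (max 0 ((t - a) * (b - t)))\<^sup>2 / pi ^ 4) ^ k = 0"
    using assms by (auto simp: max_def mult_less_0_iff zero_le_mult_iff)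
qed (use assms in auto)

lemma square_integrable_imp_integrable:
  assumes "square_integrable f" shows "integrable Mpi f"
  using square_integrable_mult[OF assms, of "\<lambda>t. 1"] square_integrable_continuous[of "\<lambda>t. 1"]
  by simp

lemma L2_eq_zero_test:
  assumes d: "square_integrable d"
    and z: "\<And>p. test_function p \<Longrightarrow> (LINT t|Mpi. d t * complex_of_real (p t)) = 0"
  shows "AE t in Mpi. d t = 0"
proof -
  note [measurable] = square_integrable_measurable[OF d]
  have int: "integrable Mpi d" by (rule square_integrable_imp_integrable[OF d])
  then have intn: "integrable Mpi (\<lambda>t. norm (d t))" by simp
  have bset: "A \<inter> space Mpi \<in> sets Mpi" if "A \<in> sets lebesgue" for A
    using that by (auto simp: sets_restrict_space)
  have ind: "indicat_real A \<in> borel_measurable Mpi" if "A \<in> sets lebesgue" for A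
    using that by (intro measurable_restrict_space1) auto
  have indint: "integrable Mpi (\<lambda>t. indicat_real A t *\<^sub>R d t)" if "A \<in> sets lebesgue" for A
    by (rule Bochner_Integration.integrable_bound[OF int])
       (use ind[OF that] square_integrable_measurable[OF d] in
         \<open>auto intro!: borel_measurable_scaleR simp: abs_if indicator_eq_0_iff split: split_indicator\<close>)
  have open0: "(LINT t|Mpi. indicat_real {a<..<b} t *\<^sub>R d t) = 0" if ab: "0 < a" "b < pi" for a b
  proof (cases "a < b")
    case True
    define q where "q t = (max 0 ((t - a) * (b - t)))\<^sup>2 / pi ^ 4" for t
    have q: "0 \<le> q t" "q t \<le> 1" "t \<in> {a<..<b} \<Longrightarrow> 0 < q t" "t \<notin> {a<..<b} \<Longrightarrow> q t = 0" for t
    proof -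
      show "0 \<le> q t" by (simp add: q_def)
      show 4: "q t = 0" if "t \<notin> {a<..<b}"
        using that True by (auto simp: q_def max_def mult_less_0_iff zero_le_mult_iff)
      show "0 < q t" if "t \<in> {a<..<b}"
        using that by (auto simp: q_def max_def)
      show "q t \<le> 1"
      proof (cases "t \<in> {a<..<b}")
        case True
        have "(t - a) * (b - t) \<le> pi * pi"
          using True ab by (intro mult_mono) auto
        moreover have "0 \<le> (t - a) * (b - t)" using True by auto
        ultimately have "(max 0 ((t - a) * (b - t)))\<^sup>2 \<le> (pi * pi)\<^sup>2"
          by (intro power_mono) auto
        then show ?thesis by (simp add: q_def power2_eq_square power4_eq_xxxx mult.assoc)
      qed (simp add: 4)
    qed
    have cq: "continuous_on UNIV q"
      unfolding q_def by (intro continuous_intros) auto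
    have lim: "(\<lambda>k. LINT t|Mpi. d t * complex_of_real (1 - (1 - q t) ^ k))
        \<longlonglongrightarrow> (LINT t|Mpi. indicat_real {a<..<b} t *\<^sub>R d t)"
    proof (rule integral_dominated_convergence[OF _ _ intn])
      show "(\<lambda>t. indicat_real {a<..<b} t *\<^sub>R d t) \<in> borel_measurable Mpi"
        using indint[of "{a<..<b}"] by auto
      show "(\<lambda>t. d t * complex_of_real (1 - (1 - q t) ^ k)) \<in> borel_measurable Mpi" for k
      proof -
        have "(\<lambda>t. complex_of_real (1 - (1 - q t) ^ k)) \<in> borel_measurable Mpi"
          by (rule square_integrable_measurable[OF square_integrable_continuous])
             (intro continuous_intros continuous_on_subset[OF cq] subset_UNIV)
        then show ?thesis by measurable
      qed
      show "AE t in Mpi. (\<lambda>k. d t * complex_of_real (1 - (1 - q t) ^ k))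
          \<longlonglongrightarrow> indicat_real {a<..<b} t *\<^sub>R d t"
      proof (rule AE_I2)
        fix t
        show "(\<lambda>k. d t * complex_of_real (1 - (1 - q t) ^ k)) \<longlonglongrightarrow> indicat_real {a<..<b} t *\<^sub>R d t"
        proof (cases "t \<in> {a<..<b}")
          case True
          have "(\<lambda>k. (1 - q t) ^ k) \<longlonglongrightarrow> 0"
            using q(2)[of t] q(3)[OF True] by (intro LIMSEQ_realpow_zero) auto
          then have "(\<lambda>k. d t * complex_of_real (1 - (1 - q t) ^ k)) \<longlonglongrightarrow> d t * complex_of_real (1 - 0)"
            by (intro tendsto_mult tendsto_const tendsto_of_real tendsto_diff)
          then show ?thesis using True by simp
        qed (simp add: q(4))
      qed
      show "AE t in Mpi. norm (d t * complex_of_real (1 - (1 - q t) ^ k)) \<le> norm (d t)" for k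
      proof (rule AE_I2)
        fix t
        have "0 \<le> (1 - q t) ^ k" "(1 - q t) ^ k \<le> 1"
          using q[of t] by (auto intro!: power_le_one)
        then have "\<bar>1 - (1 - q t) ^ k\<bar> \<le> 1" by linarith
        then show "norm (d t * complex_of_real (1 - (1 - q t) ^ k)) \<le> norm (d t)"
          by (simp add: norm_mult mult_left_le del: of_real_diff of_real_power)
      qed
    qed
    have "(LINT t|Mpi. d t * complex_of_real (1 - (1 - q t) ^ k)) = 0" for k
      unfolding q_def by (rule z[OF test_function_bump]) (use ab True in auto)
    then show ?thesis using lim LIMSEQ_unique by (simp add: LIMSEQ_const_iff)
  qed simp
  have open1: "(LINT t|Mpi. indicat_real {a<..<b} t *\<^sub>R d t) = 0" if ab: "0 \<le> a" "b \<le> pi" for a b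
  proof -
    let ?S = "\<lambda>k. {a + 1 / real (Suc k)<..<b - 1 / real (Suc k)}"
    have "(\<lambda>k. LINT t|Mpi. indicat_real (?S k) t *\<^sub>R d t)
        \<longlonglongrightarrow> (LINT t|Mpi. indicat_real {a<..<b} t *\<^sub>R d t)"
    proof (rule integral_dominated_convergence[OF _ _ intn])
      show "(\<lambda>t. indicat_real {a<..<b} t *\<^sub>R d t) \<in> borel_measurable Mpi"
        using indint[of "{a<..<b}"] by auto
      show "(\<lambda>t. indicat_real (?S k) t *\<^sub>R d t) \<in> borel_measurable Mpi" for k
        using indint[of "?S k"] by auto
      show "AE t in Mpi. (\<lambda>k. indicat_real (?S k) t *\<^sub>R d t) \<longlonglongrightarrow> indicat_real {a<..<b} t *\<^sub>R d t"
      proof (rule AE_I2)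
        fix t
        have l: "(\<lambda>k. 1 / real (Suc k)) \<longlonglongrightarrow> 0" by (rule LIMSEQ_Suc[OF lim_1_over_n])
        have "\<forall>\<^sub>F k in sequentially. indicat_real (?S k) t *\<^sub>R d t = indicat_real {a<..<b} t *\<^sub>R d t"
        proof (cases "t \<in> {a<..<b}")
          case True
          then have "0 < min (t - a) (b - t)" by auto
          from order_tendstoD(2)[OF l this] show ?thesis
            by eventually_elim (use True in auto)
        next
          case False
          then have "t \<notin> ?S k" for k
          proof -
            define e where "e = 1 / real (Suc k)"
            have "0 < e" by (simp add: e_def)
            then show ?thesis using False unfolding e_def[symmetric] by auto
          qed
          then show ?thesis using False by simp
        qed
        then show "(\<lambda>k. indicat_real (?S k) t *\<^sub>R d t) \<longlonglongrightarrow> indicat_real {a<..<b} t *\<^sub>R d t"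
          by (rule tendsto_eventually)
      qed
      show "AE t in Mpi. norm (indicat_real (?S k) t *\<^sub>R d t) \<le> norm (d t)" for k
        by (rule AE_I2) (auto simp: indicator_def)
    qed
    moreover have "(LINT t|Mpi. indicat_real (?S k) t *\<^sub>R d t) = 0" for k
    proof (rule open0)
      have "0 < 1 / real (Suc k)" by simp
      then show "0 < a + 1 / real (Suc k)" "b - 1 / real (Suc k) < pi"
        using ab by linarith+
    qed
    ultimately show ?thesis by (simp add: LIMSEQ_const_iff)
  qed
  have AE_eqI: "(LINT t|Mpi. indicat_real A t *\<^sub>R d t) = (LINT t|Mpi. indicat_real B t *\<^sub>R d t)"
    if A: "A \<in> sets lebesgue" and B: "B \<in> sets lebesgue" and N: "N \<in> null_sets lebesgue"
      and AB: "\<And>t. t \<in> {0<..<pi} \<Longrightarrow> t \<notin> N \<Longrightarrow> t \<in> A \<longleftrightarrow> t \<in> B" for A B N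
  proof (rule integral_cong_AE)
    show "(\<lambda>t. indicat_real A t *\<^sub>R d t) \<in> borel_measurable Mpi"
      "(\<lambda>t. indicat_real B t *\<^sub>R d t) \<in> borel_measurable Mpi"
      using indint[OF A] indint[OF B] by auto
    have "AE t in lebesgue. t \<in> {0<..<pi} \<longrightarrow> indicat_real A t *\<^sub>R d t = indicat_real B t *\<^sub>R d t"
      by (rule AE_I'[OF N]) (use AB in \<open>auto simp: indicator_def\<close>)
    then show "AE t in Mpi. indicat_real A t *\<^sub>R d t = indicat_real B t *\<^sub>R d t"
      by (subst AE_restrict_space_iff) auto
  qed
  have borel: "(LINT t|Mpi. indicat_real A t *\<^sub>R d t) = 0" if "A \<in> sets borel" for A
    using that
  proof (induction A rule: borel_set_induct)
    case empty
    show ?case by simp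
  next
    case (interval a b)
    have "(LINT t|Mpi. indicat_real {a..b} t *\<^sub>R d t) =
        (LINT t|Mpi. indicat_real {max 0 a<..<min pi b} t *\<^sub>R d t)"
      by (rule AE_eqI[where N = "{a, b}"])
         (auto intro!: negligible_iff_null_sets[THEN iffD1])
    also have "\<dots> = 0" by (rule open1) auto
    finally show ?case .
  next
    case (compl A)
    have A: "A \<in> sets lebesgue" using compl by auto
    have "(LINT t|Mpi. indicat_real (UNIV - A) t *\<^sub>R d t) = (LINT t|Mpi. d t - indicat_real A t *\<^sub>R d t)"
      by (rule Bochner_Integration.integral_cong) (auto simp: indicator_def)
    also have "\<dots> = (LINT t|Mpi. d t) - 0"
      using compl int indint[OF A] by (subst Bochner_Integration.integral_diff) auto
    also have "(LINT t|Mpi. d t) = (LINT t|Mpi. indicat_real {0<..<pi} t *\<^sub>R d t)"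
      by (rule Bochner_Integration.integral_cong) auto
    also have "\<dots> = 0" by (rule open1) auto
    finally show ?case by (simp add: Compl_eq_Diff_UNIV)
  next
    case (union F)
    have F: "F i \<in> sets lebesgue" for i using union(2)[of i] by auto
    have "(\<lambda>k. LINT t|Mpi. (\<Sum>i<k. indicat_real (F i) t *\<^sub>R d t))
        \<longlonglongrightarrow> (LINT t|Mpi. indicat_real (\<Union>i. F i) t *\<^sub>R d t)"
    proof (rule integral_dominated_convergence[OF _ _ intn])
      show "(\<lambda>t. indicat_real (\<Union>i. F i) t *\<^sub>R d t) \<in> borel_measurable Mpi"
        using indint[of "\<Union>i. F i"] F by auto
      show "(\<lambda>t. \<Sum>i<k. indicat_real (F i) t *\<^sub>R d t) \<in> borel_measurable Mpi" for k
        by (intro borel_measurable_sum borel_measurable_integrable[OF indint[OF F]])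
      have s: "(\<Sum>i<k. indicat_real (F i) t *\<^sub>R d t) = indicat_real (\<Union>i<k. F i) t *\<^sub>R d t" for k t
      proof -
        have "indicat_real (\<Union>i<k. F i) t = (\<Sum>i<k. indicat_real (F i) t)"
          by (rule indicator_UN_disjoint)
             (use union(1) in \<open>auto simp: disjoint_family_on_def\<close>)
        then show ?thesis by (simp add: scaleR_sum_left)
      qed
      show "AE t in Mpi. (\<lambda>k. \<Sum>i<k. indicat_real (F i) t *\<^sub>R d t)
          \<longlonglongrightarrow> indicat_real (\<Union>i. F i) t *\<^sub>R d t"
        unfolding s
        by (intro AE_I2 tendsto_scaleR tendsto_const LIMSEQ_indicator_UN)
      show "AE t in Mpi. norm (\<Sum>i<k. indicat_real (F i) t *\<^sub>R d t) \<le> norm (d t)" for k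
        unfolding s by (rule AE_I2) (auto simp: indicator_def)
    qed
    moreover have "(LINT t|Mpi. (\<Sum>i<k. indicat_real (F i) t *\<^sub>R d t)) = 0" for k
      using indint[OF F] union by (subst Bochner_Integration.integral_sum) auto
    ultimately show ?case by (simp add: LIMSEQ_const_iff)
  qed
  show ?thesis
  proof (rule sigma_finite_measure.density_zero[OF _ int])
    have "finite_measure Mpi" by (rule finite_measure_lebesgue_on) auto
    then show "sigma_finite_measure Mpi"
      unfolding finite_measure_def by blast
  next
    fix A assume "A \<in> sets Mpi"
    then have A: "A \<in> sets lebesgue" by (auto simp: sets_restrict_space)
    obtain C T where CT: "fsigma C" "T \<in> null_sets lebesgue" "C \<union> T = A"
      by (rule lebesgue_set_almost_fsigma[OF A])
    have C: "C \<in> sets borel" using CT(1) by (cases rule: fsigma.cases) auto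
    have "set_lebesgue_integral Mpi A d = (LINT t|Mpi. indicat_real C t *\<^sub>R d t)"
      unfolding set_lebesgue_integral_def
      by (rule AE_eqI[OF A _ CT(2)]) (use C CT(3) in auto)
    then show "set_lebesgue_integral Mpi A d = 0" using borel[OF C] by simp
  qed
qed

lemma has_weak_derivative_unique:
  assumes "has_weak_derivative u g" "has_weak_derivative u h"
  shows "g = h"
proof -
  obtain d where d: "square_integrable d" "g - h = abs_L2pi d" by (rule abs_L2pi_cases)
  have "(LINT t|Mpi. d t * complex_of_real (p t)) = 0" if p: "test_function p" for p
  proof -
    have "cinner g (abs_L2pi (\<lambda>t. complex_of_real (p t))) = cinner h (abs_L2pi (\<lambda>t. complex_of_real (p t)))"
      using assms p unfolding has_weak_derivative_def by (metis neg_equal_iff_equal)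
    moreover have "cinner (g - h) x + cinner h x = cinner g x" for x
      using cinner_add_left[of "g - h" h x] by simp
    ultimately have "cinner (abs_L2pi d) (abs_L2pi (\<lambda>t. complex_of_real (p t))) = 0"
      unfolding d(2)[symmetric] by (metis add_cancel_left_left)
    then show ?thesis
      by (simp add: cinner_abs_L2pi d test_function_square_integrable[OF p])
  qed
  then have "AE t in Mpi. d t = 0" by (rule L2_eq_zero_test[OF d(1)])
  then have "L2_eq d (\<lambda>t. 0)" using d(1) by (simp add: L2_eq_def square_integrable_zero)
  then have "abs_L2pi d = 0" unfolding zero_L2pi_def
    using Quotient3_rel_abs[OF Quotient3_L2pi] by simp
  then show ?thesis using d(2) by simp
qed

lemma weak_derivative_eq: "has_weak_derivative u g \<Longrightarrow> weak_derivative u = g"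
  unfolding weak_derivative_def by (blast intro: has_weak_derivative_unique)

lemma has_weak_derivative_zero: "has_weak_derivative 0 0"
proof -
  have "cinner 0 x = 0" for x :: L2pi
    using cinner_add_left[of 0 0 x] by simp
  then show ?thesis by (simp add: has_weak_derivative_def)
qed

lemma has_weak_derivative_add:
  "has_weak_derivative u g \<Longrightarrow> has_weak_derivative v h \<Longrightarrow> has_weak_derivative (u + v) (g + h)"
  by (simp add: has_weak_derivative_def cinner_add_left)

lemma has_weak_derivative_scaleC:
  "has_weak_derivative u g \<Longrightarrow> has_weak_derivative (a *\<^sub>C u) (a *\<^sub>C g)"
  by (simp add: has_weak_derivative_def cinner_scaleC_left)

text \<open>The norm that the instance below puts on \<open>H1pi\<close> is
  \<open>\<parallel>u\<parallel>\<^sup>2 = \<parallel>u'\<parallel>\<^sup>2 + \<parallel>u\<parallel>\<^sup>2\<close> (with \<open>L\<^sup>2\<close>-norms on the right).\<close>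

typedef H1pi = "{u. \<exists>g. has_weak_derivative u g}"
  morphisms H1_to_L2 L2_to_H1
  using has_weak_derivative_zero by blast

definition H1_deriv :: "H1pi \<Rightarrow> L2pi" where
  "H1_deriv u = weak_derivative (H1_to_L2 u)"

lemma H1_deriv: "has_weak_derivative (H1_to_L2 u) (H1_deriv u)"
  using H1_to_L2[of u] weak_derivative_eq unfolding H1_deriv_def by blast

setup_lifting type_definition_H1pi

instantiation H1pi :: complex_inner
begin

lift_definition zero_H1pi :: H1pi is 0
  using has_weak_derivative_zero by blast

lift_definition plus_H1pi :: "H1pi \<Rightarrow> H1pi \<Rightarrow> H1pi" is "(+)"
  using has_weak_derivative_add by blast

lift_definition scaleC_H1pi :: "complex \<Rightarrow> H1pi \<Rightarrow> H1pi" is "(*\<^sub>C)"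
  using has_weak_derivative_scaleC by blast

definition scaleR_H1pi :: "real \<Rightarrow> H1pi \<Rightarrow> H1pi" where
  "scaleR_H1pi r x = complex_of_real r *\<^sub>C x"

definition uminus_H1pi :: "H1pi \<Rightarrow> H1pi" where
  "uminus_H1pi x = (-1) *\<^sub>C x"

definition minus_H1pi :: "H1pi \<Rightarrow> H1pi \<Rightarrow> H1pi" where
  "minus_H1pi x y = x + - y"

definition cinner_H1pi :: "H1pi \<Rightarrow> H1pi \<Rightarrow> complex" where
  "cinner_H1pi u v = cinner (H1_deriv u) (H1_deriv v) + cinner (H1_to_L2 u) (H1_to_L2 v)"

definition inner_H1pi :: "H1pi \<Rightarrow> H1pi \<Rightarrow> real" where
  "inner_H1pi x y = Re (cinner x y)"

definition norm_H1pi :: "H1pi \<Rightarrow> real" where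
  "norm_H1pi x = sqrt (inner x x)"

definition sgn_H1pi :: "H1pi \<Rightarrow> H1pi" where
  "sgn_H1pi x = inverse (norm x) *\<^sub>R x"

definition dist_H1pi :: "H1pi \<Rightarrow> H1pi \<Rightarrow> real" where
  "dist_H1pi x y = norm (x - y)"

definition uniformity_H1pi :: "(H1pi \<times> H1pi) filter" where
  "uniformity_H1pi = (INF e\<in>{0<..}. principal {(x, y). dist x y < e})"

definition open_H1pi :: "H1pi set \<Rightarrow> bool" where
  "open_H1pi U \<longleftrightarrow> (\<forall>x\<in>U. eventually (\<lambda>(x', y). x' = x \<longrightarrow> y \<in> U) uniformity)"

instance
proof
  fix x y z :: H1pi and a b :: complex and r s :: real
  have dadd: "H1_deriv (x + y) = H1_deriv x + H1_deriv y" for x y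
    unfolding H1_deriv_def[of "x + y"]
    by (rule weak_derivative_eq) (simp add: plus_H1pi.rep_eq has_weak_derivative_add H1_deriv)
  have dscl: "H1_deriv (a *\<^sub>C x) = a *\<^sub>C H1_deriv x" for a x
    unfolding H1_deriv_def[of "a *\<^sub>C x"]
    by (rule weak_derivative_eq) (simp add: scaleC_H1pi.rep_eq has_weak_derivative_scaleC H1_deriv)
  have dzero: "H1_deriv 0 = 0"
    unfolding H1_deriv_def
    by (rule weak_derivative_eq) (simp add: zero_H1pi.rep_eq has_weak_derivative_zero)
  show "x + y + z = x + (y + z)" by transfer (simp add: add.assoc)
  show "x + y = y + x" by transfer (simp add: add.commute)
  show "0 + x = x" by transfer simp
  show "- x + x = 0" unfolding uminus_H1pi_def
    by transfer simp
  show "x - y = x + - y" by (simp add: minus_H1pi_def)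
  show ar: "a *\<^sub>C (x + y) = a *\<^sub>C x + a *\<^sub>C y" for a
    by transfer (simp add: scaleC_add_right)
  show al: "(a + b) *\<^sub>C x = a *\<^sub>C x + b *\<^sub>C x" for a b
    by transfer (simp add: scaleC_add_left)
  show as: "a *\<^sub>C b *\<^sub>C x = (a * b) *\<^sub>C x" for a b
    by transfer (simp add: scaleC_scaleC)
  show a1: "1 *\<^sub>C x = x"
    by transfer (simp add: scaleC_one)
  show "r *\<^sub>R x = complex_of_real r *\<^sub>C x"
    by (simp add: scaleR_H1pi_def)
  show "r *\<^sub>R (x + y) = r *\<^sub>R x + r *\<^sub>R y"
    by (simp add: scaleR_H1pi_def ar)
  show "(r + s) *\<^sub>R x = r *\<^sub>R x + s *\<^sub>R x"
    by (simp add: scaleR_H1pi_def al)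
  show "r *\<^sub>R s *\<^sub>R x = (r * s) *\<^sub>R x"
    by (simp add: scaleR_H1pi_def as)
  show "1 *\<^sub>R x = x"
    by (simp add: scaleR_H1pi_def a1)
  show comm: "cinner x y = cnj (cinner y x)" for x y :: H1pi
    unfolding cinner_H1pi_def
    by (subst (1 2) cinner_commute) simp
  show add: "cinner (x + y) z = cinner x z + cinner y z"
    by (simp add: cinner_H1pi_def dadd plus_H1pi.rep_eq cinner_add_left)
  show scl: "cinner (a *\<^sub>C x) y = a * cinner x y" for a
    by (simp add: cinner_H1pi_def dscl scaleC_H1pi.rep_eq cinner_scaleC_left distrib_left)
  show "inner x y = Re (cinner x y)"
    by (simp add: inner_H1pi_def)
  show "inner x y = inner y x"
    unfolding inner_H1pi_def by (subst comm) simp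
  show "inner (x + y) z = inner x z + inner y z"
    by (simp add: inner_H1pi_def add)
  show "inner (r *\<^sub>R x) y = r * inner x y"
    by (simp add: inner_H1pi_def scaleR_H1pi_def scl)
  have xx: "inner x x = inner (H1_deriv x) (H1_deriv x) + inner (H1_to_L2 x) (H1_to_L2 x)"
    by (simp add: inner_H1pi_def cinner_H1pi_def inner_Re_cinner)
  show "0 \<le> inner x x" by (simp add: xx)
  have "H1_to_L2 x = 0 \<longleftrightarrow> x = 0"
    by (metis H1_to_L2_inject zero_H1pi.rep_eq)
  then show "(inner x x = 0) = (x = 0)"
    by (auto simp: xx add_nonneg_eq_0_iff dzero)
  show "norm x = sqrt (inner x x)" by (simp add: norm_H1pi_def)
  show "sgn x = inverse (norm x) *\<^sub>R x" by (simp add: sgn_H1pi_def)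
  show "dist x y = norm (x - y)" by (simp add: dist_H1pi_def)
  show "uniformity = (INF e\<in>{0<..}. principal {(x, y::H1pi). dist x y < e})"
    by (simp add: uniformity_H1pi_def)
  show "open U = (\<forall>x\<in>U. \<forall>\<^sub>F (x', y) in uniformity. x' = x \<longrightarrow> y \<in> U)" for U :: "H1pi set"
    by (simp add: open_H1pi_def)
qed

end

definition H2 :: "L2pi set" where
  "H2 = {u. u \<in> range H1_to_L2 \<and> weak_derivative u \<in> range H1_to_L2}"

text \<open>The value at \<open>t \<in> [0,\<pi>]\<close> of the unique continuous representative of \<open>u \<in> H\<^sup>1(0,\<pi>)\<close>.\<close>

definition point_value :: "L2pi \<Rightarrow> real \<Rightarrow> complex" where
  "point_value u t = (SOME f. continuous_on {0..pi} f \<and> abs_L2pi f = u) t"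

definition essentially_bounded :: "(real \<Rightarrow> real) \<Rightarrow> bool" where
  "essentially_bounded w \<longleftrightarrow> w \<in> borel_measurable Mpi \<and> (\<exists>C. AE t in Mpi. \<bar>w t\<bar> \<le> C)"

text \<open>Meaningful only for essentially bounded \<open>w\<close>.\<close>

definition L2_mult :: "(real \<Rightarrow> real) \<Rightarrow> L2pi \<Rightarrow> L2pi" where
  "L2_mult w u = abs_L2pi (\<lambda>t. complex_of_real (w t) * rep_L2pi u t)"

definition delta :: "real \<Rightarrow> real \<Rightarrow> real" where
  "delta r1 r2 = 1 / pi * ln (r2 / r1)"

definition potential :: "real \<Rightarrow> real \<Rightarrow> real \<Rightarrow> (real \<Rightarrow> real) \<Rightarrow> real \<Rightarrow> real" where
  "potential r1 r2 \<omega> nn t =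
     \<omega>\<^sup>2 * r1\<^sup>2 * (delta r1 r2)\<^sup>2 * exp (2 * delta r1 r2 * t) * nn t"

definition boundary_coeff :: "real \<Rightarrow> real \<Rightarrow> real \<Rightarrow> real \<Rightarrow> complex" where
  "boundary_coeff r1 r2 \<omega> \<sigma> = \<i> * complex_of_real (\<omega> * \<sigma> * delta r1 r2 * r2)"

definition T_dom :: "real \<Rightarrow> real \<Rightarrow> real \<Rightarrow> real \<Rightarrow> L2pi set" where
  "T_dom r1 r2 \<omega> \<sigma> =
     {u \<in> H2. point_value (weak_derivative u) 0 = 0 \<and>
        point_value (weak_derivative u) pi + boundary_coeff r1 r2 \<omega> \<sigma> * point_value u pi = 0}"

definition T_op :: "real \<Rightarrow> real \<Rightarrow> real \<Rightarrow> (real \<Rightarrow> real) \<Rightarrow> L2pi \<Rightarrow> L2pi" where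
  "T_op r1 r2 \<omega> nn u = - weak_derivative (weak_derivative u) - L2_mult (potential r1 r2 \<omega> nn) u"

definition weak_eigenpair ::
    "real \<Rightarrow> real \<Rightarrow> real \<Rightarrow> real \<Rightarrow> (real \<Rightarrow> real) \<Rightarrow> complex \<Rightarrow> H1pi \<Rightarrow> bool" where
  "weak_eigenpair r1 r2 \<omega> \<sigma> nn l u \<longleftrightarrow> u \<noteq> 0 \<and>
     (\<forall>v. cinner (H1_deriv u) (H1_deriv v)
          - cinner (L2_mult (potential r1 r2 \<omega> nn) (H1_to_L2 u)) (H1_to_L2 v)
          + boundary_coeff r1 r2 \<omega> \<sigma> * point_value (H1_to_L2 u) pi * cnj (point_value (H1_to_L2 v) pi)
        = l * cinner (H1_to_L2 u) (H1_to_L2 v))"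

text \<open>Sequences are indexed from \<open>0\<close>: \<open>mu n\<close> and \<open>psi n\<close> are the \<open>(n + 1)\<close>-st pair, with
  eigenvalue \<open>n\<^sup>2 + 1\<close> and eigenfunction a multiple of \<open>cos (n t)\<close>.\<close>

definition mu :: "nat \<Rightarrow> real" where
  "mu n = (real n)\<^sup>2 + 1"

definition psi :: "nat \<Rightarrow> H1pi" where
  "psi n = L2_to_H1 (abs_L2pi (\<lambda>t. complex_of_real
     (if n = 0 then sqrt (1 / pi) else sqrt (2 / pi) * cos (real n * t))))"

lemma has_weak_derivative_C1:
  assumes f: "\<And>t. (f has_vector_derivative f' t) (at t)" and f': "continuous_on UNIV f'"
  shows "has_weak_derivative (abs_L2pi f) (abs_L2pi f')"
  unfolding has_weak_derivative_def
proof (intro allI impI)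
  fix p assume p: "test_function p"
  note sp = test_function_square_integrable[OF p]
  have cf: "continuous_on UNIV f"
    using f by (meson continuous_at_imp_continuous_on has_vector_derivative_continuous)
  have sf: "square_integrable f" "square_integrable f'"
    by (auto intro!: square_integrable_continuous intro: continuous_on_subset[OF cf]
        continuous_on_subset[OF f'])
  let ?F = "\<lambda>t. f t * complex_of_real (p t)"
  let ?F' = "\<lambda>t. f t * complex_of_real (deriv p t) + f' t * complex_of_real (p t)"
  have int: "integrable Mpi (\<lambda>t. f t * complex_of_real (deriv p t))"
    "integrable Mpi (\<lambda>t. f' t * complex_of_real (p t))"
    using square_integrable_mult[OF sf(1) sp(2)] square_integrable_mult[OF sf(2) sp(1)] by auto
  have "(?F' has_integral ?F pi - ?F 0) {0..pi}"
  proof (rule fundamental_theorem_of_calculus)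
    show "(?F has_vector_derivative ?F' t) (at t within {0..pi})" for t
      by (intro has_vector_derivative_at_within[OF has_vector_derivative_mult[OF f]]
          has_vector_derivative_of_real)
         (simp add: has_real_derivative_iff_has_vector_derivative test_function_deriv(1)[OF p])
  qed simp
  moreover have "p 0 = 0" "p pi = 0" using p by (auto simp: test_function_def)
  ultimately have "integral {0..pi} ?F' = 0" by (simp add: integral_unique)
  then have "integral {0<..<pi} ?F' = 0" by (simp add: integral_open_interval_real)
  moreover have "(LINT t|Mpi. ?F' t) = integral {0<..<pi} ?F'"
    by (rule lebesgue_integral_eq_integral) (use int in auto)
  ultimately have "(LINT t|Mpi. f t * complex_of_real (deriv p t)) +
      (LINT t|Mpi. f' t * complex_of_real (p t)) = 0"
    using int by simp
  then show "cinner (abs_L2pi f) (abs_L2pi (\<lambda>t. complex_of_real (deriv p t))) =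
      - cinner (abs_L2pi f') (abs_L2pi (\<lambda>t. complex_of_real (p t)))"
    by (simp add: cinner_abs_L2pi sf sp eq_neg_iff_add_eq_0)
qed

lemma H1_to_L2_psi:
  "H1_to_L2 (psi n) = abs_L2pi (\<lambda>t. complex_of_real
     (if n = 0 then sqrt (1 / pi) else sqrt (2 / pi) * cos (real n * t)))"
proof -
  have "has_weak_derivative
      (abs_L2pi (\<lambda>t. complex_of_real (if n = 0 then sqrt (1 / pi) else sqrt (2 / pi) * cos (real n * t))))
      (abs_L2pi (\<lambda>t. complex_of_real (if n = 0 then 0 else - sqrt (2 / pi) * real n * sin (real n * t))))"
  proof (rule has_weak_derivative_C1)
    show "continuous_on UNIV (\<lambda>t. complex_of_real
        (if n = 0 then 0 else - sqrt (2 / pi) * real n * sin (real n * t)))"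
      by (cases "n = 0") (auto intro!: continuous_intros)
    show "((\<lambda>t. complex_of_real (if n = 0 then sqrt (1 / pi) else sqrt (2 / pi) * cos (real n * t)))
        has_vector_derivative complex_of_real
          (if n = 0 then 0 else - sqrt (2 / pi) * real n * sin (real n * t))) (at t)" for t
      by (intro has_vector_derivative_of_real, cases "n = 0")
         (auto intro!: derivative_eq_intros)
  qed
  then show ?thesis
    unfolding psi_def by (subst L2_to_H1_inverse) auto
qed

end

theory Submission
  imports Defs "HOL-Complex_Analysis.Complex_Analysis"
begin

text \<open>
  The eigenvalue problem is attacked by shooting. For a spectral parameter \<open>l\<close> let \<open>y\<close> solve
  \<open>- y'' - q y = l y\<close> with \<open>y(0) = 1\<close>, \<open>y'(0) = 0\<close>. The left boundary condition then holds, and the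
  right one holds exactly when the characteristic function \<open>\<Delta>(l) = y'(\<pi>) + b y(\<pi>)\<close> vanishes.
  Since \<open>\<Delta>\<close> is entire, every spectral quantity can be read off from its zeros: the spectrum is
  the zero set (\<open>spectrum_bvp\<close>), and the Taylor coefficients of \<open>y\<close> in the variable \<open>l\<close> form a Jordan
  chain whose length is the order of the zero, so that this order is the algebraic multiplicity
  (\<open>root_space_eq_span\<close>).

  For zero potential and \<open>b = 0\<close> the solution is \<open>cos (z t)\<close> and \<open>\<Delta>(z\<^sup>2) = - z sin (\<pi> z)\<close>.
  Variation of constants shows that the perturbation changes \<open>\<Delta>(z\<^sup>2)\<close> only by
  \<open>O(exp (\<pi> |Im z|))\<close> (\<open>Delta_estimate\<close>), which is smaller than the unperturbed function on the circles
  \<open>|l| = (N + 1/2)\<^sup>2\<close> for large \<open>N\<close>. By Rouche's theorem exactly \<open>N + 1\<close> zeros lie inside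
  (\<open>zero_count\<close>). Hence each annulus between two consecutive circles contains one zero, which is
  simple. This not only proves simplicity of the large eigenvalues but also fixes their index: after
  listing the zeros inside the first circle chain by chain, the eigenvalue in the \<open>n\<close>-th annulus has number
  \<open>n\<close>, and it is \<open>z\<^sup>2\<close> with \<open>z = n + O(1/n)\<close> (\<open>zero_localization\<close>). Its eigenfunction differs from
  \<open>cos (n t)\<close> by \<open>O(1/n)\<close>, and the derivatives differ by \<open>O(1)\<close> (\<open>eigenfunction_estimates\<close>). After
  normalization, and after division by \<open>sqrt (mu n)\<close> in the case of \<open>H\<^sup>1\<close>, both distances to the cosine
  basis are \<open>O(1/n)\<close> and therefore square summable.

  By the theorem of Bari (\<open>Bari\<close>) a sequence that is quadratically close to an orthonormal basis is a Riesz
  basis as soon as it is \<open>\<omega>\<close>-independent. The operator is not self-adjoint, because \<open>b\<close> is not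
  real, but it is symmetric with respect to the bilinear form \<open>\<integral> f g\<close>. The Lagrange identity shows that
  root functions of different eigenvalues are orthogonal for this form, and that within one root space its
  Gram matrix is zero above the antidiagonal and nonzero on it. The coefficients of a
  vanishing series can therefore be extracted one after the other
  (\<open>root_vectors_omega_independent\<close>). Convergence in \<open>H\<^sup>1\<close> implies convergence in \<open>L\<^sup>2\<close>, so
  \<open>\<omega>\<close>-independence in \<open>L\<^sup>2\<close> serves both spaces.

  Solutions are handled throughout as pairs of continuous functions that satisfy an integral equation,
  which is appropriate for a potential that is merely bounded. The lemma of du Bois-Reymond connects this
  description with weak derivatives, and thereby with the operator and with the weak form
  (\<open>weak_form_iff\<close>).
\<close>

section \<open>Complex inner product spaces\<close>

lemma cinner_add_right: "cinner x (y + z) = cinner x y + cinner x (z :: 'a::complex_inner)"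
  by (metis cinner_commute cinner_add_left complex_cnj_add)

lemma cinner_scaleC_right: "cinner x (a *\<^sub>C y) = cnj a * cinner x (y :: 'a::complex_inner)"
  by (metis cinner_commute cinner_scaleC_left complex_cnj_mult)

lemma cinner_zero_left [simp]: "cinner 0 (x :: 'a::complex_inner) = 0"
  using cinner_add_left[of 0 0 x] by simp

lemma cinner_zero_right [simp]: "cinner (x :: 'a::complex_inner) 0 = 0"
  using cinner_add_right[of x 0 0] by simp

lemma cinner_minus_left: "cinner (- x) y = - cinner x (y :: 'a::complex_inner)"
  using cinner_add_left[of x "- x" y] by (simp add: add_eq_0_iff)

lemma cinner_diff_left: "cinner (x - y) z = cinner x z - cinner y (z :: 'a::complex_inner)"
  using cinner_add_left[of x "- y" z] by (simp add: cinner_minus_left)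

lemma cinner_sum_left: "cinner (\<Sum>i\<in>A. f i) z = (\<Sum>i\<in>A. cinner (f i) (z :: 'a::complex_inner))"
  by (induction A rule: infinite_finite_induct) (auto simp: cinner_add_left)

lemma cinner_sum_right: "cinner z (\<Sum>i\<in>A. f i) = (\<Sum>i\<in>A. cinner (z :: 'a::complex_inner) (f i))"
  by (induction A rule: infinite_finite_induct) (auto simp: cinner_add_right)

lemma cinner_self: "cinner x x = complex_of_real ((norm (x :: 'a::complex_inner))\<^sup>2)"
proof -
  have "Im (cinner x x) = 0"
    using arg_cong[OF cinner_commute[of x x], of Im] by simp
  then show ?thesis
    by (simp add: complex_eq_iff power2_norm_eq_inner inner_Re_cinner)
qed

lemma norm_scaleC: "norm (a *\<^sub>C x) = cmod a * norm (x :: 'a::complex_inner)"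
proof -
  have "cinner (a *\<^sub>C x) (a *\<^sub>C x) = complex_of_real ((cmod a * norm x)\<^sup>2)"
    by (simp only: cinner_scaleC_left cinner_scaleC_right cinner_self[of x] power_mult_distrib of_real_mult
        complex_norm_square[of a] mult_ac)
  then have "(norm (a *\<^sub>C x))\<^sup>2 = (cmod a * norm x)\<^sup>2"
    unfolding cinner_self of_real_eq_iff .
  then show ?thesis by (simp add: power2_eq_iff_nonneg)
qed

lemma complex_Cauchy_Schwarz: "cmod (cinner x y) \<le> norm x * norm (y :: 'a::complex_inner)"
proof (cases "cinner x y = 0")
  case False
  define a where "a = cnj (cinner x y) / complex_of_real (cmod (cinner x y))"
  have a: "cmod a = 1" using False by (simp add: a_def norm_divide)
  have "cinner (a *\<^sub>C x) y = complex_of_real (cmod (cinner x y))"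
    using False by (simp add: a_def cinner_scaleC_left mult.commute[of "cnj _"] complex_norm_square[symmetric]
        power2_eq_square field_simps)
  then have "cmod (cinner x y) = inner (a *\<^sub>C x) y"
    by (simp add: inner_Re_cinner)
  also have "\<dots> \<le> norm (a *\<^sub>C x) * norm y" by (rule norm_cauchy_schwarz)
  finally show ?thesis by (simp add: norm_scaleC a)
qed simp

lemma bounded_linear_cinner_left: "bounded_linear (\<lambda>x. cinner x (y :: 'a::complex_inner))"
  by (rule bounded_linear_intro[where K = "norm y"])
     (auto simp: cinner_add_left scaleR_scaleC cinner_scaleC_left complex_Cauchy_Schwarz scaleR_conv_of_real)

lemma bounded_linear_scaleC_left: "bounded_linear (\<lambda>a. a *\<^sub>C (y :: 'a::complex_inner))"
  by (rule bounded_linear_intro[where K = "norm y"])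
     (auto simp: scaleC_add_left scaleR_scaleC scaleC_scaleC norm_scaleC scaleR_conv_of_real)

lemma bounded_linear_scaleC_right: "bounded_linear (\<lambda>x. a *\<^sub>C (x :: 'a::complex_inner))"
  by (rule bounded_linear_intro[where K = "cmod a"])
     (auto simp: scaleC_add_right scaleR_scaleC scaleC_scaleC norm_scaleC mult.commute)

section \<open>Orthonormal bases\<close>

definition orthonormal :: "(nat \<Rightarrow> 'a::complex_inner) \<Rightarrow> bool" where
  "orthonormal e \<longleftrightarrow> (\<forall>m n. cinner (e m) (e n) = (if m = n then 1 else 0))"

lemma norm_orthonormal_sum:
  assumes "orthonormal e" "finite A"
  shows "(norm (\<Sum>n\<in>A. c n *\<^sub>C e n))\<^sup>2 = (\<Sum>n\<in>A. (cmod (c n))\<^sup>2)"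
proof -
  have "cinner (\<Sum>n\<in>A. c n *\<^sub>C e n) (\<Sum>n\<in>A. c n *\<^sub>C e n)
      = (\<Sum>n\<in>A. c n * (\<Sum>m\<in>A. cnj (c m) * (if n = m then 1 else 0)))"
    using assms(1) unfolding cinner_sum_left cinner_scaleC_left
    by (simp add: cinner_sum_right cinner_scaleC_right orthonormal_def)
  also have "\<dots> = (\<Sum>n\<in>A. c n * cnj (c n))"
    using assms(2) by (intro sum.cong refl) (simp add: mult_if_delta if_distrib cong: if_cong)
  also have "\<dots> = complex_of_real (\<Sum>n\<in>A. (cmod (c n))\<^sup>2)"
    by (simp add: complex_norm_square[symmetric] del: of_real_power)
  finally show ?thesis unfolding cinner_self of_real_eq_iff .
qed

lemma Bessel_inequality:
  assumes e: "orthonormal e" and A: "finite A"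
  shows "(\<Sum>n\<in>A. (cmod (cinner x (e n)))\<^sup>2) \<le> (norm x)\<^sup>2"
proof -
  define p where "p = (\<Sum>n\<in>A. cinner x (e n) *\<^sub>C e n)"
  have "cinner (x - p) (e m) = 0" if "m \<in> A" for m
  proof -
    have "cinner p (e m) = (\<Sum>n\<in>A. cinner x (e n) * (if n = m then 1 else 0))"
      using e by (simp add: p_def cinner_sum_left cinner_scaleC_left orthonormal_def)
    also have "\<dots> = cinner x (e m)"
      using A that by (simp add: if_distrib cong: if_cong)
    finally show ?thesis by (simp add: cinner_diff_left)
  qed
  then have "cinner (x - p) p = 0"
    by (subst (2) p_def) (simp add: cinner_sum_right cinner_scaleC_right)
  then have o: "inner (x - p) p = 0" by (simp add: inner_Re_cinner)
  have "(norm x)\<^sup>2 = (norm ((x - p) + p))\<^sup>2" by simp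
  also have "\<dots> = (norm (x - p))\<^sup>2 + (norm p)\<^sup>2"
    using norm_add_Pythagorean[of "x - p" p] o by (simp add: orthogonal_def)
  finally have "(norm p)\<^sup>2 \<le> (norm x)\<^sup>2" by simp
  then show ?thesis unfolding p_def norm_orthonormal_sum[OF e A] .
qed

lemma Bessel_summable:
  assumes e: "orthonormal e"
  shows "summable (\<lambda>n. (cmod (cinner x (e n)))\<^sup>2)" "(\<Sum>n. (cmod (cinner x (e n)))\<^sup>2) \<le> (norm x)\<^sup>2"
proof -
  show s: "summable (\<lambda>n. (cmod (cinner x (e n)))\<^sup>2)"
    by (rule bounded_imp_summable[where B = "(norm x)\<^sup>2"]) (auto intro: Bessel_inequality[OF e])
  show "(\<Sum>n. (cmod (cinner x (e n)))\<^sup>2) \<le> (norm x)\<^sup>2"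
    by (rule suminf_le_const[OF s]) (auto intro: Bessel_inequality[OF e])
qed

text \<open>The partial sums of the Fourier series are contractions and reproduce the elements of the
  span eventually; density of the span carries the convergence over to all of the space.\<close>

lemma orthonormal_basis_expansion:
  assumes "orthonormal_basis e"
  shows "(\<lambda>n. cinner x (e n) *\<^sub>C e n) sums x"
proof -
  have e: "orthonormal e" and cl: "closure (cspan (range e)) = UNIV"
    using assms by (auto simp: orthonormal_basis_def orthonormal_def)
  define P where "P n x = (\<Sum>k<n. cinner x (e k) *\<^sub>C e k)" for n x
  have P_add: "P n (x + y) = P n x + P n y" for n x y
    by (simp add: P_def cinner_add_left scaleC_add_left sum.distrib)
  have P_scale: "P n (a *\<^sub>C x) = a *\<^sub>C P n x" for n a x
    by (simp add: P_def cinner_scaleC_left scaleC_scaleC complex_vector.scale_sum_right)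
  have P_norm: "norm (P n x) \<le> norm x" for n x
  proof -
    have "(norm (P n x))\<^sup>2 \<le> (norm x)\<^sup>2"
      unfolding P_def norm_orthonormal_sum[OF e finite_lessThan] by (rule Bessel_inequality[OF e]) simp
    then show ?thesis by (simp add: power2_le_iff_abs_le)
  qed
  have span: "(\<lambda>n. P n y) \<longlonglongrightarrow> y" if "y \<in> cspan (range e)" for y
    using that
  proof (induction rule: complex_vector.span_induct_alt)
    case base
    show ?case by (simp add: P_def)
  next
    case (step c x y)
    then obtain m where m: "x = e m" by auto
    have "P n x = x" if "n > m" for n
    proof -
      have "cinner x (e k) *\<^sub>C e k = (if k = m then e m else 0)" for k
        using e by (auto simp: m orthonormal_def scaleC_one complex_vector.scale_zero_left)
      then have "P n x = (\<Sum>k<n. (if k = m then e m else 0))" by (simp add: P_def)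
      then show ?thesis using that m by simp
    qed
    then have "(\<lambda>n. P n x) \<longlonglongrightarrow> x"
      by (intro tendsto_eventually eventually_mono[OF eventually_gt_at_top[of m]])
    then show ?case unfolding P_add P_scale
      by (intro tendsto_add bounded_linear.tendsto[OF bounded_linear_scaleC_right] step)
  qed
  have "(\<lambda>n. P n x) \<longlonglongrightarrow> x"
  proof (rule LIMSEQ_I)
    fix r :: real assume r: "0 < r"
    have "x \<in> closure (cspan (range e))" using cl by simp
    then obtain y where y: "y \<in> cspan (range e)" "dist y x < r / 3"
      unfolding closure_approachable using r by (metis divide_pos_pos zero_less_numeral)
    from LIMSEQ_D[OF span[OF y(1)], of "r / 3"] r obtain n0
      where n0: "\<And>n. n \<ge> n0 \<Longrightarrow> norm (P n y - y) < r / 3" by auto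
    have "norm (P n x - x) < r" if "n \<ge> n0" for n
    proof -
      have "P n x - x = P n (x - y) + (P n y - y) + (y - x)"
        using P_add[of n "x - y" y] by simp
      then have "norm (P n x - x) \<le> norm (P n (x - y)) + norm (P n y - y) + norm (y - x)"
        by (metis norm_triangle_ineq order_trans add_right_mono)
      also have "\<dots> < r"
        using P_norm[of n "x - y"] n0[OF that] y(2) by (simp add: dist_norm norm_minus_commute)
      finally show ?thesis .
    qed
    then show "\<exists>no. \<forall>n\<ge>no. norm (P n x - x) < r" by blast
  qed
  then show ?thesis unfolding sums_def P_def .
qed

lemma Riesz_Fischer:
  fixes e :: "nat \<Rightarrow> 'a::{complex_inner,banach}"
  assumes e: "orthonormal e" and c: "summable (\<lambda>n. (cmod (c n))\<^sup>2)"
  shows "summable (\<lambda>n. c n *\<^sub>C e n)"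
  unfolding summable_Cauchy
proof (intro allI impI)
  fix r :: real assume r: "0 < r"
  then obtain N where N: "\<And>m n. m \<ge> N \<Longrightarrow> norm (\<Sum>k=m..<n. (cmod (c k))\<^sup>2) < r\<^sup>2"
    using c unfolding summable_Cauchy by (meson zero_less_power)
  have "norm (\<Sum>k=m..<n. c k *\<^sub>C e k) < r" if "m \<ge> N" for m n
  proof -
    have "(norm (\<Sum>k=m..<n. c k *\<^sub>C e k))\<^sup>2 < r\<^sup>2"
      unfolding norm_orthonormal_sum[OF e finite_atLeastLessThan] using N[OF that, of n] by simp
    then show ?thesis using r by (simp add: power2_less_imp_less)
  qed
  then show "\<exists>N. \<forall>m\<ge>N. \<forall>n. norm (\<Sum>k=m..<n. c k *\<^sub>C e k) < r" by blast
qed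

text \<open>In a complete space an orthonormal sequence with trivial orthogonal complement is an
  orthonormal basis: the Fourier series of \<open>x\<close> converges by Riesz--Fischer, and \<open>x\<close> minus its
  sum is orthogonal to the sequence.\<close>

lemma orthonormal_basisI:
  fixes e :: "nat \<Rightarrow> 'a::{complex_inner,banach}"
  assumes e: "orthonormal e" and total: "\<And>x. (\<And>n. cinner x (e n) = 0) \<Longrightarrow> x = 0"
  shows "orthonormal_basis e"
proof -
  have "x \<in> closure (cspan (range e))" for x
  proof -
    let ?f = "\<lambda>n. cinner x (e n) *\<^sub>C e n"
    have s: "summable ?f" by (rule Riesz_Fischer[OF e Bessel_summable(1)[OF e]])
    have "cinner (x - suminf ?f) (e n) = 0" for n
    proof -
      have "(\<lambda>k. cinner (?f k) (e n)) sums cinner (suminf ?f) (e n)"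
        by (rule bounded_linear.sums[OF bounded_linear_cinner_left summable_sums[OF s]])
      moreover have "(\<lambda>k. cinner (?f k) (e n)) sums cinner x (e n)"
      proof -
        have "(\<lambda>k. cinner (?f k) (e n)) = (\<lambda>k. if k = n then cinner x (e k) else 0)"
          using e by (auto simp: cinner_scaleC_left orthonormal_def)
        then show ?thesis using sums_single[of n "\<lambda>k. cinner x (e k)"] by simp
      qed
      ultimately show ?thesis by (simp add: cinner_diff_left sums_unique2)
    qed
    then have "x = suminf ?f" using total[of "x - suminf ?f"] by simp
    then have "(\<lambda>n. \<Sum>k<n. ?f k) \<longlonglongrightarrow> x" using s by (metis summable_LIMSEQ)
    moreover have "(\<Sum>k<n. ?f k) \<in> cspan (range e)" for n
      by (intro complex_vector.span_sum complex_vector.span_scale complex_vector.span_base) auto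
    ultimately show ?thesis unfolding closure_sequential by (intro exI conjI allI) auto
  qed
  then show ?thesis using e by (auto simp: orthonormal_basis_def orthonormal_def)
qed

section \<open>The theorem of Bari\<close>

lemma summable_mult_square:
  fixes a b :: "nat \<Rightarrow> real"
  assumes a: "summable (\<lambda>n. (a n)\<^sup>2)" and b: "summable (\<lambda>n. (b n)\<^sup>2)"
    and nn: "\<And>n. 0 \<le> a n" "\<And>n. 0 \<le> b n"
  shows "summable (\<lambda>n. a n * b n)" "(\<Sum>n. a n * b n) \<le> sqrt (\<Sum>n. (a n)\<^sup>2) * sqrt (\<Sum>n. (b n)\<^sup>2)"
proof -
  have fin: "(\<Sum>k<n. a k * b k) \<le> sqrt (\<Sum>n. (a n)\<^sup>2) * sqrt (\<Sum>n. (b n)\<^sup>2)" for n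
  proof -
    have "(\<Sum>k<n. a k * b k) \<le> L2_set a {..<n} * L2_set b {..<n}"
      using L2_set_mult_ineq[of a b "{..<n}"] nn by simp
    also have "\<dots> \<le> sqrt (\<Sum>n. (a n)\<^sup>2) * sqrt (\<Sum>n. (b n)\<^sup>2)"
      unfolding L2_set_def using a b
      by (intro mult_mono real_sqrt_le_mono sum_le_suminf) (auto intro!: sum_nonneg suminf_nonneg)
    finally show ?thesis .
  qed
  show s: "summable (\<lambda>n. a n * b n)"
    by (rule bounded_imp_summable[where B = "sqrt (\<Sum>n. (a n)\<^sup>2) * sqrt (\<Sum>n. (b n)\<^sup>2)"])
       (use nn fin[of "Suc _"] in \<open>auto simp: lessThan_Suc_atMost simp del: sum.lessThan_Suc\<close>)
  show "(\<Sum>n. a n * b n) \<le> sqrt (\<Sum>n. (a n)\<^sup>2) * sqrt (\<Sum>n. (b n)\<^sup>2)"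
    by (rule suminf_le_const[OF s fin])
qed

lemma Hilbert_Schmidt_series:
  fixes e d :: "nat \<Rightarrow> 'a::{complex_inner,banach}"
  assumes e: "orthonormal e" and d: "summable (\<lambda>n. (norm (d n))\<^sup>2)"
  shows "summable (\<lambda>n. cinner x (e n) *\<^sub>C d n)"
    "norm (\<Sum>n. cinner x (e n) *\<^sub>C d n) \<le> norm x * sqrt (\<Sum>n. (norm (d n))\<^sup>2)"
proof -
  have m: "summable (\<lambda>n. cmod (cinner x (e n)) * norm (d n))"
    "(\<Sum>n. cmod (cinner x (e n)) * norm (d n))
      \<le> sqrt (\<Sum>n. (cmod (cinner x (e n)))\<^sup>2) * sqrt (\<Sum>n. (norm (d n))\<^sup>2)"
    using summable_mult_square[OF Bessel_summable(1)[OF e] d] by auto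
  have n: "summable (\<lambda>n. norm (cinner x (e n) *\<^sub>C d n))"
    using m(1) by (simp add: norm_scaleC)
  show "summable (\<lambda>n. cinner x (e n) *\<^sub>C d n)" by (rule summable_norm_cancel[OF n])
  have "norm (\<Sum>n. cinner x (e n) *\<^sub>C d n) \<le> (\<Sum>n. cmod (cinner x (e n)) * norm (d n))"
    using summable_norm[OF n] by (simp add: norm_scaleC)
  also note m(2)
  also have "sqrt (\<Sum>n. (cmod (cinner x (e n)))\<^sup>2) \<le> norm x"
    using real_sqrt_le_mono[OF Bessel_summable(2)[OF e, of x]] by simp
  finally show "norm (\<Sum>n. cinner x (e n) *\<^sub>C d n) \<le> norm x * sqrt (\<Sum>n. (norm (d n))\<^sup>2)"
    using suminf_nonneg[OF d] by (simp add: mult_right_mono)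
qed

text \<open>The equation \<open>x + K x = y\<close> is the fixed point equation of the contraction \<open>x \<mapsto> y - K x\<close>.\<close>

lemma Neumann_bij:
  fixes K :: "'a::banach \<Rightarrow> 'a"
  assumes K: "linear K" "\<And>x. norm (K x) \<le> norm x / 2"
  shows "bij (\<lambda>x. x + K x)" "norm x \<le> 2 * norm (x + K x)"
proof -
  have low: "norm x \<le> 2 * norm (x + K x)" for x
  proof -
    have "norm x = norm ((x + K x) - K x)" by simp
    also have "\<dots> \<le> norm (x + K x) + norm (K x)" by (rule norm_triangle_ineq4)
    finally show ?thesis using K(2)[of x] by simp
  qed
  then show "norm x \<le> 2 * norm (x + K x)" .
  have "inj (\<lambda>x. x + K x)"
  proof (rule injI)
    fix x y assume "x + K x = y + K y"
    moreover have "(x - y) + K (x - y) = (x + K x) - (y + K y)"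
      using linear_diff[OF K(1), of x y] by simp
    ultimately have "(x - y) + K (x - y) = 0" by simp
    then show "x = y" using low[of "x - y"] by simp
  qed
  moreover have "\<exists>x. y = x + K x" for y
  proof -
    have "\<exists>!x. y - K x = x"
    proof (rule banach_fix_type)
      show "\<forall>x z. dist (y - K x) (y - K z) \<le> (1/2) * dist x z"
      proof (intro allI)
        fix x z
        have "dist (y - K x) (y - K z) = norm (K (x - z))"
          by (simp add: dist_norm linear_diff[OF K(1)] norm_minus_commute)
        then show "dist (y - K x) (y - K z) \<le> (1/2) * dist x z"
          using K(2)[of "x - z"] by (simp add: dist_norm)
      qed
    qed auto
    then show ?thesis by (metis diff_add_cancel)
  qed
  ultimately show "bij (\<lambda>x. x + K x)" by (auto simp: bij_def surj_def)
qed

text \<open>A linear injection of a finite-dimensional space into itself is onto: otherwise an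
  independent set would be larger than the dimension. Only the restriction to the span of \<open>B0\<close> matters.\<close>

lemma injective_on_finite_span_surj:
  fixes f :: "'a::complex_inner \<Rightarrow> 'a"
  assumes B0: "finite B0" and add: "\<And>x y. f (x + y) = f x + f y" and scale: "\<And>a x. f (a *\<^sub>C x) = a *\<^sub>C f x"
    and inj: "\<And>x. f x = 0 \<Longrightarrow> x = 0" and inv: "\<And>x. x \<in> cspan B0 \<Longrightarrow> f x \<in> cspan B0"
    and w: "w \<in> cspan B0"
  shows "\<exists>x\<in>cspan B0. f x = w"
proof -
  have f_sum: "f (\<Sum>x\<in>A. c x *\<^sub>C x) = (\<Sum>x\<in>A. c x *\<^sub>C f x)" if "finite A" for A c
    using that add[of 0 0] by (induction A rule: finite_induct) (auto simp: add scale)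
  have "f (x - y) = f x - f y" for x y
    using add[of "x - y" y] by (simp add: algebra_simps)
  then have inj_f: "inj f" using inj by (auto intro!: injI) (metis eq_iff_diff_eq_0)
  obtain B where B: "B \<subseteq> B0" "\<not> cdependent B" "cspan B = cspan B0"
    using complex_vector.maximal_independent_subset[of B0]
    by (metis complex_vector.span_mono complex_vector.span_span subset_antisym)
  have finB: "finite B" using B(1) B0 finite_subset by blast
  have card: "card (f ` B) = card B" using inj_f by (intro card_image) (auto simp: inj_on_def)
  have indep: "\<not> cdependent (f ` B)"
  proof
    assume "cdependent (f ` B)"
    then obtain u v where u: "v \<in> f ` B" "u v \<noteq> 0" "(\<Sum>v\<in>f ` B. u v *\<^sub>C v) = 0"
      using complex_vector.dependent_finite[of "f ` B"] finB by auto
    have "f (\<Sum>x\<in>B. u (f x) *\<^sub>C x) = (\<Sum>v\<in>f ` B. u v *\<^sub>C v)"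
      unfolding f_sum[OF finB, of "\<lambda>x. u (f x)"] using inj_f
      by (subst sum.reindex) (auto simp: inj_on_def)
    then have "(\<Sum>x\<in>B. u (f x) *\<^sub>C x) = 0" using u(3) inj by simp
    then have "cdependent B"
      using complex_vector.dependent_finite[OF finB] u(1,2) by (metis imageE)
    then show False using B(2) by simp
  qed
  have sub: "f ` B \<subseteq> cspan B"
    using inv B(3) complex_vector.span_base by blast
  have "w \<in> cspan (f ` B)"
  proof (rule ccontr)
    assume nw: "w \<notin> cspan (f ` B)"
    then have "\<not> cdependent (insert w (f ` B))"
      using indep by (simp add: complex_vector.independent_insertI)
    moreover have "insert w (f ` B) \<subseteq> cspan B" using sub w B(3) by simp
    ultimately have "card (insert w (f ` B)) \<le> card B"
      using complex_vector.independent_span_bound[OF finB] by blast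
    moreover have "w \<notin> f ` B" using nw complex_vector.span_base[of w "f ` B"] by auto
    ultimately show False using finB card by simp
  qed
  then obtain u where "w = (\<Sum>v\<in>f ` B. u v *\<^sub>C v)"
    using complex_vector.span_finite[of "f ` B"] finB by auto
  also have "\<dots> = f (\<Sum>x\<in>B. u (f x) *\<^sub>C x)"
    unfolding f_sum[OF finB, of "\<lambda>x. u (f x)"] using inj_f
    by (subst sum.reindex) (auto simp: inj_on_def)
  finally have w': "w = f (\<Sum>x\<in>B. u (f x) *\<^sub>C x)" .
  have "(\<Sum>x\<in>B. u (f x) *\<^sub>C x) \<in> cspan B0"
    unfolding B(3)[symmetric]
    by (intro complex_vector.span_sum complex_vector.span_scale complex_vector.span_base)
  then show ?thesis using w' by blast
qed

text \<open>The map \<open>S\<close> with \<open>S (e n) = b n\<close> is the identity plus a Hilbert--Schmidt operator. Cutting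
  off finitely many of its terms leaves an operator \<open>S0\<close> that a Neumann series inverts, so that
  \<open>S = S0 (1 + F)\<close> with \<open>F\<close> of finite rank; \<open>\<omega>\<close>-independence of \<open>b\<close> says that \<open>S\<close> is injective,
  and for \<open>1 + F\<close> injectivity implies bijectivity by finite-dimensional linear algebra.\<close>

theorem Bari:
  fixes e b :: "nat \<Rightarrow> 'a::{complex_inner,banach}"
  assumes e: "orthonormal_basis e" and close: "quadratically_close b e"
    and indep: "\<And>c. summable (\<lambda>n. (cmod (c n))\<^sup>2) \<Longrightarrow> (\<lambda>n. c n *\<^sub>C b n) sums 0 \<Longrightarrow> (\<And>n. c n = 0)"
  shows "bari_basis b"
proof -
  have on: "orthonormal e" using e by (auto simp: orthonormal_basis_def orthonormal_def)
  define d where "d n = b n - e n" for n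
  have d: "summable (\<lambda>n. (norm (d n))\<^sup>2)"
    using close by (simp add: quadratically_close_def d_def)
  from LIMSEQ_D[OF suminf_exist_split2[OF d], of "1/4"]
  obtain N where N: "norm (\<Sum>k. (norm (d (k + N)))\<^sup>2) < 1/4" by auto
  define d0 where "d0 n = (if n < N then 0 else d n)" for n
  have d0: "summable (\<lambda>n. (norm (d0 n))\<^sup>2)"
    by (rule summable_comparison_test'[OF d, of 0]) (auto simp: d0_def)
  have d0N: "(\<Sum>n. (norm (d0 n))\<^sup>2) \<le> 1/4"
  proof -
    have "(\<Sum>n. (norm (d0 n))\<^sup>2) = (\<Sum>n. (norm (d0 (n + N)))\<^sup>2) + (\<Sum>n<N. (norm (d0 n))\<^sup>2)"
      by (rule suminf_split_initial_segment[OF d0])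
    also have "(\<Sum>n<N. (norm (d0 n))\<^sup>2) = 0" by (simp add: d0_def)
    also have "(\<Sum>n. (norm (d0 (n + N)))\<^sup>2) = (\<Sum>n. (norm (d (n + N)))\<^sup>2)" by (simp add: d0_def)
    finally show ?thesis using N by simp
  qed
  define K where "K d x = (\<Sum>n. cinner x (e n) *\<^sub>C d n)" for d :: "nat \<Rightarrow> 'a" and x
  have K_add: "K d (x + y) = K d x + K d y" and K_scale: "K d (a *\<^sub>C x) = a *\<^sub>C K d x"
    if "summable (\<lambda>n. (norm (d n))\<^sup>2)" for d :: "nat \<Rightarrow> 'a" and x y a
  proof -
    note s = Hilbert_Schmidt_series(1)[OF on that]
    show "K d (x + y) = K d x + K d y"
      unfolding K_def suminf_add[OF s s] by (simp add: cinner_add_left scaleC_add_left)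
    show "K d (a *\<^sub>C x) = a *\<^sub>C K d x"
      unfolding K_def bounded_linear.suminf[OF bounded_linear_scaleC_right s]
      by (simp add: cinner_scaleC_left scaleC_scaleC)
  qed
  have K_lin: "linear (K d)" if "summable (\<lambda>n. (norm (d n))\<^sup>2)" for d :: "nat \<Rightarrow> 'a"
    using that by (intro linearI) (auto simp: K_add K_scale scaleR_scaleC)
  define S0 where "S0 x = x + K d0 x" for x
  have K0: "norm (K d0 x) \<le> norm x / 2" for x
  proof -
    have "sqrt (\<Sum>n. (norm (d0 n))\<^sup>2) \<le> sqrt ((1/2)\<^sup>2)"
      by (rule real_sqrt_le_mono) (use d0N in \<open>simp add: power2_eq_square\<close>)
    then have "norm x * sqrt (\<Sum>n. (norm (d0 n))\<^sup>2) \<le> norm x * (1/2)"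
      by (intro mult_left_mono) auto
    then show ?thesis using Hilbert_Schmidt_series(2)[OF on d0, of x] unfolding K_def by simp
  qed
  note S0 = Neumann_bij[OF K_lin[OF d0] K0, folded S0_def]
  have S0_bij: "bij S0" using S0(1) by (simp add: S0_def[abs_def])
  have S0_add: "S0 (x + y) = S0 x + S0 y" and S0_scale: "S0 (a *\<^sub>C x) = a *\<^sub>C S0 x" for x y a
    by (simp_all add: S0_def K_add[OF d0] K_scale[OF d0] scaleC_add_right)
  define J where "J = inv S0"
  have J1: "S0 (J x) = x" and J2: "J (S0 x) = x" for x
    using S0_bij by (simp_all add: J_def bij_is_surj surj_f_inv_f bij_is_inj)
  have J_add: "J (x + y) = J x + J y" for x y by (metis J1 J2 S0_add)
  have J_scale: "J (a *\<^sub>C x) = a *\<^sub>C J x" for a x by (metis J1 J2 S0_scale)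
  have J_norm: "norm (J x) \<le> 2 * norm x" for x using S0(2)[of "J x"] by (simp add: J1)
  define S where "S x = x + K d x" for x
  have S_add: "S (x + y) = S x + S y" and S_scale: "S (a *\<^sub>C x) = a *\<^sub>C S x" for x y a
    by (simp_all add: S_def K_add[OF d] K_scale[OF d] scaleC_add_right)
  have S_sums: "(\<lambda>n. cinner x (e n) *\<^sub>C b n) sums S x" for x
  proof -
    have "(\<lambda>n. cinner x (e n) *\<^sub>C e n + cinner x (e n) *\<^sub>C d n) sums (x + K d x)"
      unfolding K_def
      by (intro sums_add orthonormal_basis_expansion[OF e] summable_sums Hilbert_Schmidt_series(1)[OF on d])
    then show ?thesis by (simp add: S_def d_def scaleC_add_right[symmetric])
  qed
  have S_inj: "x = 0" if "S x = 0" for x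
  proof -
    have "(\<lambda>n. cinner x (e n) *\<^sub>C b n) sums 0" using S_sums[of x] that by simp
    from indep[OF Bessel_summable(1)[OF on] this] have "cinner x (e n) = 0" for n by simp
    then have "(\<lambda>n. 0) sums x"
      using orthonormal_basis_expansion[OF e, of x] by (simp add: complex_vector.scale_zero_left)
    then show "x = 0" by (simp add: sums_unique2)
  qed
  define w where "w n = J (d n)" for n
  (* With J the inverse of S0, G is the factor 1 + F in S = S0 (1 + F). *)
  define G where "G x = x + (\<Sum>n<N. cinner x (e n) *\<^sub>C w n)" for x
  have SG: "S x = S0 (G x)" for x
  proof -
    have "K d x = (\<Sum>n. cinner x (e n) *\<^sub>C d0 n) + (\<Sum>n. cinner x (e n) *\<^sub>C (d n - d0 n))"
      unfolding K_def
      by (subst suminf_add[OF Hilbert_Schmidt_series(1)[OF on d0]])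
         (auto simp: scaleC_add_right[symmetric] d0_def complex_vector.scale_zero_right
           intro!: summable_finite[of "{..<N}"] split: if_splits)
    also have "(\<Sum>n. cinner x (e n) *\<^sub>C (d n - d0 n)) = (\<Sum>n<N. cinner x (e n) *\<^sub>C (d n - d0 n))"
      by (rule suminf_finite) (auto simp: d0_def complex_vector.scale_zero_right)
    also have "\<dots> = (\<Sum>n<N. cinner x (e n) *\<^sub>C d n)" by (simp add: d0_def)
    finally have 1: "S x = S0 x + (\<Sum>n<N. cinner x (e n) *\<^sub>C d n)"
      by (simp add: S_def S0_def K_def)
    have "S0 (\<Sum>n\<in>A. c n *\<^sub>C w n) = (\<Sum>n\<in>A. c n *\<^sub>C d n)" if "finite A" for A c
      using that S0_add[of 0 0] by (induction A rule: finite_induct) (auto simp: S0_add S0_scale w_def J1)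
    then show ?thesis by (simp add: 1 G_def S0_add)
  qed
  have G_add: "G (x + y) = G x + G y" and G_scale: "G (a *\<^sub>C x) = a *\<^sub>C G x" for x y a
    by (simp_all add: G_def cinner_add_left scaleC_add_left sum.distrib cinner_scaleC_left scaleC_add_right
        scaleC_scaleC complex_vector.scale_sum_right)
  have G_inj: "x = 0" if "G x = 0" for x
    using that S_inj[of x] SG[of x] S0_add[of 0 0] by simp
  have G_span: "G x \<in> cspan (w ` {..<N})" if "x \<in> cspan (w ` {..<N})" for x
    unfolding G_def
    by (intro complex_vector.span_add[OF that] complex_vector.span_sum complex_vector.span_scale
        complex_vector.span_base) auto
  have "\<exists>g. G g = w n" if "n < N" for n
    using injective_on_finite_span_surj[of "w ` {..<N}" G "w n", OF _ G_add G_scale G_inj G_span]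
      complex_vector.span_base[of "w n" "w ` {..<N}"] that by auto
  then obtain g where g: "\<And>n. n < N \<Longrightarrow> G (g n) = w n" by metis
  (* H inverts G because G (g n) = w n for the finitely many w n that span the range of F. *)
  define H where "H y = y - (\<Sum>n<N. cinner y (e n) *\<^sub>C g n)" for y
  have GH: "G (H y) = y" for y
  proof -
    have G_diff: "G (x - y) = G x - G y" for x y using G_add[of "x - y" y] by (simp add: algebra_simps)
    have G_sum: "G (\<Sum>n\<in>A. c n *\<^sub>C g n) = (\<Sum>n\<in>A. c n *\<^sub>C w n)" if "finite A" "A \<subseteq> {..<N}" for A c
      using that G_add[of 0 0] by (induction A rule: finite_induct) (auto simp: G_add G_scale g)
    show ?thesis unfolding H_def G_diff G_sum[OF finite_lessThan order_refl] by (simp add: G_def)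
  qed
  have HG: "H (G x) = x" for x
  proof -
    have G_diff: "G (x - y) = G x - G y" for x y using G_add[of "x - y" y] by (simp add: algebra_simps)
    show ?thesis using G_inj[of "H (G x) - x"] by (simp add: G_diff GH)
  qed
  have inv_S: "inv S = (\<lambda>y. H (J y))"
    by (rule inv_equality) (simp_all add: SG J2 HG GH J1)
  have bij: "bij S"
    by (rule o_bij[of "\<lambda>y. H (J y)"]) (auto simp: fun_eq_iff SG J2 HG GH J1)
  have bl_S: "bounded_linear S"
  proof (rule bounded_linear_intro)
    show "norm (S x) \<le> norm x * (1 + sqrt (\<Sum>n. (norm (d n))\<^sup>2))" for x
      using norm_triangle_ineq[of x "K d x"] Hilbert_Schmidt_series(2)[OF on d, of x]
      unfolding S_def K_def by (simp add: algebra_simps)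
  qed (auto simp: S_add S_scale scaleR_scaleC)
  have bl_J: "bounded_linear J"
    by (rule bounded_linear_intro[where K = 2])
       (auto simp: J_add J_scale scaleR_scaleC mult.commute[of _ "2::real"] J_norm)
  have bl_H: "bounded_linear H" unfolding H_def[abs_def]
    by (intro bounded_linear_sub bounded_linear_ident bounded_linear_sum
        bounded_linear_compose[OF bounded_linear_scaleC_left bounded_linear_cinner_left])
  have bl_inv: "bounded_linear (inv S)"
    unfolding inv_S by (rule bounded_linear_compose[OF bl_H bl_J])
  have "b n = S (e n)" for n
  proof -
    have "(\<lambda>k. cinner (e n) (e k) *\<^sub>C b k) = (\<lambda>k. if k = n then b k else 0)"
      using on by (auto simp: orthonormal_def scaleC_one complex_vector.scale_zero_left)
    then show ?thesis using S_sums[of "e n"] sums_single[of n b] sums_unique2 by metis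
  qed
  then have "riesz_basis b" unfolding riesz_basis_def
    using bl_S S_scale bij bl_inv e by (intro exI[of _ S] exI[of _ e]) auto
  then show ?thesis using e close by (auto simp: bari_basis_def)
qed

section \<open>Primitives of integrable functions\<close>

abbreviation AI :: "(real \<Rightarrow> complex) \<Rightarrow> bool" where
  "AI f \<equiv> f absolutely_integrable_on {0..pi}"

definition prim :: "(real \<Rightarrow> complex) \<Rightarrow> real \<Rightarrow> complex" where
  "prim f t = integral {0..t} f"

lemma prim_0 [simp]: "prim f 0 = 0"
  by (simp add: prim_def)

lemma AI_subinterval: "AI f \<Longrightarrow> t \<in> {0..pi} \<Longrightarrow> f absolutely_integrable_on {0..t}"
  by (rule absolutely_integrable_on_subinterval) auto

lemma AI_integrable: "AI f \<Longrightarrow> t \<in> {0..pi} \<Longrightarrow> f integrable_on {0..t}"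
  using AI_subinterval by (blast intro: set_lebesgue_integral_eq_integral(1))

lemma AI_continuous: "continuous_on {0..pi} f \<Longrightarrow> AI f"
  by (rule absolutely_integrable_continuous_real)

lemma AI_cmult: "AI f \<Longrightarrow> AI (\<lambda>t. c * f t)"
  by (rule set_integrable_mult_right) auto

lemma AI_add: "AI f \<Longrightarrow> AI g \<Longrightarrow> AI (\<lambda>t. f t + g t)"
  by (rule set_integral_add(1))

lemma AI_diff: "AI f \<Longrightarrow> AI g \<Longrightarrow> AI (\<lambda>t. f t - g t)"
  by (rule set_integral_diff(1))

lemma AI_uminus: "AI f \<Longrightarrow> AI (\<lambda>t. - f t)"
  using AI_cmult[of f "-1"] by simp

lemma AI_sum: "finite I \<Longrightarrow> (\<And>i. i \<in> I \<Longrightarrow> AI (f i)) \<Longrightarrow> AI (\<lambda>t. \<Sum>i\<in>I. f i t)"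
  by (induction I rule: finite_induct) (auto intro: AI_add AI_continuous)

lemma AI_bounded_mult:
  assumes m: "f \<in> borel_measurable (lebesgue_on {0..pi})" and b: "\<And>t. t \<in> {0..pi} \<Longrightarrow> cmod (f t) \<le> B"
    and g: "AI g"
  shows "AI (\<lambda>t. f t * g t)"
  by (rule absolutely_integrable_bounded_measurable_product[OF bilinear_times m _ _ g])
     (auto simp: bounded_iff intro!: exI[of _ B] b)

lemma AI_continuous_mult:
  assumes f: "continuous_on {0..pi} f" and g: "AI g"
  shows "AI (\<lambda>t. f t * g t)"
proof -
  have "bounded (f ` {0..pi})"
    using compact_imp_bounded[OF compact_continuous_image[OF f compact_Icc]] .
  then obtain B where "\<forall>t\<in>{0..pi}. norm (f t) \<le> B" unfolding bounded_iff by auto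
  then show ?thesis
    by (intro AI_bounded_mult[OF continuous_imp_measurable_on_sets_lebesgue[OF f] _ g]) auto
qed

lemma AI_cnj: "AI f \<Longrightarrow> AI (\<lambda>t. cnj (f t))"
  using absolutely_integrable_linear[of "{0..pi}" f cnj] bounded_linear_cnj by (simp add: o_def)

lemma continuous_prim: "AI f \<Longrightarrow> continuous_on {0..pi} (prim f)"
  using indefinite_integral_continuous_1[of f 0 pi] AI_integrable[of f pi] by (simp add: prim_def[abs_def])

lemma prim_cmult: "prim (\<lambda>s. c * f s) t = c * prim f t"
  by (simp add: prim_def)

lemma prim_uminus: "prim (\<lambda>s. - f s) t = - prim f t"
  using prim_cmult[of "-1" f t] by simp

lemma prim_add:
  assumes "AI f" "AI g" "t \<in> {0..pi}"
  shows "prim (\<lambda>s. f s + g s) t = prim f t + prim g t"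
  unfolding prim_def by (rule Henstock_Kurzweil_Integration.integral_add) (auto intro: AI_integrable assms)

lemma prim_diff:
  assumes "AI f" "AI g" "t \<in> {0..pi}"
  shows "prim (\<lambda>s. f s - g s) t = prim f t - prim g t"
  unfolding prim_def by (rule Henstock_Kurzweil_Integration.integral_diff) (auto intro: AI_integrable assms)

lemma prim_cong: "(\<And>s. s \<in> {0..t} \<Longrightarrow> f s = g s) \<Longrightarrow> prim f t = prim g t"
  unfolding prim_def by (rule Henstock_Kurzweil_Integration.integral_cong)

lemma prim_split:
  assumes "AI f" "s \<in> {0..pi}"
  shows "integral {s..pi} f = prim f pi - prim f s"
  using Henstock_Kurzweil_Integration.integral_combine[of 0 s pi f] AI_integrable[OF assms(1), of pi] assms(2)
  by (simp add: prim_def algebra_simps)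

lemma prim_derivative:
  assumes F: "\<And>s. s \<in> {0..pi} \<Longrightarrow> (F has_vector_derivative f s) (at s within {0..pi})" and t: "t \<in> {0..pi}"
  shows "prim f t = F t - F 0"
  unfolding prim_def
proof (rule integral_unique, rule fundamental_theorem_of_calculus)
  show "(F has_vector_derivative f x) (at x within {0..t})" if "x \<in> {0..t}" for x
    by (rule has_vector_derivative_within_subset[OF F]) (use that t in auto)
qed (use t in auto)

lemma prim_norm_le:
  assumes "AI f" "t \<in> {0..pi}" "\<And>s. s \<in> {0..t} \<Longrightarrow> cmod (f s) \<le> g s" "(g has_integral I) {0..t}"
  shows "cmod (prim f t) \<le> I"
  unfolding prim_def using integral_norm_bound_integral[of f "{0..t}" g] assms AI_integrable
  by (metis has_integral_integrable integral_unique)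

lemma prim_const_bound:
  assumes "AI f" "t \<in> {0..pi}" "\<And>s. s \<in> {0..t} \<Longrightarrow> cmod (f s) \<le> B"
  shows "cmod (prim f t) \<le> B * t"
  using prim_norm_le[OF assms has_integral_const_real[of B 0 t]] assms(2) by (simp add: mult.commute)

text \<open>Exponential weights make integration contractive: each integration gains a factor
  \<open>1 / k\<close>.\<close>

lemma prim_exp_bound:
  assumes "AI f" "t \<in> {0..pi}" "\<And>s. s \<in> {0..pi} \<Longrightarrow> cmod (f s) \<le> B * exp (k * s)" "0 < k" "0 \<le> B"
  shows "cmod (prim f t) \<le> B / k * exp (k * t)"
proof -
  have "((\<lambda>s. B * exp (k * s)) has_integral (B / k * exp (k * t) - B / k * exp (k * 0))) {0..t}"
    by (rule fundamental_theorem_of_calculus)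
       (use assms in \<open>auto intro!: derivative_eq_intros
          simp: has_real_derivative_iff_has_vector_derivative[symmetric]\<close>)
  from prim_norm_le[OF assms(1,2) _ this] assms
  have "cmod (prim f t) \<le> B / k * exp (k * t) - B / k * exp (k * 0)" by auto
  also have "\<dots> \<le> B / k * exp (k * t)" using assms by simp
  finally show ?thesis .
qed

text \<open>Integration by parts for merely integrable \<open>f\<close> and \<open>g\<close>: by Fubini, the product of the two
  integrals is the double integral over a square, whose two triangles contribute the two terms.\<close>

lemma prim_mult_pi:
  assumes f: "AI f" and g: "AI g"
  shows "prim (\<lambda>s. f s * prim g s + prim f s * g s) pi = prim f pi * prim g pi"
proof -
  let ?M = "lebesgue_on {0..pi}"
  interpret M: finite_measure ?M by (rule finite_measure_lebesgue_on) auto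
  interpret P: pair_sigma_finite ?M ?M by unfold_locales
  note f' = absolutely_integrable_imp_integrable[OF f] and g' = absolutely_integrable_imp_integrable[OF g]
  have fm[measurable]: "f \<in> borel_measurable ?M" "g \<in> borel_measurable ?M" using f' g' by auto
  have idm[measurable]: "(\<lambda>x. x) \<in> borel_measurable ?M"
    by (rule continuous_imp_measurable_on_sets_lebesgue) auto
  have prod: "integrable (?M \<Otimes>\<^sub>M ?M) (\<lambda>(s, t). f s * g t)"
  proof (rule P.Fubini_integrable)
    show "integrable ?M (\<lambda>x. \<integral>y. norm (case (x, y) of (s, t) \<Rightarrow> f s * g t) \<partial>?M)"
      using f' g' by (simp add: norm_mult)
  qed (use g' in auto)
  define h where "h s t = (if s \<le> t then f s * g t else 0)" for s t
  have h: "integrable (?M \<Otimes>\<^sub>M ?M) (case_prod h)"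
  proof (rule Bochner_Integration.integrable_bound[OF prod])
    have [measurable]: "(\<lambda>p. fst p) \<in> borel_measurable (?M \<Otimes>\<^sub>M ?M)"
      "(\<lambda>p. snd p) \<in> borel_measurable (?M \<Otimes>\<^sub>M ?M)"
      using measurable_compose[OF measurable_fst idm] measurable_compose[OF measurable_snd idm] by auto
    show "case_prod h \<in> borel_measurable (?M \<Otimes>\<^sub>M ?M)"
      unfolding h_def case_prod_beta' by measurable
  qed (auto simp: h_def)
  have inner1: "(\<integral>s. h s t \<partial>?M) = prim f t * g t" if t: "t \<in> {0..pi}" for t
  proof -
    have "(\<integral>s. h s t \<partial>?M) = (\<integral>s. (if s \<in> {..t} then f s else 0) * g t \<partial>?M)"
      by (rule Bochner_Integration.integral_cong) (auto simp: h_def)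
    also have "\<dots> = (\<integral>s. (if s \<in> {..t} then f s else 0) \<partial>?M) * g t"
      by simp
    also have "(\<integral>s. (if s \<in> {..t} then f s else 0) \<partial>?M) = integral\<^sup>L (lebesgue_on ({..t} \<inter> {0..pi})) f"
      by (rule Lebesgue_Measure.integral_restrict_Int) auto
    also have "{..t} \<inter> {0..pi} = {0..t}" using t by auto
    also have "integral\<^sup>L (lebesgue_on {0..t}) f = prim f t" unfolding prim_def
      by (rule lebesgue_integral_eq_integral)
         (use absolutely_integrable_imp_integrable[OF AI_subinterval[OF f t]] in auto)
    finally show ?thesis .
  qed
  have inner2: "(\<integral>t. h s t \<partial>?M) = f s * (prim g pi - prim g s)" if s: "s \<in> {0..pi}" for s
  proof -
    have "(\<integral>t. h s t \<partial>?M) = (\<integral>t. f s * (if t \<in> {s..} then g t else 0) \<partial>?M)"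
      by (rule Bochner_Integration.integral_cong) (auto simp: h_def)
    also have "\<dots> = f s * (\<integral>t. (if t \<in> {s..} then g t else 0) \<partial>?M)"
      by simp
    also have "(\<integral>t. (if t \<in> {s..} then g t else 0) \<partial>?M) = integral\<^sup>L (lebesgue_on ({s..} \<inter> {0..pi})) g"
      by (rule Lebesgue_Measure.integral_restrict_Int) auto
    also have "{s..} \<inter> {0..pi} = {s..pi}" using s by auto
    also have "integral\<^sup>L (lebesgue_on {s..pi}) g = integral {s..pi} g"
      by (rule lebesgue_integral_eq_integral,
          rule absolutely_integrable_imp_integrable[OF absolutely_integrable_on_subinterval[OF g]])
         (use s in auto)
    also have "\<dots> = prim g pi - prim g s" by (rule prim_split[OF g s])
    finally show ?thesis .
  qed
  have i1: "AI (\<lambda>t. prim f t * g t)" by (rule AI_continuous_mult[OF continuous_prim[OF f] g])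
  have i2: "AI (\<lambda>t. f t * prim g t)"
    using AI_continuous_mult[OF continuous_prim[OF g] f] by (simp add: mult.commute)
  have i3: "AI (\<lambda>t. f t * prim g pi)" using AI_cmult[OF f, of "prim g pi"] by (simp add: mult.commute)
  have L: "(\<integral>t. F t \<partial>?M) = prim F pi" if "AI F" for F
    unfolding prim_def by (rule lebesgue_integral_eq_integral[OF absolutely_integrable_imp_integrable[OF that]]) auto
  have "(\<integral>t. prim f t * g t \<partial>?M) = (\<integral>t. (\<integral>s. h s t \<partial>?M) \<partial>?M)"
    by (rule Bochner_Integration.integral_cong) (auto simp: inner1)
  also have "\<dots> = (\<integral>s. (\<integral>t. h s t \<partial>?M) \<partial>?M)" by (rule P.Fubini_integral[OF h])
  also have "\<dots> = (\<integral>s. f s * prim g pi - f s * prim g s \<partial>?M)"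
    by (rule Bochner_Integration.integral_cong) (auto simp: inner2 algebra_simps)
  finally have "prim (\<lambda>t. prim f t * g t) pi = prim (\<lambda>s. f s * prim g pi - f s * prim g s) pi"
    using L[OF i1] L[OF AI_diff[OF i3 i2]] by simp
  also have "\<dots> = prim f pi * prim g pi - prim (\<lambda>s. f s * prim g s) pi"
    using prim_diff[OF i3 i2, of pi] prim_cmult[of "prim g pi" f pi] by (simp add: mult.commute)
  finally show ?thesis using prim_add[OF i2 i1, of pi] by simp
qed

lemma prim_cutoff:
  assumes t: "t \<in> {0..pi}" and s: "s \<in> {0..pi}"
  shows "prim (\<lambda>x. if x \<in> {0..t} then f x else 0) s = prim f (min s t)"
proof -
  have "{0..t} \<inter> {0..s} = {0..min s t}" by auto
  then show ?thesis
    unfolding prim_def Henstock_Kurzweil_Integration.integral_restrict_Int by (simp only:)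
qed

lemma AI_cutoff:
  assumes f: "AI f" and t: "t \<in> {0..pi}"
  shows "AI (\<lambda>x. if x \<in> {0..t} then f x else 0)"
  by (rule absolutely_integrable_on_subinterval[where S = UNIV])
     (use AI_subinterval[OF f t] in \<open>simp_all only: absolutely_integrable_restrict_UNIV subset_UNIV\<close>)

text \<open>Cutting \<open>u\<close> and \<open>v\<close> off at \<open>t\<close> reduces an arbitrary upper limit to \<open>\<pi>\<close>, where
  \<open>prim_mult_pi\<close> applies; the constants \<open>a\<close> and \<open>b\<close> contribute only linear terms.\<close>

lemma integration_by_parts_prim:
  assumes u: "AI u" and v: "AI v" and t: "t \<in> {0..pi}"
    and U: "\<And>s. s \<in> {0..pi} \<Longrightarrow> U s = a + prim u s" and V: "\<And>s. s \<in> {0..pi} \<Longrightarrow> V s = b + prim v s"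
  shows "prim (\<lambda>s. u s * V s + U s * v s) t = U t * V t - a * b"
proof -
  let ?u = "\<lambda>x. if x \<in> {0..t} then u x else 0" and ?v = "\<lambda>x. if x \<in> {0..t} then v x else 0"
  let ?k = "\<lambda>s. u s * prim v s + prim u s * v s"
  have "prim (\<lambda>s. ?u s * prim ?v s + prim ?u s * ?v s) pi = prim ?u pi * prim ?v pi"
    by (rule prim_mult_pi; rule AI_cutoff) (use u v t in auto)
  also have "prim ?u pi = prim u t" using prim_cutoff[OF t, of pi u] t by (simp add: min_absorb2)
  also have "prim ?v pi = prim v t" using prim_cutoff[OF t, of pi v] t by (simp add: min_absorb2)
  also have "prim (\<lambda>s. ?u s * prim ?v s + prim ?u s * ?v s) pi = prim (\<lambda>s. if s \<in> {0..t} then ?k s else 0) pi"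
  proof (rule prim_cong)
    fix s assume "s \<in> {0..pi}"
    then show "?u s * prim ?v s + prim ?u s * ?v s = (if s \<in> {0..t} then ?k s else 0)"
      using prim_cutoff[OF t, of s u] prim_cutoff[OF t, of s v] by (auto simp: min_def)
  qed
  also have "\<dots> = prim ?k t" using prim_cutoff[OF t, of pi ?k] t by (simp add: min_absorb2)
  finally have k: "prim ?k t = prim u t * prim v t" .
  have ik: "AI ?k"
    using AI_add[OF AI_continuous_mult[OF continuous_prim[OF v] u] AI_continuous_mult[OF continuous_prim[OF u] v]]
    by (simp add: mult.commute)
  have "prim (\<lambda>s. u s * V s + U s * v s) t = prim (\<lambda>s. (b * u s + a * v s) + ?k s) t"
    by (rule prim_cong) (use t U V in \<open>auto simp: algebra_simps\<close>)
  also have "\<dots> = prim (\<lambda>s. b * u s + a * v s) t + prim ?k t"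
    by (rule prim_add[OF AI_add[OF AI_cmult[OF u] AI_cmult[OF v]] ik t])
  also have "prim (\<lambda>s. b * u s + a * v s) t = b * prim u t + a * prim v t"
    unfolding prim_add[OF AI_cmult[OF u] AI_cmult[OF v] t] prim_cmult ..
  finally have "prim (\<lambda>s. u s * V s + U s * v s) t = b * prim u t + a * prim v t + prim u t * prim v t"
    unfolding k .
  then show ?thesis using U[OF t] V[OF t] by (simp add: algebra_simps)
qed

section \<open>Square-integrable functions\<close>

lemma integrable_Mpi_AI:
  assumes "integrable Mpi f" shows "AI f"
proof -
  have "f absolutely_integrable_on box 0 pi"
    using assms by (simp add: integrable_restrict_space set_integrable_def)
  then show ?thesis unfolding absolutely_integrable_on_open_interval by simp
qed

lemma AI_integrable_Mpi:
  assumes "AI f" shows "integrable Mpi f"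
proof (rule absolutely_integrable_imp_integrable)
  have "f absolutely_integrable_on box 0 pi"
    using assms unfolding absolutely_integrable_on_open_interval by simp
  then show "f absolutely_integrable_on {0<..<pi}" by simp
qed auto

lemma LINT_Mpi_prim:
  assumes "AI f" shows "(LINT t|Mpi. f t) = prim f pi"
  unfolding prim_def integral_open_interval_real
  by (rule lebesgue_integral_eq_integral[OF AI_integrable_Mpi[OF assms]]) auto

lemma square_integrable_AI: "square_integrable f \<Longrightarrow> AI f"
  by (rule integrable_Mpi_AI[OF square_integrable_imp_integrable])

lemma square_integrable_prim: "square_integrable f \<Longrightarrow> square_integrable (\<lambda>t. c + prim f t)"
  by (rule square_integrable_continuous)
     (intro continuous_on_add continuous_on_const continuous_prim square_integrable_AI)

lemma square_integrable_mult_AI: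
  assumes f: "square_integrable f" and g: "square_integrable g"
  shows "AI (\<lambda>t. f t * cnj (g t))"
  by (rule integrable_Mpi_AI[OF square_integrable_mult[OF f g]])

lemma cinner_prim:
  assumes f: "square_integrable f" and g: "square_integrable g"
  shows "cinner (abs_L2pi f) (abs_L2pi g) = prim (\<lambda>t. f t * cnj (g t)) pi"
  unfolding cinner_abs_L2pi[OF f g] by (rule LINT_Mpi_prim[OF square_integrable_mult_AI[OF f g]])

lemma abs_L2pi_eq_iff:
  assumes "square_integrable f" "square_integrable g"
  shows "abs_L2pi f = abs_L2pi g \<longleftrightarrow> (AE t in Mpi. f t = g t)"
  using Quotient3_rel[OF Quotient3_L2pi, of f g] assms by (simp add: L2_eq_def)

lemma abs_L2pi_cong:
  assumes "square_integrable f" "\<And>t. t \<in> {0<..<pi} \<Longrightarrow> f t = g t"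
  shows "abs_L2pi f = abs_L2pi g" "square_integrable g"
proof -
  show "square_integrable g"
    using assms(1) measurable_cong[of Mpi f g borel] assms(2)
      Bochner_Integration.integrable_cong[of Mpi Mpi "\<lambda>t. (cmod (f t))\<^sup>2" "\<lambda>t. (cmod (g t))\<^sup>2"]
    unfolding square_integrable_def by auto
  then show "abs_L2pi f = abs_L2pi g"
    using assms by (auto simp: abs_L2pi_eq_iff intro!: AE_I2)
qed

lemma abs_L2pi_add:
  assumes "square_integrable f" "square_integrable g"
  shows "abs_L2pi f + abs_L2pi g = abs_L2pi (\<lambda>t. f t + g t)"
  by (rule plus_L2pi.abs_eq) (use assms in \<open>auto simp: L2_eq_def\<close>)

lemma abs_L2pi_diff:
  assumes "square_integrable f" "square_integrable g"
  shows "abs_L2pi f - abs_L2pi g = abs_L2pi (\<lambda>t. f t - g t)"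
  by (rule minus_L2pi.abs_eq) (use assms in \<open>auto simp: L2_eq_def\<close>)

lemma abs_L2pi_uminus:
  assumes "square_integrable f"
  shows "- abs_L2pi f = abs_L2pi (\<lambda>t. - f t)"
  by (rule uminus_L2pi.abs_eq) (use assms in \<open>auto simp: L2_eq_def\<close>)

lemma abs_L2pi_scaleC:
  assumes "square_integrable f"
  shows "c *\<^sub>C abs_L2pi f = abs_L2pi (\<lambda>t. c * f t)"
  by (rule scaleC_L2pi.abs_eq) (use assms in \<open>auto simp: L2_eq_def\<close>)

lemma abs_rep_L2pi: "abs_L2pi (rep_L2pi u) = u"
  by (rule Quotient3_abs_rep[OF Quotient3_L2pi])

lemma square_integrable_rep: "square_integrable (rep_L2pi u)"
  using Quotient3_rep_reflp[OF Quotient3_L2pi, of u] by (simp add: L2_eq_def)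

lemma norm_abs_L2pi:
  assumes "square_integrable f"
  shows "(norm (abs_L2pi f))\<^sup>2 = (LINT t|Mpi. (cmod (f t))\<^sup>2)"
proof -
  have "complex_of_real ((norm (abs_L2pi f))\<^sup>2) = complex_of_real (LINT t|Mpi. (cmod (f t))\<^sup>2)"
    unfolding cinner_self[symmetric] cinner_abs_L2pi[OF assms assms] complex_norm_square[symmetric]
    by (rule integral_complex_of_real)
  then show ?thesis unfolding of_real_eq_iff .
qed

lemma norm_abs_L2pi_le:
  assumes f: "square_integrable f" and B: "\<And>t. t \<in> {0<..<pi} \<Longrightarrow> cmod (f t) \<le> B" "0 \<le> B"
  shows "norm (abs_L2pi f) \<le> sqrt pi * B"
proof -
  have fin: "finite_measure Mpi" by (rule finite_measure_lebesgue_on) auto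
  have "(LINT t|Mpi. (cmod (f t))\<^sup>2) \<le> (LINT t|Mpi. B\<^sup>2)"
    using f B unfolding square_integrable_def
    by (intro integral_mono) (auto intro!: power_mono finite_measure.integrable_const[OF fin])
  also have "\<dots> = pi * B\<^sup>2"
    by (simp add: measure_restrict_space)
  finally have "(norm (abs_L2pi f))\<^sup>2 \<le> (sqrt pi * B)\<^sup>2"
    by (simp add: norm_abs_L2pi[OF f] power_mult_distrib)
  then show ?thesis using B(2) by (simp add: power2_le_iff_abs_le)
qed

lemma LINT_cmod_le_norm:
  assumes f: "square_integrable f"
  shows "(LINT s|Mpi. cmod (f s)) \<le> sqrt pi * norm (abs_L2pi f)"
proof -
  let ?g = "\<lambda>s. complex_of_real (cmod (f s))"
  have m: "?g \<in> borel_measurable Mpi" using square_integrable_measurable[OF f] by measurable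
  have g: "square_integrable ?g" using f m by (simp add: square_integrable_def)
  have one: "square_integrable (\<lambda>t. 1)" by (rule square_integrable_continuous) auto
  have "(LINT s|Mpi. cmod (f s)) = Re (cinner (abs_L2pi ?g) (abs_L2pi (\<lambda>t. 1)))"
    by (simp add: cinner_abs_L2pi[OF g one])
  also have "\<dots> \<le> norm (abs_L2pi ?g) * norm (abs_L2pi (\<lambda>t. 1))"
    using complex_Cauchy_Schwarz complex_Re_le_cmod order_trans by blast
  also have "\<dots> \<le> norm (abs_L2pi ?g) * (sqrt pi * 1)"
    by (intro mult_left_mono norm_abs_L2pi_le one) auto
  also have "norm (abs_L2pi ?g) = norm (abs_L2pi f)"
    by (rule power2_eq_imp_eq) (simp_all add: norm_abs_L2pi[OF f] norm_abs_L2pi[OF g])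
  finally show ?thesis by (simp add: mult.commute)
qed

text \<open>The Cauchy--Schwarz inequality against the constant function one.\<close>

lemma prim_cmod_le_norm:
  assumes f: "square_integrable f" and t: "t \<in> {0..pi}"
  shows "cmod (prim f t) \<le> sqrt pi * norm (abs_L2pi f)"
proof -
  have int: "(\<lambda>s. cmod (f s)) integrable_on {0..pi}"
    using square_integrable_AI[OF f] unfolding absolutely_integrable_on_def by auto
  have "cmod (prim f t) \<le> integral {0..t} (\<lambda>s. cmod (f s))"
    unfolding prim_def using AI_subinterval[OF square_integrable_AI[OF f] t]
    by (intro integral_norm_bound_integral) (auto simp: absolutely_integrable_on_def)
  also have "\<dots> \<le> integral {0..pi} (\<lambda>s. cmod (f s))"
    using t int by (intro integral_subset_le) (auto intro: integrable_on_subinterval)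
  also have "\<dots> = (LINT s|Mpi. cmod (f s))"
    unfolding integral_open_interval_real
    by (rule lebesgue_integral_eq_integral[symmetric])
       (use square_integrable_imp_integrable[OF f] in auto)
  finally show ?thesis using LINT_cmod_le_norm[OF f] by linarith
qed

lemma continuous_abs_L2pi_eqD:
  assumes f: "continuous_on {0..pi} f" and g: "continuous_on {0..pi} g"
    and eq: "abs_L2pi f = abs_L2pi g" and t: "t \<in> {0..pi}"
  shows "f t = g t"
proof -
  let ?d = "\<lambda>t. f t - g t"
  have d: "continuous_on {0..pi} ?d" by (intro continuous_intros f g)
  have sq: "square_integrable ?d" by (rule square_integrable_continuous[OF d])
  have "abs_L2pi ?d = 0"
    using eq abs_L2pi_diff[OF square_integrable_continuous[OF f] square_integrable_continuous[OF g]] by simp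
  then have "(LINT t|Mpi. (cmod (?d t))\<^sup>2) = 0" using norm_abs_L2pi[OF sq] by simp
  moreover have "(LINT t|Mpi. (cmod (?d t))\<^sup>2) = integral {0..pi} (\<lambda>t. (cmod (?d t))\<^sup>2)"
    unfolding integral_open_interval_real
    by (rule lebesgue_integral_eq_integral) (use sq in \<open>auto simp: square_integrable_def\<close>)
  ultimately have "integral {0..pi} (\<lambda>t. (cmod (?d t))\<^sup>2) = 0" by simp
  moreover have "continuous_on {0..pi} (\<lambda>t. (cmod (?d t))\<^sup>2)" by (intro continuous_intros d)
  ultimately show ?thesis
    using integral_eq_0_iff[of 0 pi "\<lambda>t. (cmod (?d t))\<^sup>2"] t by auto
qed

lemma point_value_eq:
  assumes f: "continuous_on {0..pi} f" and t: "t \<in> {0..pi}"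
  shows "point_value (abs_L2pi f) t = f t"
proof -
  have "continuous_on {0..pi} (SOME h. continuous_on {0..pi} h \<and> abs_L2pi h = abs_L2pi f) \<and>
      abs_L2pi (SOME h. continuous_on {0..pi} h \<and> abs_L2pi h = abs_L2pi f) = abs_L2pi f"
    by (rule someI[of "\<lambda>h. continuous_on {0..pi} h \<and> abs_L2pi h = abs_L2pi f"]) (use f in simp)
  then show ?thesis unfolding point_value_def by (intro continuous_abs_L2pi_eqD[OF _ f _ t]) auto
qed

section \<open>Weak derivatives are primitives\<close>

lemma has_weak_derivative_prim:
  assumes g: "square_integrable g"
  shows "has_weak_derivative (abs_L2pi (\<lambda>t. c + prim g t)) (abs_L2pi g)"
  unfolding has_weak_derivative_def
proof (intro allI impI)
  fix p assume p: "test_function p"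
  note sp = test_function_square_integrable[OF p]
  have p0: "p 0 = 0" "p pi = 0" using p by (auto simp: test_function_def)
  let ?p = "\<lambda>t. complex_of_real (p t)" and ?p' = "\<lambda>t. complex_of_real (deriv p t)"
  have P: "?p s = 0 + prim ?p' s" if "s \<in> {0..pi}" for s
  proof -
    have "prim ?p' s = ?p s - ?p 0"
      using test_function_deriv(1)[OF p]
      by (intro prim_derivative[OF has_vector_derivative_of_real] that)
         (auto simp: has_real_derivative_iff_has_vector_derivative intro: has_vector_derivative_at_within)
    then show ?thesis using p0 by simp
  qed
  have i: "AI g" "AI ?p'" using g sp by (auto intro: square_integrable_AI)
  have "prim (\<lambda>s. g s * ?p s + (c + prim g s) * ?p' s) pi = (c + prim g pi) * ?p pi - c * 0"
    by (rule integration_by_parts_prim[OF i]) (use P in auto)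
  moreover have "prim (\<lambda>s. g s * ?p s + (c + prim g s) * ?p' s) pi =
      prim (\<lambda>s. g s * ?p s) pi + prim (\<lambda>s. (c + prim g s) * ?p' s) pi"
    using square_integrable_mult_AI[OF g sp(1)] square_integrable_mult_AI[OF square_integrable_prim[OF g] sp(2)]
    by (intro prim_add) auto
  ultimately show "cinner (abs_L2pi (\<lambda>t. c + prim g t)) (abs_L2pi ?p') = - cinner (abs_L2pi g) (abs_L2pi ?p)"
    using p0 by (simp add: cinner_prim g sp square_integrable_prim add_eq_0_iff)
qed

text \<open>The primitive of a test function is constant to the right of its support, and the constant is
  the integral.\<close>

lemma test_function_primitive:
  assumes p: "test_function p" and z: "integral {0..pi} p = 0"
  obtains P where "test_function P" "deriv P = p"
proof -
  obtain a b where ab: "0 < a" "b < pi" "\<And>t. t \<notin> {a..b} \<Longrightarrow> p t = 0"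
    using p unfolding test_function_def by blast
  have cp: "continuous_on UNIV p" by (rule test_function_deriv(3)[OF p])
  have ip: "p integrable_on {c..d}" for c d
    by (intro integrable_continuous_real continuous_on_subset[OF cp]) auto
  define P where "P t = integral {0..t} p" for t
  have low: "P t = 0" if "t < a" for t
  proof -
    have "integral {0..t} p = integral {0..t} (\<lambda>_. 0)"
      by (rule Henstock_Kurzweil_Integration.integral_cong) (use that ab in auto)
    then show ?thesis by (simp add: P_def)
  qed
  have high: "P t = 0" if "t > b" for t
  proof (cases "t < a")
    case False
    have "integral {c..d} p = 0" if "b < c" for c d
    proof -
      have "integral {c..d} p = integral {c..d} (\<lambda>_. 0)"
        by (rule Henstock_Kurzweil_Integration.integral_cong) (use that ab in auto)
      then show ?thesis by simp
    qed
    note zz = this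
    show ?thesis
    proof (cases "t \<le> pi")
      case True
      have "integral {0..t} p + integral {t..pi} p = integral {0..pi} p"
        by (rule Henstock_Kurzweil_Integration.integral_combine) (use True False ab ip in auto)
      then show ?thesis using zz[OF that, of pi] z by (simp add: P_def)
    next
      case False
      have "integral {0..pi} p + integral {pi..t} p = integral {0..t} p"
        by (rule Henstock_Kurzweil_Integration.integral_combine) (use False ip in auto)
      then show ?thesis using zz[of pi t] ab z by (simp add: P_def)
    qed
  qed (simp add: low)
  have der: "(P has_vector_derivative p t) (at t)" for t
  proof (cases "t < a")
    case True
    have "p t = 0" using ab True by auto
    then show ?thesis
      by (intro has_vector_derivative_transform_within_open[of "\<lambda>_. 0" "p t" t "{..<a}" P])
         (use True low in auto)
  next
    case False
    have "(P has_vector_derivative p t) (at t within {0..t + 1})"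
      unfolding P_def[abs_def]
      by (rule integral_has_vector_derivative) (use False ab in \<open>auto intro: continuous_on_subset[OF cp]\<close>)
    then have "(P has_vector_derivative p t) (at t within {0<..<t + 1})"
      by (rule has_vector_derivative_within_subset) auto
    then show ?thesis
      using False ab by (subst (asm) at_within_open) auto
  qed
  have "deriv P = p"
    using der by (auto simp: has_real_derivative_iff_has_vector_derivative[symmetric] DERIV_imp_deriv)
  moreover have "test_function P"
    unfolding test_function_def C1_differentiable_on_def
    using der cp ab low high by (intro conjI exI[of _ p] exI[of _ a] exI[of _ b]) (auto simp: not_le)
  ultimately show ?thesis by (rule that[rotated])
qed

lemma test_function_combine:
  assumes "test_function p" "test_function q"
  shows "test_function (\<lambda>t. p t - c * q t)"
proof -
  obtain a b where ab: "0 < a" "b < pi" "\<And>t. t \<notin> {a..b} \<Longrightarrow> p t = 0"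
    using assms unfolding test_function_def by blast
  obtain a' b' where ab': "0 < a'" "b' < pi" "\<And>t. t \<notin> {a'..b'} \<Longrightarrow> q t = 0"
    using assms unfolding test_function_def by blast
  have "(\<lambda>t. p t - c * q t) C1_differentiable_on UNIV"
    using assms unfolding test_function_def by (intro derivative_intros) auto
  moreover have "\<forall>t. t \<notin> {min a a'..max b b'} \<longrightarrow> p t - c * q t = 0"
    using ab(3) ab'(3) by (metis atLeastAtMost_iff max.bounded_iff min.bounded_iff diff_zero le_max_iff_disj
        min_le_iff_disj mult_zero_right)
  ultimately show ?thesis
    unfolding test_function_def using ab ab' by (intro conjI exI[of _ "min a a'"] exI[of _ "max b b'"]) auto
qed

text \<open>The lemma of du Bois-Reymond: if \<open>h\<close> is a test function of integral one, then
  \<open>p - (\<integral> p) h\<close> is the derivative of a test function for every test function \<open>p\<close>.\<close>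

lemma has_weak_derivative_zeroD:
  assumes w: "square_integrable w" and wd: "has_weak_derivative (abs_L2pi w) 0"
  shows "\<exists>c. AE t in Mpi. w t = c"
proof -
  obtain h where h: "test_function h" "integral {0..pi} h = 1"
  proof -
    (* The polynomial bump on (1, 2), in the form of test_function_bump with exponent 1. *)
    define k :: "real \<Rightarrow> real" where "k t = 1 - (1 - (max 0 ((t - 1) * (2 - t)))\<^sup>2 / pi ^ 4) ^ 1" for t
    have k: "test_function k" unfolding k_def
      by (rule test_function_bump) (use pi_gt3 in auto)
    have ck: "continuous_on {0..pi} k"
      using test_function_deriv(3)[OF k] continuous_on_subset by blast
    have "integral {0..pi} k \<noteq> 0"
    proof
      assume "integral {0..pi} k = 0"
      moreover have "k t \<ge> 0" for t by (simp add: k_def)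
      ultimately have "k (3/2) = 0"
        using integral_eq_0_iff[OF ck] pi_gt3 by simp
      then show False by (simp add: k_def)
    qed
    moreover have "test_function (\<lambda>t. 0 - (- 1 / integral {0..pi} k) * k t)"
      by (rule test_function_combine[OF _ k]) (use pi_gt3 in \<open>auto simp: test_function_def intro!: exI[of _ 1]\<close>)
    ultimately show ?thesis by (intro that[of "\<lambda>t. k t / integral {0..pi} k"]) simp_all
  qed
  have LP: "integral {0..pi} p = Re (prim (\<lambda>t. complex_of_real (p t)) pi)"
    and iP: "AI (\<lambda>t. complex_of_real (p t))" if "test_function p" for p
  proof -
    show "AI (\<lambda>t. complex_of_real (p t))"
      by (rule square_integrable_AI[OF test_function_square_integrable(1)[OF that]])
    then have "integral {0..pi} (Re \<circ> (\<lambda>t. complex_of_real (p t))) = Re (integral {0..pi} (\<lambda>t. complex_of_real (p t)))"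
      by (intro integral_linear) (auto simp: bounded_linear_Re intro: AI_integrable)
    then show "integral {0..pi} p = Re (prim (\<lambda>t. complex_of_real (p t)) pi)"
      by (simp add: prim_def o_def)
  qed
  have Im0: "prim (\<lambda>t. complex_of_real (p t)) pi = complex_of_real (integral {0..pi} p)" if "test_function p" for p
  proof -
    have "p integrable_on {0..pi}"
      by (intro integrable_continuous_real continuous_on_subset[OF test_function_deriv(3)[OF that]]) auto
    then show ?thesis
      unfolding prim_def using integral_linear[of p "{0..pi}" complex_of_real] bounded_linear_of_real
      by (simp add: o_def)
  qed
  define c where "c = prim (\<lambda>t. w t * complex_of_real (h t)) pi"
  have "AE t in Mpi. w t - c = 0"
  proof (rule L2_eq_zero_test)
    show "square_integrable (\<lambda>t. w t - c)"
      by (intro square_integrable_diff w square_integrable_continuous continuous_intros)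
    fix p assume p: "test_function p"
    define I where "I = integral {0..pi} p"
    let ?q = "\<lambda>t. p t - I * h t"
    have q: "test_function ?q" by (rule test_function_combine[OF p h(1)])
    have "integral {0..pi} ?q = 0"
    proof -
      have "p integrable_on {0..pi}" "h integrable_on {0..pi}"
        by (intro integrable_continuous_real continuous_on_subset[OF test_function_deriv(3)] p h; simp)+
      then show ?thesis
        using h(2) by (subst Henstock_Kurzweil_Integration.integral_diff) (auto simp: I_def intro!: integrable_on_mult_right)
    qed
    then obtain P where P: "test_function P" "deriv P = ?q"
      using test_function_primitive[OF q] by blast
    have sp: "square_integrable (\<lambda>t. complex_of_real (p t))" "square_integrable (\<lambda>t. complex_of_real (h t))"
      "square_integrable (\<lambda>t. complex_of_real (?q t))"
      using test_function_square_integrable(1) p h q by blast+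
    have "cinner (abs_L2pi w) (abs_L2pi (\<lambda>t. complex_of_real (?q t))) = 0"
      using wd P unfolding has_weak_derivative_def by (metis cinner_zero_left neg_0_equal_iff_equal)
    then have "prim (\<lambda>t. w t * complex_of_real (?q t)) pi = 0"
      using cinner_prim[OF w sp(3)] by simp
    moreover have "prim (\<lambda>t. w t * complex_of_real (?q t)) pi =
        prim (\<lambda>t. w t * complex_of_real (p t) - complex_of_real I * (w t * complex_of_real (h t))) pi"
      by (rule prim_cong) (simp add: algebra_simps)
    moreover have "\<dots> = prim (\<lambda>t. w t * complex_of_real (p t)) pi - complex_of_real I * c"
      using square_integrable_mult_AI[OF w sp(1)] square_integrable_mult_AI[OF w sp(2)]
      by (subst prim_diff) (auto intro!: AI_cmult simp: prim_cmult c_def)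
    ultimately have 1: "prim (\<lambda>t. w t * complex_of_real (p t)) pi = complex_of_real I * c" by simp
    have i: "AI (\<lambda>t. w t * complex_of_real (p t))" using square_integrable_mult_AI[OF w sp(1)] by simp
    have "(LINT t|Mpi. (w t - c) * complex_of_real (p t)) =
        prim (\<lambda>t. w t * complex_of_real (p t) - c * complex_of_real (p t)) pi"
      by (subst LINT_Mpi_prim[symmetric]) (auto intro!: AI_diff AI_cmult i iP p simp: algebra_simps)
    also have "\<dots> = prim (\<lambda>t. w t * complex_of_real (p t)) pi - c * prim (\<lambda>t. complex_of_real (p t)) pi"
      by (subst prim_diff) (auto intro!: AI_diff AI_cmult i iP p simp: prim_cmult)
    finally show "(LINT t|Mpi. (w t - c) * complex_of_real (p t)) = 0"
      using 1 Im0[OF p] by (simp add: I_def)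
  qed
  then show ?thesis by (intro exI[of _ c]) (auto elim: AE_mp)
qed

text \<open>Subtracting the primitive of the weak derivative leaves a function with weak derivative zero.\<close>

lemma has_weak_derivativeD:
  assumes f: "square_integrable f" and wd: "has_weak_derivative u (abs_L2pi f)"
  obtains c where "u = abs_L2pi (\<lambda>t. c + prim f t)"
proof -
  obtain v where v: "square_integrable v" "u = abs_L2pi v" by (rule abs_L2pi_cases)
  let ?w = "\<lambda>t. v t - (0 + prim f t)"
  have sw: "square_integrable ?w" by (intro square_integrable_diff v square_integrable_prim f)
  have "has_weak_derivative (u + (- 1) *\<^sub>C abs_L2pi (\<lambda>t. 0 + prim f t)) (abs_L2pi f + (- 1) *\<^sub>C abs_L2pi f)"
    by (intro has_weak_derivative_add wd has_weak_derivative_scaleC has_weak_derivative_prim f)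
  then have "has_weak_derivative (abs_L2pi ?w) 0"
    using abs_L2pi_diff[OF v(1) square_integrable_prim[OF f, of 0]] by (simp add: v(2) scaleC_one)
  then obtain c where c: "AE t in Mpi. ?w t = c"
    using has_weak_derivative_zeroD[OF sw] by blast
  have "abs_L2pi v = abs_L2pi (\<lambda>t. c + prim f t)"
    unfolding abs_L2pi_eq_iff[OF v(1) square_integrable_prim[OF f]]
    using c by eventually_elim (simp add: algebra_simps)
  then show ?thesis using v(2) by (intro that[of c]) simp
qed

section \<open>The initial value problem\<close>

text \<open>\<open>cauchy w f c U V\<close> says that \<open>U\<close> solves \<open>- u'' - w u = f\<close> with \<open>u(0) = c\<close> and \<open>u'(0) = 0\<close>,
  in integrated form and with \<open>V = u'\<close>.\<close>

definition cauchy ::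
    "(real \<Rightarrow> complex) \<Rightarrow> (real \<Rightarrow> complex) \<Rightarrow> complex \<Rightarrow> (real \<Rightarrow> complex) \<Rightarrow> (real \<Rightarrow> complex) \<Rightarrow> bool" where
  "cauchy w f c U V \<longleftrightarrow> continuous_on {0..pi} U \<and> continuous_on {0..pi} V \<and>
     (\<forall>t\<in>{0..pi}. U t = c + prim V t \<and> V t = - prim (\<lambda>s. w s * U s + f s) t)"

definition bounded_measurable :: "(real \<Rightarrow> complex) \<Rightarrow> real \<Rightarrow> bool" where
  "bounded_measurable w M \<longleftrightarrow> w \<in> borel_measurable (lebesgue_on {0..pi}) \<and> (\<forall>t. cmod (w t) \<le> M)"

lemma bounded_measurable_mult_AI:
  "bounded_measurable w M \<Longrightarrow> continuous_on {0..pi} U \<Longrightarrow> AI (\<lambda>s. w s * U s)"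
  by (rule AI_bounded_mult[where B = M]) (auto simp: bounded_measurable_def intro: AI_continuous)

lemma bounded_measurable_nonneg: "bounded_measurable w M \<Longrightarrow> 0 \<le> M"
  unfolding bounded_measurable_def by (meson norm_ge_zero order_trans)

lemma cauchy_combine:
  assumes w: "bounded_measurable w M" and f: "AI f" "AI f'"
    and s: "cauchy w f c U V" "cauchy w f' c' U' V'"
  shows "cauchy w (\<lambda>t. f t + a * f' t) (c + a * c') (\<lambda>t. U t + a * U' t) (\<lambda>t. V t + a * V' t)"
proof -
  have co: "continuous_on {0..pi} U" "continuous_on {0..pi} V" "continuous_on {0..pi} U'" "continuous_on {0..pi} V'"
    using s by (auto simp: cauchy_def)
  note i = AI_add[OF bounded_measurable_mult_AI[OF w co(1)] f(1)] AI_add[OF bounded_measurable_mult_AI[OF w co(3)] f(2)]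
  show ?thesis unfolding cauchy_def
  proof (intro conjI ballI)
    fix t assume t: "t \<in> {0..pi}"
    have "prim (\<lambda>t. V t + a * V' t) t = prim V t + a * prim V' t"
      by (subst prim_add[OF _ _ t]) (auto intro: AI_continuous AI_cmult co simp: prim_cmult)
    then show "U t + a * U' t = c + a * c' + prim (\<lambda>t. V t + a * V' t) t"
      using s t by (simp add: cauchy_def algebra_simps)
    have "prim (\<lambda>s. w s * (U s + a * U' s) + (f s + a * f' s)) t
        = prim (\<lambda>s. (w s * U s + f s) + a * (w s * U' s + f' s)) t"
      by (rule prim_cong) (simp add: algebra_simps)
    also have "\<dots> = prim (\<lambda>s. w s * U s + f s) t + a * prim (\<lambda>s. w s * U' s + f' s) t"
      by (subst prim_add[OF _ _ t]) (auto intro: AI_cmult i simp: prim_cmult)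
    finally show "V t + a * V' t = - prim (\<lambda>s. w s * (U s + a * U' s) + (f s + a * f' s)) t"
      using s t by (simp add: cauchy_def)
  qed (intro continuous_intros co)+
qed

lemma cauchy_cong:
  assumes "cauchy w f c U V" "\<And>t. t \<in> {0..pi} \<Longrightarrow> w t * U t + f t = w' t * U t + f' t" "c = c'"
  shows "cauchy w' f' c' U V"
  using assms prim_cong[of _ "\<lambda>s. w s * U s + f s" "\<lambda>s. w' s * U s + f' s"]
  unfolding cauchy_def by auto

lemma cauchy_initial: "cauchy w f c U V \<Longrightarrow> U 0 = c" "cauchy w f c U V \<Longrightarrow> V 0 = 0"
  by (auto simp: cauchy_def)

lemma attains_max:
  fixes g :: "real \<Rightarrow> real"
  assumes "continuous_on {0..pi} g"
  shows "\<exists>x\<in>{0..pi}. \<forall>t\<in>{0..pi}. g t \<le> g x"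
  by (rule continuous_attains_sup) (use assms in auto)

text \<open>The supremum of \<open>|U(t)| exp (- k t)\<close> is at most half of itself plus the data, because
  integration against the weight gains \<open>1 / k\<close>.\<close>

lemma cauchy_bound:
  assumes w: "bounded_measurable w M" and f: "AI f" and s: "cauchy w f c U V"
    and k: "1 \<le> k" "2 * M \<le> k" and G: "\<And>t. t \<in> {0..pi} \<Longrightarrow> cmod (prim f t) \<le> G * exp (k * t)"
    and t: "t \<in> {0..pi}"
  shows "cmod (U t) \<le> 2 * (cmod c + G) * exp (k * t)" "cmod (V t) \<le> 2 * (cmod c + G) * exp (k * t)"
proof -
  have co: "continuous_on {0..pi} U" "continuous_on {0..pi} V" using s by (auto simp: cauchy_def)
  have M: "0 \<le> M" by (rule bounded_measurable_nonneg[OF w])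
  have G0: "0 \<le> G" using order_trans[OF norm_ge_zero G[of 0]] by simp
  have "continuous_on {0..pi} (\<lambda>t. cmod (U t) * exp (- (k * t)))" by (intro continuous_intros co)
  from attains_max[OF this] obtain t0 where t0: "t0 \<in> {0..pi}"
    "\<And>t. t \<in> {0..pi} \<Longrightarrow> cmod (U t) * exp (- (k * t)) \<le> cmod (U t0) * exp (- (k * t0))"
    by blast
  define A where "A = cmod (U t0) * exp (- (k * t0))"
  have A0: "0 \<le> A" by (simp add: A_def)
  have UA: "cmod (U t) \<le> A * exp (k * t)" if "t \<in> {0..pi}" for t
    using t0(2)[OF that] unfolding A_def[symmetric] by (simp add: exp_minus field_simps)
  note i = bounded_measurable_mult_AI[OF w co(1)]
  have VB: "cmod (V t) \<le> (A / 2 + G) * exp (k * t)" if t: "t \<in> {0..pi}" for t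
  proof -
    have "cmod (prim (\<lambda>s. w s * U s) t) \<le> (M * A) / k * exp (k * t)"
    proof (rule prim_exp_bound[OF i t])
      fix s assume s: "s \<in> {0..pi}"
      have "cmod (w s * U s) \<le> M * (A * exp (k * s))"
        unfolding norm_mult using w UA[OF s] M by (intro mult_mono) (auto simp: bounded_measurable_def)
      then show "cmod (w s * U s) \<le> M * A * exp (k * s)" by simp
    qed (use k M A0 in auto)
    also have "(M * A) / k * exp (k * t) \<le> A / 2 * exp (k * t)"
    proof -
      have "M * A \<le> k / 2 * A" using k A0 by (intro mult_right_mono) auto
      then show ?thesis using k by (intro mult_right_mono) (auto simp: field_simps)
    qed
    finally have "cmod (prim (\<lambda>s. w s * U s) t + prim f t) \<le> A / 2 * exp (k * t) + G * exp (k * t)"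
      using G[OF t] norm_triangle_ineq[of "prim (\<lambda>s. w s * U s) t" "prim f t"] by simp
    moreover have "V t = - (prim (\<lambda>s. w s * U s) t + prim f t)"
      using s t prim_add[OF i f t] by (simp add: cauchy_def)
    ultimately show ?thesis by (simp only: norm_minus_cancel distrib_right)
  qed
  have "cmod (prim V t) \<le> (A / 2 + G) * exp (k * t)" if t: "t \<in> {0..pi}" for t
  proof -
    have "cmod (prim V t) \<le> (A / 2 + G) / k * exp (k * t)"
      by (rule prim_exp_bound[OF AI_continuous[OF co(2)] t VB]) (use k A0 G0 in auto)
    also have "\<dots> \<le> (A / 2 + G) / 1 * exp (k * t)"
      using k A0 G0 by (intro mult_right_mono divide_left_mono) auto
    finally show ?thesis by simp
  qed
  from this[OF t0(1)] have "cmod (U t0) \<le> cmod c + (A / 2 + G) * exp (k * t0)"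
    using s t0(1) norm_triangle_ineq[of c "prim V t0"] by (simp add: cauchy_def)
  also have "\<dots> \<le> (cmod c + A / 2 + G) * exp (k * t0)"
    using mult_left_mono[of 1 "exp (k * t0)" "cmod c"] k t0(1) by (simp add: algebra_simps)
  finally have "A \<le> cmod c + A / 2 + G"
    unfolding A_def exp_minus inverse_eq_divide
    by (simp only: times_divide_eq_right mult_1_right pos_divide_le_eq[OF exp_gt_zero])
  then have A: "A \<le> 2 * (cmod c + G)" by simp
  show "cmod (U t) \<le> 2 * (cmod c + G) * exp (k * t)"
    by (rule order_trans[OF UA[OF t] mult_right_mono[OF A]]) simp
  have "0 \<le> cmod c" by simp
  with A G0 have "A / 2 + G \<le> 2 * (cmod c + G)" by argo
  then have "(A / 2 + G) * exp (k * t) \<le> (2 * (cmod c + G)) * exp (k * t)"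
    by (intro mult_right_mono) auto
  then show "cmod (V t) \<le> 2 * (cmod c + G) * exp (k * t)" by (rule order_trans[OF VB[OF t]])
qed

lemma cauchy_unique:
  assumes w: "bounded_measurable w M" and f: "AI f" and s: "cauchy w f c U V" "cauchy w f c U' V'" and t: "t \<in> {0..pi}"
  shows "U t = U' t" "V t = V' t"
proof -
  have z: "cauchy w (\<lambda>t. f t + (- 1) * f t) (c + (- 1) * c) (\<lambda>t. U t + (- 1) * U' t) (\<lambda>t. V t + (- 1) * V' t)"
    by (rule cauchy_combine[OF w f f s])
  have i: "AI (\<lambda>t. f t + (- 1) * f t)" by (intro AI_add AI_cmult f)
  have "cmod (prim (\<lambda>t. f t + (- 1) * f t) t) \<le> 0 * exp (max 1 (2 * M) * t)" for t
    by (simp add: prim_def)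
  from cauchy_bound[OF w i z _ _ this t] show "U t = U' t" "V t = V' t" by auto
qed

lemma clamp_bcontfun:
  assumes "continuous_on {0..pi} (h :: real \<Rightarrow> complex)"
  shows "(\<lambda>t. h (max 0 (min pi t))) \<in> bcontfun"
proof -
  have "continuous_on UNIV (\<lambda>t. h (max 0 (min pi t)))"
    by (rule continuous_on_compose2[OF assms]) (auto intro!: continuous_intros)
  moreover have "bounded (range (\<lambda>t. h (max 0 (min pi t))))"
    by (rule bounded_subset[OF compact_imp_bounded[OF compact_continuous_image[OF assms compact_Icc]]]) auto
  ultimately show ?thesis by (simp add: bcontfun_def)
qed

text \<open>Banach's fixed point theorem for \<open>U\<close> divided by the weight \<open>exp (k t)\<close>. The fixed point
  is sought among the bounded continuous functions on the whole line, with the argument clamped to the interval.\<close>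

lemma cauchy_exists:
  assumes w: "bounded_measurable w M" and f: "AI f"
  shows "\<exists>U V. cauchy w f c U V"
proof -
  define k where "k = max 1 (2 * M)"
  have k: "1 \<le> k" "2 * M \<le> k" by (auto simp: k_def)
  have M: "0 \<le> M" by (rule bounded_measurable_nonneg[OF w])
  define e where "e t = complex_of_real (exp (k * t))" for t
  have ce: "continuous_on A e" for A unfolding e_def[abs_def] by (intro continuous_intros)
  have e0: "e t \<noteq> 0" for t by (simp add: e_def)
  let ?a = "apply_bcontfun"
  have i: "AI (\<lambda>s. w s * (e s * ?a v s))" for v
    by (rule bounded_measurable_mult_AI[OF w]) (intro continuous_intros ce, auto)
  define W where "W v = prim (\<lambda>s. w s * (e s * ?a v s) + f s)" for v
  have cW: "continuous_on {0..pi} (W v)" for v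
    unfolding W_def by (rule continuous_prim[OF AI_add[OF i f]])
  have iW: "AI (W v)" for v by (rule AI_continuous[OF cW])
  define P where "P v t = (c - prim (W v) t) / e t" for v t
  have cP: "continuous_on {0..pi} (P v)" for v
    unfolding P_def[abs_def] by (intro continuous_intros continuous_prim iW ce) (simp add: e0)
  define \<Phi> where "\<Phi> v = Bcontfun (\<lambda>t. P v (max 0 (min pi t)))" for v
  have \<Phi>: "?a (\<Phi> v) t = P v (max 0 (min pi t))" for v t
    unfolding \<Phi>_def by (subst Bcontfun_inverse[OF clamp_bcontfun[OF cP]]) simp
  have "\<exists>!v. \<Phi> v = v"
  proof (rule banach_fix_type)
    show "\<forall>u v. dist (\<Phi> u) (\<Phi> v) \<le> (1/2) * dist u v"
    proof (intro allI dist_bound)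
      fix u v :: "real \<Rightarrow>\<^sub>C complex" and t :: real
      define s where "s = max 0 (min pi t)"
      have s: "s \<in> {0..pi}" by (auto simp: s_def)
      have D: "cmod (W u x - W v x) \<le> (M * dist u v / k) * exp (k * x)" if x: "x \<in> {0..pi}" for x
      proof -
        have "W u x - W v x = prim (\<lambda>s. (w s * (e s * ?a u s) + f s) - (w s * (e s * ?a v s) + f s)) x"
          unfolding W_def by (rule prim_diff[symmetric, OF AI_add[OF i f] AI_add[OF i f] x])
        also have "cmod \<dots> \<le> (M * dist u v) / k * exp (k * x)"
        proof (rule prim_exp_bound[OF AI_diff[OF AI_add[OF i f] AI_add[OF i f]] x])
          fix s
          have "cmod (w s * (e s * (?a u s - ?a v s))) \<le> M * (exp (k * s) * dist u v)"
            unfolding norm_mult using w dist_bounded[of u s v] M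
            by (intro mult_mono) (auto simp: bounded_measurable_def e_def dist_norm)
          then show "cmod (w s * (e s * ?a u s) + f s - (w s * (e s * ?a v s) + f s)) \<le> M * dist u v * exp (k * s)"
            by (simp add: algebra_simps)
        qed (use k M in auto)
        finally show ?thesis by simp
      qed
      have "dist (?a (\<Phi> u) t) (?a (\<Phi> v) t) = cmod (prim (\<lambda>x. W u x - W v x) s) / exp (k * s)"
        unfolding \<Phi> s_def[symmetric] P_def dist_norm prim_diff[OF iW iW s]
        by (simp add: diff_divide_distrib[symmetric] norm_divide e_def norm_minus_commute)
      also have "\<dots> \<le> (M * dist u v / k / k * exp (k * s)) / exp (k * s)"
        by (intro divide_right_mono prim_exp_bound[OF AI_diff[OF iW iW] s D]) (use k M in auto)
      also have "\<dots> = M / k * dist u v / k" by simp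
      also have "\<dots> \<le> (1/2) * dist u v / 1"
        by (rule frac_le, simp, rule mult_right_mono) (use k M in \<open>auto simp: field_simps\<close>)
      finally show "dist (?a (\<Phi> u) t) (?a (\<Phi> v) t) \<le> (1/2) * dist u v" by simp
    qed
  qed auto
  then obtain v where v: "\<Phi> v = v" by blast
  define U where "U t = e t * ?a v t" for t
  have U: "U t = c - prim (W v) t" if "t \<in> {0..pi}" for t
  proof -
    have "?a v t = P v t" using \<Phi>[of v t] that by (simp add: v)
    then show ?thesis by (simp add: U_def P_def e0)
  qed
  have W: "W v = prim (\<lambda>s. w s * U s + f s)" by (simp add: W_def U_def)
  have "cauchy w f c U (\<lambda>t. - W v t)"
    unfolding cauchy_def
  proof (intro conjI ballI)
    show "continuous_on {0..pi} U" unfolding U_def[abs_def] by (intro continuous_intros ce) auto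
    fix t assume "t \<in> {0..pi}"
    then show "U t = c + prim (\<lambda>t. - W v t) t" by (simp add: U prim_uminus)
    show "- W v t = - prim (\<lambda>s. w s * U s + f s) t" by (simp add: W)
  qed (intro continuous_intros cW)
  then show ?thesis by blast
qed

lemma prim_tail_exp_bound:
  assumes f: "AI f" "t \<in> {0..pi}" "\<And>s. s \<in> {0..pi} \<Longrightarrow> cmod (f s) \<le> B * exp (k * (pi - s))" "0 < k" "0 \<le> B"
  shows "cmod (prim f pi - prim f t) \<le> B / k * exp (k * (pi - t))"
proof -
  have h: "((\<lambda>s. B * exp (k * (pi - s))) has_integral
      (- B / k * exp (k * (pi - pi)) - (- B / k * exp (k * (pi - t))))) {t..pi}"
    by (rule fundamental_theorem_of_calculus)
       (use f in \<open>auto intro!: derivative_eq_intros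
          simp: has_real_derivative_iff_has_vector_derivative[symmetric]\<close>)
  have "f absolutely_integrable_on {t..pi}"
    by (rule absolutely_integrable_on_subinterval[OF f(1)]) (use f(2) in auto)
  then have "f integrable_on {t..pi}" by (simp add: absolutely_integrable_on_def)
  then have "cmod (integral {t..pi} f) \<le> - B / k * exp (k * (pi - pi)) - (- B / k * exp (k * (pi - t)))"
    unfolding integral_unique[OF h, symmetric]
    by (rule integral_norm_bound_integral) (use has_integral_integrable[OF h] f(2,3) in auto)
  also have "\<dots> \<le> B / k * exp (k * (pi - t))" using f by simp
  finally show ?thesis by (simp add: prim_split[OF f(1,2)])
qed

text \<open>The estimate of \<open>cauchy_bound\<close>, run from the right end point with the reflected weight.\<close>

lemma cauchy_backward_unique:
  assumes w: "bounded_measurable w M" and s: "cauchy w (\<lambda>_. 0) c U V" and e: "U pi = 0" "V pi = 0"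
  shows "c = 0"
proof -
  define k where "k = max 1 (2 * M)"
  have k: "1 \<le> k" "2 * M \<le> k" by (auto simp: k_def)
  have M: "0 \<le> M" by (rule bounded_measurable_nonneg[OF w])
  have co: "continuous_on {0..pi} U" "continuous_on {0..pi} V" using s by (auto simp: cauchy_def)
  have "continuous_on {0..pi} (\<lambda>t. cmod (U t) * exp (- (k * (pi - t))))" by (intro continuous_intros co)
  from attains_max[OF this] obtain t0 where t0: "t0 \<in> {0..pi}"
    "\<And>t. t \<in> {0..pi} \<Longrightarrow> cmod (U t) * exp (- (k * (pi - t))) \<le> cmod (U t0) * exp (- (k * (pi - t0)))"
    by blast
  define A where "A = cmod (U t0) * exp (- (k * (pi - t0)))"
  have A0: "0 \<le> A" by (simp add: A_def)
  have UA: "cmod (U t) \<le> A * exp (k * (pi - t))" if "t \<in> {0..pi}" for t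
    using t0(2)[OF that] unfolding A_def[symmetric] unfolding exp_minus inverse_eq_divide
    by (simp only: times_divide_eq_right mult_1_right pos_divide_le_eq[OF exp_gt_zero])
  note i = bounded_measurable_mult_AI[OF w co(1)]
  have VB: "cmod (V t) \<le> A / 2 * exp (k * (pi - t))" if t: "t \<in> {0..pi}" for t
  proof -
    have "cmod (prim (\<lambda>s. w s * U s) pi - prim (\<lambda>s. w s * U s) t) \<le> (M * A) / k * exp (k * (pi - t))"
    proof (rule prim_tail_exp_bound[OF i t])
      fix s assume s: "s \<in> {0..pi}"
      have "cmod (w s * U s) \<le> M * (A * exp (k * (pi - s)))"
        unfolding norm_mult using w UA[OF s] M by (intro mult_mono) (auto simp: bounded_measurable_def)
      then show "cmod (w s * U s) \<le> M * A * exp (k * (pi - s))" by simp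
    qed (use k M A0 in auto)
    also have "(M * A) / k * exp (k * (pi - t)) \<le> A / 2 * exp (k * (pi - t))"
    proof -
      have "M * A \<le> k / 2 * A" using k A0 by (intro mult_right_mono) auto
      then show ?thesis using k by (intro mult_right_mono) (auto simp: field_simps)
    qed
    finally have "cmod (prim (\<lambda>s. w s * U s) pi - prim (\<lambda>s. w s * U s) t) \<le> A / 2 * exp (k * (pi - t))" .
    moreover have "V t = prim (\<lambda>s. w s * U s) pi - prim (\<lambda>s. w s * U s) t"
      using s t e(2) by (simp add: cauchy_def)
    ultimately show ?thesis by simp
  qed
  have "cmod (prim V pi - prim V t0) \<le> A / 2 / k * exp (k * (pi - t0))"
    by (rule prim_tail_exp_bound[OF AI_continuous[OF co(2)] t0(1) VB]) (use k A0 in auto)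
  also have "\<dots> \<le> A / 2 / 1 * exp (k * (pi - t0))"
    using k A0 by (intro mult_right_mono divide_left_mono) auto
  also have "prim V pi - prim V t0 = - U t0"
  proof -
    have "prim V pi = U pi - c" "prim V t0 = U t0 - c" using s t0(1) by (auto simp: cauchy_def)
    then show ?thesis using e(1) by simp
  qed
  finally have "A \<le> A / 2"
    unfolding A_def exp_minus inverse_eq_divide norm_minus_cancel
    by (simp only: times_divide_eq_right mult_1_right pos_divide_le_eq[OF exp_gt_zero])
  then have "U 0 = 0" using A0 UA[of 0] by simp
  then show "c = 0" using cauchy_initial(1)[OF s] by simp
qed

section \<open>The characteristic function\<close>

text \<open>The operator is \<open>T u = - u'' - q u\<close> with boundary conditions \<open>u'(0) = 0\<close> and
  \<open>u'(\<pi>) + b u(\<pi>) = 0\<close>. Here \<open>q\<close> is bounded everywhere and not only almost everywhere, so that pointwise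
  estimates need no exceptional sets.\<close>

locale sturm_liouville =
  fixes q :: "real \<Rightarrow> real" and Q :: real and b :: complex
  assumes q_measurable: "q \<in> borel_measurable (lebesgue_on {0..pi})" and q_bounded: "\<bar>q t\<bar> \<le> Q"
begin

text \<open>The equation \<open>(T - l) u = f\<close> reads \<open>- u'' - w l u = f\<close>.\<close>

definition w :: "complex \<Rightarrow> real \<Rightarrow> complex" where
  "w l t = complex_of_real (q t) + l"

lemma Q_nonneg: "0 \<le> Q"
  using q_bounded[of 0] by simp

lemma bounded_measurable_w: "bounded_measurable (w l) (Q + cmod l)"
  unfolding bounded_measurable_def
proof (intro conjI allI)
  show "w l \<in> borel_measurable (lebesgue_on {0..pi})"
    using q_measurable unfolding w_def[abs_def] by measurable
  show "cmod (w l t) \<le> Q + cmod l" for t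
    using norm_triangle_ineq[of "complex_of_real (q t)" l] q_bounded[of t] by (simp add: w_def)
qed

definition sol :: "complex \<Rightarrow> (real \<Rightarrow> complex) \<Rightarrow> complex \<Rightarrow> (real \<Rightarrow> complex) \<times> (real \<Rightarrow> complex)" where
  "sol l f c = (SOME p. cauchy (w l) f c (fst p) (snd p))"

lemma sol: "AI f \<Longrightarrow> cauchy (w l) f c (fst (sol l f c)) (snd (sol l f c))"
  unfolding sol_def using cauchy_exists[OF bounded_measurable_w, of f l c]
    someI_ex[of "\<lambda>p. cauchy (w l) f c (fst p) (snd p)"] by auto

text \<open>The \<open>k\<close>-th member of the chain at \<open>l\<close> is, up to the factor \<open>k!\<close>, the \<open>k\<close>-th derivative
  with respect to the spectral parameter of the solution with initial values \<open>1, 0\<close>.\<close>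

primrec chain :: "complex \<Rightarrow> nat \<Rightarrow> (real \<Rightarrow> complex) \<times> (real \<Rightarrow> complex)" where
  "chain l 0 = sol l (\<lambda>_. 0) 1"
| "chain l (Suc k) = sol l (fst (chain l k)) 0"

definition y :: "complex \<Rightarrow> nat \<Rightarrow> real \<Rightarrow> complex" where "y l k = fst (chain l k)"
definition y' :: "complex \<Rightarrow> nat \<Rightarrow> real \<Rightarrow> complex" where "y' l k = snd (chain l k)"

text \<open>The right-hand side of the equation for the chain member; the value zero at \<open>k = 0\<close> lets one
  equation describe the homogeneous solution and the higher members alike.\<close>

definition pred_y :: "complex \<Rightarrow> nat \<Rightarrow> real \<Rightarrow> complex" where
  "pred_y l k = (case k of 0 \<Rightarrow> (\<lambda>_. 0) | Suc j \<Rightarrow> y l j)"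

lemma pred_y_simps [simp]: "pred_y l 0 = (\<lambda>_. 0)" "pred_y l (Suc k) = y l k"
  by (simp_all add: pred_y_def)

lemma cauchy_y: "cauchy (w l) (pred_y l k) (if k = 0 then 1 else 0) (y l k) (y' l k)"
proof (induction k)
  case 0
  show ?case using sol[of "\<lambda>_. 0" l 1] by (simp add: y_def y'_def AI_continuous)
next
  case (Suc k)
  then have "AI (y l k)" by (intro AI_continuous) (simp add: cauchy_def)
  from sol[OF this, of l 0] show ?case by (simp add: y_def y'_def)
qed

lemma continuous_y: "continuous_on {0..pi} (y l k)" "continuous_on {0..pi} (y' l k)"
  using cauchy_y[of l k] by (auto simp: cauchy_def)

lemma continuous_pred_y: "continuous_on {0..pi} (pred_y l k)"
  by (cases k) (auto intro: continuous_y)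

lemmas AI_y = AI_continuous[OF continuous_y(1)]
lemmas AI_pred_y = AI_continuous[OF continuous_pred_y]

text \<open>The value of the right boundary form on the chain; by \<open>Delta_sums\<close> below these are the Taylor
  coefficients of the characteristic function at \<open>l\<close>.\<close>

definition Delta_coeff :: "complex \<Rightarrow> nat \<Rightarrow> complex" where
  "Delta_coeff l k = y' l k pi + b * y l k pi"

definition Delta :: "complex \<Rightarrow> complex" where
  "Delta l = Delta_coeff l 0"

text \<open>The bound does not grow with \<open>n\<close>: the data of the next member are the primitive of the
  previous one, and the exponential weight makes this primitive no larger than half of the allowed bound.\<close>

lemma y_bound:
  assumes k: "2 \<le> k" "2 * (Q + cmod l) \<le> k" and t: "t \<in> {0..pi}"
  shows "cmod (y l n t) \<le> 2 * exp (k * t)"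
  using t
proof (induction n arbitrary: t)
  case 0
  have "cmod (prim (pred_y l 0) t) \<le> 0 * exp (k * t)" for t by (simp add: prim_def)
  from cauchy_bound(1)[OF bounded_measurable_w AI_pred_y cauchy_y _ _ this 0] k show ?case by simp
next
  case (Suc n)
  have "cmod (prim (pred_y l (Suc n)) t) \<le> 1 * exp (k * t)" if "t \<in> {0..pi}" for t
  proof -
    have "cmod (prim (pred_y l (Suc n)) t) \<le> 2 / k * exp (k * t)"
      by (rule prim_exp_bound[OF AI_pred_y that]) (use Suc.IH k in auto)
    also have "\<dots> \<le> 1 * exp (k * t)" using k by (intro mult_right_mono) auto
    finally show ?thesis .
  qed
  from cauchy_bound(1)[OF bounded_measurable_w AI_pred_y cauchy_y _ _ this Suc.prems] k show ?case by simp
qed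

text \<open>The partial sums of the Taylor series in the spectral parameter solve the initial value
  problem at \<open>l + z\<close> up to an error that tends to zero geometrically.\<close>

lemma cauchy_partial_sum:
  "cauchy (w (l + z)) (\<lambda>t. - (z ^ Suc n) * y l n t) 1
     (\<lambda>t. \<Sum>k\<le>n. z ^ k * y l k t) (\<lambda>t. \<Sum>k\<le>n. z ^ k * y' l k t)"
proof (induction n)
  case 0
  show ?case using cauchy_y[of l 0] by (auto intro: cauchy_cong simp: w_def algebra_simps)
next
  case (Suc n)
  have s: "cauchy (w (l + z)) (\<lambda>t. y l n t - z * y l (Suc n) t) 0 (y l (Suc n)) (y' l (Suc n))"
    by (rule cauchy_cong[OF cauchy_y]) (auto simp: w_def algebra_simps)
  have "cauchy (w (l + z)) (\<lambda>t. - (z ^ Suc n) * y l n t + z ^ Suc n * (y l n t - z * y l (Suc n) t)) (1 + z ^ Suc n * 0)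
     (\<lambda>t. (\<Sum>k\<le>n. z ^ k * y l k t) + z ^ Suc n * y l (Suc n) t)
     (\<lambda>t. (\<Sum>k\<le>n. z ^ k * y' l k t) + z ^ Suc n * y' l (Suc n) t)"
    by (rule cauchy_combine[OF bounded_measurable_w AI_cmult[OF AI_y] AI_diff[OF AI_y AI_cmult[OF AI_y]] Suc s])
  then show ?case by (auto intro: cauchy_cong simp: algebra_simps)
qed

lemma Delta_sums:
  assumes z: "cmod z < 1"
  shows "(\<lambda>k. Delta_coeff l k * z ^ k) sums Delta (l + z)"
proof -
  define k where "k = max 2 (2 * (Q + cmod l + 1))"
  have k: "2 \<le> k" "2 * (Q + cmod l) \<le> k" by (auto simp: k_def)
  have "cmod (l + z) \<le> cmod l + 1" using norm_triangle_ineq[of l z] z by linarith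
  then have k': "2 * (Q + cmod (l + z)) \<le> k" by (auto simp: k_def)
  define E where "E = 4 * exp (k * pi)"
  let ?S = "\<lambda>n t. \<Sum>k\<le>n. z ^ k * y l k t" and ?S' = "\<lambda>n t. \<Sum>k\<le>n. z ^ k * y' l k t"
  have err: "cmod (?S n pi - y (l + z) 0 pi) \<le> E * cmod z ^ n"
    "cmod (?S' n pi - y' (l + z) 0 pi) \<le> E * cmod z ^ n" for n
  proof -
    have c: "cauchy (w (l + z)) (\<lambda>t. - (z ^ Suc n) * y l n t + (- 1) * pred_y (l + z) 0 t) (1 + (- 1) * (if (0::nat) = 0 then 1 else 0))
        (\<lambda>t. ?S n t + (- 1) * y (l + z) 0 t) (\<lambda>t. ?S' n t + (- 1) * y' (l + z) 0 t)"
      by (rule cauchy_combine[OF bounded_measurable_w AI_cmult[OF AI_y] AI_pred_y cauchy_partial_sum cauchy_y])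
    have G: "cmod (prim (\<lambda>t. - (z ^ Suc n) * y l n t + (- 1) * pred_y (l + z) 0 t) t) \<le> (2 * cmod z ^ n) * exp (k * t)"
      if t: "t \<in> {0..pi}" for t
    proof -
      have "cmod (prim (\<lambda>t. - (z ^ Suc n) * y l n t + (- 1) * pred_y (l + z) 0 t) t)
          = cmod z ^ Suc n * cmod (prim (y l n) t)"
        using prim_cmult[of "- (z ^ Suc n)" "y l n" t] by (simp add: norm_mult norm_power)
      also have "\<dots> \<le> cmod z ^ n * (2 / k * exp (k * t))"
        using z k by (intro mult_mono prim_exp_bound[OF AI_y t] y_bound) (auto intro!: power_decreasing mult_left_le_one_le)
      also have "\<dots> \<le> cmod z ^ n * (2 / 1 * exp (k * t))"
        using k by (intro mult_left_mono mult_right_mono divide_left_mono) auto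
      finally show ?thesis by simp
    qed
    have i: "AI (\<lambda>t. - (z ^ Suc n) * y l n t + (- 1) * pred_y (l + z) 0 t)"
      by (intro AI_add AI_cmult AI_y AI_pred_y)
    show "cmod (?S n pi - y (l + z) 0 pi) \<le> E * cmod z ^ n"
      using cauchy_bound(1)[OF bounded_measurable_w i c _ k' G, of pi] k by (simp add: E_def mult_ac)
    show "cmod (?S' n pi - y' (l + z) 0 pi) \<le> E * cmod z ^ n"
      using cauchy_bound(2)[OF bounded_measurable_w i c _ k' G, of pi] k by (simp add: E_def mult_ac)
  qed
  have g: "(\<lambda>n. E * cmod z ^ n) \<longlonglongrightarrow> 0"
    using tendsto_mult_right_zero[OF LIMSEQ_power_zero[of "cmod z"]] z by simp
  have l1: "(\<lambda>n. ?S n pi) \<longlonglongrightarrow> y (l + z) 0 pi"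
    by (rule LIM_zero_cancel, rule Lim_null_comparison[OF always_eventually g]) (use err in auto)
  have l2: "(\<lambda>n. ?S' n pi) \<longlonglongrightarrow> y' (l + z) 0 pi"
    by (rule LIM_zero_cancel, rule Lim_null_comparison[OF always_eventually g]) (use err in auto)
  have "(\<lambda>n. \<Sum>k\<le>n. Delta_coeff l k * z ^ k) = (\<lambda>n. ?S' n pi + b * ?S n pi)"
    by (simp add: Delta_coeff_def sum.distrib[symmetric] sum_distrib_left algebra_simps)
  moreover have "(\<lambda>n. ?S' n pi + b * ?S n pi) \<longlonglongrightarrow> Delta (l + z)"
    unfolding Delta_def Delta_coeff_def by (intro tendsto_intros l1 l2)
  ultimately show ?thesis by (simp add: sums_def_le)
qed

lemma holomorphic_Delta: "Delta holomorphic_on S"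
proof -
  have "Delta holomorphic_on ball l 1" for l
  proof (rule power_series_holomorphic)
    fix z assume "z \<in> ball l 1"
    then show "(\<lambda>n. Delta_coeff l n * (z - l) ^ n) sums Delta z"
      using Delta_sums[of "z - l" l] by (simp add: dist_norm norm_minus_commute)
  qed
  then have "Delta field_differentiable (at l within S)" for l
    by (meson centre_in_ball field_differentiable_at_within holomorphic_on_imp_differentiable_at open_ball zero_less_one)
  then show ?thesis by (simp add: holomorphic_on_def)
qed

end

section \<open>Completeness of the function spaces\<close>

lemma square_integrable_subtract_cancel:
  assumes "square_integrable (\<lambda>t. g t - h t)" "square_integrable h"
  shows "square_integrable g"
  using square_integrable_add[OF assms] by simp

lemma L2pi_series_AE_summable:
  assumes f: "\<And>k. square_integrable (f k)" and s: "summable (\<lambda>k. norm (abs_L2pi (f k)))"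
  shows "AE t in Mpi. summable (\<lambda>k. cmod (f k t))"
proof -
  have m: "(\<lambda>t. ennreal (cmod (f k t))) \<in> borel_measurable Mpi" for k
    using square_integrable_measurable[OF f] by measurable
  have "(\<integral>\<^sup>+t. (\<Sum>k. ennreal (cmod (f k t))) \<partial>Mpi) = (\<Sum>k. \<integral>\<^sup>+t. ennreal (cmod (f k t)) \<partial>Mpi)"
    by (rule nn_integral_suminf[OF m])
  also have "\<dots> = (\<Sum>k. ennreal (LINT t|Mpi. cmod (f k t)))"
    by (intro suminf_cong nn_integral_eq_integral)
       (use square_integrable_imp_integrable[OF f] in auto)
  also have "\<dots> \<le> (\<Sum>k. ennreal (sqrt pi * norm (abs_L2pi (f k))))"
    by (intro suminf_le ennreal_leI LINT_cmod_le_norm f) auto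
  also have "\<dots> < \<infinity>"
    using summable_mult[OF s, of "sqrt pi"] by (subst suminf_ennreal2) auto
  finally have "AE t in Mpi. (\<Sum>k. ennreal (cmod (f k t))) \<noteq> \<infinity>"
    using m by (intro nn_integral_noteq_infinite borel_measurable_suminf) auto
  then show ?thesis
    by eventually_elim (rule summable_suminf_not_top, auto)
qed

text \<open>The Riesz--Fischer argument: a rapidly converging subsequence converges almost everywhere, and
  by Fatou's lemma the pointwise limit is the limit in norm.\<close>

instance L2pi :: complete_space
proof
  fix X :: "nat \<Rightarrow> L2pi" assume X: "Cauchy X"
  have "\<forall>k. \<exists>N. \<forall>m\<ge>N. \<forall>n\<ge>N. norm (X m - X n) < (1/2) ^ k"
    using X[unfolded Cauchy_iff] by simp
  then obtain N where N: "\<And>k m n. m \<ge> N k \<Longrightarrow> n \<ge> N k \<Longrightarrow> norm (X m - X n) < (1/2) ^ k" by metis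
  define r where "r k = (\<Sum>i\<le>k. N i) + k" for k
  have rN: "N k \<le> r k" "N k \<le> r (Suc k)" and rk: "k \<le> r k" for k
    using member_le_sum[of k "{..k}" N] by (auto simp: r_def)
  define h where "h k = rep_L2pi (X (r k))" for k
  have h: "square_integrable (h k)" and ah: "abs_L2pi (h k) = X (r k)" for k
    by (simp_all add: h_def square_integrable_rep abs_rep_L2pi)
  have hm: "h k \<in> borel_measurable Mpi" for k by (rule square_integrable_measurable[OF h])
  have sd: "square_integrable (\<lambda>t. h j t - h k t)" for j k by (rule square_integrable_diff[OF h h])
  have nd: "(LINT t|Mpi. (cmod (h j t - h k t))\<^sup>2) = (norm (X (r j) - X (r k)))\<^sup>2" for j k
    using norm_abs_L2pi[OF sd] abs_L2pi_diff[OF h h] by (simp add: ah)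
  have "norm (abs_L2pi (\<lambda>t. h (Suc k) t - h k t)) \<le> (1/2) ^ k" for k
    using N[OF rN(2) rN(1), of k] abs_L2pi_diff[OF h h, of "Suc k" k] by (simp add: ah)
  then have "summable (\<lambda>k. norm (abs_L2pi (\<lambda>t. h (Suc k) t - h k t)))"
    by (intro summable_comparison_test'[OF summable_geometric[of "1/2::real"]]) auto
  from L2pi_series_AE_summable[OF sd this]
  have AEs: "AE t in Mpi. summable (\<lambda>k. cmod (h (Suc k) t - h k t))" .
  define g where "g t = lim (\<lambda>k. h k t)" for t
  have AEc: "AE t in Mpi. (\<lambda>k. h k t) \<longlonglongrightarrow> g t"
    using AEs
  proof eventually_elim
    fix t assume "summable (\<lambda>k. cmod (h (Suc k) t - h k t))"
    then have "summable (\<lambda>k. h (Suc k) t - h k t)" by (rule summable_norm_cancel)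
    then have "(\<lambda>n. (\<Sum>k<n. h (Suc k) t - h k t) + h 0 t) \<longlonglongrightarrow> (\<Sum>k. h (Suc k) t - h k t) + h 0 t"
      by (intro tendsto_add tendsto_const summable_LIMSEQ)
    then have "convergent (\<lambda>k. h k t)"
      using sum_lessThan_telescope[of "\<lambda>k. h k t"] by (auto simp: convergent_def)
    then show "(\<lambda>k. h k t) \<longlonglongrightarrow> g t" unfolding g_def by (simp add: convergent_LIMSEQ_iff)
  qed
  have gm: "g \<in> borel_measurable Mpi"
    unfolding g_def[abs_def] by (rule borel_measurable_lim_metric[OF hm])
  have fatou: "(\<integral>\<^sup>+t. ennreal ((cmod (g t - h j t))\<^sup>2) \<partial>Mpi) \<le> ennreal (e\<^sup>2)"
    if e: "\<And>k. k \<ge> j \<Longrightarrow> norm (X (r k) - X (r j)) \<le> e" "0 \<le> e" for j e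
  proof -
    have "AE t in Mpi. ennreal ((cmod (g t - h j t))\<^sup>2) = liminf (\<lambda>k. ennreal ((cmod (h k t - h j t))\<^sup>2))"
      using AEc
    proof eventually_elim
      fix t assume "(\<lambda>k. h k t) \<longlonglongrightarrow> g t"
      then have "(\<lambda>k. ennreal ((cmod (h k t - h j t))\<^sup>2)) \<longlonglongrightarrow> ennreal ((cmod (g t - h j t))\<^sup>2)"
        by (intro tendsto_ennrealI tendsto_intros)
      then show "ennreal ((cmod (g t - h j t))\<^sup>2) = liminf (\<lambda>k. ennreal ((cmod (h k t - h j t))\<^sup>2))"
        by (intro lim_imp_Liminf[symmetric]) auto
    qed
    then have "(\<integral>\<^sup>+t. ennreal ((cmod (g t - h j t))\<^sup>2) \<partial>Mpi)
        = (\<integral>\<^sup>+t. liminf (\<lambda>k. ennreal ((cmod (h k t - h j t))\<^sup>2)) \<partial>Mpi)"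
      by (rule nn_integral_cong_AE)
    also have "\<dots> \<le> liminf (\<lambda>k. \<integral>\<^sup>+t. ennreal ((cmod (h k t - h j t))\<^sup>2) \<partial>Mpi)"
      by (rule nn_integral_liminf) (use hm in measurable)
    also have "\<dots> \<le> ennreal (e\<^sup>2)"
    proof (rule Liminf_le)
      have "(\<integral>\<^sup>+t. ennreal ((cmod (h k t - h j t))\<^sup>2) \<partial>Mpi) \<le> ennreal (e\<^sup>2)" if "k \<ge> j" for k
      proof -
        have "(\<integral>\<^sup>+t. ennreal ((cmod (h k t - h j t))\<^sup>2) \<partial>Mpi) = ennreal (LINT t|Mpi. (cmod (h k t - h j t))\<^sup>2)"
          by (rule nn_integral_eq_integral) (use sd[of k j] in \<open>auto simp: square_integrable_def\<close>)
        also have "\<dots> \<le> ennreal (e\<^sup>2)"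
          unfolding nd using e that by (intro ennreal_leI power_mono) auto
        finally show ?thesis .
      qed
      then show "\<forall>\<^sub>F k in sequentially. (\<integral>\<^sup>+t. ennreal ((cmod (h k t - h j t))\<^sup>2) \<partial>Mpi) \<le> ennreal (e\<^sup>2)"
        unfolding eventually_sequentially by blast
    qed auto
    finally show ?thesis .
  qed
  have close: "square_integrable (\<lambda>t. g t - h j t) \<and> norm (abs_L2pi (\<lambda>t. g t - h j t)) \<le> e"
    if e: "\<And>k. k \<ge> j \<Longrightarrow> norm (X (r k) - X (r j)) \<le> e" "0 \<le> e" for j e
  proof -
    have dm: "(\<lambda>t. g t - h j t) \<in> borel_measurable Mpi" using gm hm by measurable
    have i: "integrable Mpi (\<lambda>t. (cmod (g t - h j t))\<^sup>2)"
    proof (rule integrableI_bounded)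
      have "(\<integral>\<^sup>+t. ennreal (norm ((cmod (g t - h j t))\<^sup>2)) \<partial>Mpi) \<le> ennreal (e\<^sup>2)"
        using fatou[OF e] by simp
      then show "(\<integral>\<^sup>+t. ennreal (norm ((cmod (g t - h j t))\<^sup>2)) \<partial>Mpi) < \<infinity>"
        using ennreal_less_top le_less_trans by (metis infinity_ennreal_def)
    qed (use dm in measurable)
    have sq: "square_integrable (\<lambda>t. g t - h j t)" using i dm by (simp add: square_integrable_def)
    have "ennreal (LINT t|Mpi. (cmod (g t - h j t))\<^sup>2) = (\<integral>\<^sup>+t. ennreal ((cmod (g t - h j t))\<^sup>2) \<partial>Mpi)"
      by (rule nn_integral_eq_integral[symmetric, OF i]) auto
    then have "ennreal ((norm (abs_L2pi (\<lambda>t. g t - h j t)))\<^sup>2) \<le> ennreal (e\<^sup>2)"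
      using fatou[OF e] by (simp add: norm_abs_L2pi[OF sq])
    then have "(norm (abs_L2pi (\<lambda>t. g t - h j t)))\<^sup>2 \<le> e\<^sup>2" by simp
    then show ?thesis using e(2) sq by (simp add: power2_le_iff_abs_le)
  qed
  have "square_integrable (\<lambda>t. g t - h 0 t)"
  proof -
    have "norm (X (r k) - X (r 0)) \<le> 1" for k
      using N[of 0 "r k" "r 0"] member_le_sum[of 0 "{..k}" N] by (fastforce simp: r_def)
    then show ?thesis using close[of 0 1] by simp
  qed
  then have g: "square_integrable g" by (rule square_integrable_subtract_cancel[OF _ h])
  have "X \<longlonglongrightarrow> abs_L2pi g"
  proof (rule LIMSEQ_I)
    fix e :: real assume e: "0 < e"
    then obtain M where M: "\<And>m n. m \<ge> M \<Longrightarrow> n \<ge> M \<Longrightarrow> norm (X m - X n) < e / 2"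
      using X[unfolded Cauchy_iff] by (meson half_gt_zero)
    have "norm (X n - abs_L2pi g) < e" if "n \<ge> M" for n
    proof -
      have "norm (abs_L2pi (\<lambda>t. g t - h M t)) \<le> e / 2"
        using close[of M "e / 2"] M rk e by (meson dual_order.trans half_gt_zero less_imp_le)
      then have "norm (abs_L2pi g - X (r M)) \<le> e / 2"
        using abs_L2pi_diff[OF g h] by (simp add: ah)
      moreover have "norm (X n - X (r M)) < e / 2" using M[OF that rk] .
      ultimately show ?thesis
        using norm_triangle_ineq[of "X n - X (r M)" "X (r M) - abs_L2pi g"] by (simp add: norm_minus_commute)
    qed
    then show "\<exists>no. \<forall>n\<ge>no. norm (X n - abs_L2pi g) < e" by blast
  qed
  then show "convergent X" by (auto simp: convergent_def)
qed

instance L2pi :: banach ..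

lemma H1_to_L2_add: "H1_to_L2 (u + v) = H1_to_L2 u + H1_to_L2 v"
  by (rule plus_H1pi.rep_eq)

lemma H1_to_L2_scaleC: "H1_to_L2 (a *\<^sub>C u) = a *\<^sub>C H1_to_L2 u"
  by (rule scaleC_H1pi.rep_eq)

lemma H1_to_L2_scaleR: "H1_to_L2 (a *\<^sub>R u) = a *\<^sub>R H1_to_L2 u"
  unfolding scaleR_scaleC by (rule H1_to_L2_scaleC)

lemma H1_to_L2_diff: "H1_to_L2 (u - v) = H1_to_L2 u - H1_to_L2 v"
  using H1_to_L2_add[of "u - v" v] by simp

lemma H1_deriv_eq: "has_weak_derivative (H1_to_L2 u) g \<Longrightarrow> H1_deriv u = g"
  unfolding H1_deriv_def by (rule weak_derivative_eq)

lemma H1_deriv_add: "H1_deriv (u + v) = H1_deriv u + H1_deriv v"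
  by (rule H1_deriv_eq) (simp add: H1_to_L2_add has_weak_derivative_add H1_deriv)

lemma H1_deriv_scaleC: "H1_deriv (a *\<^sub>C u) = a *\<^sub>C H1_deriv u"
  by (rule H1_deriv_eq) (simp add: H1_to_L2_scaleC has_weak_derivative_scaleC H1_deriv)

lemma H1_deriv_diff: "H1_deriv (u - v) = H1_deriv u - H1_deriv v"
  using H1_deriv_add[of "u - v" v] by simp

lemma norm_H1_sq: "(norm (u :: H1pi))\<^sup>2 = (norm (H1_deriv u))\<^sup>2 + (norm (H1_to_L2 u))\<^sup>2"
  unfolding power2_norm_eq_inner inner_Re_cinner by (simp add: cinner_H1pi_def)

lemma norm_H1_ge: "norm (H1_to_L2 u) \<le> norm u" "norm (H1_deriv u) \<le> norm u"
  by (rule power2_le_imp_le; simp add: norm_H1_sq)+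

lemma norm_H1_le: "norm (u :: H1pi) \<le> norm (H1_deriv u) + norm (H1_to_L2 u)"
  by (rule power2_le_imp_le) (auto simp: norm_H1_sq power2_sum)

text \<open>The derivative is a closed operator.\<close>

lemma has_weak_derivative_LIMSEQ:
  assumes "\<And>n. has_weak_derivative (u n) (g n)" "u \<longlonglongrightarrow> U" "g \<longlonglongrightarrow> G"
  shows "has_weak_derivative U G"
  unfolding has_weak_derivative_def
proof (intro allI impI)
  fix p assume p: "test_function p"
  let ?p = "abs_L2pi (\<lambda>t. complex_of_real (p t))" and ?p' = "abs_L2pi (\<lambda>t. complex_of_real (deriv p t))"
  have "(\<lambda>n. cinner (u n) ?p') \<longlonglongrightarrow> cinner U ?p'"
    by (rule bounded_linear.tendsto[OF bounded_linear_cinner_left assms(2)])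
  moreover have "(\<lambda>n. - cinner (g n) ?p) \<longlonglongrightarrow> - cinner G ?p"
    by (intro tendsto_minus bounded_linear.tendsto[OF bounded_linear_cinner_left assms(3)])
  moreover have "cinner (u n) ?p' = - cinner (g n) ?p" for n
    using assms(1) p unfolding has_weak_derivative_def by blast
  ultimately show "cinner U ?p' = - cinner G ?p" by (auto intro: LIMSEQ_unique)
qed

instance H1pi :: complete_space
proof
  fix X :: "nat \<Rightarrow> H1pi" assume X: "Cauchy X"
  have "Cauchy (\<lambda>n. H1_to_L2 (X n))" "Cauchy (\<lambda>n. H1_deriv (X n))"
    unfolding Cauchy_iff H1_to_L2_diff[symmetric] H1_deriv_diff[symmetric]
    using X[unfolded Cauchy_iff] norm_H1_ge le_less_trans by meson+
  then obtain u g where u: "(\<lambda>n. H1_to_L2 (X n)) \<longlonglongrightarrow> u" and g: "(\<lambda>n. H1_deriv (X n)) \<longlonglongrightarrow> g"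
    by (auto dest!: Cauchy_convergent simp: convergent_def)
  have wd: "has_weak_derivative u g" by (rule has_weak_derivative_LIMSEQ[OF H1_deriv u g])
  define U where "U = L2_to_H1 u"
  have U: "H1_to_L2 U = u" unfolding U_def using wd by (intro L2_to_H1_inverse) auto
  have U': "H1_deriv U = g" by (rule H1_deriv_eq) (simp add: U wd)
  have "(\<lambda>n. norm (H1_deriv (X n) - g) + norm (H1_to_L2 (X n) - u)) \<longlonglongrightarrow> 0 + 0"
    using u g by (intro tendsto_add tendsto_norm_zero LIM_zero)
  then have lim: "(\<lambda>n. norm (H1_deriv (X n) - g) + norm (H1_to_L2 (X n) - u)) \<longlonglongrightarrow> 0" by simp
  have "norm (X n - U) \<le> norm (H1_deriv (X n) - g) + norm (H1_to_L2 (X n) - u)" for n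
    using norm_H1_le[of "X n - U"] by (simp add: H1_deriv_diff H1_to_L2_diff U U')
  then have "(\<lambda>n. X n - U) \<longlonglongrightarrow> 0"
    by (intro Lim_null_comparison[OF always_eventually lim]) auto
  then have "X \<longlonglongrightarrow> U" by (rule LIM_zero_cancel)
  then show "convergent X" by (auto simp: convergent_def)
qed

instance H1pi :: banach ..

lemma bounded_linear_H1_to_L2: "bounded_linear H1_to_L2"
  by (rule bounded_linear_intro[where K = 1])
     (auto simp: H1_to_L2_add H1_to_L2_scaleR norm_H1_ge)

section \<open>The cosine basis\<close>

definition psi_fun :: "nat \<Rightarrow> real \<Rightarrow> complex" where
  "psi_fun n t = complex_of_real (if n = 0 then sqrt (1 / pi) else sqrt (2 / pi) * cos (real n * t))"

definition dpsi_fun :: "nat \<Rightarrow> real \<Rightarrow> complex" where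
  "dpsi_fun n t = complex_of_real (- sqrt (2 / pi) * real n * sin (real n * t))"

lemma psi_fun_deriv: "(psi_fun n has_vector_derivative dpsi_fun n t) (at t within S)"
  unfolding psi_fun_def[abs_def] dpsi_fun_def
  by (intro has_vector_derivative_of_real, cases "n = 0") (auto intro!: derivative_eq_intros)

lemma dpsi_fun_deriv:
  "(dpsi_fun n has_vector_derivative - ((complex_of_real (real n))\<^sup>2 * psi_fun n t)) (at t within S)"
proof -
  have "((\<lambda>t. complex_of_real (- sqrt (2 / pi) * real n * sin (real n * t))) has_vector_derivative
      complex_of_real (- sqrt (2 / pi) * (real n)\<^sup>2 * cos (real n * t))) (at t within S)"
    by (intro has_vector_derivative_of_real) (auto intro!: derivative_eq_intros simp: power2_eq_square)
  then show ?thesis unfolding dpsi_fun_def[abs_def]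
    by (rule has_vector_derivative_eq_rhs) (simp add: psi_fun_def mult_ac)
qed

lemma continuous_psi_fun: "continuous_on S (psi_fun n)" "continuous_on S (dpsi_fun n)"
  unfolding psi_fun_def[abs_def] dpsi_fun_def[abs_def] by (cases "n = 0"; auto intro!: continuous_intros)+

lemma square_integrable_psi_fun: "square_integrable (psi_fun n)" "square_integrable (dpsi_fun n)"
  by (auto intro: square_integrable_continuous continuous_psi_fun)

lemma cnj_psi_fun [simp]: "cnj (psi_fun n t) = psi_fun n t" "cnj (dpsi_fun n t) = dpsi_fun n t"
  by (simp_all only: psi_fun_def dpsi_fun_def complex_cnj_complex_of_real)

lemma dpsi_fun_boundary [simp]: "dpsi_fun n 0 = 0" "dpsi_fun n pi = 0"
  by (simp_all add: dpsi_fun_def)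

lemma H1_psi: "H1_to_L2 (psi n) = abs_L2pi (psi_fun n)" "H1_deriv (psi n) = abs_L2pi (dpsi_fun n)"
proof -
  show 1: "H1_to_L2 (psi n) = abs_L2pi (psi_fun n)"
    by (simp add: H1_to_L2_psi psi_fun_def[abs_def])
  show "H1_deriv (psi n) = abs_L2pi (dpsi_fun n)"
    unfolding H1_deriv_def 1
    by (intro weak_derivative_eq has_weak_derivative_C1[OF psi_fun_deriv] continuous_psi_fun)
qed

lemma H1_obtain:
  obtains U V c where "square_integrable V" "H1_to_L2 u = abs_L2pi U" "H1_deriv u = abs_L2pi V"
    "\<And>t. U t = c + prim V t"
proof -
  obtain V where V: "square_integrable V" "H1_deriv u = abs_L2pi V" by (rule abs_L2pi_cases)
  obtain c where "H1_to_L2 u = abs_L2pi (\<lambda>t. c + prim V t)"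
    using has_weak_derivativeD[OF V(1)] H1_deriv[of u] V(2) by metis
  then show ?thesis using V by (intro that[of V _ c]) auto
qed

text \<open>The cosines satisfy \<open>\<psi>'' = - n\<^sup>2 \<psi>\<close> and \<open>\<psi>'(0) = \<psi>'(\<pi>) = 0\<close>, so the
  derivative term of the inner product is \<open>n\<^sup>2\<close> times the \<open>L\<^sup>2\<close> inner product. Orthogonality and
  totality in \<open>H\<^sup>1\<close> thus reduce to \<open>L\<^sup>2\<close>.\<close>

lemma cinner_H1_psi: "cinner u (psi n) = complex_of_real (mu n) * cinner (H1_to_L2 u) (H1_to_L2 (psi n))"
proof -
  obtain U V c where V: "square_integrable V" and u: "H1_to_L2 u = abs_L2pi U" "H1_deriv u = abs_L2pi V"
    and U: "\<And>t. U t = c + prim V t" by (rule H1_obtain[of u]) auto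
  have sU: "square_integrable U" using square_integrable_prim[OF V, of c] by (simp add: U[abs_def])
  let ?g = "\<lambda>t. - ((complex_of_real (real n))\<^sup>2 * psi_fun n t)"
  have "prim (\<lambda>s. V s * dpsi_fun n s + U s * ?g s) pi = U pi * dpsi_fun n pi - c * 0"
  proof (rule integration_by_parts_prim[OF square_integrable_AI[OF V]])
    show "AI ?g" by (intro AI_uminus AI_cmult AI_continuous continuous_psi_fun)
    show "dpsi_fun n s = 0 + prim ?g s" if "s \<in> {0..pi}" for s
      using prim_derivative[OF dpsi_fun_deriv that, of n] by simp
  qed (auto simp: U)
  then have "prim (\<lambda>s. V s * dpsi_fun n s + U s * ?g s) pi = 0" by simp
  moreover have "prim (\<lambda>s. V s * dpsi_fun n s + U s * ?g s) pi
      = prim (\<lambda>s. V s * dpsi_fun n s + - ((complex_of_real (real n))\<^sup>2) * (U s * psi_fun n s)) pi"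
    by (rule prim_cong) (simp add: algebra_simps)
  moreover have "\<dots> = prim (\<lambda>s. V s * dpsi_fun n s) pi - (complex_of_real (real n))\<^sup>2 * prim (\<lambda>s. U s * psi_fun n s) pi"
    using square_integrable_mult_AI[OF V square_integrable_psi_fun(2)[of n]]
      square_integrable_mult_AI[OF sU square_integrable_psi_fun(1)[of n]]
    by (subst prim_add) (auto intro: AI_cmult AI_uminus simp: prim_cmult prim_uminus)
  ultimately have "prim (\<lambda>s. V s * dpsi_fun n s) pi = (complex_of_real (real n))\<^sup>2 * prim (\<lambda>s. U s * psi_fun n s) pi"
    by simp
  then show ?thesis
    by (simp add: cinner_H1pi_def u H1_psi cinner_prim V sU square_integrable_psi_fun mu_def algebra_simps)
qed

lemma prim_cos:
  assumes "k \<noteq> 0"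
  shows "prim (\<lambda>t. complex_of_real (cos (of_int k * t))) pi = 0"
proof -
  have "prim (\<lambda>t. complex_of_real (cos (of_int k * t))) pi
      = complex_of_real (sin (of_int k * pi) / of_int k) - complex_of_real (sin (of_int k * 0) / of_int k)"
    by (rule prim_derivative, rule has_vector_derivative_of_real)
       (use assms in \<open>auto intro!: derivative_eq_intros\<close>)
  also have "sin (of_int k * pi) = 0" using sin_zero_iff_int2 by blast
  finally show ?thesis by simp
qed

lemma orthonormal_psi_L2: "orthonormal (\<lambda>n. H1_to_L2 (psi n))"
  unfolding orthonormal_def
proof (intro allI)
  fix m n
  define a where "a n = (if n = 0 then sqrt (1 / pi) else sqrt (2 / pi))" for n :: nat
  have pf: "psi_fun n t = complex_of_real (a n * cos (real n * t))" for n t by (simp add: psi_fun_def a_def)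
  let ?c = "\<lambda>k t. complex_of_real (cos (of_int k * t))"
  have i: "AI (?c k)" for k by (intro AI_continuous continuous_intros)
  have "cinner (H1_to_L2 (psi m)) (H1_to_L2 (psi n)) = prim (\<lambda>t. psi_fun m t * psi_fun n t) pi"
    by (simp add: H1_psi cinner_prim square_integrable_psi_fun)
  also have "\<dots> = prim (\<lambda>t. complex_of_real (a m * a n / 2) * (?c (int m - int n) t + ?c (int m + int n) t)) pi"
  proof (rule prim_cong)
    fix t
    have "cos (real m * t) * cos (real n * t) = (cos (of_int (int m - int n) * t) + cos (of_int (int m + int n) * t)) / 2"
      by (simp add: cos_times_cos left_diff_distrib distrib_right)
    then have eq: "(a m * cos (real m * t)) * (a n * cos (real n * t))
        = a m * a n / 2 * (cos (of_int (int m - int n) * t) + cos (of_int (int m + int n) * t))"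
      by (simp add: mult_ac)
    show "psi_fun m t * psi_fun n t
        = complex_of_real (a m * a n / 2) * (?c (int m - int n) t + ?c (int m + int n) t)"
      unfolding pf of_real_mult[symmetric] of_real_add[symmetric] of_real_eq_iff by (rule eq)
  qed
  also have "\<dots> = complex_of_real (a m * a n / 2) * (prim (?c (int m - int n)) pi + prim (?c (int m + int n)) pi)"
    unfolding prim_cmult by (subst prim_add[OF i i]) auto
  finally have *: "cinner (H1_to_L2 (psi m)) (H1_to_L2 (psi n))
      = complex_of_real (a m * a n / 2) * (prim (?c (int m - int n)) pi + prim (?c (int m + int n)) pi)" .
  have c0: "prim (?c 0) pi = complex_of_real pi" by (simp add: prim_def scaleR_conv_of_real)
  show "cinner (H1_to_L2 (psi m)) (H1_to_L2 (psi n)) = (if m = n then 1 else 0)"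
  proof (cases "m = n")
    case True
    show ?thesis
    proof (cases "n = 0")
      case True
      with \<open>m = n\<close> have "cinner (H1_to_L2 (psi m)) (H1_to_L2 (psi n)) = complex_of_real (a 0 * a 0 / 2 * (pi + pi))"
        unfolding * using c0 by simp
      also have "a 0 * a 0 / 2 * (pi + pi) = 1" by (simp add: a_def)
      finally show ?thesis using \<open>m = n\<close> by simp
    next
      case False
      with \<open>m = n\<close> have "cinner (H1_to_L2 (psi m)) (H1_to_L2 (psi n)) = complex_of_real (a n * a n / 2 * pi)"
        unfolding * using c0 prim_cos[of "int n + int n"] by simp
      also have "a n * a n / 2 * pi = 1" using False by (simp add: a_def)
      finally show ?thesis using \<open>m = n\<close> by simp
    qed
  next
    case False
    then show ?thesis unfolding * using prim_cos[of "int m - int n"] prim_cos[of "int m + int n"] by simp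
  qed
qed

text \<open>A function orthogonal to all cosines is orthogonal to all polynomials in \<open>cos t\<close>, hence, by
  the theorem of Weierstrass applied to \<open>p \<circ> arccos\<close>, to every test function \<open>p\<close>.\<close>

lemma psi_total_L2:
  assumes u: "\<And>n. cinner u (H1_to_L2 (psi n)) = 0"
  shows "u = 0"
proof -
  obtain h where h: "square_integrable h" "u = abs_L2pi h" by (rule abs_L2pi_cases)
  have hAI: "AI h" by (rule square_integrable_AI[OF h(1)])
  have hc: "AI (\<lambda>t. h t * complex_of_real (c t))" if "continuous_on {0..pi} c" for c
    using AI_continuous_mult[OF _ hAI, of "\<lambda>t. complex_of_real (c t)"] that
    by (simp add: mult.commute continuous_on_of_real)
  have cos0: "prim (\<lambda>t. h t * complex_of_real (cos (real n * t))) pi = 0" for n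
  proof -
    define a where "a = (if n = 0 then sqrt (1 / pi) else sqrt (2 / pi))"
    have "psi_fun n t = complex_of_real (a * cos (real n * t))" for t by (simp add: psi_fun_def a_def)
    then have "cinner u (H1_to_L2 (psi n)) = prim (\<lambda>t. complex_of_real a * (h t * complex_of_real (cos (real n * t)))) pi"
      unfolding H1_psi h(2) cinner_prim[OF h(1) square_integrable_psi_fun(1)]
      by (simp add: mult_ac)
    then have "complex_of_real a * prim (\<lambda>t. h t * complex_of_real (cos (real n * t))) pi = 0"
      using u prim_cmult by metis
    then show ?thesis by (simp add: a_def split: if_splits)
  qed
  have 1: "prim (\<lambda>t. h t * complex_of_real (cos t ^ i * cos (real n * t))) pi = 0" for i n
  proof (induction i arbitrary: n)
    case 0
    show ?case using cos0 by simp
  next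
    case (Suc i)
    have A: "AI (\<lambda>t. h t * complex_of_real (cos t ^ i * cos (real n * t)))" for n
      by (intro hc continuous_intros)
    show ?case
    proof (cases n)
      case 0
      then show ?thesis using Suc[of 1] by (simp add: mult_ac)
    next
      case (Suc m)
      have "prim (\<lambda>t. h t * complex_of_real (cos t ^ Suc i * cos (real n * t))) pi
          = prim (\<lambda>t. (1/2) * (h t * complex_of_real (cos t ^ i * cos (real (Suc n) * t))
              + h t * complex_of_real (cos t ^ i * cos (real m * t)))) pi"
      proof (rule prim_cong)
        fix t
        have "cos (real (Suc n) * t) + cos (real m * t) = 2 * cos t * cos (real n * t)"
        proof -
          have "(real (Suc n) * t + real m * t) / 2 = real n * t" "(real (Suc n) * t - real m * t) / 2 = t"
            by (simp_all add: Suc field_simps)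
          then show ?thesis unfolding cos_plus_cos by simp
        qed
        then have "cos t ^ Suc i * cos (real n * t) = (1/2) * (cos t ^ i * cos (real (Suc n) * t) + cos t ^ i * cos (real m * t))"
          by (simp add: distrib_left[symmetric])
        then show "h t * complex_of_real (cos t ^ Suc i * cos (real n * t)) =
            (1/2) * (h t * complex_of_real (cos t ^ i * cos (real (Suc n) * t))
              + h t * complex_of_real (cos t ^ i * cos (real m * t)))"
          by (simp only: of_real_mult of_real_add of_real_divide of_real_1 of_real_numeral) (simp add: algebra_simps)
      qed
      also have "\<dots> = 0"
        unfolding prim_cmult by (subst prim_add[OF A A], simp, simp only: Suc.IH add_0_right mult_zero_right)
      finally show ?thesis .
    qed
  qed
  have 2: "prim (\<lambda>t. h t * complex_of_real (g (cos t))) pi = 0" if gp: "real_polynomial_function g" for g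
  proof -
    obtain a N where g: "g = (\<lambda>x. \<Sum>i\<le>(N::nat). a i * x ^ i)"
      using real_polynomial_function_imp_sum[OF gp] by blast
    have A: "AI (\<lambda>t. h t * complex_of_real (cos t ^ i))" for i by (intro hc continuous_intros)
    have "prim (\<lambda>t. \<Sum>i\<le>n. complex_of_real (a i) * (h t * complex_of_real (cos t ^ i))) pi = 0" for n
    proof (induction n)
      case 0
      show ?case using 1[of 0 0] by (simp add: prim_cmult)
    next
      case (Suc n)
      have S: "AI (\<lambda>t. \<Sum>i\<le>n. complex_of_real (a i) * (h t * complex_of_real (cos t ^ i)))"
        by (intro AI_sum AI_cmult A) auto
      have "prim (\<lambda>t. h t * complex_of_real (cos t ^ Suc n)) pi = 0"
        using 1[of "Suc n" 0] by (simp del: power_Suc of_real_power)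
      then show ?case
        unfolding sum.atMost_Suc using Suc prim_cmult
        by (subst prim_add[OF S AI_cmult[OF A]]) (simp_all del: of_real_power power_Suc)
    qed
    moreover have "(\<lambda>t. h t * complex_of_real (g (cos t)))
        = (\<lambda>t. \<Sum>i\<le>N. complex_of_real (a i) * (h t * complex_of_real (cos t ^ i)))"
      by (simp add: g sum_distrib_left mult_ac)
    ultimately show ?thesis by simp
  qed
  have "AE t in Mpi. h t = 0"
  proof (rule L2_eq_zero_test[OF h(1)])
    fix p assume p: "test_function p"
    have cp: "continuous_on UNIV p" by (rule test_function_deriv(3)[OF p])
    define I where "I = (LINT t|Mpi. h t * complex_of_real (p t))"
    have Ih: "I = prim (\<lambda>t. h t * complex_of_real (p t)) pi"
      unfolding I_def by (intro LINT_Mpi_prim hc continuous_on_subset[OF cp]) auto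
    define B where "B = (LINT t|Mpi. cmod (h t))"
    have "cmod I \<le> e * B" if e: "0 < e" for e
    proof -
      have "continuous_on {-1..1} (\<lambda>x. p (arccos x))"
        by (intro continuous_on_compose2[OF cp] continuous_on_arccos' continuous_intros) auto
      then obtain g where g: "real_polynomial_function g" "\<And>x. x \<in> {-1..1} \<Longrightarrow> \<bar>p (arccos x) - g x\<bar> < e"
        using Stone_Weierstrass_real_polynomial_function[of "{-1..1::real}" "\<lambda>x. p (arccos x)" e] e
        by (metis compact_Icc)
      obtain a N where gs: "g = (\<lambda>x. \<Sum>i\<le>(N::nat). a i * x ^ i)"
        using real_polynomial_function_imp_sum[OF g(1)] by blast
      have cg: "continuous_on S (\<lambda>t. g (cos t))" for S unfolding gs by (intro continuous_intros)
      have cpS: "continuous_on S p" for S by (rule continuous_on_subset[OF cp]) simp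
      have i: "AI (\<lambda>t. h t * complex_of_real (p t - g (cos t)))"
        by (intro hc continuous_intros cpS cg)
      have "I = prim (\<lambda>t. h t * complex_of_real (p t)) pi - prim (\<lambda>t. h t * complex_of_real (g (cos t))) pi"
        by (simp add: Ih 2[OF g(1)])
      also have "\<dots> = prim (\<lambda>t. h t * complex_of_real (p t) - h t * complex_of_real (g (cos t))) pi"
        by (rule prim_diff[symmetric]) (auto intro!: hc cpS cg)
      also have "\<dots> = (LINT t|Mpi. h t * complex_of_real (p t - g (cos t)))"
        unfolding LINT_Mpi_prim[OF i] by (rule prim_cong) (simp add: algebra_simps)
      also have "cmod \<dots> \<le> (LINT t|Mpi. e * cmod (h t))"
      proof (rule Bochner_Integration.integral_norm_bound_integral[OF AI_integrable_Mpi[OF i]])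
        show "integrable Mpi (\<lambda>t. e * cmod (h t))"
          using square_integrable_imp_integrable[OF h(1)] by simp
        fix t assume "t \<in> space Mpi"
        then have t: "t \<in> {0<..<pi}" by simp
        then have "\<bar>p (arccos (cos t)) - g (cos t)\<bar> < e" by (intro g(2)) auto
        then have "\<bar>p t - g (cos t)\<bar> \<le> e" using t by (simp add: arccos_cos)
        then have "cmod (h t) * \<bar>p t - g (cos t)\<bar> \<le> cmod (h t) * e" by (intro mult_left_mono) auto
        then show "cmod (h t * complex_of_real (p t - g (cos t))) \<le> e * cmod (h t)"
          unfolding norm_mult norm_of_real by (simp add: mult.commute)
      qed
      finally show ?thesis by (simp add: B_def)
    qed
    note small = this
    have B0: "0 \<le> B" unfolding B_def by (rule integral_nonneg_AE) auto
    have "cmod I \<le> 0"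
    proof (rule field_le_epsilon)
      fix e :: real assume e: "0 < e"
      have "e / (B + 1) * B \<le> e" using e B0 by (simp add: field_simps)
      then show "cmod I \<le> 0 + e" using small[of "e / (B + 1)"] e B0 by auto
    qed
    then show "(LINT t|Mpi. h t * complex_of_real (p t)) = 0" by (simp add: I_def)
  qed
  then have "abs_L2pi h = abs_L2pi (\<lambda>t. 0)"
    by (subst abs_L2pi_eq_iff[OF h(1) square_integrable_zero])
  then show ?thesis by (simp add: h(2) zero_L2pi_def)
qed

lemma orthonormal_basis_psi_L2: "orthonormal_basis (\<lambda>n. H1_to_L2 (psi n))"
  by (rule orthonormal_basisI[OF orthonormal_psi_L2 psi_total_L2])

lemma mu_pos: "0 < mu n"
  by (simp add: mu_def add_nonneg_pos)

lemma orthonormal_basis_psi_H1: "orthonormal_basis (\<lambda>n. psi n /\<^sub>R sqrt (mu n))"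
proof (rule orthonormal_basisI)
  show "orthonormal (\<lambda>n. psi n /\<^sub>R sqrt (mu n))"
    unfolding orthonormal_def
  proof (intro allI)
    fix m n
    have "cinner (psi m /\<^sub>R sqrt (mu m)) (psi n /\<^sub>R sqrt (mu n))
        = complex_of_real (inverse (sqrt (mu m)) * inverse (sqrt (mu n)) * mu n)
          * cinner (H1_to_L2 (psi m)) (H1_to_L2 (psi n))"
      by (simp add: scaleR_scaleC cinner_scaleC_left cinner_scaleC_right cinner_H1_psi H1_to_L2_scaleC)
    also have "\<dots> = (if m = n then 1 else 0)"
      using orthonormal_psi_L2 mu_pos[of n]
      by (auto simp: orthonormal_def of_real_mult[symmetric] of_real_inverse[symmetric] field_simps
          simp del: of_real_mult of_real_inverse)
    finally show "cinner (psi m /\<^sub>R sqrt (mu m)) (psi n /\<^sub>R sqrt (mu n)) = (if m = n then 1 else 0)" .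
  qed
  fix u assume u: "\<And>n. cinner u (psi n /\<^sub>R sqrt (mu n)) = 0"
  have "cinner (H1_to_L2 u) (H1_to_L2 (psi n)) = 0" for n
    using u[of n] mu_pos[of n] by (simp add: scaleR_scaleC cinner_scaleC_right cinner_H1_psi)
  then have "H1_to_L2 u = 0" by (rule psi_total_L2)
  then show "u = 0" by (metis H1_to_L2_inject zero_H1pi.rep_eq)
qed

lemma norm_psi: "norm (H1_to_L2 (psi n)) = 1" "norm (psi n) = sqrt (mu n)"
proof -
  have 1: "cinner (H1_to_L2 (psi n)) (H1_to_L2 (psi n)) = 1"
    using orthonormal_psi_L2 by (simp add: orthonormal_def)
  have "complex_of_real ((norm (H1_to_L2 (psi n)))\<^sup>2) = complex_of_real 1"
    unfolding cinner_self[symmetric] 1 by simp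
  then have "(norm (H1_to_L2 (psi n)))\<^sup>2 = 1" unfolding of_real_eq_iff .
  then show "norm (H1_to_L2 (psi n)) = 1" by (metis norm_ge_zero real_sqrt_one real_sqrt_unique)
  have "complex_of_real ((norm (psi n))\<^sup>2) = complex_of_real (mu n)"
    unfolding cinner_self[symmetric] cinner_H1_psi 1 by simp
  then have "(norm (psi n))\<^sup>2 = mu n" unfolding of_real_eq_iff .
  then show "norm (psi n) = sqrt (mu n)" by (metis norm_ge_zero real_sqrt_unique)
qed

section \<open>The Sturm--Liouville operator\<close>

lemma prim_abs_L2pi_cong:
  assumes f: "square_integrable f" and g: "square_integrable g" and eq: "abs_L2pi f = abs_L2pi g" and t: "t \<in> {0..pi}"
  shows "prim f t = prim g t"
proof -
  have "cmod (prim (\<lambda>s. f s - g s) t) \<le> sqrt pi * norm (abs_L2pi (\<lambda>s. f s - g s))"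
    by (rule prim_cmod_le_norm[OF square_integrable_diff[OF f g] t])
  also have "abs_L2pi (\<lambda>s. f s - g s) = 0" using eq abs_L2pi_diff[OF f g] by simp
  finally show ?thesis
    using prim_diff[OF square_integrable_AI[OF f] square_integrable_AI[OF g] t] by simp
qed

lemma square_integrable_cnj: "square_integrable f \<Longrightarrow> square_integrable (\<lambda>t. cnj (f t))"
  unfolding square_integrable_def using cnj_measurable by auto

lemma square_integrable_bounded_mult:
  assumes h: "h \<in> borel_measurable Mpi" "\<And>t. cmod (h t) \<le> B" and f: "square_integrable f"
  shows "square_integrable (\<lambda>t. h t * f t)"
  unfolding square_integrable_def
proof
  show m: "(\<lambda>t. h t * f t) \<in> borel_measurable Mpi"
    using h(1) square_integrable_measurable[OF f] by measurable
  show "integrable Mpi (\<lambda>t. (cmod (h t * f t))\<^sup>2)"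
  proof (rule Bochner_Integration.integrable_bound)
    show "integrable Mpi (\<lambda>t. B\<^sup>2 * (cmod (f t))\<^sup>2)" using f by (simp add: square_integrable_def)
    have "(cmod (h t * f t))\<^sup>2 \<le> B\<^sup>2 * (cmod (f t))\<^sup>2" for t
      unfolding norm_mult power_mult_distrib using h(2)[of t] by (intro mult_right_mono power_mono) auto
    then show "AE t in Mpi. norm ((cmod (h t * f t))\<^sup>2) \<le> norm (B\<^sup>2 * (cmod (f t))\<^sup>2)" by simp
  qed (use m in measurable)
qed

lemma has_weak_derivative_range: "u \<in> range H1_to_L2 \<Longrightarrow> has_weak_derivative u (weak_derivative u)"
  using H1_deriv by (auto simp: H1_deriv_def)

lemma has_weak_derivative_rangeI: "has_weak_derivative u g \<Longrightarrow> u \<in> range H1_to_L2"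
  using L2_to_H1_inverse[of u] by (metis (mono_tags, lifting) mem_Collect_eq rangeI)

lemma has_weak_derivative_continuous_prim:
  assumes g: "square_integrable g" and U: "\<And>t. t \<in> {0..pi} \<Longrightarrow> U t = c + prim g t"
  shows "has_weak_derivative (abs_L2pi U) (abs_L2pi g)"
proof -
  have "abs_L2pi (\<lambda>t. c + prim g t) = abs_L2pi U"
    by (rule abs_L2pi_cong(1)[OF square_integrable_prim[OF g]]) (simp add: U)
  then show ?thesis using has_weak_derivative_prim[OF g, of c] by simp
qed

lemma L2_to_H1_weak:
  assumes "has_weak_derivative u g"
  shows "H1_to_L2 (L2_to_H1 u) = u" "H1_deriv (L2_to_H1 u) = g"
proof -
  show 1: "H1_to_L2 (L2_to_H1 u) = u" using assms by (intro L2_to_H1_inverse) auto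
  show "H1_deriv (L2_to_H1 u) = g" by (rule H1_deriv_eq) (simp add: 1 assms)
qed

context sturm_liouville
begin

definition bvp_dom :: "L2pi set" where
  "bvp_dom = {u \<in> H2. point_value (weak_derivative u) 0 = 0 \<and>
     point_value (weak_derivative u) pi + b * point_value u pi = 0}"

definition bvp_op :: "L2pi \<Rightarrow> L2pi" where
  "bvp_op u = - weak_derivative (weak_derivative u) - L2_mult q u"

lemma q_measurable_Mpi: "(\<lambda>t. complex_of_real (q t)) \<in> borel_measurable Mpi"
proof -
  have "q \<in> borel_measurable Mpi"
    by (rule measurable_restrict_mono[OF q_measurable]) auto
  then show ?thesis by measurable
qed

lemma square_integrable_q_mult: "square_integrable f \<Longrightarrow> square_integrable (\<lambda>t. complex_of_real (q t) * f t)"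
  by (rule square_integrable_bounded_mult[OF q_measurable_Mpi, of Q]) (use q_bounded in auto)

lemma square_integrable_w_mult: "square_integrable f \<Longrightarrow> square_integrable (\<lambda>t. w l t * f t)"
  unfolding w_def distrib_right by (intro square_integrable_add square_integrable_q_mult square_integrable_scale)

lemma L2_mult_abs:
  assumes f: "square_integrable f"
  shows "L2_mult q (abs_L2pi f) = abs_L2pi (\<lambda>t. complex_of_real (q t) * f t)"
proof -
  have "AE t in Mpi. rep_L2pi (abs_L2pi f) t = f t"
    using abs_L2pi_eq_iff[OF square_integrable_rep f, of "abs_L2pi f"] by (simp add: abs_rep_L2pi)
  then show ?thesis
    unfolding L2_mult_def abs_L2pi_eq_iff[OF square_integrable_q_mult[OF square_integrable_rep] square_integrable_q_mult[OF f]]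
    by eventually_elim simp
qed

text \<open>Together with its converse \<open>bvp_imp_cauchy\<close>, this identifies solutions of
  \<open>(T - l) u = f\<close> with solutions of the initial value problem that satisfy the right boundary condition.
  Everything that follows about the operator goes through these two lemmas.\<close>

lemma cauchy_imp_bvp:
  assumes f: "square_integrable f" and s: "cauchy (w l) f c U V" and bc: "V pi + b * U pi = 0"
  shows "abs_L2pi U \<in> bvp_dom" "bvp_op (abs_L2pi U) - l *\<^sub>C abs_L2pi U = abs_L2pi f"
proof -
  have co: "continuous_on {0..pi} U" "continuous_on {0..pi} V" using s by (auto simp: cauchy_def)
  note sq = square_integrable_continuous[OF co(1)] square_integrable_continuous[OF co(2)]
  let ?g = "\<lambda>s. - (w l s * U s + f s)"
  have sg: "square_integrable ?g"
    by (intro square_integrable_uminus square_integrable_add square_integrable_w_mult sq f)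
  have 1: "has_weak_derivative (abs_L2pi U) (abs_L2pi V)"
    by (rule has_weak_derivative_continuous_prim[OF sq(2)]) (use s in \<open>auto simp: cauchy_def\<close>)
  have 2: "has_weak_derivative (abs_L2pi V) (abs_L2pi ?g)"
  proof (rule has_weak_derivative_continuous_prim[OF sg])
    show "V t = 0 + prim ?g t" if "t \<in> {0..pi}" for t
      using s that by (subst prim_uminus) (simp add: cauchy_def)
  qed
  have wd: "weak_derivative (abs_L2pi U) = abs_L2pi V" "weak_derivative (abs_L2pi V) = abs_L2pi ?g"
    by (rule weak_derivative_eq[OF 1], rule weak_derivative_eq[OF 2])
  show "abs_L2pi U \<in> bvp_dom"
    using has_weak_derivative_rangeI[OF 1] has_weak_derivative_rangeI[OF 2] bc cauchy_initial(2)[OF s]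
    by (simp add: bvp_dom_def H2_def wd point_value_eq[OF co(1)] point_value_eq[OF co(2)])
  show "bvp_op (abs_L2pi U) - l *\<^sub>C abs_L2pi U = abs_L2pi f"
    by (simp add: bvp_op_def wd L2_mult_abs abs_L2pi_uminus abs_L2pi_scaleC abs_L2pi_diff sq sg
        square_integrable_uminus square_integrable_q_mult square_integrable_scale square_integrable_diff
        square_integrable_add square_integrable_w_mult f)
       (simp add: w_def algebra_simps)
qed

lemma bvp_imp_cauchy:
  assumes f: "square_integrable f" and u: "u \<in> bvp_dom" and eq: "bvp_op u - l *\<^sub>C u = abs_L2pi f"
  obtains U V c where "cauchy (w l) f c U V" "u = abs_L2pi U" "V pi + b * U pi = 0"
proof -
  have r: "u \<in> range H1_to_L2" "weak_derivative u \<in> range H1_to_L2" using u by (auto simp: bvp_dom_def H2_def)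
  obtain W where W: "square_integrable W" "weak_derivative (weak_derivative u) = abs_L2pi W" by (rule abs_L2pi_cases)
  obtain c1 where c1: "weak_derivative u = abs_L2pi (\<lambda>t. c1 + prim W t)"
    using has_weak_derivativeD[OF W(1)] has_weak_derivative_range[OF r(2)] W(2) by metis
  define V where "V t = c1 + prim W t" for t
  have cV: "continuous_on {0..pi} V"
    unfolding V_def[abs_def] by (intro continuous_intros continuous_prim square_integrable_AI W)
  note sV = square_integrable_continuous[OF cV]
  have wV: "weak_derivative u = abs_L2pi V" using c1 by (simp add: V_def[abs_def])
  obtain c where c: "u = abs_L2pi (\<lambda>t. c + prim V t)"
    using has_weak_derivativeD[OF sV] has_weak_derivative_range[OF r(1)] wV by metis
  define U where "U t = c + prim V t" for t
  have cU: "continuous_on {0..pi} U"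
    unfolding U_def[abs_def] by (intro continuous_intros continuous_prim square_integrable_AI sV)
  note sU = square_integrable_continuous[OF cU]
  have uU: "u = abs_L2pi U" using c by (simp add: U_def[abs_def])
  have c10: "c1 = 0"
    using u point_value_eq[OF cV, of 0] by (simp add: bvp_dom_def wV V_def)
  have bc: "V pi + b * U pi = 0"
  proof -
    have "point_value u pi = U pi" using point_value_eq[OF cU, of pi] by (simp add: uU)
    then show ?thesis using u point_value_eq[OF cV, of pi] by (simp add: bvp_dom_def wV)
  qed
  let ?g = "\<lambda>s. - (w l s * U s + f s)"
  have sg: "square_integrable ?g"
    by (intro square_integrable_uminus square_integrable_add square_integrable_w_mult sU f)
  have "abs_L2pi W = - (abs_L2pi f + l *\<^sub>C abs_L2pi U + L2_mult q (abs_L2pi U))"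
    using eq[symmetric] unfolding bvp_op_def W(2) uU[symmetric] by simp
  also have "\<dots> = abs_L2pi ?g"
  proof -
    have "?g = (\<lambda>t. - (f t + l * U t + complex_of_real (q t) * U t))"
      by (rule ext) (simp add: w_def algebra_simps)
    then show ?thesis
      by (simp add: L2_mult_abs abs_L2pi_uminus abs_L2pi_scaleC abs_L2pi_add sU f
          square_integrable_q_mult square_integrable_scale square_integrable_add)
  qed
  finally have "prim W t = prim ?g t" if "t \<in> {0..pi}" for t
    by (intro prim_abs_L2pi_cong[OF W(1) sg _ that])
  note Wg = this
  have "V t = - prim (\<lambda>s. w l s * U s + f s) t" if "t \<in> {0..pi}" for t
    by (simp only: V_def c10 add_0_left Wg[OF that] prim_uminus)
  then have "cauchy (w l) f c U V"
    unfolding cauchy_def using cU cV by (simp add: U_def)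
  then show ?thesis using uU bc by (rule that)
qed

text \<open>Linearity is inherited from the initial value problem at \<open>l = 0\<close>.\<close>

lemma bvp_linear:
  assumes u: "u \<in> bvp_dom" and v: "v \<in> bvp_dom"
  shows "u + a *\<^sub>C v \<in> bvp_dom" "bvp_op (u + a *\<^sub>C v) = bvp_op u + a *\<^sub>C bvp_op v"
proof -
  obtain f g where f: "square_integrable f" "bvp_op u - 0 *\<^sub>C u = abs_L2pi f"
    and g: "square_integrable g" "bvp_op v - 0 *\<^sub>C v = abs_L2pi g"
    by (meson abs_L2pi_cases)
  obtain U V c where U: "cauchy (w 0) f c U V" "u = abs_L2pi U" "V pi + b * U pi = 0"
    by (rule bvp_imp_cauchy[OF f(1) u f(2)])
  obtain X Y c' where X: "cauchy (w 0) g c' X Y" "v = abs_L2pi X" "Y pi + b * X pi = 0"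
    by (rule bvp_imp_cauchy[OF g(1) v g(2)])
  note s = cauchy_combine[OF bounded_measurable_w square_integrable_AI[OF f(1)] square_integrable_AI[OF g(1)] U(1) X(1), of a]
  have "V pi + a * Y pi + b * (U pi + a * X pi) = (V pi + b * U pi) + a * (Y pi + b * X pi)"
    by (simp add: algebra_simps)
  then have bc: "V pi + a * Y pi + b * (U pi + a * X pi) = 0" using U(3) X(3) by simp
  have sq: "square_integrable U" "square_integrable X"
    using U(1) X(1) by (auto simp: cauchy_def intro: square_integrable_continuous)
  have e: "abs_L2pi (\<lambda>t. U t + a * X t) = u + a *\<^sub>C v"
    using sq by (simp add: U(2) X(2) abs_L2pi_scaleC abs_L2pi_add square_integrable_scale)
  have "square_integrable (\<lambda>t. f t + a * g t)" by (intro square_integrable_add square_integrable_scale f g)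
  from cauchy_imp_bvp[OF this s bc] show "u + a *\<^sub>C v \<in> bvp_dom" "bvp_op (u + a *\<^sub>C v) = bvp_op u + a *\<^sub>C bvp_op v"
    using f g by (simp_all add: e complex_vector.scale_zero_left abs_L2pi_scaleC abs_L2pi_add square_integrable_scale)
qed

lemma zero_in_bvp_dom: "0 \<in> bvp_dom" "bvp_op 0 = 0"
proof -
  have "cauchy (w 0) (\<lambda>_. 0) 0 (\<lambda>_. 0) (\<lambda>_. 0)" by (simp add: cauchy_def prim_def)
  from cauchy_imp_bvp[OF square_integrable_zero this]
  have "abs_L2pi (\<lambda>_. 0) \<in> bvp_dom" "bvp_op (abs_L2pi (\<lambda>_. 0)) = abs_L2pi (\<lambda>_. 0)"
    by (simp_all add: complex_vector.scale_zero_left)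
  then show "0 \<in> bvp_dom" "bvp_op 0 = 0" by (simp_all add: zero_L2pi_def)
qed

definition root_fun :: "complex \<Rightarrow> nat \<Rightarrow> L2pi" where
  "root_fun l k = abs_L2pi (y l k)"

lemma square_integrable_y: "square_integrable (y l k)" "square_integrable (y' l k)" "square_integrable (pred_y l k)"
  by (auto intro: square_integrable_continuous continuous_y continuous_pred_y)

lemma root_fun_nonzero: "root_fun l 0 \<noteq> 0"
proof
  assume "root_fun l 0 = 0"
  then have "abs_L2pi (y l 0) = abs_L2pi (\<lambda>_. 0)" by (simp add: root_fun_def zero_L2pi_def)
  from continuous_abs_L2pi_eqD[OF continuous_y(1) continuous_on_const this, of 0]
  show False using cauchy_initial(1)[OF cauchy_y[of l 0]] by simp
qed

lemma homogeneous_solution: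
  assumes "cauchy (w l) (\<lambda>_. 0) c U V" "t \<in> {0..pi}"
  shows "U t = c * y l 0 t" "V t = c * y' l 0 t"
proof -
  have "cauchy (w l) (\<lambda>t. 0 + c * pred_y l 0 t) (0 + c * 1) (\<lambda>t. 0 + c * y l 0 t) (\<lambda>t. 0 + c * y' l 0 t)"
    by (rule cauchy_combine[OF bounded_measurable_w, where V = "\<lambda>_. 0"])
       (use cauchy_y[of l 0] in \<open>auto simp: cauchy_def prim_def intro: AI_continuous\<close>)
  then have s: "cauchy (w l) (\<lambda>_. 0) c (\<lambda>t. c * y l 0 t) (\<lambda>t. c * y' l 0 t)" by simp
  show "U t = c * y l 0 t" "V t = c * y' l 0 t"
    using cauchy_unique[OF bounded_measurable_w _ assms(1) s assms(2)] by (auto intro: AI_continuous)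
qed

lemma root_fun_eigenvector:
  assumes "Delta l = 0" shows "eigenvector bvp_dom bvp_op l (root_fun l 0)"
proof -
  have s: "cauchy (w l) (\<lambda>_. 0) 1 (y l 0) (y' l 0)" using cauchy_y[of l 0] by simp
  from cauchy_imp_bvp[OF square_integrable_zero s] assms
  show ?thesis using root_fun_nonzero[of l]
    by (simp add: eigenvector_def root_fun_def Delta_def Delta_coeff_def zero_L2pi_def[symmetric])
qed

text \<open>If \<open>l\<close> is not a zero of the characteristic function, a multiple of the homogeneous solution
  corrects the boundary value of any solution of the inhomogeneous initial value problem.\<close>

lemma resolvent_setI:
  assumes D: "Delta l \<noteq> 0"
  shows "l \<in> resolvent_set bvp_dom bvp_op"
proof -
  have Dd: "y' l 0 pi + b * y l 0 pi = Delta l" by (simp add: Delta_def Delta_coeff_def)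
  have inj: "u = v" if u: "u \<in> bvp_dom" "v \<in> bvp_dom" "bvp_op u - l *\<^sub>C u = bvp_op v - l *\<^sub>C v" for u v
  proof -
    have uv1: "u + (- 1) *\<^sub>C v \<in> bvp_dom" by (rule bvp_linear(1)[OF u(1,2)])
    have "bvp_op (u + (- 1) *\<^sub>C v) - l *\<^sub>C (u + (- 1) *\<^sub>C v) = (bvp_op u - l *\<^sub>C u) - (bvp_op v - l *\<^sub>C v)"
      unfolding bvp_linear(2)[OF u(1,2)] by (simp add: scaleC_one complex_vector.scale_right_diff_distrib)
    then have uv2: "bvp_op (u + (- 1) *\<^sub>C v) - l *\<^sub>C (u + (- 1) *\<^sub>C v) = abs_L2pi (\<lambda>_. 0)"
      unfolding u(3) by (simp add: zero_L2pi_def)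
    obtain U V c where U: "cauchy (w l) (\<lambda>_. 0) c U V" "u + (- 1) *\<^sub>C v = abs_L2pi U" "V pi + b * U pi = 0"
      by (rule bvp_imp_cauchy[OF square_integrable_zero uv1 uv2])
    have "c * (y' l 0 pi + b * y l 0 pi) = 0"
      using U(3) homogeneous_solution[OF U(1), of pi] by (simp add: algebra_simps)
    then have "c = 0" using D Dd by simp
    have "abs_L2pi (\<lambda>_. 0) = abs_L2pi U"
      by (rule abs_L2pi_cong(1)[OF square_integrable_zero])
         (use homogeneous_solution(1)[OF U(1)] \<open>c = 0\<close> in simp)
    then have "u + (- 1) *\<^sub>C v = 0" using U(2) by (simp add: zero_L2pi_def)
    then show "u = v" by (simp add: scaleC_one)
  qed
  define k where "k = max 1 (2 * (Q + cmod l))"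
  define E where "E = exp (k * pi)"
  (* The bound of the resolvent: the first summand controls the particular solution U, the second the
     correction by the multiple a of the homogeneous solution. *)
  define K where "K = sqrt pi * (4 * sqrt pi * E + (4 * sqrt pi * E * (1 + cmod b)) / cmod (Delta l) * (2 * E))"
  have k: "1 \<le> k" "2 * (Q + cmod l) \<le> k" by (auto simp: k_def)
  have E0: "0 < E" by (simp add: E_def)
  have Et: "exp (k * t) \<le> E" if "t \<in> {0..pi}" for t using that k by (simp add: E_def)
  have ex: "\<exists>u\<in>bvp_dom. bvp_op u - l *\<^sub>C u = g \<and> norm u \<le> K * norm g" for g
  proof -
    obtain f where f: "square_integrable f" "g = abs_L2pi f" by (rule abs_L2pi_cases)
    obtain U V where U: "cauchy (w l) f 0 U V" using cauchy_exists[OF bounded_measurable_w square_integrable_AI[OF f(1)]] by blast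
    define a where "a = - (V pi + b * U pi) / Delta l"
    have s0: "cauchy (w l) (\<lambda>t. f t + a * pred_y l 0 t) (0 + a * 1) (\<lambda>t. U t + a * y l 0 t) (\<lambda>t. V t + a * y' l 0 t)"
      by (rule cauchy_combine[OF bounded_measurable_w square_integrable_AI[OF f(1)] AI_pred_y U])
         (use cauchy_y[of l 0] in simp)
    then have s: "cauchy (w l) f a (\<lambda>t. U t + a * y l 0 t) (\<lambda>t. V t + a * y' l 0 t)" by simp
    have "V pi + a * y' l 0 pi + b * (U pi + a * y l 0 pi) = (V pi + b * U pi) + a * (y' l 0 pi + b * y l 0 pi)"
      by (simp add: algebra_simps)
    also have "\<dots> = 0" using D by (simp add: a_def Dd)
    finally have bc: "V pi + a * y' l 0 pi + b * (U pi + a * y l 0 pi) = 0" .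
    define G where "G = sqrt pi * norm g"
    have G0: "0 \<le> G" by (simp add: G_def)
    have pf: "cmod (prim f t) \<le> G * exp (k * t)" if t: "t \<in> {0..pi}" for t
    proof -
      have "cmod (prim f t) \<le> G * 1" using prim_cmod_le_norm[OF f(1) t] by (simp add: G_def f(2))
      also have "\<dots> \<le> G * exp (k * t)" using G0 k t by (intro mult_left_mono) auto
      finally show ?thesis .
    qed
    have bd: "cmod (U t) \<le> 2 * (cmod 0 + G) * exp (k * t)" "cmod (V t) \<le> 2 * (cmod 0 + G) * exp (k * t)"
      if "t \<in> {0..pi}" for t
      by (rule cauchy_bound[OF bounded_measurable_w square_integrable_AI[OF f(1)] U k pf that], assumption)+
    have UV: "cmod (U t) \<le> 2 * G * E" "cmod (V t) \<le> 2 * G * E" if t: "t \<in> {0..pi}" for t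
      using bd[OF t] mult_left_mono[OF Et[OF t], of "2 * G"] G0 by auto
    have "cmod (prim (pred_y l 0) t) \<le> 0 * exp (k * t)" for t by (simp add: prim_def)
    note yb = cauchy_bound(1)[OF bounded_measurable_w AI_pred_y cauchy_y k this]
    have yB: "cmod (y l 0 t) \<le> 2 * E" if t: "t \<in> {0..pi}" for t
      using yb[OF t] Et[OF t] by simp
    have "cmod (V pi + b * U pi) \<le> 2 * G * E + cmod b * (2 * G * E)"
      using norm_triangle_ineq[of "V pi" "b * U pi"] UV[of pi] mult_left_mono[OF UV(1)[of pi], of "cmod b"]
      by (simp add: norm_mult)
    then have "cmod a \<le> (2 * G * E + cmod b * (2 * G * E)) / cmod (Delta l)"
      unfolding a_def norm_divide norm_minus_cancel by (rule divide_right_mono) simp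
    also have "\<dots> = 2 * G * E * (1 + cmod b) / cmod (Delta l)" by (simp add: algebra_simps)
    finally have ab: "cmod a \<le> 2 * G * E * (1 + cmod b) / cmod (Delta l)" .
    have "cmod (U t + a * y l 0 t) \<le> 2 * G * E + 2 * G * E * (1 + cmod b) / cmod (Delta l) * (2 * E)"
      if t: "t \<in> {0..pi}" for t
    proof -
      have "cmod (a * y l 0 t) \<le> 2 * G * E * (1 + cmod b) / cmod (Delta l) * (2 * E)"
        unfolding norm_mult using ab yB[OF t] G0 E0 by (intro mult_mono) auto
      then show ?thesis using norm_triangle_ineq[of "U t" "a * y l 0 t"] UV(1)[OF t] by linarith
    qed
    then have "norm (abs_L2pi (\<lambda>t. U t + a * y l 0 t))
        \<le> sqrt pi * (2 * G * E + 2 * G * E * (1 + cmod b) / cmod (Delta l) * (2 * E))"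
      using s G0 E0 by (intro norm_abs_L2pi_le square_integrable_continuous) (auto simp: cauchy_def)
    also have "\<dots> = sqrt pi * (2 * sqrt pi * E + (2 * sqrt pi * E * (1 + cmod b)) / cmod (Delta l) * (2 * E)) * norm g"
      by (simp add: G_def algebra_simps add_divide_distrib)
    also have "\<dots> \<le> K * norm g"
      unfolding K_def using E0 by (intro mult_right_mono mult_left_mono add_mono divide_right_mono) auto
    finally have "norm (abs_L2pi (\<lambda>t. U t + a * y l 0 t)) \<le> K * norm g" .
    then show ?thesis using cauchy_imp_bvp[OF f(1) s bc] f(2) by blast
  qed
  have "bij_betw (\<lambda>u. bvp_op u - l *\<^sub>C u) bvp_dom UNIV"
  proof (rule bij_betw_imageI)
    show "inj_on (\<lambda>u. bvp_op u - l *\<^sub>C u) bvp_dom" using inj by (intro inj_onI)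
    show "(\<lambda>u. bvp_op u - l *\<^sub>C u) ` bvp_dom = UNIV"
    proof (rule UNIV_eq_I[symmetric])
      fix g show "g \<in> (\<lambda>u. bvp_op u - l *\<^sub>C u) ` bvp_dom" using ex[of g] by blast
    qed
  qed
  moreover have "norm u \<le> K * norm (bvp_op u - l *\<^sub>C u)" if "u \<in> bvp_dom" for u
  proof -
    obtain v where "v \<in> bvp_dom" "bvp_op v - l *\<^sub>C v = bvp_op u - l *\<^sub>C u" "norm v \<le> K * norm (bvp_op u - l *\<^sub>C u)"
      using ex by blast
    then show ?thesis using inj[of v u] that by simp
  qed
  ultimately show ?thesis unfolding resolvent_set_def by blast
qed

lemma spectrum_bvp: "spectrum bvp_dom bvp_op = {l. Delta l = 0}"
proof -
  have "l \<notin> resolvent_set bvp_dom bvp_op" if "Delta l = 0" for l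
  proof
    assume "l \<in> resolvent_set bvp_dom bvp_op"
    then have "inj_on (\<lambda>u. bvp_op u - l *\<^sub>C u) bvp_dom"
      by (simp add: resolvent_set_def bij_betw_def)
    moreover have "root_fun l 0 \<in> bvp_dom" "bvp_op (root_fun l 0) - l *\<^sub>C root_fun l 0 = bvp_op 0 - l *\<^sub>C 0"
      using root_fun_eigenvector[OF that] by (auto simp: eigenvector_def zero_in_bvp_dom complex_vector.scale_zero_right)
    ultimately have "root_fun l 0 = 0" using zero_in_bvp_dom(1) by (meson inj_onD)
    then show False using root_fun_nonzero by simp
  qed
  then show ?thesis using resolvent_setI by (auto simp: spectrum_def)
qed

section \<open>Root spaces\<close>

text \<open>The order of vanishing of \<open>Delta\<close> at \<open>l\<close>. The least element is meaningful because \<open>Delta\<close> does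
  not vanish identically, which only the asymptotics will show; until then this is a hypothesis.\<close>

definition ord :: "complex \<Rightarrow> nat" where
  "ord l = (LEAST k. Delta_coeff l k \<noteq> 0)"

lemma Delta_coeff_below_ord: "k < ord l \<Longrightarrow> Delta_coeff l k = 0"
  unfolding ord_def using not_less_Least by blast

lemma ord_pos: "Delta l = 0 \<Longrightarrow> Delta_coeff l k \<noteq> 0 \<Longrightarrow> 0 < ord l"
  unfolding ord_def Delta_def by (metis (mono_tags, lifting) LeastI gr0I)

lemma Delta_coeff_ord: "Delta_coeff l k \<noteq> 0 \<Longrightarrow> Delta_coeff l (ord l) \<noteq> 0"
  unfolding ord_def by (rule LeastI)

text \<open>Below the order of the zero, the chain members satisfy the right boundary condition, so they form a
  Jordan chain of the operator.\<close>

lemma root_fun_chain: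
  assumes "k < ord l"
  shows "root_fun l k \<in> bvp_dom" "bvp_op (root_fun l k) - l *\<^sub>C root_fun l k = (if k = 0 then 0 else root_fun l (k - 1))"
proof -
  have "y' l k pi + b * y l k pi = 0" using Delta_coeff_below_ord[OF assms] by (simp add: Delta_coeff_def)
  note c = cauchy_imp_bvp[OF square_integrable_y(3) cauchy_y this]
  show "root_fun l k \<in> bvp_dom" using c(1) by (simp add: root_fun_def)
  show "bvp_op (root_fun l k) - l *\<^sub>C root_fun l k = (if k = 0 then 0 else root_fun l (k - 1))"
    using c(2) by (cases k) (auto simp: root_fun_def zero_L2pi_def)
qed

lemma ker_power_linear:
  assumes "u \<in> ker_power bvp_dom bvp_op l k" "v \<in> ker_power bvp_dom bvp_op l k"
  shows "u + a *\<^sub>C v \<in> ker_power bvp_dom bvp_op l k"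
  using assms
proof (induction k arbitrary: u v)
  case 0
  then show ?case by (simp add: complex_vector.scale_zero_right)
next
  case (Suc k)
  have "bvp_op (u + a *\<^sub>C v) - l *\<^sub>C (u + a *\<^sub>C v) = (bvp_op u - l *\<^sub>C u) + a *\<^sub>C (bvp_op v - l *\<^sub>C v)"
    using Suc.prems bvp_linear(2)[of u v a]
    by (simp add: scaleC_add_right complex_vector.scale_right_diff_distrib scaleC_scaleC mult.commute)
  then show ?case using Suc bvp_linear(1)[of u v a] by simp
qed

lemma zero_in_ker_power: "0 \<in> ker_power bvp_dom bvp_op l k"
  by (induction k) (auto simp: zero_in_bvp_dom complex_vector.scale_zero_right)

lemma ker_power_subspace: "complex_vector.subspace (ker_power bvp_dom bvp_op l k)"
  unfolding complex_vector.subspace_def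
  using ker_power_linear[of _ l k _ 1] ker_power_linear[OF zero_in_ker_power, of _ l k] zero_in_ker_power
  by (auto simp: scaleC_one)

lemma root_fun_in_ker_power: "k < ord l \<Longrightarrow> k < n \<Longrightarrow> root_fun l k \<in> ker_power bvp_dom bvp_op l n"
proof (induction n arbitrary: k)
  case (Suc n)
  then show ?case using root_fun_chain[of k l] Suc.IH[of "k - 1"] by (auto simp: zero_in_ker_power)
qed simp

lemma cspan_image_lessThan:
  assumes "x \<in> cspan (f ` {..<n::nat})"
  shows "\<exists>a. x = (\<Sum>i<n. a i *\<^sub>C f i)"
  using assms
proof (induction rule: complex_vector.span_induct_alt)
  case base
  show ?case by (rule exI[of _ "\<lambda>_. 0"]) (simp add: complex_vector.scale_zero_left)
next
  case (step c x y)
  then obtain j a where j: "j < n" "x = f j" and a: "y = (\<Sum>i<n. a i *\<^sub>C f i)" by auto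
  have "(a i + (if i = j then c else 0)) *\<^sub>C f i = a i *\<^sub>C f i + (if i = j then c *\<^sub>C f i else 0)" for i
    by (simp add: scaleC_add_left)
  then have "(\<Sum>i<n. (a i + (if i = j then c else 0)) *\<^sub>C f i) = (\<Sum>i<n. a i *\<^sub>C f i) + (\<Sum>i<n. if i = j then c *\<^sub>C f i else 0)"
    by (simp only: sum.distrib)
  then show ?case using j a by (intro exI[of _ "\<lambda>i. a i + (if i = j then c else 0)"]) (simp add: add.commute)
qed

lemma cauchy_chain_sum:
  "cauchy (w l) (\<lambda>t. \<Sum>i<n. a i * y l i t) 0 (\<lambda>t. \<Sum>i<n. a i * y l (Suc i) t) (\<lambda>t. \<Sum>i<n. a i * y' l (Suc i) t)"
proof (induction n)
  case 0
  show ?case by (simp add: cauchy_def prim_def)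
next
  case (Suc n)
  have i: "AI (\<lambda>t. \<Sum>i<n. a i * y l i t)" by (intro AI_sum AI_cmult AI_y) auto
  have "cauchy (w l) (y l n) 0 (y l (Suc n)) (y' l (Suc n))" using cauchy_y[of l "Suc n"] by simp
  from cauchy_combine[OF bounded_measurable_w i AI_y Suc this, of "a n"] show ?case by simp
qed

lemma abs_L2pi_sum_y:
  "finite A \<Longrightarrow> abs_L2pi (\<lambda>t. \<Sum>i\<in>A. a i * y l (g i) t) = (\<Sum>i\<in>A. a i *\<^sub>C root_fun l (g i))
     \<and> square_integrable (\<lambda>t. \<Sum>i\<in>A. a i * y l (g i) t)"
proof (induction A rule: finite_induct)
  case empty
  show ?case by (simp add: zero_L2pi_def square_integrable_zero)
next
  case (insert x A)
  then show ?case
    by (simp add: abs_L2pi_add[symmetric] abs_L2pi_scaleC[symmetric] square_integrable_scale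
        square_integrable_y square_integrable_add root_fun_def)
qed

text \<open>Solving \<open>(T - l) u = g\<close> for \<open>g\<close> in the span of the chain shifts the chain by one; the
  boundary condition stops this at the order of the zero of the characteristic function.\<close>

lemma ker_power_eq_span:
  assumes nz: "Delta_coeff l (ord l) \<noteq> 0" and D: "Delta l = 0"
  shows "ker_power bvp_dom bvp_op l k = cspan (root_fun l ` {..<min k (ord l)})"
proof
  show "cspan (root_fun l ` {..<min k (ord l)}) \<subseteq> ker_power bvp_dom bvp_op l k"
    by (rule complex_vector.span_minimal[OF _ ker_power_subspace]) (auto intro: root_fun_in_ker_power)
  show "ker_power bvp_dom bvp_op l k \<subseteq> cspan (root_fun l ` {..<min k (ord l)})"
  proof (induction k)
    case (Suc k)
    show ?case
    proof
      fix u assume u: "u \<in> ker_power bvp_dom bvp_op l (Suc k)"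
      define n where "n = min k (ord l)"
      from u Suc have ud: "u \<in> bvp_dom" and g: "bvp_op u - l *\<^sub>C u \<in> cspan (root_fun l ` {..<n})" by (auto simp: n_def)
      from cspan_image_lessThan[OF g] obtain a where a: "bvp_op u - l *\<^sub>C u = (\<Sum>i<n. a i *\<^sub>C root_fun l i)" by blast
      let ?f = "\<lambda>t. \<Sum>i<n. a i * y l i t"
      have f: "square_integrable ?f" and fa: "bvp_op u - l *\<^sub>C u = abs_L2pi ?f"
        using abs_L2pi_sum_y[of "{..<n}" a l "\<lambda>i. i"] a by auto
      obtain U V c where U: "cauchy (w l) ?f c U V" "u = abs_L2pi U" "V pi + b * U pi = 0"
        by (rule bvp_imp_cauchy[OF f ud fa])
      let ?X = "\<lambda>t. \<Sum>i<n. a i * y l (Suc i) t" and ?Y = "\<lambda>t. \<Sum>i<n. a i * y' l (Suc i) t"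
      note AIf = square_integrable_AI[OF f]
      have "cauchy (w l) (\<lambda>t. ?f t + (- 1) * ?f t) (c + (- 1) * 0) (\<lambda>t. U t + (- 1) * ?X t) (\<lambda>t. V t + (- 1) * ?Y t)"
        by (rule cauchy_combine[OF bounded_measurable_w AIf AIf U(1) cauchy_chain_sum])
      then have h: "cauchy (w l) (\<lambda>_. 0) c (\<lambda>t. U t - ?X t) (\<lambda>t. V t - ?Y t)" by simp
      have UX: "U t = ?X t + c * y l 0 t" "V t = ?Y t + c * y' l 0 t" if "t \<in> {0..pi}" for t
        using homogeneous_solution[OF h that] by (simp_all add: algebra_simps)
      have "(\<Sum>i<n. a i * Delta_coeff l (Suc i)) + c * Delta_coeff l 0 = V pi + b * U pi"
        using UX[of pi] by (simp add: Delta_coeff_def sum_distrib_left sum.distrib algebra_simps)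
      then have bc: "(\<Sum>i<n. a i * Delta_coeff l (Suc i)) = 0" using U(3) D by (simp add: Delta_def)
      (* The boundary condition kills the coefficient that would shift past the end of the chain. *)
      have top: "a i = 0" if "i < n" "Suc i \<ge> ord l" for i
      proof -
        have io: "Suc i = ord l" "n = Suc i" using that by (auto simp: n_def)
        have "(\<Sum>j<n. a j * Delta_coeff l (Suc j)) = a i * Delta_coeff l (Suc i)"
        proof -
          have "Delta_coeff l (Suc j) = 0" if "j < i" for j using Delta_coeff_below_ord[of "Suc j" l] io(1) that by simp
          then show ?thesis unfolding io(2) by simp
        qed
        then show ?thesis using bc nz io by simp
      qed
      have "abs_L2pi (\<lambda>t. ?X t + c * y l 0 t) = u"
        unfolding U(2)
        using abs_L2pi_sum_y[of "{..<n}" a l Suc] by (intro abs_L2pi_cong(1)) (auto simp: UX intro!: square_integrable_add square_integrable_scale square_integrable_y)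
      moreover have "abs_L2pi (\<lambda>t. ?X t + c * y l 0 t) = (\<Sum>i<n. a i *\<^sub>C root_fun l (Suc i)) + c *\<^sub>C root_fun l 0"
        using abs_L2pi_sum_y[of "{..<n}" a l Suc]
        by (simp add: abs_L2pi_add[symmetric] square_integrable_scale square_integrable_y root_fun_def abs_L2pi_scaleC)
      moreover have "a i *\<^sub>C root_fun l (Suc i) \<in> cspan (root_fun l ` {..<min (Suc k) (ord l)})" if "i < n" for i
      proof (cases "Suc i < ord l")
        case True
        then show ?thesis using that
          by (intro complex_vector.span_scale complex_vector.span_base) (auto simp: n_def)
      qed (use top[OF that] in \<open>auto simp: complex_vector.scale_zero_left complex_vector.span_zero\<close>)
      moreover have "0 < ord l" using ord_pos[OF D nz] .
      ultimately show "u \<in> cspan (root_fun l ` {..<min (Suc k) (ord l)})"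
        by (metis (no_types, lifting) complex_vector.span_add complex_vector.span_sum complex_vector.span_scale
            complex_vector.span_base imageI lessThan_iff min_less_iff_conj zero_less_Suc)
    qed
  qed simp
qed

lemma root_space_eq_span:
  assumes nz: "Delta_coeff l (ord l) \<noteq> 0" and D: "Delta l = 0"
  shows "root_space bvp_dom bvp_op l = cspan (root_fun l ` {..<ord l})"
proof -
  have "ker_power bvp_dom bvp_op l k \<subseteq> ker_power bvp_dom bvp_op l (ord l)" for k
    unfolding ker_power_eq_span[OF assms] by (intro complex_vector.span_mono) auto
  then have "root_space bvp_dom bvp_op l = ker_power bvp_dom bvp_op l (ord l)"
    by (auto simp: root_space_def)
  then show ?thesis by (simp add: ker_power_eq_span[OF assms])
qed

section \<open>The bilinear pairing of root functions\<close>

text \<open>Integrating \<open>U1 U2''\<close> and \<open>U1'' U2\<close> by parts produces the same integral of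
  \<open>U1' U2'\<close>. There is no complex conjugation, so a complex spectral parameter or boundary coefficient
  does no harm.\<close>

lemma Lagrange_identity:
  assumes f: "AI f1" "AI f2" and s1: "cauchy (w l1) f1 c1 U1 V1" and s2: "cauchy (w l2) f2 c2 U2 V2"
  shows "(l1 - l2) * prim (\<lambda>t. U1 t * U2 t) pi + prim (\<lambda>t. f1 t * U2 t) pi - prim (\<lambda>t. U1 t * f2 t) pi
    = U1 pi * V2 pi - V1 pi * U2 pi"
proof -
  have co: "continuous_on {0..pi} U1" "continuous_on {0..pi} V1" "continuous_on {0..pi} U2" "continuous_on {0..pi} V2"
    using s1 s2 by (auto simp: cauchy_def)
  have "prim (\<lambda>s. V s * Z s + U s * - (w l s * X s + f s)) pi = U pi * Z pi"
    if s: "cauchy (w l') f' c U V" and s': "cauchy (w l) f c' X Z" and f: "AI f" for l' f' c U V l f c' X Z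
  proof -
    have cX: "continuous_on {0..pi} X" "continuous_on {0..pi} V" using s s' by (auto simp: cauchy_def)
    have "prim (\<lambda>s. V s * Z s + U s * - (w l s * X s + f s)) pi = U pi * Z pi - c * 0"
    proof (rule integration_by_parts_prim[OF AI_continuous[OF cX(2)]])
      show "AI (\<lambda>s. - (w l s * X s + f s))"
        by (intro AI_uminus AI_add bounded_measurable_mult_AI[OF bounded_measurable_w] cX f)
      show "Z t = 0 + prim (\<lambda>s. - (w l s * X s + f s)) t" if "t \<in> {0..pi}" for t
        using s' that by (subst prim_uminus) (simp add: cauchy_def)
    qed (use s in \<open>auto simp: cauchy_def\<close>)
    then show ?thesis by simp
  qed
  note ibp = this
  let ?F = "\<lambda>s. V1 s * V2 s + U1 s * - (w l2 s * U2 s + f2 s)"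
  let ?G = "\<lambda>s. V2 s * V1 s + U2 s * - (w l1 s * U1 s + f1 s)"
  have iF: "AI ?F" and iG: "AI ?G"
    by (intro AI_add AI_continuous_mult AI_uminus AI_continuous bounded_measurable_mult_AI[OF bounded_measurable_w] co f)+
  have i: "AI (\<lambda>t. U1 t * U2 t)" "AI (\<lambda>t. f1 t * U2 t)" "AI (\<lambda>t. U1 t * f2 t)"
    using AI_continuous_mult[OF co(3) f(1)] AI_continuous_mult[OF co(1) f(2)]
      AI_continuous_mult[OF co(1) AI_continuous[OF co(3)]] by (simp_all add: mult.commute)
  have "U1 pi * V2 pi - V1 pi * U2 pi = prim ?F pi - prim ?G pi"
    using ibp[OF s1 s2 f(2)] ibp[OF s2 s1 f(1)] by (simp add: mult.commute)
  also have "\<dots> = prim (\<lambda>s. ?F s - ?G s) pi" by (rule prim_diff[symmetric, OF iF iG]) simp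
  also have "\<dots> = prim (\<lambda>s. ((l1 - l2) * (U1 s * U2 s) + f1 s * U2 s) - U1 s * f2 s) pi"
    by (rule prim_cong) (simp add: w_def algebra_simps)
  also have "\<dots> = (l1 - l2) * prim (\<lambda>t. U1 t * U2 t) pi + prim (\<lambda>t. f1 t * U2 t) pi - prim (\<lambda>t. U1 t * f2 t) pi"
    by (subst prim_diff, intro AI_add AI_cmult i, intro i, simp,
        subst prim_add, intro AI_cmult i, intro i, simp, simp add: prim_cmult)
  finally show ?thesis by simp
qed

text \<open>Bilinear, not sesquilinear: the operator is symmetric for this form, whatever the value of \<open>b\<close>.\<close>

definition pairing :: "(real \<Rightarrow> complex) \<Rightarrow> (real \<Rightarrow> complex) \<Rightarrow> complex" where
  "pairing f g = prim (\<lambda>t. f t * g t) pi"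

lemma pairing_zero [simp]: "pairing (\<lambda>_. 0) g = 0" "pairing f (\<lambda>_. 0) = 0"
  by (simp_all add: pairing_def prim_def)

lemma pairing_chain:
  assumes "i < ord l1" "j < ord l2"
  shows "(l1 - l2) * pairing (y l1 i) (y l2 j) + pairing (pred_y l1 i) (y l2 j) - pairing (y l1 i) (pred_y l2 j) = 0"
proof -
  have "y' l1 i pi = - b * y l1 i pi" "y' l2 j pi = - b * y l2 j pi"
    using Delta_coeff_below_ord[OF assms(1)] Delta_coeff_below_ord[OF assms(2)] by (simp_all add: Delta_coeff_def add_eq_0_iff2)
  then show ?thesis
    using Lagrange_identity[OF AI_pred_y AI_pred_y cauchy_y cauchy_y, of l1 l2 i j] by (simp add: pairing_def)
qed

text \<open>The factor \<open>l1 - l2\<close> expresses a pairing through two pairings with smaller \<open>i + j\<close>.\<close>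

lemma pairing_different:
  assumes "l1 \<noteq> l2" "i < ord l1" "j < ord l2"
  shows "pairing (y l1 i) (y l2 j) = 0"
  using assms(2,3)
proof (induction "i + j" arbitrary: i j rule: less_induct)
  case less
  have "pairing (pred_y l1 i) (y l2 j) = 0"
    using less by (cases i) auto
  moreover have "pairing (y l1 i) (pred_y l2 j) = 0"
    using less by (cases j) auto
  ultimately show ?case using pairing_chain[OF less.prems] assms(1) by simp
qed

text \<open>Within one root space the Gram matrix is of Hankel type.\<close>

lemma pairing_shift:
  assumes "i + j < ord l"
  shows "pairing (y l i) (y l j) = pairing (y l 0) (y l (i + j))"
  using assms
proof (induction i arbitrary: j)
  case (Suc i)
  have "pairing (y l i) (y l (Suc j)) = pairing (y l (Suc i)) (y l j)"
    using pairing_chain[of "Suc i" l "Suc j" l] Suc.prems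
    by (cases "Suc j < ord l") (auto simp: algebra_simps)
  then show ?case using Suc.IH[of "Suc j"] Suc.prems by simp
qed simp

lemma pairing_below:
  assumes "Suc (i + j) < ord l"
  shows "pairing (y l i) (y l j) = 0"
  using pairing_shift[of i j l] pairing_chain[of 0 l "Suc (i + j)" l] assms by simp

text \<open>The antidiagonal value is \<open>- Delta_coeff l (ord l) * y l 0 pi\<close>. Here \<open>y l 0 pi\<close> cannot vanish:
  then \<open>y' l 0 pi\<close> would vanish as well, by the boundary condition, and backward uniqueness would give \<open>y l 0 0 = 0\<close>.\<close>

lemma pairing_antidiagonal:
  assumes nz: "Delta_coeff l (ord l) \<noteq> 0" and D: "Delta l = 0" and ij: "Suc (i + j) = ord l"
  shows "pairing (y l i) (y l j) \<noteq> 0"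
proof -
  obtain m where m: "ord l = Suc m" using ij by metis
  have bc: "y' l 0 pi = - b * y l 0 pi" using D by (simp add: Delta_def Delta_coeff_def add_eq_0_iff2)
  have "pairing (y l m) (y l 0) = y l (Suc m) pi * y' l 0 pi - y' l (Suc m) pi * y l 0 pi"
    using Lagrange_identity[OF AI_pred_y AI_pred_y cauchy_y cauchy_y, of l l "Suc m" 0]
    by (simp add: pairing_def prim_def)
  also have "\<dots> = - Delta_coeff l (ord l) * y l 0 pi" by (simp add: bc m Delta_coeff_def algebra_simps)
  finally have "pairing (y l m) (y l 0) = - Delta_coeff l (ord l) * y l 0 pi" .
  moreover have "y l 0 pi \<noteq> 0"
  proof
    assume "y l 0 pi = 0"
    then have "(1::complex) = 0"
      using cauchy_backward_unique[OF bounded_measurable_w, of l 1 "y l 0" "y' l 0"] cauchy_y[of l 0] bc by simp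
    then show False by simp
  qed
  moreover have "pairing (y l i) (y l j) = pairing (y l m) (y l 0)"
    using pairing_shift[of i j l] pairing_shift[of m 0 l] ij m by simp
  ultimately show ?thesis using nz by simp
qed

lemma cinner_root_fun_pairing: "cinner (root_fun l i) (abs_L2pi (\<lambda>t. cnj (y l' j t))) = pairing (y l i) (y l' j)"
  unfolding root_fun_def cinner_prim[OF square_integrable_y(1) square_integrable_cnj[OF square_integrable_y(1)]]
  by (simp add: pairing_def)

text \<open>Pair a vanishing combination with the chain member dual to the highest member that occurs
  with a nonzero coefficient.\<close>

lemma root_vectors_omega_independent:
  assumes z: "\<And>n. Delta (lam n) = 0" "\<And>n. Delta_coeff (lam n) (ord (lam n)) \<noteq> 0"
    and k: "\<And>n. k n < ord (lam n)" and inj: "inj (\<lambda>n. (lam n, k n))" and al: "\<And>n. al n \<noteq> 0"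
    and s: "(\<lambda>n. c n *\<^sub>C (al n *\<^sub>C root_fun (lam n) (k n))) sums 0"
  shows "c n = 0"
proof (rule ccontr)
  assume "c n \<noteq> 0"
  define l where "l = lam n"
  have "lam n = l \<and> c n \<noteq> 0" using \<open>c n \<noteq> 0\<close> l_def by blast
  moreover have "\<forall>p. lam p = l \<and> c p \<noteq> 0 \<longrightarrow> k p < ord l" using k by auto
  ultimately obtain p where p0: "lam p = l \<and> c p \<noteq> 0" and mx0: "\<forall>p'. lam p' = l \<and> c p' \<noteq> 0 \<longrightarrow> k p' \<le> k p"
    using ex_has_greatest_nat[of "\<lambda>p. lam p = l \<and> c p \<noteq> 0" n k "ord l"] by blast
  define x where "x = k p"
  have p: "lam p = l" "c p \<noteq> 0" "k p = x" using p0 by (auto simp: x_def)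
  (* The member of index j is dual to the one of index x: smaller indices pair with it to zero, and larger
     ones do not occur. *)
  define j where "j = ord l - 1 - x"
  have xl: "x < ord l" using k[of p] p by simp
  have j: "Suc (x + j) = ord l" "j < ord l" using xl by (auto simp: j_def)
  let ?g = "abs_L2pi (\<lambda>t. cnj (y l j t))"
  have "(\<lambda>n. cinner (c n *\<^sub>C (al n *\<^sub>C root_fun (lam n) (k n))) ?g) sums cinner 0 ?g"
    by (rule bounded_linear.sums[OF bounded_linear_cinner_left s])
  moreover have "cinner (c r *\<^sub>C (al r *\<^sub>C root_fun (lam r) (k r))) ?g
      = (if r = p then c p * al p * pairing (y l x) (y l j) else 0)" for r
  proof -
    have "c r * pairing (y (lam r) (k r)) (y l j) = 0" if "r \<noteq> p"
    proof (cases "lam r = l")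
      case True
      have "k r \<noteq> x" using inj True that p by (auto dest!: injD[of _ r p])
      then consider "k r < x" | "k r > x" by linarith
      then show ?thesis
      proof cases
        case 1
        then show ?thesis using pairing_below[of "k r" j l] True j by simp
      next
        case 2
        then have "c r = 0" using mx0 True p(3) by force
        then show ?thesis by simp
      qed
    qed (use pairing_different[of "lam r" l "k r" j] k[of r] j in auto)
    then show ?thesis using p by (auto simp: cinner_scaleC_left cinner_root_fun_pairing)
  qed
  ultimately have "(\<lambda>r. if r = p then c p * al p * pairing (y l x) (y l j) else 0) sums 0" by simp
  then have "c p * al p * pairing (y l x) (y l j) = 0"
    using sums_single[of p "\<lambda>r. c p * al p * pairing (y l x) (y l j)"] by (auto dest: sums_unique2)
  moreover have "pairing (y l x) (y l j) \<noteq> 0"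
    using pairing_antidiagonal[of l x j] z[of p] p j by simp
  ultimately show False using p al by simp
qed

section \<open>The weak form\<close>

text \<open>Integration by parts turns the weak form into the boundary terms
  \<open>(u'(\<pi>) + b u(\<pi>)) cnj (v(\<pi>)) - u'(0) cnj (v(0))\<close>, once \<open>u\<close> solves the differential equation.
  Conversely, test functions \<open>v\<close> have no boundary values and show that \<open>u\<close> solves the equation; then \<open>v(t) = t\<close>
  and \<open>v(t) = 1\<close> isolate the two boundary conditions.\<close>

lemma weak_form_iff:
  "(\<forall>v. cinner (H1_deriv u) (H1_deriv v) - cinner (L2_mult q (H1_to_L2 u)) (H1_to_L2 v)
        + b * point_value (H1_to_L2 u) pi * cnj (point_value (H1_to_L2 v) pi)
      = l * cinner (H1_to_L2 u) (H1_to_L2 v)) \<longleftrightarrow>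
   H1_to_L2 u \<in> bvp_dom \<and> bvp_op (H1_to_L2 u) = l *\<^sub>C H1_to_L2 u" (is "?L \<longleftrightarrow> ?R")
proof -
  have key: "(cinner (H1_deriv u) (H1_deriv v) - cinner (L2_mult q (H1_to_L2 u)) (H1_to_L2 v)
        + b * point_value (H1_to_L2 u) pi * cnj (point_value (H1_to_L2 v) pi)
      = l * cinner (H1_to_L2 u) (H1_to_L2 v)) \<longleftrightarrow> (V pi + b * U pi) * cnj (X pi) - c1 * cnj a = 0"
    if sV: "continuous_on {0..pi} V" and u: "H1_to_L2 u = abs_L2pi U" "H1_deriv u = abs_L2pi V"
      and U: "\<And>t. t \<in> {0..pi} \<Longrightarrow> U t = c + prim V t" and V: "\<And>t. t \<in> {0..pi} \<Longrightarrow> V t = c1 + prim (\<lambda>s. - (w l s * U s)) t"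
      and Z: "square_integrable Z" and v: "H1_to_L2 v = abs_L2pi X" "H1_deriv v = abs_L2pi Z"
      and X: "\<And>t. X t = a + prim Z t" for U V c c1 v X Z a
  proof -
    have cU: "continuous_on {0..pi} U"
    proof (rule continuous_on_eq)
      show "continuous_on {0..pi} (\<lambda>t. c + prim V t)"
        by (intro continuous_intros continuous_prim AI_continuous sV)
    qed (simp add: U)
    note sU = square_integrable_continuous[OF cU] and sV' = square_integrable_continuous[OF sV]
    have cX: "continuous_on {0..pi} X" unfolding X[abs_def]
      by (intro continuous_intros continuous_prim square_integrable_AI Z)
    note sX = square_integrable_continuous[OF cX]
    have i: "AI (\<lambda>s. - (w l s * U s))" by (intro AI_uminus bounded_measurable_mult_AI[OF bounded_measurable_w] cU)
    have cX': "cnj (X s) = cnj a + prim (\<lambda>t. cnj (Z t)) s" if "s \<in> {0..pi}" for s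
    proof -
      have "prim (\<lambda>t. cnj (Z t)) s = cnj (prim Z s)"
        unfolding prim_def using integral_linear[of Z "{0..s}" cnj] AI_integrable[OF square_integrable_AI[OF Z] that]
        by (simp add: o_def bounded_linear_cnj)
      then show ?thesis by (simp add: X)
    qed
    have E0: "prim (\<lambda>s. - (w l s * U s) * cnj (X s) + V s * cnj (Z s)) pi = V pi * cnj (X pi) - c1 * cnj a"
      by (rule integration_by_parts_prim[OF i AI_cnj[OF square_integrable_AI[OF Z]] _ V cX']) auto
    have E1: "prim (\<lambda>s. - (w l s * U s) * cnj (X s) + V s * cnj (Z s)) pi
      = prim (\<lambda>s. - ((complex_of_real (q s) * U s) * cnj (X s)) + (- l * (U s * cnj (X s)) + V s * cnj (Z s))) pi"
      by (rule prim_cong) (simp add: w_def algebra_simps)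
    also have E2: "\<dots> = - prim (\<lambda>s. (complex_of_real (q s) * U s) * cnj (X s)) pi
        + (- l * prim (\<lambda>s. U s * cnj (X s)) pi + prim (\<lambda>s. V s * cnj (Z s)) pi)"
    proof -
      have I: "AI (\<lambda>s. (complex_of_real (q s) * U s) * cnj (X s))" "AI (\<lambda>s. U s * cnj (X s))" "AI (\<lambda>s. V s * cnj (Z s))"
        by (intro square_integrable_mult_AI square_integrable_q_mult sU sX sV' Z)+
      show ?thesis
        using prim_add[OF AI_uminus[OF I(1)] AI_add[OF AI_cmult[OF I(2), of "- l"] I(3)], of pi]
          prim_add[OF AI_cmult[OF I(2), of "- l"] I(3), of pi]
        unfolding prim_cmult prim_uminus by simp
    qed
    finally have E: "V pi * cnj (X pi) - c1 * cnj a = - prim (\<lambda>s. (complex_of_real (q s) * U s) * cnj (X s)) pi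
        + (- l * prim (\<lambda>s. U s * cnj (X s)) pi + prim (\<lambda>s. V s * cnj (Z s)) pi)"
      unfolding E0 .
    have arith: "S - P + b * x * z = l * R \<longleftrightarrow> (v + b * x) * z - m = 0"
      if "v * z - m = - P + (- l * R + S)" for S P R x z v m
    proof -
      have "(v + b * x) * z - m = (S - P + b * x * z) - l * R" using that by (simp add: algebra_simps)
      then show ?thesis by simp
    qed
    have c: "cinner (H1_deriv u) (H1_deriv v) = prim (\<lambda>s. V s * cnj (Z s)) pi"
      "cinner (L2_mult q (H1_to_L2 u)) (H1_to_L2 v) = prim (\<lambda>s. (complex_of_real (q s) * U s) * cnj (X s)) pi"
      "cinner (H1_to_L2 u) (H1_to_L2 v) = prim (\<lambda>s. U s * cnj (X s)) pi"
      by (simp_all add: u v L2_mult_abs cinner_prim sU sV' sX Z square_integrable_q_mult)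
    have p: "point_value (H1_to_L2 u) pi = U pi" "point_value (H1_to_L2 v) pi = X pi"
      by (simp_all add: u v point_value_eq cU cX)
    show ?thesis unfolding c p by (rule arith[OF E])
  qed
  show ?thesis
  proof
    assume R: ?R
    then have ud: "H1_to_L2 u \<in> bvp_dom" and eq: "bvp_op (H1_to_L2 u) - l *\<^sub>C H1_to_L2 u = abs_L2pi (\<lambda>_. 0)"
      by (auto simp: zero_L2pi_def)
    obtain U V c where U: "cauchy (w l) (\<lambda>_. 0) c U V" "H1_to_L2 u = abs_L2pi U" "V pi + b * U pi = 0"
      by (rule bvp_imp_cauchy[OF square_integrable_zero ud eq])
    have cV: "continuous_on {0..pi} V" using U(1) by (simp add: cauchy_def)
    have "has_weak_derivative (abs_L2pi U) (abs_L2pi V)"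
      by (rule has_weak_derivative_continuous_prim[OF square_integrable_continuous[OF cV]])
         (use U(1) in \<open>auto simp: cauchy_def\<close>)
    then have u': "H1_deriv u = abs_L2pi V" using U(2) by (intro H1_deriv_eq) simp
    show ?L
    proof
      fix v
      obtain X Z a where Z: "square_integrable Z" "H1_to_L2 v = abs_L2pi X" "H1_deriv v = abs_L2pi Z"
        "\<And>t. X t = a + prim Z t" by (rule H1_obtain[of v]) auto
      have V: "V t = 0 + prim (\<lambda>s. - (w l s * U s)) t" if "t \<in> {0..pi}" for t
        using U(1) that by (subst prim_uminus) (simp add: cauchy_def)
      show "cinner (H1_deriv u) (H1_deriv v) - cinner (L2_mult q (H1_to_L2 u)) (H1_to_L2 v)
          + b * point_value (H1_to_L2 u) pi * cnj (point_value (H1_to_L2 v) pi)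
        = l * cinner (H1_to_L2 u) (H1_to_L2 v)"
        by (subst key[OF cV U(2) u' _ V Z]) (use U in \<open>auto simp: cauchy_def\<close>)
    qed
  next
    assume L: ?L
    obtain U V0 c0 where V0: "square_integrable V0" "H1_to_L2 u = abs_L2pi U" "H1_deriv u = abs_L2pi V0"
      "\<And>t. U t = c0 + prim V0 t" by (rule H1_obtain[of u]) auto
    have cU: "continuous_on {0..pi} U" unfolding V0(4)[abs_def]
      by (intro continuous_intros continuous_prim square_integrable_AI V0)
    note sU = square_integrable_continuous[OF cU]
    let ?g = "\<lambda>s. - (w l s * U s)"
    have sg: "square_integrable ?g" by (intro square_integrable_uminus square_integrable_w_mult sU)
    have "has_weak_derivative (H1_deriv u) (abs_L2pi ?g)"
      unfolding has_weak_derivative_def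
    proof (intro allI impI)
      fix p assume p: "test_function p"
      let ?p = "\<lambda>t. complex_of_real (p t)" and ?p' = "\<lambda>t. complex_of_real (deriv p t)"
      note sp = test_function_square_integrable[OF p]
      have cp: "continuous_on {0..pi} ?p"
        by (intro continuous_intros continuous_on_subset[OF test_function_deriv(3)[OF p]]) auto
      have "has_weak_derivative (abs_L2pi ?p) (abs_L2pi ?p')"
      proof (rule has_weak_derivative_C1)
        show "(?p has_vector_derivative ?p' t) (at t)" for t
          using test_function_deriv(1)[OF p] has_real_derivative_iff_has_vector_derivative
          by (intro has_vector_derivative_of_real) auto
      qed (intro continuous_intros test_function_deriv(2)[OF p])
      then have v: "H1_to_L2 (L2_to_H1 (abs_L2pi ?p)) = abs_L2pi ?p" "H1_deriv (L2_to_H1 (abs_L2pi ?p)) = abs_L2pi ?p'"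
        by (rule L2_to_H1_weak)+
      have "p pi = 0" using p by (auto simp: test_function_def)
      then have "cinner (H1_deriv u) (abs_L2pi ?p') = cinner (L2_mult q (H1_to_L2 u) + l *\<^sub>C H1_to_L2 u) (abs_L2pi ?p)"
        using spec[OF L, of "L2_to_H1 (abs_L2pi ?p)"] point_value_eq[OF cp, of pi]
        by (simp add: v cinner_add_left cinner_scaleC_left algebra_simps)
      also have "L2_mult q (H1_to_L2 u) + l *\<^sub>C H1_to_L2 u = - abs_L2pi ?g"
        by (simp add: V0(2) L2_mult_abs sU abs_L2pi_scaleC abs_L2pi_add square_integrable_q_mult square_integrable_scale
            abs_L2pi_uminus sg) (simp add: w_def algebra_simps)
      finally show "cinner (H1_deriv u) (abs_L2pi ?p') = - cinner (abs_L2pi ?g) (abs_L2pi ?p)"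
        by (simp add: cinner_minus_left)
    qed
    then obtain c1 where c1: "H1_deriv u = abs_L2pi (\<lambda>t. c1 + prim ?g t)" by (rule has_weak_derivativeD[OF sg])
    define V where "V t = c1 + prim ?g t" for t
    have cV: "continuous_on {0..pi} V"
      unfolding V_def[abs_def] by (intro continuous_intros continuous_prim square_integrable_AI sg)
    have u': "H1_deriv u = abs_L2pi V" using c1 by (simp add: V_def[abs_def])
    have U: "U t = c0 + prim V t" if "t \<in> {0..pi}" for t
      using prim_abs_L2pi_cong[OF V0(1) square_integrable_continuous[OF cV] _ that] V0(3,4) u' by simp
    have bdry: "(V pi + b * U pi) * cnj (a + prim Z pi) - c1 * cnj a = 0" if Z: "square_integrable Z" for a Z
    proof -
      let ?X = "\<lambda>t. a + prim Z t"
      have wd: "has_weak_derivative (abs_L2pi ?X) (abs_L2pi Z)" by (rule has_weak_derivative_prim[OF Z])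
      then have v: "H1_to_L2 (L2_to_H1 (abs_L2pi ?X)) = abs_L2pi ?X" "H1_deriv (L2_to_H1 (abs_L2pi ?X)) = abs_L2pi Z"
        by (rule L2_to_H1_weak)+
      show ?thesis using key[OF cV V0(2) u' U V_def Z v] spec[OF L, of "L2_to_H1 (abs_L2pi ?X)"] by simp
    qed
    have one: "square_integrable (\<lambda>_. 1)" by (intro square_integrable_continuous continuous_intros)
    have "prim (\<lambda>_. 1) pi = complex_of_real pi" by (simp add: prim_def scaleR_conv_of_real)
    (* v(t) = t, which vanishes at 0 only. *)
    then have bc: "V pi + b * U pi = 0" using bdry[OF one, of 0] by simp
    (* v(t) = 1; c1 is the value u'(0). *)
    then have "c1 = 0" using bdry[OF square_integrable_zero, of 1] by simp
    have "cauchy (w l) (\<lambda>_. 0) c0 U V"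
      unfolding cauchy_def using cU cV U \<open>c1 = 0\<close> by (auto simp: V_def prim_uminus)
    from cauchy_imp_bvp[OF square_integrable_zero this bc] show ?R
      by (simp add: V0(2) zero_L2pi_def[symmetric])
  qed
qed

end

section \<open>Estimates for the complex sine\<close>

lemma norm_sin_cos_le:
  "cmod (sin v) \<le> exp \<bar>Im v\<bar>" "cmod (cos v) \<le> exp \<bar>Im v\<bar>"
proof -
  have e: "cmod (exp (\<i> * v)) \<le> exp \<bar>Im v\<bar>" "cmod (exp (- (\<i> * v))) \<le> exp \<bar>Im v\<bar>" by auto
  have "cmod (sin v) = cmod (exp (\<i> * v) - exp (- (\<i> * v))) / 2"
    by (simp add: sin_exp_eq norm_divide norm_mult)
  also have "\<dots> \<le> (exp \<bar>Im v\<bar> + exp \<bar>Im v\<bar>) / 2"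
    by (intro divide_right_mono order_trans[OF norm_triangle_ineq4] add_mono e) simp
  finally show "cmod (sin v) \<le> exp \<bar>Im v\<bar>" by simp
  have "cmod (cos v) = cmod (exp (\<i> * v) + exp (- (\<i> * v))) / 2"
    by (simp add: cos_exp_eq norm_divide)
  also have "\<dots> \<le> (exp \<bar>Im v\<bar> + exp \<bar>Im v\<bar>) / 2"
    by (intro divide_right_mono order_trans[OF norm_triangle_ineq] add_mono e) simp
  finally show "cmod (cos v) \<le> exp \<bar>Im v\<bar>" by simp
qed

text \<open>The graph of the concave function \<open>sin (\<pi> x)\<close> lies above its chord.\<close>

lemma Jordan_sine_inequality:
  assumes "0 \<le> x" "x \<le> 1/2"
  shows "2 * x \<le> sin (pi * x)"
proof -
  have "convex_on {0..1/2} (\<lambda>x. - sin (pi * x))"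
  proof (rule f''_ge0_imp_convex)
    show "((\<lambda>x. - sin (pi * x)) has_real_derivative - (pi * cos (pi * x))) (at x)" for x
      by (auto intro!: derivative_eq_intros)
    show "((\<lambda>x. - (pi * cos (pi * x))) has_real_derivative pi * pi * sin (pi * x)) (at x)" for x
      by (auto intro!: derivative_eq_intros)
    show "0 \<le> pi * pi * sin (pi * x)" if "x \<in> {0..1/2}" for x
      using that by (intro mult_nonneg_nonneg sin_ge_zero) (auto intro: mult_left_le)
  qed auto
  from convex_onD[OF this, of "2 * x" 0 "1/2"] assms show ?thesis by simp
qed

text \<open>By \<open>|sin (\<pi> v)|\<^sup>2 = sin\<^sup>2 (\<pi> Re v) + sinh\<^sup>2 (\<pi> Im v)\<close>. If \<open>\<pi> |Im v|\<close> is at least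
  one, the hyperbolic sine alone is comparable with the exponential; otherwise the exponential is
  bounded and both summands are bounded below linearly.\<close>

lemma sin_pi_lower_bound:
  assumes "\<bar>Re v\<bar> \<le> 1/2"
  shows "2/5 * min 1 (cmod v) * exp (pi * \<bar>Im v\<bar>) \<le> cmod (sin (v * complex_of_real pi))"
proof -
  define x a where "x = Re v" and "a = pi * \<bar>Im v\<bar>"
  have a0: "0 \<le> a" by (simp add: a_def)
  have sq: "(cmod (sin (v * complex_of_real pi)))\<^sup>2 = (sin (pi * x))\<^sup>2 + ((exp a - exp (- a)) / 2)\<^sup>2"
  proof -
    have "(cmod (sin (v * complex_of_real pi)))\<^sup>2
        = (exp (2 * (Im v * pi)) + inverse (exp (2 * (Im v * pi))) - 2 * cos (2 * (pi * x))) / 4"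
      unfolding norm_sin_squared by (simp add: x_def mult_ac)
    also have "cos (2 * (pi * x)) = 1 - 2 * (sin (pi * x))\<^sup>2" by (rule cos_double_sin)
    also have "exp (2 * (Im v * pi)) + inverse (exp (2 * (Im v * pi))) = (exp a - exp (- a))\<^sup>2 + 2"
    proof -
      have "(exp a - exp (- a))\<^sup>2 + 2 = exp (2 * a) + exp (- (2 * a))"
      proof -
        have "(exp a)\<^sup>2 = exp (2 * a)" "(exp (- a))\<^sup>2 = exp (- (2 * a))" "exp a * exp (- a) = 1"
          using exp_double[of a] exp_double[of "- a"] by (simp_all add: exp_minus)
        then show ?thesis by (simp add: power2_diff)
      qed
      then show ?thesis
        by (cases "Im v \<ge> 0") (auto simp: a_def exp_minus mult_ac)
    qed
    finally show ?thesis by (simp add: power_divide field_simps)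
  qed
  show ?thesis
  proof (cases "a \<ge> 1")
    case True
    have "5 \<le> exp (2 * a)"
    proof -
      have "5 \<le> 1 + 2 * a + (2 * a)\<^sup>2 / 2" using True by (simp add: power2_eq_square) (smt (verit) mult_le_cancel_left1 mult_nonneg_nonneg)
      also have "\<dots> \<le> exp (2 * a)" by (rule exp_lower_Taylor_quadratic) (use a0 in simp)
      finally show ?thesis .
    qed
    then have "5 * exp (- a) \<le> exp (2 * a) * exp (- a)" by (intro mult_right_mono) auto
    also have "\<dots> = exp a" by (simp add: exp_add[symmetric])
    finally have "2/5 * exp a \<le> (exp a - exp (- a)) / 2" by simp
    also have "\<dots> \<le> cmod (sin (v * complex_of_real pi))"
      by (rule power2_le_imp_le) (simp_all add: sq)
    finally have "2/5 * exp a \<le> cmod (sin (v * complex_of_real pi))" .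
    moreover have "2/5 * min 1 (cmod v) * exp a \<le> 2/5 * 1 * exp a" by (intro mult_right_mono mult_left_mono) auto
    ultimately show ?thesis unfolding a_def by linarith
  next
    case False
    have "2 * \<bar>x\<bar> \<le> sin (pi * \<bar>x\<bar>)" by (rule Jordan_sine_inequality) (use assms in \<open>auto simp: x_def\<close>)
    then have "(2 * \<bar>x\<bar>)\<^sup>2 \<le> (sin (pi * \<bar>x\<bar>))\<^sup>2" by (intro power_mono) auto
    moreover have "(sin (pi * \<bar>x\<bar>))\<^sup>2 = (sin (pi * x))\<^sup>2" by (cases "x \<ge> 0") simp_all
    ultimately have 1: "4 * x\<^sup>2 \<le> (sin (pi * x))\<^sup>2" by (simp add: power_mult_distrib)
    have "2 * \<bar>Im v\<bar> \<le> (exp a - exp (- a)) / 2"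
    proof -
      have "2 * \<bar>Im v\<bar> \<le> a" unfolding a_def using pi_gt3 by (intro mult_right_mono) auto
      also have "a \<le> (exp a - exp (- a)) / 2"
      proof -
        have "(\<lambda>s. (exp s - exp (- s)) / 2 - s) 0 \<le> (\<lambda>s. (exp s - exp (- s)) / 2 - s) a"
        proof (rule DERIV_nonneg_imp_nondecreasing[OF a0])
          fix s :: real
          have "((\<lambda>s. (exp s - exp (- s)) / 2 - s) has_real_derivative ((exp s + exp (- s)) / 2 - 1)) (at s)"
            by (auto intro!: derivative_eq_intros)
          moreover have "2 \<le> exp s + exp (- s)"
            using add_mono[OF exp_ge_add_one_self[of s] exp_ge_add_one_self[of "- s"]] by simp
          then have "0 \<le> (exp s + exp (- s)) / 2 - 1" by simp
          ultimately show "\<exists>y. ((\<lambda>s. (exp s - exp (- s)) / 2 - s) has_real_derivative y) (at s) \<and> 0 \<le> y" by blast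
        qed
        then show ?thesis by simp
      qed
      finally show ?thesis .
    qed
    then have "(2 * \<bar>Im v\<bar>)\<^sup>2 \<le> ((exp a - exp (- a)) / 2)\<^sup>2" by (rule power_mono) simp
    moreover have "(2 * cmod v)\<^sup>2 = 4 * x\<^sup>2 + (2 * \<bar>Im v\<bar>)\<^sup>2"
      by (simp add: power_mult_distrib cmod_power2 x_def)
    ultimately have "(2 * cmod v)\<^sup>2 \<le> (cmod (sin (v * complex_of_real pi)))\<^sup>2"
      unfolding sq using 1 by linarith
    then have 2: "2 * cmod v \<le> cmod (sin (v * complex_of_real pi))" by (rule power2_le_imp_le) simp
    have "exp a \<le> exp 1" using False by simp
    also have "\<dots> \<le> 5" using exp_le by simp
    finally have "2/5 * min 1 (cmod v) * exp a \<le> 2/5 * cmod v * 5"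
      by (intro mult_mono) auto
    then show ?thesis using 2 by (simp add: a_def)
  qed
qed

lemma norm_sin_pi_shift:
  "cmod (sin ((z - of_int k) * complex_of_real pi)) = cmod (sin (z * complex_of_real pi))"
proof -
  have s: "sin (of_int k * pi) = 0" using sin_zero_iff_int2 by blast
  then have "(cos (of_int k * pi))\<^sup>2 = 1" using sin_cos_squared_add[of "of_int k * pi"] by simp
  then have "\<bar>cos (of_int k * pi)\<bar> = 1" by (simp add: abs_square_eq_1)
  then have "cmod (cos (complex_of_real (of_int k * pi))) = 1" unfolding cos_of_real norm_of_real .
  moreover have "sin (complex_of_real (of_int k * pi)) = 0" unfolding sin_of_real s by simp
  moreover have "(z - of_int k) * complex_of_real pi = z * complex_of_real pi - complex_of_real (of_int k * pi)"
    by (simp add: algebra_simps)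
  ultimately show ?thesis by (simp add: sin_diff norm_mult)
qed

text \<open>On a circle of half-integer radius the nearest integer is at distance at least one half. The left
  half-plane has to be excluded only to keep the nearest integer nonnegative.\<close>

lemma nearest_int_distance:
  assumes "0 \<le> Re z" "cmod z = real N + 1/2"
  shows "1/2 \<le> cmod (z - of_int (round (Re z)))"
proof -
  let ?k = "round (Re z)"
  have "of_int ?k > Re z - 1/2" by (rule of_int_round_gt)
  then have k0: "0 \<le> ?k" using assms(1) by linarith
  show ?thesis
  proof (cases "?k \<le> int N")
    case True
    then have "real_of_int ?k \<le> real N" by linarith
    then have "1/2 \<le> cmod z - cmod (of_int ?k)" using k0 assms(2) by simp
    then show ?thesis using norm_triangle_ineq2[of z "of_int ?k"] by linarith
  next
    case False
    then have "real N + 1 \<le> real_of_int ?k" by linarith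
    moreover have "Re z \<le> real N + 1/2" using complex_Re_le_cmod[of z] assms(2) by simp
    ultimately have "1/2 \<le> \<bar>Re (z - of_int ?k)\<bar>" by simp
    then show ?thesis using abs_Re_le_cmod[of "z - of_int ?k"] by linarith
  qed
qed

lemma round_Re_bound: "\<bar>Re (z - of_int (round (Re z)))\<bar> \<le> 1/2"
  using of_int_round_abs_le[of "Re z"] by (simp add: abs_minus_commute)

section \<open>Asymptotics of the solutions\<close>

lemma integration_by_parts_smooth:
  assumes u: "AI u" and U: "\<And>s. s \<in> {0..pi} \<Longrightarrow> U s = a + prim u s"
    and G: "\<And>s. s \<in> {0..pi} \<Longrightarrow> (G has_vector_derivative g s) (at s within {0..pi})"
    and g: "continuous_on {0..pi} g" and t: "t \<in> {0..pi}"
  shows "prim (\<lambda>s. u s * G s + U s * g s) t = U t * G t - a * G 0"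
  by (rule integration_by_parts_prim[OF u AI_continuous[OF g] t U])
     (use prim_derivative[OF G] in auto)

abbreviation S_kernel :: "complex \<Rightarrow> real \<Rightarrow> real \<Rightarrow> complex" where
  "S_kernel z t s \<equiv> sin (z * (complex_of_real t - complex_of_real s))"

abbreviation C_kernel :: "complex \<Rightarrow> real \<Rightarrow> real \<Rightarrow> complex" where
  "C_kernel z t s \<equiv> cos (z * (complex_of_real t - complex_of_real s))"

lemma kernel_deriv:
  "(S_kernel z t has_vector_derivative - z * C_kernel z t s) (at s within A)"
  "(C_kernel z t has_vector_derivative z * S_kernel z t s) (at s within A)"
proof -
  have "((\<lambda>x. sin (z * (complex_of_real t - x))) has_field_derivative - z * C_kernel z t s) (at (of_real s))"
    by (auto intro!: derivative_eq_intros)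
  from has_vector_derivative_real_field[OF this]
  show "(S_kernel z t has_vector_derivative - z * C_kernel z t s) (at s within A)" .
  have "((\<lambda>x. cos (z * (complex_of_real t - x))) has_field_derivative z * S_kernel z t s) (at (of_real s))"
    by (auto intro!: derivative_eq_intros)
  from has_vector_derivative_real_field[OF this]
  show "(C_kernel z t has_vector_derivative z * S_kernel z t s) (at s within A)" .
qed

lemma continuous_kernel: "continuous_on A (S_kernel z t)" "continuous_on A (C_kernel z t)"
  by (intro continuous_intros)+

lemma kernel_bound:
  assumes "s \<in> {0..t}"
  shows "cmod (S_kernel z t s) \<le> exp (\<bar>Im z\<bar> * (t - s))" "cmod (C_kernel z t s) \<le> exp (\<bar>Im z\<bar> * (t - s))"
proof -
  have "\<bar>Im (z * (complex_of_real t - complex_of_real s))\<bar> = \<bar>Im z\<bar> * (t - s)"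
    using assms by (simp add: abs_mult)
  then show "cmod (S_kernel z t s) \<le> exp (\<bar>Im z\<bar> * (t - s))" "cmod (C_kernel z t s) \<le> exp (\<bar>Im z\<bar> * (t - s))"
    using norm_sin_cos_le by metis+
qed

context sturm_liouville
begin

lemma bounded_measurable_q: "bounded_measurable (\<lambda>t. complex_of_real (q t)) Q"
  using bounded_measurable_w[of 0] by (simp add: w_def[abs_def])

text \<open>Variation of constants around \<open>cos (z t)\<close>: integrate the equation by parts against the
  fundamental solution \<open>S_kernel z t s / z\<close> of \<open>u'' + z\<^sup>2 u\<close>, and against its derivative with respect to \<open>t\<close>.\<close>

lemma variation_of_constants:
  assumes z: "z \<noteq> 0" and t: "t \<in> {0..pi}"
  shows "y (z\<^sup>2) 0 t = cos (z * complex_of_real t) - prim (\<lambda>s. S_kernel z t s / z * (complex_of_real (q s) * y (z\<^sup>2) 0 s)) t"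
    and "y' (z\<^sup>2) 0 t = - z * sin (z * complex_of_real t) - prim (\<lambda>s. C_kernel z t s * (complex_of_real (q s) * y (z\<^sup>2) 0 s)) t"
proof -
  let ?U = "y (z\<^sup>2) 0" and ?V = "y' (z\<^sup>2) 0"
  have s: "cauchy (w (z\<^sup>2)) (\<lambda>_. 0) 1 ?U ?V" using cauchy_y[of "z\<^sup>2" 0] by simp
  let ?u = "\<lambda>s. - (w (z\<^sup>2) s * ?U s)"
  have U: "?U s = 1 + prim ?V s" if "s \<in> {0..pi}" for s using s that by (simp add: cauchy_def)
  have V: "?V s = 0 + prim ?u s" if "s \<in> {0..pi}" for s
    using s that by (subst prim_uminus) (simp add: cauchy_def)
  have iu: "AI ?u" by (intro AI_uminus bounded_measurable_mult_AI[OF bounded_measurable_w] continuous_y)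
  have iV: "AI ?V" by (intro AI_continuous continuous_y)
  have iq: "AI (\<lambda>s. complex_of_real (q s) * ?U s)" by (rule bounded_measurable_mult_AI[OF bounded_measurable_q continuous_y(1)])
  have "prim (\<lambda>s. ?u s * (S_kernel z t s / z) + ?V s * (- C_kernel z t s)) t = ?V t * (S_kernel z t t / z) - 0 * (S_kernel z t 0 / z)"
  proof (rule integration_by_parts_smooth[OF iu V _ _ t])
    show "((\<lambda>s. S_kernel z t s / z) has_vector_derivative - C_kernel z t s) (at s within {0..pi})" for s
      using has_vector_derivative_divide[OF kernel_deriv(1)[of z t s "{0..pi}"], of z] z by simp
    show "continuous_on {0..pi} (\<lambda>s. - C_kernel z t s)" by (intro continuous_intros)
  qed
  moreover have "prim (\<lambda>s. ?V s * C_kernel z t s + ?U s * (z * S_kernel z t s)) t = ?U t * C_kernel z t t - 1 * C_kernel z t 0"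
    by (rule integration_by_parts_smooth[OF iV _ _ _ t], rule U, assumption, rule kernel_deriv(2), intro continuous_intros)
  moreover have "prim (\<lambda>s. ?u s * (S_kernel z t s / z) + ?V s * (- C_kernel z t s)) t
      + prim (\<lambda>s. ?V s * C_kernel z t s + ?U s * (z * S_kernel z t s)) t
      = prim (\<lambda>s. - (S_kernel z t s / z * (complex_of_real (q s) * ?U s))) t"
  proof (subst prim_add[symmetric, OF _ _ t])
    have "AI (\<lambda>s. S_kernel z t s / z * ?u s)"
      by (intro AI_continuous_mult iu continuous_intros) (use z in auto)
    then have A1: "AI (\<lambda>s. ?u s * (S_kernel z t s / z))" by (subst mult.commute)
    show "AI (\<lambda>s. ?u s * (S_kernel z t s / z) + ?V s * (- C_kernel z t s))"
      by (rule AI_add[OF A1]) (intro AI_continuous continuous_intros continuous_y)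
    show "AI (\<lambda>s. ?V s * C_kernel z t s + ?U s * (z * S_kernel z t s))"
      by (intro AI_continuous continuous_intros continuous_y)
    show "prim (\<lambda>s. ?u s * (S_kernel z t s / z) + ?V s * (- C_kernel z t s) + (?V s * C_kernel z t s + ?U s * (z * S_kernel z t s))) t
        = prim (\<lambda>s. - (S_kernel z t s / z * (complex_of_real (q s) * ?U s))) t"
      by (rule prim_cong) (simp add: w_def field_simps power2_eq_square z)
  qed
  ultimately show "?U t = cos (z * complex_of_real t) - prim (\<lambda>s. S_kernel z t s / z * (complex_of_real (q s) * ?U s)) t"
    unfolding prim_uminus by (simp add: algebra_simps)
  have e1: "prim (\<lambda>s. ?u s * C_kernel z t s + ?V s * (z * S_kernel z t s)) t = ?V t * C_kernel z t t - 0 * C_kernel z t 0"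
    by (rule integration_by_parts_smooth[OF iu _ _ _ t], rule V, assumption, rule kernel_deriv(2), intro continuous_intros)
  have e2: "prim (\<lambda>s. ?V s * (z * S_kernel z t s) + ?U s * (- (z\<^sup>2) * C_kernel z t s)) t = ?U t * (z * S_kernel z t t) - 1 * (z * S_kernel z t 0)"
  proof (rule integration_by_parts_smooth[OF iV U _ _ t])
    show "((\<lambda>s. z * S_kernel z t s) has_vector_derivative - (z\<^sup>2) * C_kernel z t s) (at s within {0..pi})" for s
      using has_vector_derivative_mult_right[OF kernel_deriv(1)[of z t s "{0..pi}"], of z] by (simp add: power2_eq_square mult.assoc)
    show "continuous_on {0..pi} (\<lambda>s. - (z\<^sup>2) * C_kernel z t s)" by (intro continuous_intros)
  qed auto
  have e3: "prim (\<lambda>s. ?u s * C_kernel z t s + ?V s * (z * S_kernel z t s)) t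
      - prim (\<lambda>s. ?V s * (z * S_kernel z t s) + ?U s * (- (z\<^sup>2) * C_kernel z t s)) t
      = prim (\<lambda>s. - (C_kernel z t s * (complex_of_real (q s) * ?U s))) t"
  proof (subst prim_diff[symmetric, OF _ _ t])
    have "AI (\<lambda>s. C_kernel z t s * ?u s)" by (intro AI_continuous_mult iu continuous_intros)
    then have A1: "AI (\<lambda>s. ?u s * C_kernel z t s)" by (subst mult.commute)
    show "AI (\<lambda>s. ?u s * C_kernel z t s + ?V s * (z * S_kernel z t s))"
      by (rule AI_add[OF A1]) (intro AI_continuous continuous_intros continuous_y)
    show "AI (\<lambda>s. ?V s * (z * S_kernel z t s) + ?U s * (- (z\<^sup>2) * C_kernel z t s))"
      by (intro AI_continuous continuous_intros continuous_y)
    show "prim (\<lambda>s. ?u s * C_kernel z t s + ?V s * (z * S_kernel z t s) - (?V s * (z * S_kernel z t s) + ?U s * (- (z\<^sup>2) * C_kernel z t s))) t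
        = prim (\<lambda>s. - (C_kernel z t s * (complex_of_real (q s) * ?U s))) t"
      by (rule prim_cong) (simp add: w_def algebra_simps)
  qed
  have arith: "v = - m - P" if "- P = v + m" for P v m :: complex
  proof -
    have "v = (v + m) - m" by simp
    also have "v + m = - P" using that by simp
    finally show ?thesis by (metis minus_diff_commute)
  qed
  have "- prim (\<lambda>s. C_kernel z t s * (complex_of_real (q s) * ?U s)) t
      = (?V t * C_kernel z t t - 0 * C_kernel z t 0) - (?U t * (z * S_kernel z t t) - 1 * (z * S_kernel z t 0))"
    by (simp only: prim_uminus[symmetric] e3[symmetric] e1 e2)
  also have "\<dots> = ?V t + z * sin (z * complex_of_real t)" by simp
  finally show "?V t = - z * sin (z * complex_of_real t) - prim (\<lambda>s. C_kernel z t s * (complex_of_real (q s) * ?U s)) t"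
    using arith[of _ "?V t" "z * sin (z * complex_of_real t)"] by simp
qed

lemma kernel_prim_bound:
  assumes "t \<in> {0..pi}" "continuous_on {0..pi} k" "\<And>s. s \<in> {0..t} \<Longrightarrow> cmod (k s) \<le> B * exp (m * (t - s))"
    and "continuous_on {0..pi} U" "\<And>s. s \<in> {0..pi} \<Longrightarrow> cmod (U s) \<le> A * exp (m * s)" "0 \<le> A" "0 \<le> B"
  shows "cmod (prim (\<lambda>s. k s * (complex_of_real (q s) * U s)) t) \<le> B * Q * A * pi * exp (m * t)"
proof -
  have "cmod (prim (\<lambda>s. k s * (complex_of_real (q s) * U s)) t) \<le> (B * Q * A * exp (m * t)) * t"
  proof (rule prim_const_bound[OF _ assms(1)])
    show "AI (\<lambda>s. k s * (complex_of_real (q s) * U s))"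
      by (rule AI_continuous_mult[OF assms(2) bounded_measurable_mult_AI[OF bounded_measurable_q assms(4)]])
    fix s assume s: "s \<in> {0..t}"
    have "cmod (k s * (complex_of_real (q s) * U s)) \<le> (B * exp (m * (t - s))) * (Q * (A * exp (m * s)))"
      unfolding norm_mult using s assms q_bounded[of s] Q_nonneg by (intro mult_mono) auto
    also have "\<dots> = B * Q * A * (exp (m * (t - s)) * exp (m * s))" by simp
    also have "exp (m * (t - s)) * exp (m * s) = exp (m * t)" by (simp add: exp_add[symmetric] algebra_simps)
    finally show "cmod (k s * (complex_of_real (q s) * U s)) \<le> B * Q * A * exp (m * t)" .
  qed
  also have "\<dots> \<le> (B * Q * A * exp (m * t)) * pi"
    using assms(1,6,7) Q_nonneg by (intro mult_left_mono) auto
  finally show ?thesis by (simp add: mult_ac)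
qed

text \<open>The supremum \<open>A\<close> of \<open>|y(t)| exp (- |Im z| t)\<close> satisfies \<open>A \<le> 1 + A \<pi> Q / |z|\<close> by variation of constants,
  whence \<open>A \<le> 2\<close> for large \<open>z\<close>; inserting this into the integral terms gives the remainders.\<close>

lemma solution_estimates:
  assumes z: "z \<noteq> 0" "2 * pi * Q \<le> cmod z" and t: "t \<in> {0..pi}"
  shows "cmod (y (z\<^sup>2) 0 t - cos (z * complex_of_real t)) \<le> 2 * pi * Q / cmod z * exp (\<bar>Im z\<bar> * t)"
    and "cmod (y' (z\<^sup>2) 0 t + z * sin (z * complex_of_real t)) \<le> 2 * pi * Q * exp (\<bar>Im z\<bar> * t)"
    and "cmod (y (z\<^sup>2) 0 t) \<le> 2 * exp (\<bar>Im z\<bar> * t)"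
proof -
  let ?U = "y (z\<^sup>2) 0" and ?m = "\<bar>Im z\<bar>"
  have "continuous_on {0..pi} (\<lambda>t. cmod (?U t) * exp (- (?m * t)))" by (intro continuous_intros continuous_y)
  from attains_max[OF this] obtain t0 where t0: "t0 \<in> {0..pi}"
    "\<And>t. t \<in> {0..pi} \<Longrightarrow> cmod (?U t) * exp (- (?m * t)) \<le> cmod (?U t0) * exp (- (?m * t0))" by blast
  define A where "A = cmod (?U t0) * exp (- (?m * t0))"
  have A0: "0 \<le> A" by (simp add: A_def)
  have UA: "cmod (?U t) \<le> A * exp (?m * t)" if "t \<in> {0..pi}" for t
    using t0(2)[OF that] unfolding A_def[symmetric] unfolding exp_minus inverse_eq_divide
    by (simp only: times_divide_eq_right mult_1_right pos_divide_le_eq[OF exp_gt_zero])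
  have S: "cmod (prim (\<lambda>s. S_kernel z t s / z * (complex_of_real (q s) * ?U s)) t) \<le> 1 / cmod z * Q * A * pi * exp (?m * t)"
    if t: "t \<in> {0..pi}" for t
  proof (rule kernel_prim_bound[OF t _ _ continuous_y(1) UA A0])
    show "continuous_on {0..pi} (\<lambda>s. S_kernel z t s / z)" by (intro continuous_intros) (use z in auto)
    show "cmod (S_kernel z t s / z) \<le> 1 / cmod z * exp (?m * (t - s))" if "s \<in> {0..t}" for s
      using divide_right_mono[OF kernel_bound(1)[OF that, of z], of "cmod z"] by (simp add: norm_divide)
  qed auto
  have cos_b: "cmod (cos (z * complex_of_real t)) \<le> exp (?m * t)" if "t \<in> {0..pi}" for t
    using kernel_bound(2)[of 0 t z] that by simp
  have "cmod (?U t0) \<le> exp (?m * t0) + 1 / cmod z * Q * A * pi * exp (?m * t0)"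
    unfolding variation_of_constants(1)[OF z(1) t0(1)]
    by (rule order_trans[OF norm_triangle_ineq4 add_mono[OF cos_b[OF t0(1)] S[OF t0(1)]]])
  also have "\<dots> = (1 + pi * Q / cmod z * A) * exp (?m * t0)" by (simp add: algebra_simps)
  also have "\<dots> \<le> (1 + 1/2 * A) * exp (?m * t0)"
    using z A0 by (intro mult_right_mono add_left_mono) (auto simp: field_simps)
  finally have "A \<le> 1 + 1/2 * A"
    unfolding A_def exp_minus inverse_eq_divide
    by (simp only: times_divide_eq_right mult_1_right pos_divide_le_eq[OF exp_gt_zero])
  then have A2: "A \<le> 2" by simp
  have UB: "cmod (?U t) \<le> 2 * exp (?m * t)" if "t \<in> {0..pi}" for t
    by (rule order_trans[OF UA[OF that] mult_right_mono[OF A2]]) simp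
  show "cmod (y (z\<^sup>2) 0 t) \<le> 2 * exp (\<bar>Im z\<bar> * t)" by (rule UB[OF t])
  have "cmod (prim (\<lambda>s. S_kernel z t s / z * (complex_of_real (q s) * ?U s)) t) \<le> 1 / cmod z * Q * 2 * pi * exp (?m * t)"
  proof (rule order_trans[OF S[OF t]])
    show "1 / cmod z * Q * A * pi * exp (?m * t) \<le> 1 / cmod z * Q * 2 * pi * exp (?m * t)"
      using A2 Q_nonneg by (intro mult_right_mono mult_left_mono) auto
  qed
  moreover have "?U t - cos (z * complex_of_real t) = - prim (\<lambda>s. S_kernel z t s / z * (complex_of_real (q s) * ?U s)) t"
    using variation_of_constants(1)[OF z(1) t] by simp
  ultimately show "cmod (?U t - cos (z * complex_of_real t)) \<le> 2 * pi * Q / cmod z * exp (?m * t)"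
    by (simp only: norm_minus_cancel) (simp add: mult_ac)
  have "cmod (prim (\<lambda>s. C_kernel z t s * (complex_of_real (q s) * ?U s)) t) \<le> 1 * Q * 2 * pi * exp (?m * t)"
    by (rule kernel_prim_bound[OF t continuous_kernel(2) _ continuous_y(1) UB]) (use kernel_bound(2) in auto)
  moreover have "y' (z\<^sup>2) 0 t + z * sin (z * complex_of_real t) = - prim (\<lambda>s. C_kernel z t s * (complex_of_real (q s) * ?U s)) t"
    using variation_of_constants(2)[OF z(1) t] by simp
  ultimately show "cmod (y' (z\<^sup>2) 0 t + z * sin (z * complex_of_real t)) \<le> 2 * pi * Q * exp (?m * t)"
    by (simp only: norm_minus_cancel) (simp add: mult_ac)
qed

definition remainder_const :: real where "remainder_const = 2 * pi * Q + 2 * cmod b"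

lemma remainder_const_nonneg: "0 \<le> remainder_const" "2 * pi * Q \<le> remainder_const"
  using Q_nonneg by (simp_all add: remainder_const_def)

text \<open>The derivative \<open>y'(\<pi>)\<close> carries the main term; the boundary term \<open>b y(\<pi>)\<close> has the size of the
  remainder.\<close>

lemma Delta_estimate:
  assumes "z \<noteq> 0" "2 * pi * Q \<le> cmod z"
  shows "cmod (Delta (z\<^sup>2) + z * sin (z * complex_of_real pi)) \<le> remainder_const * exp (pi * \<bar>Im z\<bar>)"
proof -
  have "Delta (z\<^sup>2) + z * sin (z * complex_of_real pi) = (y' (z\<^sup>2) 0 pi + z * sin (z * complex_of_real pi)) + b * y (z\<^sup>2) 0 pi"
    by (simp add: Delta_def Delta_coeff_def)
  also have "cmod \<dots> \<le> 2 * pi * Q * exp (\<bar>Im z\<bar> * pi) + cmod b * (2 * exp (\<bar>Im z\<bar> * pi))"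
    using solution_estimates(2)[OF assms, of pi] mult_left_mono[OF solution_estimates(3)[OF assms, of pi], of "cmod b"]
      norm_triangle_ineq[of "y' (z\<^sup>2) 0 pi + z * sin (z * complex_of_real pi)" "b * y (z\<^sup>2) 0 pi"]
    by (simp add: norm_mult)
  finally show ?thesis by (simp add: remainder_const_def algebra_simps)
qed

lemma zorder_Delta:
  assumes nz: "Delta_coeff l k \<noteq> 0"
  shows "zorder Delta l = int (ord l)"
proof -
  define g where "g v = (\<Sum>n. Delta_coeff l (n + ord l) * (v - l) ^ n)" for v
  have sm: "summable (\<lambda>n. Delta_coeff l (n + ord l) * (v - l) ^ n)"
    and Dg: "Delta v = g v * (v - l) ^ ord l" if v: "v \<in> ball l 1" for v
  proof -
    have s: "(\<lambda>n. Delta_coeff l n * (v - l) ^ n) sums Delta v"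
      using Delta_sums[of "v - l" l] v by (simp add: dist_norm norm_minus_commute)
    have z: "(\<Sum>n<ord l. Delta_coeff l n * (v - l) ^ n) = 0" using Delta_coeff_below_ord by simp
    have s2: "(\<lambda>n. Delta_coeff l (n + ord l) * (v - l) ^ (n + ord l)) sums Delta v"
      using sums_split_initial_segment[OF s, of "ord l"] z by simp
    show "summable (\<lambda>n. Delta_coeff l (n + ord l) * (v - l) ^ n)"
    proof (cases "v = l")
      case True
      show ?thesis by (rule summable_finite[of "{0}"]) (auto simp: True)
    next
      case False
      have "(\<lambda>n. Delta_coeff l (n + ord l) * (v - l) ^ n) = (\<lambda>n. Delta_coeff l (n + ord l) * (v - l) ^ (n + ord l) / (v - l) ^ ord l)"
        using False by (simp add: power_add)
      then show ?thesis using summable_divide[OF sums_summable[OF s2], of "(v - l) ^ ord l"] by simp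
    qed
    then have "(\<lambda>n. Delta_coeff l (n + ord l) * (v - l) ^ n * (v - l) ^ ord l) sums (g v * (v - l) ^ ord l)"
      unfolding g_def by (intro sums_mult2 summable_sums)
    then show "Delta v = g v * (v - l) ^ ord l"
      using s2 by (simp add: power_add mult.assoc sums_unique2)
  qed
  show ?thesis
  proof (rule zorder_eqI[of "ball l 1" l g])
    show "g holomorphic_on ball l 1"
    proof (rule power_series_holomorphic)
      show "(\<lambda>n. Delta_coeff l (n + ord l) * (v - l) ^ n) sums g v" if "v \<in> ball l 1" for v
        unfolding g_def by (rule summable_sums[OF sm[OF that]])
    qed
    have "g l = Delta_coeff l (ord l)"
      unfolding g_def using suminf_finite[of "{0}" "\<lambda>n. Delta_coeff l (n + ord l) * (l - l) ^ n"] by (auto simp: power_0_left)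
    then show "g l \<noteq> 0" using Delta_coeff_ord[OF nz] by simp
  qed (use Dg in auto)
qed

end

section \<open>The unperturbed problem\<close>

interpretation free: sturm_liouville "\<lambda>_. 0" 0 0
  by unfold_locales auto

text \<open>The constant of \<open>Delta_estimate\<close> is zero for zero potential and \<open>b = 0\<close>, so the estimate becomes an
  identity.\<close>

lemma free_Delta: "z \<noteq> 0 \<Longrightarrow> free.Delta (z\<^sup>2) = - z * sin (z * complex_of_real pi)"
proof -
  assume z: "z \<noteq> 0"
  have "cmod (free.Delta (z\<^sup>2) + z * sin (z * complex_of_real pi)) \<le> free.remainder_const * exp (pi * \<bar>Im z\<bar>)"
    by (rule free.Delta_estimate[OF z]) simp
  also have "\<dots> = 0" by (simp add: free.remainder_const_def)
  finally have "free.Delta (z\<^sup>2) + z * sin (z * complex_of_real pi) = 0" by simp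
  then show ?thesis by (simp add: add_eq_0_iff2)
qed

lemma free_solution:
  assumes t: "t \<in> {0..pi}"
  shows "free.y ((of_nat n)\<^sup>2) 0 t = complex_of_real (cos (real n * t))"
    "free.y' ((of_nat n)\<^sup>2) 0 t = complex_of_real (- real n * sin (real n * t))"
proof -
  let ?U = "\<lambda>t. complex_of_real (cos (real n * t))" and ?V = "\<lambda>t. complex_of_real (- real n * sin (real n * t))"
  have "cauchy (free.w ((of_nat n)\<^sup>2)) (\<lambda>_. 0) 1 ?U ?V"
    unfolding cauchy_def
  proof (intro conjI ballI)
    fix t assume t: "t \<in> {0..pi}"
    have "(?U has_vector_derivative ?V s) (at s within {0..pi})" for s
      by (intro has_vector_derivative_of_real) (auto intro!: derivative_eq_intros)
    from prim_derivative[OF this t] show "?U t = 1 + prim ?V t" by simp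
    have "(?V has_vector_derivative complex_of_real (- (real n)\<^sup>2 * cos (real n * s))) (at s within {0..pi})" for s
      by (intro has_vector_derivative_of_real) (auto intro!: derivative_eq_intros simp: power2_eq_square)
    from prim_derivative[OF this t]
    have "?V t = prim (\<lambda>s. complex_of_real (- (real n)\<^sup>2 * cos (real n * s))) t" by simp
    also have "\<dots> = prim (\<lambda>s. - (free.w ((of_nat n)\<^sup>2) s * ?U s + 0)) t"
      by (rule prim_cong) (simp add: free.w_def)
    finally show "?V t = - prim (\<lambda>s. free.w ((of_nat n)\<^sup>2) s * ?U s + 0) t" by (simp only: prim_uminus)
  qed (intro continuous_intros)+
  from free.homogeneous_solution[OF this t]
  show "free.y ((of_nat n)\<^sup>2) 0 t = ?U t" "free.y' ((of_nat n)\<^sup>2) 0 t = ?V t" by simp_all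
qed

lemma free_Delta_zero_iff: "free.Delta l = 0 \<longleftrightarrow> (\<exists>n::nat. l = (of_nat n)\<^sup>2)"
proof
  assume D: "free.Delta l = 0"
  define z where "z = csqrt l"
  have lz: "l = z\<^sup>2" by (simp add: z_def)
  show "\<exists>n::nat. l = (of_nat n)\<^sup>2"
  proof (cases "z = 0")
    case True
    then show ?thesis by (intro exI[of _ 0]) (simp add: lz)
  next
    case False
    then have "sin (z * complex_of_real pi) = 0" using D free_Delta[OF False] by (simp add: lz)
    then obtain k :: int where "z * complex_of_real pi = complex_of_real (of_int k * pi)"
      unfolding sin_eq_0 by blast
    then have z: "z = of_int k" by simp
    have "0 \<le> Re z" unfolding z_def by (rule Re_csqrt)
    then have "z = of_nat (nat k)" using z by simp
    then show ?thesis using lz by blast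
  qed
next
  assume "\<exists>n::nat. l = (of_nat n)\<^sup>2"
  then show "free.Delta l = 0" using free_solution(2)[of pi] by (auto simp: free.Delta_def free.Delta_coeff_def)
qed

text \<open>If \<open>n\<^sup>2\<close> were a multiple zero, the Lagrange identity would make \<open>\<integral> cos\<^sup>2 (n t)\<close> vanish.\<close>

lemma free_simple: "free.Delta_coeff ((of_nat n)\<^sup>2) 1 \<noteq> 0" "free.ord ((of_nat n)\<^sup>2) = 1"
proof -
  let ?l = "(of_nat n)\<^sup>2 :: complex"
  have d0: "free.Delta_coeff ?l 0 = 0" using free_Delta_zero_iff by (auto simp: free.Delta_def)
  show d1: "free.Delta_coeff ?l 1 \<noteq> 0"
  proof
    assume "free.Delta_coeff ?l 1 = 0"
    then have "free.y' ?l 1 pi = 0" "free.y' ?l 0 pi = 0" using d0 by (auto simp: free.Delta_coeff_def)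
    then have "prim (\<lambda>t. free.y ?l 0 t * free.y ?l 0 t) pi = 0"
      using free.Lagrange_identity[OF free.AI_pred_y free.AI_pred_y free.cauchy_y free.cauchy_y, of ?l ?l 1 0]
      by (simp add: prim_def)
    also have "prim (\<lambda>t. free.y ?l 0 t * free.y ?l 0 t) pi = prim (\<lambda>t. complex_of_real ((cos (real n * t))\<^sup>2)) pi"
    proof (rule prim_cong)
      fix s assume "s \<in> {0..pi}"
      then show "free.y ?l 0 s * free.y ?l 0 s = complex_of_real ((cos (real n * s))\<^sup>2)"
        unfolding free_solution(1)[OF \<open>s \<in> {0..pi}\<close>] by (simp add: power2_eq_square)
    qed
    also have "\<dots> = complex_of_real (integral {0..pi} (\<lambda>t. (cos (real n * t))\<^sup>2))"
      unfolding prim_def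
      using integral_linear[of "\<lambda>t. (cos (real n * t))\<^sup>2" "{0..pi}" complex_of_real] bounded_linear_of_real
      by (simp add: o_def integrable_continuous_real continuous_intros)
    finally have "integral {0..pi} (\<lambda>t. (cos (real n * t))\<^sup>2) = 0" by simp
    moreover have "continuous_on {0..pi} (\<lambda>t. (cos (real n * t))\<^sup>2)" by (intro continuous_intros)
    ultimately have "\<forall>t\<in>{0..pi}. (cos (real n * t))\<^sup>2 = 0"
      using integral_eq_0_iff[of 0 pi "\<lambda>t. (cos (real n * t))\<^sup>2"] by simp
    from bspec[OF this, of 0] show False by simp
  qed
  show "free.ord ?l = 1"
    unfolding free.ord_def using d0 d1 by (intro Least_equality) (auto simp: Suc_le_eq intro: gr0I)
qed

section \<open>Counting eigenvalues\<close>

context sturm_liouville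
begin

text \<open>On the circle, \<open>sin_pi_lower_bound\<close> gives \<open>|sin (\<pi> z)| \<ge> exp (\<pi> |Im z|) / 5\<close>, and the additional factor
  \<open>z\<close> beats the constant of the remainder.\<close>

lemma circle_estimate:
  assumes N: "5 * remainder_const < real N + 1/2" and l: "cmod l = (real N + 1/2)\<^sup>2"
  shows "cmod (Delta l - free.Delta l) < cmod (free.Delta l)"
proof -
  define z where "z = csqrt l"
  have lz: "l = z\<^sup>2" by (simp add: z_def)
  have zN: "cmod z = real N + 1/2" by (simp add: z_def l)
  then have z0: "z \<noteq> 0" by auto
  have zQ: "2 * pi * Q \<le> cmod z" using N remainder_const_nonneg zN by simp
  have rz: "0 \<le> Re z" unfolding z_def by (rule Re_csqrt)
  let ?v = "z - of_int (round (Re z))"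
  have "min 1 (cmod ?v) \<ge> 1/2" using nearest_int_distance[OF rz zN] by simp
  then have "2/5 * (1/2) * exp (pi * \<bar>Im ?v\<bar>) \<le> 2/5 * min 1 (cmod ?v) * exp (pi * \<bar>Im ?v\<bar>)"
    by (intro mult_right_mono mult_left_mono) auto
  also have "\<dots> \<le> cmod (sin (?v * complex_of_real pi))" by (rule sin_pi_lower_bound[OF round_Re_bound])
  finally have "1/5 * exp (pi * \<bar>Im z\<bar>) \<le> cmod (sin (z * complex_of_real pi))"
    by (simp add: norm_sin_pi_shift)
  then have "cmod z * (1/5 * exp (pi * \<bar>Im z\<bar>)) \<le> cmod (free.Delta l)"
    unfolding lz free_Delta[OF z0] norm_mult norm_minus_cancel by (intro mult_left_mono) auto
  moreover have "remainder_const * exp (pi * \<bar>Im z\<bar>) < (cmod z * (1/5)) * exp (pi * \<bar>Im z\<bar>)"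
    using N zN by (intro mult_strict_right_mono) auto
  moreover have "cmod (Delta l - free.Delta l) \<le> remainder_const * exp (pi * \<bar>Im z\<bar>)"
    using Delta_estimate[OF z0 zQ] by (simp add: lz free_Delta[OF z0])
  ultimately show ?thesis by linarith
qed

lemma Delta_nonzero: "\<exists>v. Delta v \<noteq> 0"
proof -
  obtain N where "5 * remainder_const < real N" using reals_Archimedean2 by blast
  then have "5 * remainder_const < real N + 1/2" by simp
  from circle_estimate[OF this, of "complex_of_real ((real N + 1/2)\<^sup>2)"]
  have "Delta (complex_of_real ((real N + 1/2)\<^sup>2)) \<noteq> 0"
    by (auto simp del: of_real_power)
  then show ?thesis by blast
qed

text \<open>An entire function all of whose Taylor coefficients vanish at one point is zero.\<close>

lemma Delta_coeff_nonzero: "\<exists>k. Delta_coeff l k \<noteq> 0"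
proof (rule ccontr)
  assume "\<nexists>k. Delta_coeff l k \<noteq> 0"
  then have z: "Delta v = 0" if "v \<in> ball l 1" for v
    using Delta_sums[of "v - l" l] that by (auto simp: dist_norm norm_minus_commute sums_iff)
  have "Delta v = 0" for v
    by (rule analytic_continuation_open[of "ball l 1" UNIV Delta "\<lambda>_. 0"])
       (auto simp: z holomorphic_Delta)
  then show False using Delta_nonzero by blast
qed

lemma Delta_coeff_ord_nonzero: "Delta_coeff l (ord l) \<noteq> 0"
  using Delta_coeff_nonzero[of l] Delta_coeff_ord by blast

lemma ord_positive: "Delta l = 0 \<Longrightarrow> 0 < ord l"
  using Delta_coeff_nonzero[of l] ord_pos by blast

lemma zorder_Delta_ord: "zorder Delta l = int (ord l)"
  using Delta_coeff_nonzero[of l] zorder_Delta by blast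

lemma finite_zeros_ball: "finite {p \<in> ball 0 R. Delta p = 0}"
proof (cases "Delta constant_on UNIV")
  case True
  then have "{p \<in> ball 0 R. Delta p = 0} = {}" using Delta_nonzero by (force simp: constant_on_def)
  then show ?thesis by (simp only: finite.emptyI)
next
  case False
  then have "finite {p \<in> cball 0 R. Delta p = 0}"
    by (intro holomorphic_compact_finite_zeros[of Delta UNIV]) (auto simp: holomorphic_Delta)
  then show ?thesis by (rule rev_finite_subset) auto
qed

definition zeros :: "nat \<Rightarrow> complex set" where
  "zeros N = {p. cmod p < (real N + 1/2)\<^sup>2 \<and> Delta p = 0}"

lemma finite_zeros: "finite (zeros N)"
  using finite_zeros_ball[of "(real N + 1/2)\<^sup>2"] by (simp add: zeros_def)

end

lemma free_zeros: "free.zeros N = (\<lambda>n. (of_nat n)\<^sup>2) ` {..N}"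
proof -
  have "cmod ((of_nat n)\<^sup>2) < (real N + 1/2)\<^sup>2 \<longleftrightarrow> n \<le> N" for n :: nat
  proof -
    have "cmod ((of_nat n)\<^sup>2) < (real N + 1/2)\<^sup>2 \<longleftrightarrow> real n < real N + 1/2"
      unfolding norm_power norm_of_nat by (auto intro: power2_less_imp_less power_strict_mono)
    also have "\<dots> \<longleftrightarrow> n \<le> N" by linarith
    finally show ?thesis .
  qed
  then show ?thesis by (auto simp: free.zeros_def free_Delta_zero_iff)
qed

context sturm_liouville
begin

text \<open>Rouche's theorem on the circle of radius \<open>(N + 1/2)\<^sup>2\<close>, compared with the unperturbed problem.\<close>

lemma zero_count:
  assumes N: "5 * remainder_const < real N + 1/2"
  shows "(\<Sum>p\<in>zeros N. ord p) = N + 1"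
proof -
  define R where "R = (real N + 1/2)\<^sup>2"
  have R0: "0 < R" by (simp add: R_def)
  define \<gamma> where "\<gamma> = circlepath 0 R"
  define s where "s = ball (0::complex) (R + 1)"
  let ?g = "\<lambda>p. Delta p - free.Delta p"
  have fg: "free.Delta p + ?g p = Delta p" for p by simp
  have circ: "path_image \<gamma> = sphere 0 R" using R0 by (simp add: \<gamma>_def path_image_circlepath_nonneg)
  have R: "(\<Sum>p\<in>{p\<in>s. free.Delta p + ?g p = 0}. winding_number \<gamma> p * zorder (\<lambda>p. free.Delta p + ?g p) p)
      = (\<Sum>p\<in>{p\<in>s. free.Delta p = 0}. winding_number \<gamma> p * zorder free.Delta p)"
  proof (rule Rouche_theorem)
    show "finite {p \<in> s. free.Delta p + ?g p = 0}" unfolding fg s_def by (rule finite_zeros_ball)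
    show "finite {p \<in> s. free.Delta p = 0}" unfolding s_def by (rule free.finite_zeros_ball)
    show "path_image \<gamma> \<subseteq> s" unfolding circ s_def by auto
    show "\<forall>z\<in>path_image \<gamma>. cmod (free.Delta z) > cmod (?g z)"
      unfolding circ using circle_estimate[OF N] by (auto simp: R_def)
    show "\<forall>z. z \<notin> s \<longrightarrow> winding_number \<gamma> z = 0"
    proof (intro allI impI)
      fix z assume "z \<notin> s"
      then show "winding_number \<gamma> z = 0"
        using R0 by (intro winding_number_zero_outside[of \<gamma> s]) (auto simp: \<gamma>_def s_def)
    qed
  qed (auto simp: \<gamma>_def s_def intro!: holomorphic_intros holomorphic_Delta free.holomorphic_Delta)
  have W: "(\<Sum>p\<in>{p\<in>s. F p = 0}. winding_number \<gamma> p * of_int (zorder F p)) = (\<Sum>p\<in>{p. cmod p < R \<and> F p = 0}. of_int (zorder F p))"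
    if fin: "finite {p \<in> s. F p = 0}" and nz: "\<And>p. cmod p = R \<Longrightarrow> F p \<noteq> 0" for F :: "complex \<Rightarrow> complex"
  proof -
    have "(\<Sum>p\<in>{p. cmod p < R \<and> F p = 0}. of_int (zorder F p)) = (\<Sum>p\<in>{p. cmod p < R \<and> F p = 0}. winding_number \<gamma> p * of_int (zorder F p))"
      by (intro sum.cong refl) (simp add: \<gamma>_def winding_number_circlepath)
    also have "\<dots> = (\<Sum>p\<in>{p\<in>s. F p = 0}. winding_number \<gamma> p * of_int (zorder F p))"
    proof (rule sum.mono_neutral_left[OF fin])
      show "{p. cmod p < R \<and> F p = 0} \<subseteq> {p \<in> s. F p = 0}" by (auto simp: s_def)
      show "\<forall>p\<in>{p \<in> s. F p = 0} - {p. cmod p < R \<and> F p = 0}. winding_number \<gamma> p * of_int (zorder F p) = 0"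
      proof
        fix p assume "p \<in> {p \<in> s. F p = 0} - {p. cmod p < R \<and> F p = 0}"
        then have "R < cmod p" using nz[of p] by force
        then have "winding_number \<gamma> p = 0"
          using R0 by (intro winding_number_zero_outside[of \<gamma> "cball 0 R"]) (auto simp: \<gamma>_def)
        then show "winding_number \<gamma> p * of_int (zorder F p) = 0" by simp
      qed
    qed
    finally show ?thesis ..
  qed
  have nz: "Delta p \<noteq> 0" "free.Delta p \<noteq> 0" if "cmod p = R" for p
    using circle_estimate[OF N, of p] that by (auto simp: R_def)
  have "(\<Sum>p\<in>zeros N. of_int (zorder Delta p)) = (\<Sum>p\<in>free.zeros N. of_int (zorder free.Delta p) :: complex)"
    using R[unfolded fg] W[OF finite_zeros_ball[of "R + 1", folded s_def] nz(1)]
      W[OF free.finite_zeros_ball[of "R + 1", folded s_def] nz(2)]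
    by (simp add: zeros_def free.zeros_def R_def)
  then have "complex_of_nat (\<Sum>p\<in>zeros N. ord p) = complex_of_nat (\<Sum>p\<in>free.zeros N. free.ord p)"
    by (simp add: zorder_Delta_ord free.zorder_Delta_ord)
  then have "(\<Sum>p\<in>zeros N. ord p) = (\<Sum>p\<in>free.zeros N. free.ord p)" unfolding of_nat_eq_iff .
  also have "\<dots> = (\<Sum>n\<le>N. free.ord ((of_nat n)\<^sup>2))"
    unfolding free_zeros
  proof (rule sum.reindex_cong[OF _ refl refl])
    show "inj_on (\<lambda>n. (of_nat n :: complex)\<^sup>2) {..N}"
    proof (rule inj_onI)
      fix m n :: nat assume "(of_nat m :: complex)\<^sup>2 = (of_nat n)\<^sup>2"
      then have "of_nat (m\<^sup>2) = (of_nat (n\<^sup>2) :: complex)" by simp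
      then have "m\<^sup>2 = n\<^sup>2" unfolding of_nat_eq_iff .
      then show "m = n" by simp
    qed
  qed
  also have "\<dots> = N + 1" by (simp add: free_simple)
  finally show ?thesis .
qed

lemma zeros_mono: "M \<le> N \<Longrightarrow> zeros M \<subseteq> zeros N"
proof -
  assume "M \<le> N"
  then have "(real M + 1/2)\<^sup>2 \<le> (real N + 1/2)\<^sup>2" by (intro power_mono) auto
  then show ?thesis unfolding zeros_def by (blast intro: less_le_trans)
qed

text \<open>The orders of the zeros in the annulus add up to one.\<close>

lemma annulus_zero:
  assumes N: "5 * remainder_const < real N + 1/2"
  shows "\<exists>l. zeros (Suc N) - zeros N = {l} \<and> ord l = 1"
proof -
  have N': "5 * remainder_const < real (Suc N) + 1/2" using N by simp
  let ?Z = "zeros (Suc N) - zeros N"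
  have "(\<Sum>p\<in>zeros (Suc N). ord p) = (\<Sum>p\<in>?Z. ord p) + (\<Sum>p\<in>zeros N. ord p)"
    by (rule sum.subset_diff[OF zeros_mono finite_zeros]) simp
  then have s: "(\<Sum>p\<in>?Z. ord p) = 1" using zero_count[OF N] zero_count[OF N'] by simp
  have f: "finite ?Z" using finite_zeros by blast
  from s sum_eq_1_iff[OF f, of ord] obtain l where l: "l \<in> ?Z" "ord l = 1" "\<forall>p\<in>?Z. l \<noteq> p \<longrightarrow> ord p = 0" by blast
  have "p = l" if "p \<in> ?Z" for p
    using l(3) that ord_positive[of p] by (force simp: zeros_def)
  then show ?thesis using l by blast
qed

section \<open>Localization of the eigenvalues\<close>

text \<open>The characteristic equation forces \<open>sin (\<pi> z)\<close> to be \<open>O(1/n) exp (\<pi> |Im z|)\<close>, hence \<open>z\<close> to be within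
  \<open>O(1/n)\<close> of an integer. The annulus in which the zero lies tells which integer it is.\<close>

lemma zero_localization:
  assumes n: "10 * remainder_const < real n" and l: "l \<in> zeros n - zeros (n - 1)" and n0: "0 < n"
  shows "cmod (csqrt l - of_nat n) \<le> 5 * remainder_const / real n" "csqrt l \<noteq> 0" "2 * pi * Q \<le> cmod (csqrt l)"
    "real n / 2 \<le> cmod (csqrt l)"
proof -
  define z where "z = csqrt l"
  have lz: "l = z\<^sup>2" by (simp add: z_def)
  have D: "Delta l = 0" using l by (simp add: zeros_def)
  have n1: "real (n - 1) + 1/2 = real n - 1/2" using n0 by (simp add: of_nat_diff)
  have up: "cmod z < real n + 1/2"
  proof (rule power2_less_imp_less)
    show "(cmod z)\<^sup>2 < (real n + 1/2)\<^sup>2" using l by (simp add: lz norm_power zeros_def)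
  qed simp
  have lo: "real n - 1/2 \<le> cmod z"
  proof (rule power2_le_imp_le)
    have "l \<notin> zeros (n - 1)" using l by simp
    then have "\<not> (cmod l < (real n - 1/2)\<^sup>2 \<and> Delta l = 0)" unfolding zeros_def mem_Collect_eq n1 .
    with D have "\<not> cmod l < (real n - 1/2)\<^sup>2" by simp
    then show "(real n - 1/2)\<^sup>2 \<le> (cmod z)\<^sup>2" by (simp add: lz norm_power)
  qed simp
  have n1': "1 \<le> real n" using n0 by linarith
  have half: "real n / 2 \<le> cmod z" using lo n1' by linarith
  then show "real n / 2 \<le> cmod (csqrt l)" by (simp add: z_def)
  have zQ: "2 * pi * Q \<le> cmod z" using half n remainder_const_nonneg by linarith
  then show "2 * pi * Q \<le> cmod (csqrt l)" by (simp add: z_def)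
  have z0: "z \<noteq> 0" using half n1' by auto
  then show "csqrt l \<noteq> 0" by (simp add: z_def)
  have rz: "0 \<le> Re z" unfolding z_def by (rule Re_csqrt)
  let ?k = "round (Re z)" let ?v = "z - of_int ?k"
  have "cmod z * cmod (sin (z * complex_of_real pi)) \<le> remainder_const * exp (pi * \<bar>Im z\<bar>)"
    using Delta_estimate[OF z0 zQ] D by (simp add: lz norm_mult)
  moreover have "real n / 2 * (2/5 * min 1 (cmod ?v) * exp (pi * \<bar>Im z\<bar>)) \<le> cmod z * cmod (sin (z * complex_of_real pi))"
    using half sin_pi_lower_bound[OF round_Re_bound, of z] by (intro mult_mono) (auto simp: norm_sin_pi_shift)
  ultimately have "(real n / 5 * min 1 (cmod ?v)) * exp (pi * \<bar>Im z\<bar>) \<le> remainder_const * exp (pi * \<bar>Im z\<bar>)" by linarith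
  then have "real n / 5 * min 1 (cmod ?v) \<le> remainder_const" by (rule mult_right_le_imp_le) simp
  then have m: "min 1 (cmod ?v) \<le> 5 * remainder_const / real n" using n1' by (simp add: field_simps)
  also have "5 * remainder_const / real n < 1/2" using n n1' by (simp add: field_simps)
  finally have v: "cmod ?v < 1/2" by linarith
  have "of_int ?k > Re z - 1/2" by (rule of_int_round_gt)
  then have k0: "0 \<le> ?k" using rz by linarith
  have "\<bar>cmod z - real_of_int ?k\<bar> \<le> cmod ?v" using norm_triangle_ineq3[of z "of_int ?k"] k0 by simp
  then have "\<bar>real_of_int ?k - real n\<bar> < 1" using v up lo by linarith
  then have "?k = int n" by linarith
  then have "cmod (z - of_nat n) = cmod ?v" by simp
  also have "\<dots> \<le> 5 * remainder_const / real n" using m v by linarith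
  finally show "cmod (csqrt l - of_nat n) \<le> 5 * remainder_const / real n" by (simp add: z_def)
qed

text \<open>Compare with \<open>cos (z t)\<close> by \<open>solution_estimates\<close>, and then \<open>cos (z t)\<close> with \<open>cos (n t)\<close> by the mean
  value inequality in the strip \<open>|Im v| \<le> \<pi> / 2\<close>, which is convex and on which sine and cosine are
  bounded by \<open>exp (\<pi> / 2)\<close>.\<close>

lemma eigenfunction_estimates:
  assumes n: "10 * remainder_const < real n" and l: "l \<in> zeros n - zeros (n - 1)" and n0: "0 < n" and t: "t \<in> {0..pi}"
  defines "K \<equiv> exp (pi / 2) * (6 + 5 * pi) * remainder_const"
  shows "cmod (y l 0 t - complex_of_real (cos (real n * t))) \<le> K / real n"
    and "cmod (y' l 0 t - complex_of_real (- real n * sin (real n * t))) \<le> K"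
proof -
  define z E \<epsilon> where "z = csqrt l" and "E = exp (pi / 2)" and "\<epsilon> = 5 * remainder_const / real n"
  note loc = zero_localization[OF n l n0, folded z_def]
  have lz: "l = z\<^sup>2" by (simp add: z_def)
  have n1: "1 \<le> real n" using n0 by linarith
  have e: "cmod (z - of_nat n) \<le> \<epsilon>" "0 \<le> \<epsilon>" "\<epsilon> \<le> 1/2"
    using loc(1) n n1 remainder_const_nonneg by (auto simp: \<epsilon>_def field_simps)
  have E0: "0 < E" by (simp add: E_def)
  have m: "\<bar>Im z\<bar> \<le> 1/2" using abs_Im_le_cmod[of "z - of_nat n"] e by simp
  have strip: "exp \<bar>Im v\<bar> \<le> E" if "\<bar>Im v\<bar> \<le> pi / 2" for v using that by (simp add: E_def)
  have mt: "\<bar>Im z\<bar> * t \<le> pi / 2"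
    using mult_mono[OF m, of t pi] t by simp
  have Et: "exp (\<bar>Im z\<bar> * t) \<le> E" using mt by (simp add: E_def)
  let ?a = "z * complex_of_real t" and ?b = "complex_of_real (real n * t)"
  have ab: "cmod (?a - ?b) \<le> pi * \<epsilon>"
  proof -
    have "?a - ?b = (z - of_nat n) * complex_of_real t" by (simp add: algebra_simps)
    then have "cmod (?a - ?b) = cmod (z - of_nat n) * t" using t by (simp add: norm_mult)
    also have "\<dots> \<le> \<epsilon> * pi" using e t by (intro mult_mono) auto
    finally show ?thesis by (simp add: mult.commute)
  qed
  define S where "S = {v::complex. \<bar>Im v\<bar> \<le> pi / 2}"
  have S: "convex S" "?a \<in> S" "?b \<in> S"
  proof -
    have "S = {v. Im v \<le> pi / 2} \<inter> {v. Im v \<ge> - (pi / 2)}" by (auto simp: S_def)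
    then show "convex S" by (simp only: convex_Int convex_halfspace_Im_le convex_halfspace_Im_ge)
    show "?a \<in> S" "?b \<in> S" using mt t by (auto simp: S_def abs_mult)
  qed
  have cosd: "cmod (cos ?a - cos ?b) \<le> E * (pi * \<epsilon>)"
  proof -
    have "cmod (cos ?a - cos ?b) \<le> E * cmod (?a - ?b)"
      by (rule field_differentiable_bound[OF S(1), where f' = "\<lambda>v. - sin v"])
         (use S in \<open>auto intro!: derivative_eq_intros order_trans[OF norm_sin_cos_le(1)] strip simp: S_def\<close>)
    then show ?thesis using mult_left_mono[OF ab, of E] E0 by linarith
  qed
  have sind: "cmod (sin ?a - sin ?b) \<le> E * (pi * \<epsilon>)"
  proof -
    have "cmod (sin ?a - sin ?b) \<le> E * cmod (?a - ?b)"
      by (rule field_differentiable_bound[OF S(1), where f' = cos])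
         (use S in \<open>auto intro!: derivative_eq_intros order_trans[OF norm_sin_cos_le(2)] strip simp: S_def\<close>)
    then show ?thesis using mult_left_mono[OF ab, of E] E0 by linarith
  qed
  note est = solution_estimates[OF loc(2,3) t, folded lz]
  have "cmod (y l 0 t - cos ?a) \<le> 2 * pi * Q / cmod z * E"
    using est(1) mult_left_mono[OF Et, of "2 * pi * Q / cmod z"] Q_nonneg by force
  also have "\<dots> \<le> remainder_const / (real n / 2) * E"
    using loc(4) n1 remainder_const_nonneg E0 Q_nonneg by (intro mult_right_mono frac_le) auto
  finally have "cmod (y l 0 t - cos ?a) \<le> 2 * remainder_const / real n * E" by (simp add: mult_ac)
  moreover have "cmod (y l 0 t - cos ?b) \<le> cmod (y l 0 t - cos ?a) + cmod (cos ?a - cos ?b)"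
    using norm_triangle_ineq[of "y l 0 t - cos ?a" "cos ?a - cos ?b"] by simp
  ultimately have "cmod (y l 0 t - cos ?b) \<le> 2 * remainder_const / real n * E + E * (pi * \<epsilon>)" using cosd by linarith
  also have "\<dots> = E * (2 + 5 * pi) * remainder_const / real n" by (simp add: \<epsilon>_def algebra_simps add_divide_distrib)
  also have "\<dots> \<le> K / real n"
    unfolding K_def E_def[symmetric] using E0 remainder_const_nonneg by (intro divide_right_mono mult_right_mono mult_left_mono) auto
  finally show "cmod (y l 0 t - complex_of_real (cos (real n * t))) \<le> K / real n" unfolding cos_of_real .
  have "cmod (y' l 0 t + z * sin ?a) \<le> 2 * pi * Q * E"
    by (rule order_trans[OF est(2) mult_left_mono[OF Et]]) (use Q_nonneg in simp)
  then have 1: "cmod (y' l 0 t + z * sin ?a) \<le> remainder_const * E"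
    by (rule order_trans[OF _ mult_right_mono[OF remainder_const_nonneg(2)]]) (use E0 in simp)
  have 2: "cmod ((z - of_nat n) * sin ?a) \<le> 5 * remainder_const * E"
  proof -
    have "cmod (sin ?a) \<le> E" using norm_sin_cos_le(1)[of ?a] strip[of ?a] S(2) by (auto simp: S_def)
    then have "cmod ((z - of_nat n) * sin ?a) \<le> \<epsilon> * E" unfolding norm_mult using e by (intro mult_mono) auto
    also have "\<dots> \<le> 5 * remainder_const * E"
    proof (rule mult_right_mono)
      have "\<epsilon> \<le> 5 * remainder_const / 1" unfolding \<epsilon>_def using n1 remainder_const_nonneg by (intro divide_left_mono) auto
      then show "\<epsilon> \<le> 5 * remainder_const" by simp
    qed (use E0 in simp)
    finally show ?thesis .
  qed
  have 3: "cmod (of_nat n * (sin ?a - sin ?b)) \<le> E * pi * 5 * remainder_const"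
  proof -
    have "cmod (of_nat n * (sin ?a - sin ?b)) \<le> real n * (E * (pi * \<epsilon>))"
      unfolding norm_mult norm_of_nat using sind by (intro mult_left_mono) auto
    also have "\<dots> = E * pi * 5 * remainder_const" using n1 by (simp add: \<epsilon>_def)
    finally show ?thesis .
  qed
  have "y' l 0 t - complex_of_real (- real n * sin (real n * t)) = y' l 0 t + of_nat n * sin ?b"
    unfolding sin_of_real by simp
  also have "y' l 0 t + of_nat n * sin ?b = (y' l 0 t + z * sin ?a) - (z - of_nat n) * sin ?a - of_nat n * (sin ?a - sin ?b)"
    by (simp add: algebra_simps)
  also have "cmod \<dots> \<le> remainder_const * E + 5 * remainder_const * E + E * pi * 5 * remainder_const"
    using 1 2 3 norm_triangle_ineq4[of "(y' l 0 t + z * sin ?a) - (z - of_nat n) * sin ?a" "of_nat n * (sin ?a - sin ?b)"]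
      norm_triangle_ineq4[of "y' l 0 t + z * sin ?a" "(z - of_nat n) * sin ?a"] by linarith
  also have "\<dots> = E * (6 + 5 * pi) * remainder_const" by (simp add: algebra_simps)
  also have "\<dots> \<le> K"
    unfolding K_def E_def[symmetric] using E0 remainder_const_nonneg by (intro mult_right_mono mult_left_mono) auto
  finally show "cmod (y' l 0 t - complex_of_real (- real n * sin (real n * t))) \<le> K" .
qed

end

section \<open>Enumeration of the root vectors\<close>

text \<open>Listing \<open>m z\<close> chain members for each \<open>z\<close>, one \<open>z\<close> after the other, puts each chain member
  directly after its predecessor. The second component of \<open>p n\<close> is the position in the chain.\<close>

lemma enumerate_blocks:
  fixes m :: "'a \<Rightarrow> nat"
  assumes "finite Z"
  shows "\<exists>p. bij_betw p {..<\<Sum>z\<in>Z. m z} (SIGMA z:Z. {..<m z}) \<and>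
    (\<forall>n. Suc n < (\<Sum>z\<in>Z. m z) \<longrightarrow> snd (p (Suc n)) = 0 \<or>
       fst (p (Suc n)) = fst (p n) \<and> snd (p (Suc n)) = Suc (snd (p n)))"
  using assms
proof (induction Z rule: finite_induct)
  case empty
  show ?case by (auto simp: bij_betw_def)
next
  case (insert z Z)
  let ?M = "\<Sum>z\<in>Z. m z"
  obtain p where p: "bij_betw p {..<?M} (SIGMA z:Z. {..<m z})"
    and step: "\<And>n. Suc n < ?M \<Longrightarrow> snd (p (Suc n)) = 0 \<or>
       fst (p (Suc n)) = fst (p n) \<and> snd (p (Suc n)) = Suc (snd (p n))"
    using insert.IH by blast
  define p' where "p' n = (if n < ?M then p n else (z, n - ?M))" for n
  have "bij_betw p' {..<?M} (SIGMA z:Z. {..<m z})"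
    using p by (rule bij_betw_cong[THEN iffD1, rotated]) (simp add: p'_def)
  moreover have "bij_betw p' {?M..<?M + m z} ({z} \<times> {..<m z})"
    by (rule bij_betw_byWitness[where f' = "\<lambda>x. ?M + snd x"]) (auto simp: p'_def)
  ultimately have "bij_betw p' ({..<?M} \<union> {?M..<?M + m z}) ((SIGMA z:Z. {..<m z}) \<union> {z} \<times> {..<m z})"
    by (rule bij_betw_combine) (use insert in auto)
  moreover have "{..<?M} \<union> {?M..<?M + m z} = {..<\<Sum>z\<in>insert z Z. m z}"
    using insert by auto
  moreover have "(SIGMA z:Z. {..<m z}) \<union> {z} \<times> {..<m z} = (SIGMA z:insert z Z. {..<m z})" by auto
  ultimately have "bij_betw p' {..<\<Sum>z\<in>insert z Z. m z} (SIGMA z:insert z Z. {..<m z})" by simp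
  moreover have "snd (p' (Suc n)) = 0 \<or> fst (p' (Suc n)) = fst (p' n) \<and> snd (p' (Suc n)) = Suc (snd (p' n))" for n
    using step[of n] by (auto simp: p'_def Suc_diff_le not_less)
  ultimately show ?case by blast
qed

lemma quadratically_closeI:
  assumes "\<And>n. n > N \<Longrightarrow> norm (x n - y n) \<le> C / real n"
  shows "quadratically_close x y"
  unfolding quadratically_close_def
proof (rule summable_comparison_test'[of "\<lambda>n. C\<^sup>2 * inverse (real n ^ 2)" "Suc N"])
  show "summable (\<lambda>n. C\<^sup>2 * inverse (real n ^ 2))"
    by (intro summable_mult inverse_power_summable) auto
  fix n assume "Suc N \<le> n"
  then have "norm (x n - y n) \<le> C / real n" by (intro assms) simp
  then have "(norm (x n - y n))\<^sup>2 \<le> (C / real n)\<^sup>2" by (intro power_mono) auto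
  then show "norm ((norm (x n - y n))\<^sup>2) \<le> C\<^sup>2 * inverse (real n ^ 2)"
    by (simp add: power_divide field_simps)
qed

lemma quadratically_close_sym: "quadratically_close x y \<longleftrightarrow> quadratically_close y x"
  by (simp add: quadratically_close_def norm_minus_commute)

text \<open>Normalizing moves \<open>x\<close> by the distance of its norm from one, which is at most \<open>norm (x - e)\<close>.\<close>

lemma normalize_close:
  assumes e: "norm e = 1"
  shows "norm (x /\<^sub>R norm x - e) \<le> 2 * norm (x - e)"
proof (cases "x = 0")
  case False
  have "x /\<^sub>R norm x - x = (inverse (norm x) - 1) *\<^sub>R x" by (simp add: scaleR_left_diff_distrib)
  then have "norm (x /\<^sub>R norm x - x) = \<bar>inverse (norm x) - 1\<bar> * norm x" by simp
  also have "\<dots> = \<bar>(inverse (norm x) - 1) * norm x\<bar>" by (simp add: abs_mult)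
  also have "(inverse (norm x) - 1) * norm x = norm e - norm x" using False e by (simp add: field_simps)
  also have "\<bar>norm e - norm x\<bar> \<le> norm (x - e)" using norm_triangle_ineq3[of e x] by (simp add: norm_minus_commute)
  finally have "norm (x /\<^sub>R norm x - x) \<le> norm (x - e)" .
  moreover have "norm (x /\<^sub>R norm x - e) \<le> norm (x /\<^sub>R norm x - x) + norm (x - e)"
    using norm_triangle_ineq[of "x /\<^sub>R norm x - x" "x - e"] by simp
  ultimately show ?thesis by linarith
qed (use e in simp)

lemma real_le_sqrt_mu: "real n \<le> sqrt (mu n)"
  by (rule real_le_rsqrt) (simp add: mu_def)

lemma sqrt_mu_le: "0 < n \<Longrightarrow> sqrt (mu n) \<le> 2 * real n"
proof (rule real_le_lsqrt)
  assume "0 < n"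
  then have "1 \<le> (real n)\<^sup>2" by (simp add: Suc_leI)
  then show "mu n \<le> (2 * real n)\<^sup>2" by (simp add: mu_def power_mult_distrib)
qed auto

context sturm_liouville
begin

text \<open>The zeros inside the circle of index \<open>N0\<close> are listed in blocks and use the numbers \<open>0, \<dots>, N0\<close>,
  because their orders add up to \<open>N0 + 1\<close>. From then on, the zero in the \<open>n\<close>-th annulus gets the number \<open>n\<close>.\<close>

lemma spectral_enumeration:
  obtains N0 :: nat and lam :: "nat \<Rightarrow> complex" and k :: "nat \<Rightarrow> nat"
  where "0 < N0" "10 * remainder_const < real N0" "inj (\<lambda>n. (lam n, k n))"
    "range (\<lambda>n. (lam n, k n)) = {(l, j). Delta l = 0 \<and> j < ord l}"
    "\<And>n. k (Suc n) = 0 \<or> lam (Suc n) = lam n \<and> k (Suc n) = Suc (k n)"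
    "\<And>n. n > N0 \<Longrightarrow> lam n \<in> zeros n - zeros (n - 1) \<and> ord (lam n) = 1 \<and> k n = 0"
proof -
  obtain N where "10 * remainder_const < real N" using reals_Archimedean2 by blast
  define N0 where "N0 = Suc N"
  have N0: "0 < N0" "10 * remainder_const < real N0" using \<open>10 * remainder_const < real N\<close> by (auto simp: N0_def)
  have large: "5 * remainder_const < real n + 1/2" if "n \<ge> N0" for n using N0 that remainder_const_nonneg by linarith
  have cnt: "(\<Sum>z\<in>zeros N0. ord z) = Suc N0" using zero_count[OF large[of N0]] by simp
  obtain p where p: "bij_betw p {..<Suc N0} (SIGMA z:zeros N0. {..<ord z})"
    and step: "\<And>n. Suc n < Suc N0 \<Longrightarrow> snd (p (Suc n)) = 0 \<or>
       fst (p (Suc n)) = fst (p n) \<and> snd (p (Suc n)) = Suc (snd (p n))"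
    using enumerate_blocks[OF finite_zeros[of N0], of ord] unfolding cnt by blast
  have "\<exists>l. zeros n - zeros (n - 1) = {l} \<and> ord l = 1" if "n > N0" for n
    using annulus_zero[of "n - 1"] large[of "n - 1"] that by simp
  then obtain L where L: "\<And>n. n > N0 \<Longrightarrow> zeros n - zeros (n - 1) = {L n} \<and> ord (L n) = 1" by metis
  define lam where "lam n = (if n \<le> N0 then fst (p n) else L n)" for n
  define k where "k n = (if n \<le> N0 then snd (p n) else 0)" for n
  have pz: "lam n \<in> zeros N0" "k n < ord (lam n)" "(lam n, k n) = p n" if "n \<le> N0" for n
  proof -
    have "p n \<in> (SIGMA z:zeros N0. {..<ord z})" using bij_betwE[OF p] that by auto
    then show "lam n \<in> zeros N0" "k n < ord (lam n)" "(lam n, k n) = p n"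
      using that by (auto simp: lam_def k_def mem_Times_iff)
  qed
  have Lz: "lam n \<in> zeros n" "lam n \<notin> zeros (n - 1)" "ord (lam n) = 1" "k n = 0" if "n > N0" for n
    using L[OF that] that by (auto simp: lam_def k_def)
  have zb: "lam n \<in> zeros (max n N0)" for n
    using pz(1)[of n] Lz(1)[of n] by (cases "n \<le> N0") (auto simp: max_def)
  have "(lam m, k m) \<noteq> (lam n, k n)" if "m < n" for m n
  proof (cases "n \<le> N0")
    case True
    then show ?thesis using pz(3)[of m] pz(3)[of n] that bij_betw_imp_inj_on[OF p] by (auto dest: inj_onD)
  next
    case False
    then have "max m N0 \<le> n - 1" using that by auto
    then have "lam m \<in> zeros (n - 1)" using zb[of m] zeros_mono by blast
    then show ?thesis using Lz(2)[of n] False by auto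
  qed
  then have inj: "inj (\<lambda>n. (lam n, k n))" by (intro linorder_injI) auto
  have rng: "range (\<lambda>n. (lam n, k n)) = {(l, j). Delta l = 0 \<and> j < ord l}"
  proof (intro equalityI subsetI)
    fix x assume "x \<in> range (\<lambda>n. (lam n, k n))"
    then obtain n where x: "x = (lam n, k n)" by blast
    have "Delta (lam n) = 0" using zb[of n] by (simp add: zeros_def)
    moreover have "k n < ord (lam n)" using pz(2)[of n] Lz(3,4)[of n] by (cases "n \<le> N0") auto
    ultimately show "x \<in> {(l, j). Delta l = 0 \<and> j < ord l}" by (simp add: x)
  next
    fix x assume "x \<in> {(l, j). Delta l = 0 \<and> j < ord l}"
    then obtain l j where x: "x = (l, j)" "Delta l = 0" "j < ord l" by blast
    show "x \<in> range (\<lambda>n. (lam n, k n))"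
    proof (cases "l \<in> zeros N0")
      case True
      then have "x \<in> p ` {..<Suc N0}" using p x by (auto simp: bij_betw_def)
      then obtain n where "n \<le> N0" "x = p n" by (auto simp: less_Suc_eq_le)
      then have "x = (lam n, k n)" using pz(3)[of n] by simp
      then show ?thesis by (rule range_eqI)
    next
      case False
      obtain M where M: "cmod l < real M" using reals_Archimedean2 by blast
      have "real M \<le> (real M + 1/2)\<^sup>2" by (simp add: power2_eq_square algebra_simps)
      then have "l \<in> zeros M" using M x(2) by (simp add: zeros_def)
      then have lM: "l \<in> zeros (N0 + M)" using zeros_mono[of M "N0 + M"] by auto
      (* The first circle that encloses l determines the annulus of l. *)
      define n where "n = (LEAST n. n \<ge> N0 \<and> l \<in> zeros n)"
      have n: "n \<ge> N0 \<and> l \<in> zeros n" unfolding n_def by (rule LeastI[of _ "N0 + M"]) (simp add: lM)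
      then have nN: "n > N0" using False by (metis le_neq_implies_less)
      have "\<not> (n - 1 \<ge> N0 \<and> l \<in> zeros (n - 1))"
      proof (rule not_less_Least)
        show "n - 1 < (LEAST n. n \<ge> N0 \<and> l \<in> zeros n)" using nN unfolding n_def[symmetric] by simp
      qed
      then have "l \<in> zeros n - zeros (n - 1)" using n nN by auto
      then have "l = lam n" using L[OF nN] nN by (auto simp: lam_def)
      moreover from this have "j = k n" using x(3) Lz(3,4)[OF nN] by simp
      ultimately show ?thesis using x(1) by blast
    qed
  qed
  show ?thesis
  proof (rule that[OF N0 inj rng])
    show "k (Suc n) = 0 \<or> lam (Suc n) = lam n \<and> k (Suc n) = Suc (k n)" for n
      using step[of n] by (auto simp: lam_def k_def)
    show "lam n \<in> zeros n - zeros (n - 1) \<and> ord (lam n) = 1 \<and> k n = 0" if "n > N0" for n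
      using Lz[OF that] by blast
  qed
qed

section \<open>Bari bases of root vectors\<close>

lemma root_fun_has_weak_derivative: "has_weak_derivative (root_fun l j) (abs_L2pi (y' l j))"
  unfolding root_fun_def
  by (rule has_weak_derivative_continuous_prim[OF square_integrable_y(2)])
     (use cauchy_y[of l j] in \<open>auto simp: cauchy_def\<close>)

text \<open>All members of a chain are divided by the norm of its eigenvector, so that they remain a chain and
  the eigenvector is normalized.\<close>

theorem root_vector_basis:
  "\<exists>(lam :: nat \<Rightarrow> complex) (phi :: nat \<Rightarrow> H1pi).
        normalized_root_vector_pairs bvp_dom bvp_op lam (\<lambda>n. H1_to_L2 (phi n)) \<and>
        (\<exists>n0>0. \<forall>n>n0. simple_eigenvalue bvp_dom bvp_op (lam n)) \<and>
        bari_basis (\<lambda>n. H1_to_L2 (phi n)) \<and>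
        quadratically_close (\<lambda>n. H1_to_L2 (psi n)) (\<lambda>n. H1_to_L2 (phi n)) \<and>
        bari_basis (\<lambda>n. phi n /\<^sub>R sqrt (mu n)) \<and>
        quadratically_close (\<lambda>n. psi n /\<^sub>R sqrt (mu n)) (\<lambda>n. phi n /\<^sub>R sqrt (mu n)) \<and>
        (\<lambda>n. sqrt (cmod (lam n)) / sqrt (mu n)) \<longlonglongrightarrow> 1 \<and>
        (\<lambda>n. sqrt (cmod (lam n)) / norm (phi n)) \<longlonglongrightarrow> 1 \<and>
        quadratically_close (\<lambda>n. phi n /\<^sub>R norm (phi n)) (\<lambda>n. psi n /\<^sub>R sqrt (mu n)) \<and>
        (\<lambda>n. lam n / complex_of_real (mu n)) \<longlonglongrightarrow> 1"
proof -
  obtain N0 lam k where N0: "0 < N0" "10 * remainder_const < real N0" and inj: "inj (\<lambda>n. (lam n, k n))"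
    and rng: "range (\<lambda>n. (lam n, k n)) = {(l, j). Delta l = 0 \<and> j < ord l}"
    and step: "\<And>n. k (Suc n) = 0 \<or> lam (Suc n) = lam n \<and> k (Suc n) = Suc (k n)"
    and tail: "\<And>n. n > N0 \<Longrightarrow> lam n \<in> zeros n - zeros (n - 1) \<and> ord (lam n) = 1 \<and> k n = 0"
    by (rule spectral_enumeration, rule that)
  have D: "Delta (lam n) = 0" and ko: "k n < ord (lam n)" for n
    using rng rangeI[of "\<lambda>n. (lam n, k n)" n] by auto
  have surj: "\<exists>n. lam n = l \<and> k n = j" if "Delta l = 0" "j < ord l" for l j
  proof -
    have "(l, j) \<in> range (\<lambda>n. (lam n, k n))" unfolding rng using that by simp
    then show ?thesis by auto
  qed
  define a where "a n = complex_of_real (1 / norm (root_fun (lam n) 0))" for n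
  have e0: "0 < norm (root_fun l 0)" for l using root_fun_nonzero by simp
  have a0: "a n \<noteq> 0" for n using e0[of "lam n"] by (simp add: a_def)
  define f where "f n = a n *\<^sub>C root_fun (lam n) (k n)" for n
  have omega: "c n = 0" if "(\<lambda>n. c n *\<^sub>C f n) sums 0" for c n
    by (rule root_vectors_omega_independent[OF D Delta_coeff_ord_nonzero ko inj a0 that[unfolded f_def]])
  have fin_indep: "c n = 0" if "(\<Sum>n\<in>A. c n *\<^sub>C f n) = 0" "finite A" "n \<in> A" for c A n
  proof -
    have "(\<lambda>n. (if n \<in> A then c n else 0) *\<^sub>C f n) sums (\<Sum>n\<in>A. (if n \<in> A then c n else 0) *\<^sub>C f n)"
      by (rule sums_finite[OF that(2)]) (simp add: complex_vector.scale_zero_left)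
    also have "(\<Sum>n\<in>A. (if n \<in> A then c n else 0) *\<^sub>C f n) = 0"
      using that(1) by (simp cong: sum.cong)
    finally show ?thesis using omega[of "\<lambda>n. if n \<in> A then c n else 0" n] that(3) by simp
  qed
  have f0: "f n \<noteq> 0" for n
    using fin_indep[of "\<lambda>_. 1" "{n}" n] by (auto simp: scaleC_one)
  have inj_f: "inj f"
  proof (rule injI, rule ccontr)
    fix m n assume "f m = f n" "m \<noteq> n"
    then have "(\<Sum>i\<in>{m, n}. (if i = m then 1 else -1) *\<^sub>C f i) = 0"
      by (simp add: scaleC_one)
    from fin_indep[OF this, of m] show False by simp
  qed
  have indep: "\<not> cdependent (f ` A)" if A: "finite A" for A
  proof
    assume "cdependent (f ` A)"
    then obtain u v where u: "v \<in> f ` A" "u v \<noteq> 0" "(\<Sum>v\<in>f ` A. u v *\<^sub>C v) = 0"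
      using complex_vector.dependent_finite[of "f ` A"] A by auto
    from u(3) have "(\<Sum>n\<in>A. u (f n) *\<^sub>C f n) = 0"
      using inj_f by (subst (asm) sum.reindex) (auto simp: inj_on_def)
    from fin_indep[OF this A] u show False by auto
  qed
  have fe: "root_fun l j = complex_of_real (norm (root_fun l 0)) *\<^sub>C f n" if "lam n = l" "k n = j" for l j n
    using e0[of l] that by (simp add: f_def a_def scaleC_scaleC scaleC_one)
  have root: "root_space bvp_dom bvp_op l = cspan (f ` {n. lam n = l})" if l: "Delta l = 0" for l
  proof -
    have "cspan (root_fun l ` {..<ord l}) = cspan (f ` {n. lam n = l})"
    proof (intro equalityI complex_vector.span_minimal complex_vector.subspace_span)
      show "root_fun l ` {..<ord l} \<subseteq> cspan (f ` {n. lam n = l})"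
      proof
        fix x assume "x \<in> root_fun l ` {..<ord l}"
        then obtain j where j: "j < ord l" "x = root_fun l j" by auto
        from surj[OF l j(1)] obtain n where n: "lam n = l" "k n = j" by blast
        show "x \<in> cspan (f ` {n. lam n = l})"
          unfolding j(2) fe[OF n] by (intro complex_vector.span_scale complex_vector.span_base) (use n in auto)
      qed
      show "f ` {n. lam n = l} \<subseteq> cspan (root_fun l ` {..<ord l})"
      proof -
        have "f n \<in> cspan (root_fun l ` {..<ord l})" if "lam n = l" for n
          unfolding f_def by (intro complex_vector.span_scale complex_vector.span_base) (use ko[of n] that in auto)
        then show ?thesis by auto
      qed
    qed
    then show ?thesis by (simp add: root_space_eq_span[OF Delta_coeff_ord_nonzero l])
  qed
  have block: "bij_betw k {n. lam n = l} {..<ord l}" if l: "Delta l = 0" for l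
  proof (rule bij_betw_imageI)
    show "inj_on k {n. lam n = l}" using inj by (auto simp: inj_on_def dest: injD)
    show "k ` {n. lam n = l} = {..<ord l}" using ko surj[OF l] by force
  qed
  have finA: "finite {n. lam n = l}" and cardA: "card {n. lam n = l} = ord l" if l: "Delta l = 0" for l
    using bij_betw_finite[OF block[OF l]] bij_betw_same_card[OF block[OF l]] by auto
  have mult: "alg_mult bvp_dom bvp_op l = ord l" if l: "Delta l = 0" for l
  proof -
    have "cdim (cspan (f ` {n. lam n = l})) = card (f ` {n. lam n = l})"
      by (rule complex_vector.dim_span_eq_card_independent[OF indep[OF finA[OF l]]])
    also have "\<dots> = ord l" using inj_f cardA[OF l] by (subst card_image) (auto simp: inj_on_def)
    finally show ?thesis by (simp add: alg_mult_def root[OF l])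
  qed
  have finite_mult: "finite_alg_mult bvp_dom bvp_op l" if l: "Delta l = 0" for l
    unfolding finite_alg_mult_def root[OF l] using finA[OF l] by blast
  have range_lam: "range lam = {l. Delta l = 0}"
  proof -
    have "l \<in> range lam" if "Delta l = 0" for l
      using surj[OF that ord_positive[OF that]] by auto
    then show ?thesis using D by auto
  qed
  have fd: "f n \<in> bvp_dom" "bvp_op (f n) - lam n *\<^sub>C f n = (if k n = 0 then 0 else a n *\<^sub>C root_fun (lam n) (k n - 1))" for n
  proof -
    note ch = root_fun_chain[OF ko[of n]]
    note lin = bvp_linear[OF zero_in_bvp_dom(1) ch(1), of "a n"]
    show "f n \<in> bvp_dom" using lin(1) by (simp add: f_def)
    have "bvp_op (f n) - lam n *\<^sub>C f n = a n *\<^sub>C (bvp_op (root_fun (lam n) (k n)) - lam n *\<^sub>C root_fun (lam n) (k n))"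
      using lin(2) by (simp add: f_def zero_in_bvp_dom complex_vector.scale_right_diff_distrib scaleC_scaleC mult.commute)
    then show "bvp_op (f n) - lam n *\<^sub>C f n = (if k n = 0 then 0 else a n *\<^sub>C root_fun (lam n) (k n - 1))"
      by (simp add: ch(2) complex_vector.scale_zero_right)
  qed
  have eig_iff: "eigenvector bvp_dom bvp_op (lam n) (f n) \<longleftrightarrow> k n = 0" for n
  proof -
    have "a n *\<^sub>C root_fun (lam n) (k n - 1) \<noteq> 0"
    proof -
      have "k n - 1 < ord (lam n)" using ko[of n] by simp
      from surj[OF D this] obtain m where m: "lam m = lam n" "k m = k n - 1" by blast
      have "a n *\<^sub>C root_fun (lam n) (k n - 1) = f m" by (simp add: f_def m a_def)
      then show ?thesis using f0 by simp
    qed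
    then show ?thesis
      using fd[of n] f0[of n] by (auto simp: eigenvector_def split: if_splits)
  qed
  have rvp: "root_vector_pairs bvp_dom bvp_op lam f"
    unfolding root_vector_pairs_def
  proof (intro conjI allI ballI)
    show "countable (spectrum bvp_dom bvp_op)"
      unfolding spectrum_bvp range_lam[symmetric] by simp
    show "range lam = spectrum bvp_dom bvp_op" by (simp add: spectrum_bvp range_lam)
    fix z assume "z \<in> spectrum bvp_dom bvp_op"
    then have z: "Delta z = 0" by (simp add: spectrum_bvp)
    show "\<exists>u. eigenvector bvp_dom bvp_op z u" using root_fun_eigenvector[OF z] by blast
    show "finite_alg_mult bvp_dom bvp_op z" by (rule finite_mult[OF z])
  next
    fix m
    show "card {n. lam n = lam m} = alg_mult bvp_dom bvp_op (lam m)" using cardA[OF D] mult[OF D] by simp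
    show "\<not> cdependent (f ` {n. lam n = lam m})" by (rule indep[OF finA[OF D]])
    show "cspan (f ` {n. lam n = lam m}) = root_space bvp_dom bvp_op (lam m)" by (simp add: root[OF D])
  next
    fix n
    show "eigenvector bvp_dom bvp_op (lam (Suc n)) (f (Suc n)) \<or>
        f (Suc n) \<in> bvp_dom \<and> bvp_op (f (Suc n)) - lam (Suc n) *\<^sub>C f (Suc n) = f n"
    proof (cases "k (Suc n) = 0")
      case False
      then have "lam (Suc n) = lam n" "k (Suc n) = Suc (k n)" using step[of n] by auto
      then show ?thesis using fd[of "Suc n"] by (simp add: f_def a_def)
    qed (simp add: eig_iff)
  qed
  have norm1: "norm (f n) = 1" if "k n = 0" for n
    using e0[of "lam n"] that by (simp add: f_def a_def norm_scaleC norm_divide)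
  define phi where "phi n = L2_to_H1 (f n)" for n
  have wd_f: "has_weak_derivative (f n) (a n *\<^sub>C abs_L2pi (y' (lam n) (k n)))" for n
    unfolding f_def by (rule has_weak_derivative_scaleC[OF root_fun_has_weak_derivative])
  have phi: "H1_to_L2 (phi n) = f n" "H1_deriv (phi n) = a n *\<^sub>C abs_L2pi (y' (lam n) (k n))" for n
    using L2_to_H1_weak[OF wd_f] by (simp_all add: phi_def)
  have normalized: "normalized_root_vector_pairs bvp_dom bvp_op lam (\<lambda>n. H1_to_L2 (phi n))"
    unfolding normalized_root_vector_pairs_def phi using rvp by (auto simp: eig_iff norm1)
  have simple: "simple_eigenvalue bvp_dom bvp_op (lam n)" if "n > N0" for n
    unfolding simple_eigenvalue_def
    using root_fun_eigenvector[OF D[of n]] finite_mult[OF D[of n]] mult[OF D[of n]] tail[OF that] by auto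
  define K where "K = exp (pi / 2) * (6 + 5 * pi) * remainder_const"
  have K0: "0 \<le> K" using remainder_const_nonneg by (simp add: K_def)
  define \<kappa> where "\<kappa> = sqrt 2 * K"
  have k0: "0 \<le> \<kappa>" using K0 by (simp add: \<kappa>_def)
  obtain N1' where N1': "2 * \<kappa> < real N1'" using reals_Archimedean2 by blast
  define N1 where "N1 = max N0 N1'"
  have est: "norm (H1_to_L2 (phi n) - H1_to_L2 (psi n)) \<le> 8 * \<kappa> / real n \<and> norm (phi n - psi n) \<le> 8 * \<kappa>"
    if n: "n > N1" for n
  proof -
    have nN0: "n > N0" and n2: "2 * \<kappa> < real n" using n N1' by (auto simp: N1_def)
    have n1: "1 \<le> real n" "0 < n" using nN0 by auto
    let ?l = "lam n"
    have lz: "?l \<in> zeros n - zeros (n - 1)" and kn: "k n = 0" using tail[OF nN0] by auto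
    have large_n: "10 * remainder_const < real n" using N0 nN0 by simp
    note ee = eigenfunction_estimates[OF large_n lz n1(2), folded K_def]
    define s where "s = complex_of_real (sqrt (2 / pi))"
    have s: "cmod s = sqrt (2 / pi)" by (simp add: s_def)
    have s0: "s \<noteq> 0" by (simp add: s_def)
    (* The eigenfunction scaled like the cosine; dividing by its norm, which is close to one, gives phi n. *)
    define X where "X = s *\<^sub>C L2_to_H1 (root_fun ?l 0)"
    have X: "H1_to_L2 X = s *\<^sub>C root_fun ?l 0" "H1_deriv X = s *\<^sub>C abs_L2pi (y' ?l 0)"
      using L2_to_H1_weak[OF root_fun_has_weak_derivative] by (simp_all add: X_def H1_to_L2_scaleC H1_deriv_scaleC)
    have psi_s: "psi_fun n t = s * complex_of_real (cos (real n * t))"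
      "dpsi_fun n t = s * complex_of_real (- real n * sin (real n * t))" for t
      using n1(2) by (simp_all add: psi_fun_def dpsi_fun_def s_def)
    have L2: "norm (H1_to_L2 X - H1_to_L2 (psi n)) \<le> \<kappa> / real n"
    proof -
      have "H1_to_L2 X - H1_to_L2 (psi n) = abs_L2pi (\<lambda>t. s * y ?l 0 t - psi_fun n t)"
        by (simp add: X H1_psi root_fun_def abs_L2pi_scaleC abs_L2pi_diff square_integrable_y square_integrable_scale square_integrable_psi_fun)
      also have "norm \<dots> \<le> sqrt pi * (sqrt (2 / pi) * (K / real n))"
      proof (rule norm_abs_L2pi_le)
        fix t assume "t \<in> {0<..<pi}"
        then have "cmod (y ?l 0 t - complex_of_real (cos (real n * t))) \<le> K / real n" by (intro ee(1)) auto
        then have "cmod s * cmod (y ?l 0 t - complex_of_real (cos (real n * t))) \<le> sqrt (2 / pi) * (K / real n)"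
          unfolding s by (intro mult_left_mono) auto
        then show "cmod (s * y ?l 0 t - psi_fun n t) \<le> sqrt (2 / pi) * (K / real n)"
          by (simp only: psi_s norm_mult[symmetric] right_diff_distrib)
      qed (use K0 n1 in \<open>auto intro!: square_integrable_diff square_integrable_scale square_integrable_y square_integrable_psi_fun\<close>)
      also have "\<dots> = \<kappa> / real n" by (simp add: \<kappa>_def real_sqrt_divide)
      finally show ?thesis .
    qed
    have H1: "norm (H1_deriv X - H1_deriv (psi n)) \<le> \<kappa>"
    proof -
      have "H1_deriv X - H1_deriv (psi n) = abs_L2pi (\<lambda>t. s * y' ?l 0 t - dpsi_fun n t)"
        by (simp add: X H1_psi abs_L2pi_scaleC abs_L2pi_diff square_integrable_y square_integrable_scale square_integrable_psi_fun)
      also have "norm \<dots> \<le> sqrt pi * (sqrt (2 / pi) * K)"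
      proof (rule norm_abs_L2pi_le)
        fix t assume "t \<in> {0<..<pi}"
        then have "cmod (y' ?l 0 t - complex_of_real (- real n * sin (real n * t))) \<le> K" by (intro ee(2)) auto
        then have "cmod s * cmod (y' ?l 0 t - complex_of_real (- real n * sin (real n * t))) \<le> sqrt (2 / pi) * K"
          unfolding s by (intro mult_left_mono) auto
        then show "cmod (s * y' ?l 0 t - dpsi_fun n t) \<le> sqrt (2 / pi) * K"
          by (simp only: psi_s norm_mult[symmetric] right_diff_distrib)
      qed (use K0 in \<open>auto intro!: square_integrable_diff square_integrable_scale square_integrable_y square_integrable_psi_fun\<close>)
      also have "\<dots> = \<kappa>" by (simp add: \<kappa>_def real_sqrt_divide)
      finally show ?thesis .
    qed
    define \<alpha> where "\<alpha> = norm (H1_to_L2 X)"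
    have \<eta>: "\<kappa> / real n \<le> 1/2" using n2 n1 by (simp add: field_simps)
    have \<alpha>1: "\<bar>\<alpha> - 1\<bar> \<le> \<kappa> / real n"
      using norm_triangle_ineq3[of "H1_to_L2 X" "H1_to_L2 (psi n)"] L2 by (simp add: \<alpha>_def norm_psi)
    then have \<alpha>h: "1/2 \<le> \<alpha>" using \<eta> by linarith
    have phiX: "phi n = X /\<^sub>R \<alpha>"
    proof -
      have "H1_to_L2 (phi n) = H1_to_L2 (X /\<^sub>R \<alpha>)"
      proof -
        have "\<alpha> = sqrt (2 / pi) * norm (root_fun ?l 0)" by (simp add: \<alpha>_def X norm_scaleC s)
        then have "complex_of_real (inverse \<alpha>) * s = a n" using s0 e0[of ?l] by (simp add: s_def a_def field_simps)
        then have "H1_to_L2 (X /\<^sub>R \<alpha>) = a n *\<^sub>C root_fun ?l 0"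
          by (simp only: scaleR_scaleC H1_to_L2_scaleC X scaleC_scaleC)
        then show ?thesis by (simp add: phi f_def kn)
      qed
      then show ?thesis by (simp only: H1_to_L2_inject)
    qed
    have L2': "norm (H1_to_L2 (phi n) - H1_to_L2 (psi n)) \<le> 2 * (\<kappa> / real n)"
    proof -
      have "H1_to_L2 (phi n) = H1_to_L2 X /\<^sub>R norm (H1_to_L2 X)" by (simp add: phiX H1_to_L2_scaleR \<alpha>_def)
      then show ?thesis using normalize_close[of "H1_to_L2 (psi n)" "H1_to_L2 X"] L2 by (simp add: norm_psi)
    qed
    have "norm (X - psi n) \<le> \<kappa> + \<kappa> / real n"
      using norm_H1_le[of "X - psi n"] L2 H1 by (simp add: H1_deriv_diff H1_to_L2_diff)
    also have "\<kappa> / real n \<le> \<kappa> / 1" using n1 k0 by (intro divide_left_mono) auto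
    finally have Xp: "norm (X - psi n) \<le> 2 * \<kappa>" by simp
    have "phi n - psi n = (X - psi n) /\<^sub>R \<alpha> + (inverse \<alpha> - 1) *\<^sub>R psi n"
      by (simp add: phiX scaleR_right_diff_distrib scaleR_left_diff_distrib)
    then have "norm (phi n - psi n) \<le> inverse \<alpha> * norm (X - psi n) + \<bar>inverse \<alpha> - 1\<bar> * sqrt (mu n)"
      using norm_triangle_ineq[of "(X - psi n) /\<^sub>R \<alpha>" "(inverse \<alpha> - 1) *\<^sub>R psi n"] \<alpha>h by (simp add: norm_psi)
    (* The normalization error is O(1/n) times the norm of psi n in H1, which is at most 2 n. *)
    also have "\<dots> \<le> 2 * (2 * \<kappa>) + (2 * (\<kappa> / real n)) * (2 * real n)"
    proof (intro add_mono mult_mono)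
      show i2: "inverse \<alpha> \<le> 2" using \<alpha>h by (simp add: inverse_eq_divide field_simps)
      have "\<bar>inverse \<alpha> - 1\<bar> = inverse \<alpha> * \<bar>\<alpha> - 1\<bar>"
        using \<alpha>h by (simp add: abs_mult_pos'[symmetric] abs_minus_commute field_simps)
      also have "\<dots> \<le> 2 * (\<kappa> / real n)" using i2 \<alpha>1 \<alpha>h by (intro mult_mono) auto
      finally show "\<bar>inverse \<alpha> - 1\<bar> \<le> 2 * (\<kappa> / real n)" .
    qed (use Xp k0 sqrt_mu_le[OF n1(2)] mu_pos[of n] in auto)
    also have "\<dots> = 8 * \<kappa>" using n1 by simp
    finally have H1': "norm (phi n - psi n) \<le> 8 * \<kappa>" .
    have "2 * (\<kappa> / real n) \<le> 8 * \<kappa> / real n" using k0 n1 by (simp add: field_simps)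
    then show ?thesis using L2' H1' by linarith
  qed
  have qc_L2: "quadratically_close (\<lambda>n. H1_to_L2 (phi n)) (\<lambda>n. H1_to_L2 (psi n))"
    by (rule quadratically_closeI[of N1]) (use est in blast)
  have scaled: "norm (phi n /\<^sub>R sqrt (mu n) - psi n /\<^sub>R sqrt (mu n)) \<le> 8 * \<kappa> / real n" if "n > N1" for n
  proof -
    have "norm (phi n /\<^sub>R sqrt (mu n) - psi n /\<^sub>R sqrt (mu n)) = norm (phi n - psi n) / sqrt (mu n)"
      using mu_pos[of n] by (simp add: scaleR_right_diff_distrib[symmetric] divide_inverse mult.commute)
    also have "\<dots> \<le> 8 * \<kappa> / real n"
      using est[OF that] real_le_sqrt_mu[of n] that k0 by (intro frac_le) auto
    finally show ?thesis .
  qed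
  have qc_H1: "quadratically_close (\<lambda>n. phi n /\<^sub>R sqrt (mu n)) (\<lambda>n. psi n /\<^sub>R sqrt (mu n))"
    by (rule quadratically_closeI[of N1]) (use scaled in blast)
  have bari_L2: "bari_basis (\<lambda>n. H1_to_L2 (phi n))"
    by (rule Bari[OF orthonormal_basis_psi_L2 qc_L2]) (simp add: phi omega)
  have bari_H1: "bari_basis (\<lambda>n. phi n /\<^sub>R sqrt (mu n))"
  proof (rule Bari[OF orthonormal_basis_psi_H1 qc_H1])
    fix c :: "nat \<Rightarrow> complex" and n
    assume "(\<lambda>n. c n *\<^sub>C (phi n /\<^sub>R sqrt (mu n))) sums 0"
    from bounded_linear.sums[OF bounded_linear_H1_to_L2 this]
    have "(\<lambda>n. (c n * complex_of_real (inverse (sqrt (mu n)))) *\<^sub>C f n) sums 0"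
      by (simp add: H1_to_L2_scaleC scaleR_scaleC phi scaleC_scaleC zero_H1pi.rep_eq)
    from omega[OF this, of n] show "c n = 0" using mu_pos[of n] by simp
  qed
  have lam_lim: "(\<lambda>n. lam n / complex_of_real (mu n)) \<longlonglongrightarrow> 1"
  proof -
    have r0: "(\<lambda>n. 1 / real n) \<longlonglongrightarrow> 0" by (rule lim_1_over_n)
    have "(\<lambda>n. csqrt (lam n) / of_nat n - 1) \<longlonglongrightarrow> 0"
    proof (rule Lim_null_comparison)
      show "\<forall>\<^sub>F n in sequentially. norm (csqrt (lam n) / of_nat n - 1) \<le> 5 * remainder_const * (1 / real n)"
      proof (rule eventually_mono[OF eventually_gt_at_top[of N0]])
        fix n assume n: "n > N0"
        have n0: "1 \<le> real n" "0 < n" using n by auto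
        have "cmod (csqrt (lam n) - of_nat n) \<le> 5 * remainder_const / real n"
          by (rule zero_localization(1)) (use N0 n tail[OF n] in auto)
        then have "cmod (csqrt (lam n) - of_nat n) / real n \<le> (5 * remainder_const / real n) / real n"
          by (rule divide_right_mono) simp
        also have "\<dots> \<le> (5 * remainder_const / real n) / 1"
          using n0 remainder_const_nonneg by (intro divide_left_mono) auto
        finally have "cmod (csqrt (lam n) - of_nat n) / real n \<le> 5 * remainder_const * (1 / real n)" by simp
        moreover have "csqrt (lam n) / of_nat n - 1 = (csqrt (lam n) - of_nat n) / of_nat n"
          using n0 by (simp add: diff_divide_distrib)
        ultimately show "norm (csqrt (lam n) / of_nat n - 1) \<le> 5 * remainder_const * (1 / real n)"
          by (simp add: norm_divide)
      qed
      show "(\<lambda>n. 5 * remainder_const * (1 / real n)) \<longlonglongrightarrow> 0" using tendsto_mult_right_zero[OF r0] by blast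
    qed
    then have z1: "(\<lambda>n. csqrt (lam n) / of_nat n) \<longlonglongrightarrow> 1" by (rule LIM_zero_cancel)
    have "(\<lambda>n. 1 / (1 + (1 / real n)\<^sup>2)) \<longlonglongrightarrow> 1 / (1 + 0\<^sup>2)"
      by (intro tendsto_intros r0) simp
    then have "(\<lambda>n. complex_of_real (1 / (1 + (1 / real n)\<^sup>2))) \<longlonglongrightarrow> complex_of_real (1 / (1 + 0\<^sup>2))"
      by (rule tendsto_of_real)
    from tendsto_mult[OF tendsto_power[OF z1, of 2] this]
    have "(\<lambda>n. (csqrt (lam n) / of_nat n)\<^sup>2 * complex_of_real (1 / (1 + (1 / real n)\<^sup>2))) \<longlonglongrightarrow> 1" by simp
    moreover have "\<forall>\<^sub>F n in sequentially. (csqrt (lam n) / of_nat n)\<^sup>2 * complex_of_real (1 / (1 + (1 / real n)\<^sup>2))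
        = lam n / complex_of_real (mu n)"
    proof (rule eventually_mono[OF eventually_gt_at_top[of 0]])
      fix n :: nat assume n: "0 < n"
      have "1 / (1 + (1 / real n)\<^sup>2) = (real n)\<^sup>2 / mu n"
        using n by (simp add: mu_def field_simps power2_eq_square)
      then show "(csqrt (lam n) / of_nat n)\<^sup>2 * complex_of_real (1 / (1 + (1 / real n)\<^sup>2)) = lam n / complex_of_real (mu n)"
        using n by (simp add: power_divide)
    qed
    ultimately show ?thesis by (rule Lim_transform_eventually)
  qed
  have sq_lim: "(\<lambda>n. sqrt (cmod (lam n)) / sqrt (mu n)) \<longlonglongrightarrow> 1"
  proof -
    have "(\<lambda>n. sqrt (cmod (lam n / complex_of_real (mu n)))) \<longlonglongrightarrow> sqrt (cmod 1)"
      by (intro tendsto_real_sqrt tendsto_norm lam_lim)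
    then show ?thesis using mu_pos by (simp add: norm_divide real_sqrt_divide abs_of_pos)
  qed
  have n_lim: "(\<lambda>n. norm (phi n) / sqrt (mu n)) \<longlonglongrightarrow> 1"
  proof (rule LIM_zero_cancel, rule Lim_null_comparison)
    show "\<forall>\<^sub>F n in sequentially. norm (norm (phi n) / sqrt (mu n) - 1) \<le> 8 * \<kappa> * (1 / real n)"
    proof (rule eventually_mono[OF eventually_gt_at_top[of N1]])
      fix n assume n: "n > N1"
      have "norm (norm (phi n) / sqrt (mu n) - 1) = \<bar>norm (phi n /\<^sub>R sqrt (mu n)) - norm (psi n /\<^sub>R sqrt (mu n))\<bar>"
        using mu_pos[of n] by (simp add: norm_psi divide_inverse mult.commute)
      also have "\<dots> \<le> 8 * \<kappa> / real n" by (rule order_trans[OF norm_triangle_ineq3 scaled[OF n]])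
      finally show "norm (norm (phi n) / sqrt (mu n) - 1) \<le> 8 * \<kappa> * (1 / real n)" by simp
    qed
    show "(\<lambda>n. 8 * \<kappa> * (1 / real n)) \<longlonglongrightarrow> 0" using tendsto_mult_right_zero[OF lim_1_over_n] by blast
  qed
  have sq_lim2: "(\<lambda>n. sqrt (cmod (lam n)) / norm (phi n)) \<longlonglongrightarrow> 1"
  proof -
    have "(\<lambda>n. (sqrt (cmod (lam n)) / sqrt (mu n)) / (norm (phi n) / sqrt (mu n))) \<longlonglongrightarrow> 1 / 1"
      by (intro tendsto_divide sq_lim n_lim) simp
    moreover have "(sqrt (cmod (lam n)) / sqrt (mu n)) / (norm (phi n) / sqrt (mu n)) = sqrt (cmod (lam n)) / norm (phi n)" for n
      using mu_pos[of n] by simp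
    ultimately show ?thesis by (simp only: div_by_1)
  qed
  have qc_norm: "quadratically_close (\<lambda>n. phi n /\<^sub>R norm (phi n)) (\<lambda>n. psi n /\<^sub>R sqrt (mu n))"
  proof (rule quadratically_closeI[of N1 _ _ "16 * \<kappa>"])
    fix n assume n: "n > N1"
    let ?x = "phi n /\<^sub>R sqrt (mu n)"
    have "norm (psi n /\<^sub>R sqrt (mu n)) = 1" using mu_pos[of n] by (simp add: norm_psi)
    from normalize_close[OF this, of ?x]
    have "norm (?x /\<^sub>R norm ?x - psi n /\<^sub>R sqrt (mu n)) \<le> 2 * (8 * \<kappa> / real n)" using scaled[OF n] by simp
    moreover have "?x /\<^sub>R norm ?x = phi n /\<^sub>R norm (phi n)"
      using mu_pos[of n] by (simp add: field_simps)
    ultimately show "norm (phi n /\<^sub>R norm (phi n) - psi n /\<^sub>R sqrt (mu n)) \<le> 16 * \<kappa> / real n"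
      by (simp only:)
  qed
  show ?thesis
    using normalized simple N0(1) bari_L2 qc_L2 bari_H1 qc_H1 sq_lim sq_lim2 qc_norm lam_lim
      quadratically_close_sym[of "\<lambda>n. H1_to_L2 (phi n)"] quadratically_close_sym[of "\<lambda>n. phi n /\<^sub>R sqrt (mu n)"]
    by (intro exI[of _ lam] exI[of _ phi] conjI) auto
qed

end

section \<open>The eigenvalue problem of the theorem\<close>

lemma potential_essentially_bounded:
  assumes "essentially_bounded nn"
  shows "essentially_bounded (potential r1 r2 \<omega> nn)"
proof -
  obtain C where m: "nn \<in> borel_measurable Mpi" and C: "AE t in Mpi. \<bar>nn t\<bar> \<le> C"
    using assms by (auto simp: essentially_bounded_def)
  let ?d = "delta r1 r2" and ?c = "\<omega>\<^sup>2 * r1\<^sup>2 * (delta r1 r2)\<^sup>2"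
  have em: "(\<lambda>t. exp (2 * ?d * t)) \<in> borel_measurable Mpi"
    by (rule continuous_imp_measurable_on_sets_lebesgue) (auto intro!: continuous_intros)
  have "potential r1 r2 \<omega> nn \<in> borel_measurable Mpi"
    unfolding potential_def[abs_def] using em m by measurable
  moreover have "AE t in Mpi. t \<in> {0<..<pi}" by (rule AE_I2) simp
  then have "AE t in Mpi. \<bar>potential r1 r2 \<omega> nn t\<bar> \<le> ?c * exp (2 * \<bar>?d\<bar> * pi) * C"
    using C
  proof eventually_elim
    fix t assume t: "t \<in> {0<..<pi}" and C: "\<bar>nn t\<bar> \<le> C"
    have "?d * t \<le> \<bar>?d\<bar> * t" using t by (intro mult_right_mono) auto
    also have "\<dots> \<le> \<bar>?d\<bar> * pi" using t by (intro mult_left_mono) auto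
    finally have "exp (2 * ?d * t) \<le> exp (2 * \<bar>?d\<bar> * pi)" by simp
    moreover have "0 \<le> C" using C by simp
    ultimately show "\<bar>potential r1 r2 \<omega> nn t\<bar> \<le> ?c * exp (2 * \<bar>?d\<bar> * pi) * C"
      unfolding potential_def abs_mult using C by (intro mult_mono) auto
  qed
  ultimately show ?thesis unfolding essentially_bounded_def by blast
qed

text \<open>Only the class of the potential modulo null sets matters, so it may be replaced by a
  representative that is bounded everywhere and vanishes outside the interval.\<close>

lemma bounded_representative:
  assumes "essentially_bounded v"
  obtains q Q where "q \<in> borel_measurable (lebesgue_on {0..pi})" "\<And>t. \<bar>q t\<bar> \<le> Q" "L2_mult v = L2_mult q"
proof -
  obtain C where m: "v \<in> borel_measurable Mpi" and C: "AE t in Mpi. \<bar>v t\<bar> \<le> C"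
    using assms by (auto simp: essentially_bounded_def)
  define q0 where "q0 t = (if \<bar>v t\<bar> \<le> C then v t else 0)" for t
  define q where "q t = (if t \<in> {0<..<pi} then q0 t else 0)" for t
  have q0m: "q0 \<in> borel_measurable Mpi" unfolding q0_def[abs_def] using m by measurable
  then have "q \<in> borel_measurable lebesgue"
    unfolding q_def[abs_def] by (subst borel_measurable_if) auto
  then have qm: "q \<in> borel_measurable (lebesgue_on {0..pi})" by (rule measurable_restrict_space1)
  have qb: "\<bar>q t\<bar> \<le> \<bar>C\<bar>" for t by (auto simp: q_def q0_def)
  have qM: "q \<in> borel_measurable Mpi" by (rule measurable_restrict_mono[OF qm]) auto
  have "AE t in Mpi. t \<in> {0<..<pi}" by (rule AE_I2) simp
  then have eq: "AE t in Mpi. v t = q t" using C by eventually_elim (simp add: q_def q0_def)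
  have "L2_mult v u = L2_mult q u" for u
  proof -
    let ?r = "rep_L2pi u"
    have sq: "square_integrable (\<lambda>t. complex_of_real (q t) * ?r t)"
      by (rule square_integrable_bounded_mult[of _ "\<bar>C\<bar>"]) (use qM qb square_integrable_rep in auto)
    have e: "AE t in Mpi. complex_of_real (v t) * ?r t = complex_of_real (q t) * ?r t"
      using eq by eventually_elim simp
    have vm: "(\<lambda>t. complex_of_real (v t) * ?r t) \<in> borel_measurable Mpi"
      using m square_integrable_measurable[OF square_integrable_rep[of u]] by measurable
    have "integrable Mpi (\<lambda>t. (cmod (complex_of_real (v t) * ?r t))\<^sup>2)"
    proof (rule integrable_cong_AE[THEN iffD1])
      show "integrable Mpi (\<lambda>t. (cmod (complex_of_real (q t) * ?r t))\<^sup>2)"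
        using sq by (simp add: square_integrable_def)
      show "AE t in Mpi. (cmod (complex_of_real (q t) * ?r t))\<^sup>2 = (cmod (complex_of_real (v t) * ?r t))\<^sup>2"
        using e by eventually_elim (simp only:)
    qed (use vm square_integrable_measurable[OF sq] in measurable)
    then have sv: "square_integrable (\<lambda>t. complex_of_real (v t) * ?r t)" using vm by (simp add: square_integrable_def)
    show ?thesis unfolding L2_mult_def abs_L2pi_eq_iff[OF sv sq] by (rule e)
  qed
  then have "L2_mult v = L2_mult q" by (rule ext)
  with qm qb show ?thesis by (rule that)
qed

theorem theorem3p3:
  fixes r1 r2 \<omega> \<sigma> :: real and nn :: "real \<Rightarrow> real"
  assumes "0 < r1" and "r1 < r2" and "0 < \<omega>" and "0 < \<sigma>" and "essentially_bounded nn"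
  shows
    "(\<forall>z u. weak_eigenpair r1 r2 \<omega> \<sigma> nn z u \<longleftrightarrow>
            eigenvector (T_dom r1 r2 \<omega> \<sigma>) (T_op r1 r2 \<omega> nn) z (H1_to_L2 u)) \<and>
     (\<exists>(lam :: nat \<Rightarrow> complex) (phi :: nat \<Rightarrow> H1pi).
        normalized_root_vector_pairs (T_dom r1 r2 \<omega> \<sigma>) (T_op r1 r2 \<omega> nn)
          lam (\<lambda>n. H1_to_L2 (phi n)) \<and>
        (\<exists>n0>0. \<forall>n>n0. simple_eigenvalue (T_dom r1 r2 \<omega> \<sigma>) (T_op r1 r2 \<omega> nn) (lam n)) \<and>
        bari_basis (\<lambda>n. H1_to_L2 (phi n)) \<and>
        quadratically_close (\<lambda>n. H1_to_L2 (psi n)) (\<lambda>n. H1_to_L2 (phi n)) \<and>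
        bari_basis (\<lambda>n. phi n /\<^sub>R sqrt (mu n)) \<and>
        quadratically_close (\<lambda>n. psi n /\<^sub>R sqrt (mu n)) (\<lambda>n. phi n /\<^sub>R sqrt (mu n)) \<and>
        (\<lambda>n. sqrt (cmod (lam n)) / sqrt (mu n)) \<longlonglongrightarrow> 1 \<and>
        (\<lambda>n. sqrt (cmod (lam n)) / norm (phi n)) \<longlonglongrightarrow> 1 \<and>
        quadratically_close (\<lambda>n. phi n /\<^sub>R norm (phi n)) (\<lambda>n. psi n /\<^sub>R sqrt (mu n)) \<and>
        (\<lambda>n. lam n / complex_of_real (mu n)) \<longlonglongrightarrow> 1)"
proof -
  obtain q Q where q: "q \<in> borel_measurable (lebesgue_on {0..pi})" "\<And>t. \<bar>q t\<bar> \<le> Q"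
    and L: "L2_mult (potential r1 r2 \<omega> nn) = L2_mult q"
    by (rule bounded_representative[OF potential_essentially_bounded[OF assms(5), of r1 r2 \<omega>]], rule that)
  define b where "b = boundary_coeff r1 r2 \<omega> \<sigma>"
  interpret sturm_liouville q Q b by unfold_locales (rule q)+
  have dom: "T_dom r1 r2 \<omega> \<sigma> = bvp_dom" by (simp only: T_dom_def bvp_dom_def b_def[symmetric])
  have op: "T_op r1 r2 \<omega> nn = bvp_op" by (rule ext) (simp add: T_op_def bvp_op_def L)
  have zero: "H1_to_L2 u = 0 \<longleftrightarrow> u = 0" for u by (metis H1_to_L2_inject zero_H1pi.rep_eq)
  have "weak_eigenpair r1 r2 \<omega> \<sigma> nn z u \<longleftrightarrow> eigenvector bvp_dom bvp_op z (H1_to_L2 u)" for z u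
    unfolding weak_eigenpair_def eigenvector_def L b_def[symmetric] weak_form_iff zero by blast
  then show ?thesis unfolding dom op using root_vector_basis by blast
qed

end
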